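(* Let $C$ be a single-vertex crease pattern and let $\mu: C\to\{M,V\}$ be a mountain-valley assignment. Then $(C,\mu)$ can be continuously parameterized in a family of rigid origami folds (that is, there is a continuous family of rigid foldings of $C$ starting at the flat unfolded state and ending at a rigid folding in which every crease $c\in C$ has non-zero folding angle, positive if $\mu(c)=V$ and negative if $\mu(c)=M$) if and only if $(C,\mu)$ contains a bird's foot.
   Context: The paper is a closed disk $A\subset\mathbb{R}^2$. A single-vertex crease pattern $C$ is a finite set of more than two distinct creases, which are radii of $A$ issuing from the center of $A$ (the vertex). The creases divide $A$ into sectors (faces). A rigid origami (rigid folding) of $C$ is an injective continuous map $f:A\to\mathbb{R}^3$ that is an isometry on each face (each face is mapped rigidly onto a congruent planar sector) and is non-differentiable only along $C$. The folding angle of a crease is the signed angle by which the two faces adjacent to it deviate from being coplanar. It lies in $(-\pi,\pi)$ and is $0$ when the crease is not folded. A mountain-valley (MV) assignment is a function $\mu:C\to\{M,V\}$. Valley creases ($V$) are to have positive folding angle, and mountain creases ($M$) negative folding angle. In the flat unfolded state all folding angles are $0$. $\angle(c,d)\in(0,2\pi)$ denotes the oriented angle measured counterclockwise from crease $c$ to a different crease $d$. $(C,\mu)$ has a mountain (resp. valley) tripod if there are three creases $c_1,c_2,c_3\in C$ in counterclockwise order, not necessarily contiguous, with $\mu(c_i)=M$ (resp. $\mu(c_i)=V$) for $i=1,2,3$ and $0<\angle(c_i,c_{i+1})<\pi$ for $i=1,2,3$ (indices mod 3). $(C,\mu)$ has a mountain (resp. valley) cross if there are four creases $c_1,c_2,c_3,c_4\in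 C$ in counterclockwise order, not necessarily contiguous, such that $c_1,c_3$ form a straight line, $c_2,c_4$ form a straight line, and $\mu(c_i)=M$ (resp. $\mu(c_i)=V$) for $i=1,2,3,4$. $(C,\mu)$ contains a bird's foot if it contains a tripod or a cross together with another crease whose assignment is opposite to that of the tripod or cross. *)

theory Defs
  imports "HOL-Analysis.Analysis"
begin

text \<open>
  The plane is the type \<^typ>\<open>complex\<close>, the paper is the disk \<^term>\<open>cball p r\<close>, and a crease is
  represented by its endpoint \<open>c\<close> on the boundary circle \<^term>\<open>sphere p r\<close>: the crease itself is
  the radius \<^term>\<open>closed_segment p c\<close>.
\<close>

definition crease_pattern :: "complex \<Rightarrow> real \<Rightarrow> complex set \<Rightarrow> bool" where
  "crease_pattern p r C \<longleftrightarrow> 0 < r \<and> finite C \<and> 2 < card C \<and> C \<subseteq> sphere p r"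

datatype mv = Mountain | Valley

text \<open>Counterclockwise angle at \<open>p\<close> from the ray through \<open>c\<close> to the ray through \<open>d\<close>, in
  \<open>[0, 2\<pi>)\<close>.\<close>

definition ccw_angle :: "complex \<Rightarrow> complex \<Rightarrow> complex \<Rightarrow> real" where
  "ccw_angle p c d = Arg2pi ((d - p) / (c - p))"

subsection \<open>Faces\<close>

definition consecutive :: "complex \<Rightarrow> complex set \<Rightarrow> complex \<Rightarrow> complex \<Rightarrow> bool" where
  "consecutive p C c d \<longleftrightarrow>
     c \<in> C \<and> d \<in> C \<and> c \<noteq> d \<and> (\<forall>e \<in> C - {c}. ccw_angle p c d \<le> ccw_angle p c e)"

definition next_crease :: "complex \<Rightarrow> complex set \<Rightarrow> complex \<Rightarrow> complex" where
  "next_crease p C c = (THE d. consecutive p C c d)"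

definition prev_crease :: "complex \<Rightarrow> complex set \<Rightarrow> complex \<Rightarrow> complex" where
  "prev_crease p C c = (THE b. consecutive p C b c)"

definition sector :: "complex \<Rightarrow> real \<Rightarrow> complex \<Rightarrow> complex \<Rightarrow> complex set" where
  "sector p r c d = {x \<in> cball p r. x = p \<or> ccw_angle p c x \<le> ccw_angle p c d}"

definition faces :: "complex \<Rightarrow> real \<Rightarrow> complex set \<Rightarrow> complex set set" where
  "faces p r C = {sector p r c d | c d. consecutive p C c d}"

subsection \<open>Rigid foldings\<close>

text \<open>Distances are the Euclidean distances of the plane and of space, also for a nonconvex face
  (a sector of angle greater than \<open>\<pi>\<close>). So \<open>f\<close> maps each face rigidly onto a congruent planar
  sector.\<close>

definition rigid_folding ::
    "complex \<Rightarrow> real \<Rightarrow> complex set \<Rightarrow> (complex \<Rightarrow> real^3) \<Rightarrow> bool" where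
  "rigid_folding p r C f \<longleftrightarrow>
     inj_on f (cball p r) \<and>
     continuous_on (cball p r) f \<and>
     (\<forall>S \<in> faces p r C. \<forall>x \<in> S. \<forall>y \<in> S. dist (f x) (f y) = dist x y) \<and>
     (\<forall>x \<in> cball p r - (\<Union>c \<in> C. closed_segment p c). f differentiable (at x within cball p r))"

definition flat_state :: "complex \<Rightarrow> real^3" where
  "flat_state x = vector [Re x, Im x, 0]"

subsection \<open>Folding angles\<close>

text \<open>On a face \<open>S\<close> a rigid folding is \<open>x \<mapsto> f p + L (x - p)\<close> for a unique linear isometry \<open>L\<close>. The
  unit normal \<open>L 1 \<times> L \<i>\<close> of the folded face points to the side from which the paper is seen with
  its original (counterclockwise) orientation; it is \<open>(0, 0, 1)\<close> in the flat state.\<close>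

definition face_linear ::
    "complex \<Rightarrow> (complex \<Rightarrow> real^3) \<Rightarrow> complex set \<Rightarrow> complex \<Rightarrow> real^3" where
  "face_linear p f S = (THE L. linear L \<and> (\<forall>x \<in> S. f x = f p + L (x - p)))"

definition face_normal :: "complex \<Rightarrow> (complex \<Rightarrow> real^3) \<Rightarrow> complex set \<Rightarrow> real^3" where
  "face_normal p f S = cross3 (face_linear p f S 1) (face_linear p f S \<i>)"

text \<open>Let \<open>u\<close> be the direction of the folded crease, pointing away from the vertex. Both normals
  \<open>m\<close> and \<open>n\<close> are unit vectors orthogonal to \<open>u\<close>, so \<open>m \<bullet> n\<close> and \<open>u \<bullet> (m \<times> n)\<close> are the cosine and
  the sine of the angle of the rotation about \<open>u\<close> that carries the normal \<open>m\<close> of the face clockwise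
  of \<open>c\<close> to the normal \<open>n\<close> of the face counterclockwise of \<open>c\<close>. The angle is positive if the two
  faces bend towards the side of the normals (a valley as seen from that side). The value \<open>\<pi>\<close>
  belongs to faces folded onto each other and does not occur for injective \<open>f\<close>.\<close>

definition folding_angle ::
    "complex \<Rightarrow> real \<Rightarrow> complex set \<Rightarrow> (complex \<Rightarrow> real^3) \<Rightarrow> complex \<Rightarrow> real" where
  "folding_angle p r C f c =
     (let u = sgn (f c - f p);
          m = face_normal p f (sector p r (prev_crease p C c) c);
          n = face_normal p f (sector p r c (next_crease p C c))
      in Arg (Complex (m \<bullet> n) (u \<bullet> cross3 m n)))"

definition realizes ::
    "complex \<Rightarrow> real \<Rightarrow> complex set \<Rightarrow> (complex \<Rightarrow> mv) \<Rightarrow> (complex \<Rightarrow> real^3) \<Rightarrow> bool" where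
  "realizes p r C \<mu> f \<longleftrightarrow>
     (\<forall>c \<in> C. (\<mu> c = Valley \<longrightarrow> folding_angle p r C f c > 0) \<and>
              (\<mu> c = Mountain \<longrightarrow> folding_angle p r C f c < 0))"

definition continuously_foldable ::
    "complex \<Rightarrow> real \<Rightarrow> complex set \<Rightarrow> (complex \<Rightarrow> mv) \<Rightarrow> bool" where
  "continuously_foldable p r C \<mu> \<longleftrightarrow>
     (\<exists>F :: real \<Rightarrow> complex \<Rightarrow> real^3.
        continuous_on ({0..1} \<times> cball p r) (\<lambda>(t, x). F t x) \<and>
        (\<forall>t \<in> {0..1}. rigid_folding p r C (F t)) \<and>
        (\<forall>x \<in> cball p r. F 0 x = flat_state x) \<and>
        realizes p r C \<mu> (F 1))"

subsection \<open>Tripods, crosses and bird's feet\<close>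

definition has_tripod :: "complex \<Rightarrow> complex set \<Rightarrow> (complex \<Rightarrow> mv) \<Rightarrow> mv \<Rightarrow> bool" where
  "has_tripod p C \<mu> m \<longleftrightarrow>
     (\<exists>c1 \<in> C. \<exists>c2 \<in> C. \<exists>c3 \<in> C.
        ccw_angle p c1 c2 < ccw_angle p c1 c3 \<and>
        \<mu> c1 = m \<and> \<mu> c2 = m \<and> \<mu> c3 = m \<and>
        0 < ccw_angle p c1 c2 \<and> ccw_angle p c1 c2 < pi \<and>
        0 < ccw_angle p c2 c3 \<and> ccw_angle p c2 c3 < pi \<and>
        0 < ccw_angle p c3 c1 \<and> ccw_angle p c3 c1 < pi)"

definition has_cross :: "complex \<Rightarrow> complex set \<Rightarrow> (complex \<Rightarrow> mv) \<Rightarrow> mv \<Rightarrow> bool" where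
  "has_cross p C \<mu> m \<longleftrightarrow>
     (\<exists>c1 \<in> C. \<exists>c2 \<in> C. \<exists>c3 \<in> C. \<exists>c4 \<in> C.
        0 < ccw_angle p c1 c2 \<and> ccw_angle p c1 c2 < ccw_angle p c1 c3 \<and>
        ccw_angle p c1 c3 < ccw_angle p c1 c4 \<and>
        p \<in> open_segment c1 c3 \<and> p \<in> open_segment c2 c4 \<and>
        \<mu> c1 = m \<and> \<mu> c2 = m \<and> \<mu> c3 = m \<and> \<mu> c4 = m)"

definition contains_birds_foot :: "complex \<Rightarrow> complex set \<Rightarrow> (complex \<Rightarrow> mv) \<Rightarrow> bool" where
  "contains_birds_foot p C \<mu> \<longleftrightarrow>
     (\<exists>m. (has_tripod p C \<mu> m \<or> has_cross p C \<mu> m) \<and> (\<exists>c \<in> C. \<mu> c \<noteq> m))"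

end

theory Submission
  imports Defs
begin

text \<open>
  Necessity. The folded boundary circle is a simple closed spherical polygon of length \<open>2\<pi>\<close> with at
  least three proper vertices, hence lies in an open hemisphere. Its central projection is a simple planar
  polygon whose turns have the signs of the folding angles. Let \<open>m\<close> be the assignment of an extreme vertex,
  which turns the way the polygon is oriented. Not all vertices turn that way, because a convex spherical
  polygon is shorter than \<open>2\<pi>\<close>. A chain of vertices turning the other way is shorter than its complement,
  that is, shorter than \<open>\<pi>\<close>. So every \<open>m\<close>-crease is followed by another one at an angle less than \<open>\<pi>\<close>,
  which gives a tripod or a cross.

  Sufficiency. Prescribe heights \<open>z\<^sub>k\<close> on the unit sphere for the ends of the creases. The longitude
  differences of consecutive ends are then determined, and the heights define an embedded folded cone as
  soon as these differences add up to \<open>2\<pi>\<close>. For small heights the folding angles have the signs of a load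
  \<open>\<rho>\<close> with vanishing resultant, and the total longitude is \<open>2\<pi>\<close> to second order if the energy of the load
  vanishes. The bird's foot provides such a load with the prescribed signs: the tripod or cross carries a
  load of positive energy, and the opposite crease together with two neighbouring creases of the tripod or
  cross carries one of negative energy. Finally the height of one crease end is adjusted so that the
  longitudes add up to exactly \<open>2\<pi>\<close>; they depend monotonically on it, so the solution is unique and
  continuous.
\<close>

section \<open>Angles between vectors\<close>

text \<open>The Jordan curve theorem is replaced by angles. For a vertex of a simple closed polygon,
  the angle swept by the rest of the polygon plus the exterior angle gives \<open>ori\<close>. While
  the viewpoint moves along an edge, this number varies continuously and its \<open>cis\<close>
  stays \<open>-1\<close>, so it is the same at all vertices; at an extreme vertex it is pi or -pi
  with the sign of the turn. The pole of the hemisphere is close to \<open>g 0 + g pi\<close>: each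
  half of the curve has length pi, so the distances of any of its points from both ends add up to at
  most pi, and the inner product with this vector is nonnegative. A point where it vanishes splits
  its half of the curve into two geodesics, and no geodesic has a crease inside. The obstacle to
  sufficiency is that the flat state is singular: the closing condition vanishes there to second
  order in the size \<open>t\<close> of the heights, so the implicit function theorem does not apply
  at \<open>t = 0\<close>. Its \<open>t^2\<close> coefficient changes sign with the adjusted height,
  which yields a root for every small \<open>t > 0\<close>; at \<open>t = 0\<close> continuity is
  automatic, because all heights carry the factor \<open>t\<close>.\<close>

definition sang :: "'a::real_inner \<Rightarrow> 'a \<Rightarrow> real" where
  "sang a b = arccos (a \<bullet> b / (norm a * norm b))"

lemma sang_arg_bounds: "\<bar>a \<bullet> b / (norm a * norm b)\<bar> \<le> 1"
proof (cases "a = 0 \<or> b = 0")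
  case False
  then show ?thesis
    using Cauchy_Schwarz_ineq2[of a b] by (simp add: abs_mult divide_le_eq)
qed auto

lemma sang_ge_0: "0 \<le> sang a b" and sang_le_pi: "sang a b \<le> pi"
  using sang_arg_bounds[of a b] unfolding sang_def abs_le_iff
  by (intro arccos_lbound arccos_ubound; linarith)+

lemma cos_sang: "cos (sang a b) = a \<bullet> b / (norm a * norm b)"
  using sang_arg_bounds[of a b] unfolding sang_def abs_le_iff by (intro cos_arccos) linarith+

lemma sang_commute: "sang a b = sang b a"
  by (simp add: sang_def inner_commute mult.commute)

lemma sang_scale: "0 < k \<Longrightarrow> sang (k *\<^sub>R a) b = sang a b" "0 < k \<Longrightarrow> sang a (k *\<^sub>R b) = sang a b"
  by (auto simp: sang_def)

lemma sang_minus: "sang (- a) b = pi - sang a b"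
proof -
  have "cos (sang (- a) b) = cos (pi - sang a b)"
    by (simp add: cos_sang)
  then show ?thesis
    using sang_ge_0[of "-a" b] sang_le_pi[of "-a" b] sang_ge_0[of a b] sang_le_pi[of a b]
    by (intro cos_inj_pi[of "sang (-a) b"]) auto
qed

text \<open>The role of \<open>x\<close> is played by a sum of two angles, which may exceed pi;
  there the claim is trivial.\<close>

lemma cos_ge_sum_if_le:
  assumes "cos x \<le> cos y" "0 \<le> x" "0 \<le> y" "y \<le> pi"
  shows "y \<le> x"
proof (cases "x \<le> pi")
  case True
  then show ?thesis using assms cos_mono_le_eq[of x y] by auto
qed (use assms in auto)

lemma antiparallel:
  fixes x y :: "'a::real_inner"
  assumes "x \<bullet> y = - (norm x * norm y)" "x \<noteq> 0"
  shows "y = - (norm y / norm x) *\<^sub>R x"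
proof -
  have "(- x) \<bullet> y = norm (- x) * norm y" using assms by simp
  then have "norm x *\<^sub>R y = norm y *\<^sub>R (- x)"
    unfolding norm_cauchy_schwarz_eq by simp
  then have "(1/norm x) *\<^sub>R norm x *\<^sub>R y = (1/norm x) *\<^sub>R norm y *\<^sub>R (- x)" by (simp only:)
  then show ?thesis using assms(2) by simp
qed

text \<open>With \<open>?x\<close> and \<open>?y\<close> the components of \<open>a\<close> and
  \<open>c\<close> orthogonal to \<open>b\<close>, the cosine of the left-hand side exceeds that of
  the sum by \<open>?x \<bullet> ?y + norm ?x * norm ?y\<close>. This is nonnegative by
  Cauchy-Schwarz, and for nonzero components it vanishes only if they are antiparallel.\<close>

lemma sang_triangle_unit:
  assumes "norm a = 1" "norm b = 1" "norm c = 1"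
  shows "sang a c \<le> sang a b + sang b c"
    and "a - (a \<bullet> b) *\<^sub>R b \<noteq> 0 \<Longrightarrow> c - (c \<bullet> b) *\<^sub>R b \<noteq> 0 \<Longrightarrow>
         (\<And>k. 0 < k \<Longrightarrow> c - (c \<bullet> b) *\<^sub>R b \<noteq> - k *\<^sub>R (a - (a \<bullet> b) *\<^sub>R b)) \<Longrightarrow> sang a c < sang a b + sang b c"
proof -
  let ?x = "a - (a \<bullet> b) *\<^sub>R b" and ?y = "c - (c \<bullet> b) *\<^sub>R b"
  have bb: "b \<bullet> b = 1" using assms by (simp add: norm_eq_1)
  have nn: "norm (u - (u \<bullet> b) *\<^sub>R b) = sin (sang u b)" if "norm u = 1" for u
  proof -
    have uu: "u \<bullet> u = 1" using that by (simp add: norm_eq_1)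
    have "(norm (u - (u \<bullet> b) *\<^sub>R b))\<^sup>2 = 1 - (u \<bullet> b)\<^sup>2"
      unfolding power2_norm_eq_inner
      by (simp add: inner_diff_left inner_diff_right bb uu inner_commute[of b u] power2_eq_square)
    also have "\<dots> = (sin (sang u b))\<^sup>2"
      unfolding sin_squared_eq by (simp add: cos_sang that assms)
    finally show ?thesis
      by (rule power2_eq_imp_eq) (intro norm_ge_zero sin_ge_zero sang_ge_0 sang_le_pi)+
  qed
  have nx: "norm ?x = sin (sang a b)" "norm ?y = sin (sang b c)"
    using nn assms by (auto simp: sang_commute[of b c])
  have xy: "?x \<bullet> ?y = a \<bullet> c - (a \<bullet> b) * (b \<bullet> c)"
    using bb by (simp add: inner_diff_left inner_diff_right inner_commute)
  have e: "cos (sang a c) - cos (sang a b + sang b c) = ?x \<bullet> ?y + norm ?x * norm ?y"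
    unfolding xy cos_add nx using assms by (simp add: cos_sang)
  have CS: "- (norm ?x * norm ?y) \<le> ?x \<bullet> ?y"
    using Cauchy_Schwarz_ineq2[of ?x ?y] by linarith
  show "sang a c \<le> sang a b + sang b c"
  proof (rule cos_ge_sum_if_le)
    show "cos (sang a b + sang b c) \<le> cos (sang a c)" using e CS by linarith
  qed (intro add_nonneg_nonneg sang_ge_0 sang_le_pi)+
  assume nz: "?x \<noteq> 0" "?y \<noteq> 0" and k: "\<And>k. 0 < k \<Longrightarrow> ?y \<noteq> - k *\<^sub>R ?x"
  have "?x \<bullet> ?y \<noteq> - (norm ?x * norm ?y)"
  proof
    assume "?x \<bullet> ?y = - (norm ?x * norm ?y)"
    from antiparallel[OF this nz(1)] have "?y = - (norm ?y / norm ?x) *\<^sub>R ?x" .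
    moreover have "norm ?y / norm ?x > 0" using nz by simp
    ultimately show False using k by blast
  qed
  then have lt: "cos (sang a c) > cos (sang a b + sang b c)" using e CS by linarith
  show "sang a c < sang a b + sang b c"
    using lt \<open>sang a c \<le> _\<close> by (metis order_le_less less_irrefl)
qed

lemma sang_sgn: "a \<noteq> 0 \<Longrightarrow> sang (sgn a) b = sang a b" "b \<noteq> 0 \<Longrightarrow> sang a (sgn b) = sang a b"
  unfolding sgn_div_norm by (simp_all add: sang_scale)

lemma sang_triangle:
  assumes "a \<noteq> 0" "b \<noteq> 0" "c \<noteq> 0"
  shows "sang a c \<le> sang a b + sang b c"
  using sang_triangle_unit(1)[of "sgn a" "sgn b" "sgn c"] assms by (simp add: sang_sgn norm_sgn)

lemma sang_triangle_strict:
  fixes a b c :: "real^3"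
  assumes "a \<bullet> cross3 b c \<noteq> 0"
  shows "sang a c < sang a b + sang b c"
proof -
  have nz: "a \<noteq> 0" "b \<noteq> 0" "c \<noteq> 0" using assms by auto
  let ?a = "sgn a" and ?b = "sgn b" and ?c = "sgn c"
  have d: "?a \<bullet> cross3 ?b ?c \<noteq> 0"
    using assms nz by (simp add: sgn_div_norm cross_mult_left cross_mult_right)
  have tri: "\<And>s t k. k *\<^sub>R ?a = s *\<^sub>R ?b + t *\<^sub>R ?c \<Longrightarrow> k = 0"
  proof -
    fix s t k assume h: "k *\<^sub>R ?a = s *\<^sub>R ?b + t *\<^sub>R ?c"
    have "k * (?a \<bullet> cross3 ?b ?c) = (s *\<^sub>R ?b + t *\<^sub>R ?c) \<bullet> cross3 ?b ?c"
      by (simp add: h[symmetric])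
    also have "\<dots> = 0" by (simp add: inner_add_left dot_cross_self)
    finally show "k = 0" using d by simp
  qed
  have tri2: "\<And>s. ?c \<noteq> s *\<^sub>R ?b"
    using d by (metis cross_mult_right cross_refl inner_zero_right scaleR_zero_right)
  have "sang ?a ?c < sang ?a ?b + sang ?b ?c"
  proof (rule sang_triangle_unit(2))
    show "?a - (?a \<bullet> ?b) *\<^sub>R ?b \<noteq> 0"
      using tri[of 1 "?a \<bullet> ?b" 0] by auto
    show "?c - (?c \<bullet> ?b) *\<^sub>R ?b \<noteq> 0" using tri2 by auto
    fix k :: real assume "0 < k"
    show "?c - (?c \<bullet> ?b) *\<^sub>R ?b \<noteq> - k *\<^sub>R (?a - (?a \<bullet> ?b) *\<^sub>R ?b)"
    proof
      assume "?c - (?c \<bullet> ?b) *\<^sub>R ?b = - k *\<^sub>R (?a - (?a \<bullet> ?b) *\<^sub>R ?b)"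
      then have "k *\<^sub>R ?a = (?c \<bullet> ?b + k * (?a \<bullet> ?b)) *\<^sub>R ?b + (-1) *\<^sub>R ?c"
        by (simp add: algebra_simps)
      from tri[OF this] show False using \<open>0 < k\<close> by simp
    qed
  qed (use nz in \<open>auto simp: norm_sgn\<close>)
  then show ?thesis using nz by (simp add: sang_sgn)
qed

text \<open>Cosine and sine of both parts are explicit in the coefficients and in
  \<open>norm c\<close>, and the addition formulas give the cosine and sine of their sum.\<close>

lemma sang_split_unit:
  assumes "norm a = 1" "norm b = 1" "0 \<le> \<alpha>" "0 \<le> \<beta>" "c = \<alpha> *\<^sub>R a + \<beta> *\<^sub>R b" "c \<noteq> 0"
  shows "sang a b = sang a c + sang c b"
proof -
  let ?A = "sang a c" and ?B = "sang c b" and ?x = "a \<bullet> b" and ?n = "norm c"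
  have n: "?n > 0" using assms by simp
  have ab: "a \<bullet> a = 1" "b \<bullet> b = 1" using assms by (simp_all add: norm_eq_1)
  have n2: "?n\<^sup>2 = \<alpha>\<^sup>2 + \<beta>\<^sup>2 + 2 * \<alpha> * \<beta> * ?x"
    unfolding power2_norm_eq_inner assms(5)
    by (simp add: inner_add_left inner_add_right ab inner_commute power2_eq_square algebra_simps)
  have x1: "\<bar>?x\<bar> \<le> 1" using Cauchy_Schwarz_ineq2[of a b] assms by simp
  define s where "s = sqrt (1 - ?x\<^sup>2)"
  have s0: "s \<ge> 0" and s2: "s\<^sup>2 = 1 - ?x\<^sup>2" using x1 by (auto simp: s_def abs_square_le_1)
  have cA: "cos ?A * ?n = \<alpha> + \<beta> * ?x" and cB: "cos ?B * ?n = \<alpha> * ?x + \<beta>"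
    using assms n by (simp_all add: cos_sang inner_add_left inner_add_right ab inner_commute)
  have sq: "(sin t * ?n)\<^sup>2 = ?n\<^sup>2 - (cos t * ?n)\<^sup>2" for t
    unfolding power_mult_distrib sin_squared_eq by (simp add: algebra_simps)
  have sA: "sin ?A * ?n = \<beta> * s"
  proof (rule power2_eq_imp_eq)
    show "(sin ?A * ?n)\<^sup>2 = (\<beta> * s)\<^sup>2"
      unfolding sq cA n2 unfolding power_mult_distrib s2 by (simp add: power2_eq_square algebra_simps)
    show "0 \<le> sin ?A * ?n" by (intro mult_nonneg_nonneg sin_ge_zero sang_ge_0 sang_le_pi norm_ge_zero)
  qed (use s0 assms in simp)
  have sB: "sin ?B * ?n = \<alpha> * s"
  proof (rule power2_eq_imp_eq)
    show "(sin ?B * ?n)\<^sup>2 = (\<alpha> * s)\<^sup>2"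
      unfolding sq cB n2 unfolding power_mult_distrib s2 by (simp add: power2_eq_square algebra_simps)
    show "0 \<le> sin ?B * ?n" by (intro mult_nonneg_nonneg sin_ge_zero sang_ge_0 sang_le_pi norm_ge_zero)
  qed (use s0 assms in simp)
  have "cos (?A + ?B) * ?n\<^sup>2 = (cos ?A * ?n) * (cos ?B * ?n) - (sin ?A * ?n) * (sin ?B * ?n)"
    unfolding cos_add by (simp add: power2_eq_square algebra_simps)
  also have "\<dots> = (\<alpha> + \<beta> * ?x) * (\<alpha> * ?x + \<beta>) - \<alpha> * \<beta> * s\<^sup>2"
    unfolding cA cB sA sB by (simp add: power2_eq_square)
  also have "\<dots> = ?x * ?n\<^sup>2"
    unfolding n2 s2 by (simp add: algebra_simps power2_eq_square)
  finally have e: "cos (?A + ?B) = ?x" using n by simp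
  have "sin (?A + ?B) * ?n\<^sup>2 = (sin ?A * ?n) * (cos ?B * ?n) + (cos ?A * ?n) * (sin ?B * ?n)"
    unfolding sin_add by (simp add: power2_eq_square algebra_simps)
  also have "\<dots> = s * ?n\<^sup>2"
    unfolding cA cB sA sB n2 by (simp add: algebra_simps power2_eq_square)
  finally have sAB: "sin (?A + ?B) \<ge> 0" using n s0 by simp
  \<comment> \<open>Required before \<open>arccos\<close> can be undone. Above pi, a nonnegative
    sine leaves only the value 2 pi; then both parts equal pi, and the sum of their cosines
    contradicts the nonnegative coefficients.\<close>
  have "?A + ?B \<le> pi"
  proof (rule ccontr)
    assume "\<not> ?thesis"
    then have gt: "?A + ?B > pi" by simp
    have le: "?A + ?B \<le> 2 * pi" using sang_le_pi[of a c] sang_le_pi[of c b] by simp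
    have "\<not> ?A + ?B < 2 * pi"
    proof
      assume "?A + ?B < 2 * pi"
      then have "sin (?A + ?B - pi) > 0" using gt by (intro sin_gt_zero) auto
      then show False using sAB by (simp add: sin_diff)
    qed
    then have AB: "?A = pi" "?B = pi" using le sang_le_pi[of a c] sang_le_pi[of c b] by linarith+
    then have "\<alpha> + \<beta> * ?x < 0" "\<alpha> * ?x + \<beta> < 0"
      using n cA cB unfolding AB cos_pi by linarith+
    then have "(\<alpha> + \<beta> * ?x) + (\<alpha> * ?x + \<beta>) < 0" by linarith
    also have "(\<alpha> + \<beta> * ?x) + (\<alpha> * ?x + \<beta>) = (\<alpha> + \<beta>) * (1 + ?x)" by (simp add: algebra_simps)
    finally have "(\<alpha> + \<beta>) * (1 + ?x) < 0" .
    moreover have "(\<alpha> + \<beta>) * (1 + ?x) \<ge> 0" using assms x1 by (intro mult_nonneg_nonneg) auto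
    ultimately show False by simp
  qed
  then have "?A + ?B = arccos ?x" unfolding e[symmetric]
    using sang_ge_0[of a c] sang_ge_0[of c b] by (intro arccos_cos[symmetric]) auto
  then show ?thesis by (simp add: sang_def[of a b] assms(1,2))
qed

lemma sang_split:
  assumes "a \<noteq> 0" "b \<noteq> 0" "0 \<le> \<alpha>" "0 \<le> \<beta>" "c = \<alpha> *\<^sub>R a + \<beta> *\<^sub>R b" "c \<noteq> 0"
  shows "sang a b = sang a c + sang c b"
proof -
  have "c = (\<alpha> * norm a) *\<^sub>R sgn a + (\<beta> * norm b) *\<^sub>R sgn b"
    using assms(1,2) unfolding assms(5) sgn_div_norm scaleR_scaleR by (simp add: mult.assoc)
  from sang_split_unit[OF _ _ _ _ this assms(6)] assms(1-4)
  have "sang (sgn a) (sgn b) = sang (sgn a) c + sang c (sgn b)"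
    by (simp add: norm_sgn)
  then show ?thesis unfolding sang_sgn(1)[OF assms(1)] sang_sgn(2)[OF assms(2)] .
qed

section \<open>Simple closed polygons in the plane\<close>

text \<open>Twice the signed area of the triangle \<open>x v y\<close>: positive for a left
  turn.\<close>

definition turn :: "complex \<Rightarrow> complex \<Rightarrow> complex \<Rightarrow> real" where
  "turn x v y = Im (cnj (v - x) * (y - v))"

text \<open>The angle swept by the path as seen from \<open>z\<close>. The principal value is the
  right one on each edge as long as \<open>z\<close> is off that edge.\<close>

fun pang :: "complex \<Rightarrow> complex list \<Rightarrow> real" where
  "pang z (x # y # p) = Arg ((y - z) / (x - z)) + pang z (y # p)"
| "pang z _ = 0"

text \<open>The final point is left out, so that a closed path can satisfy \<open>psimple\<close>
  although it returns to its start.\<close>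

fun pset :: "complex list \<Rightarrow> complex set" where
  "pset (x # y # p) = (closed_segment x y - {y}) \<union> pset (y # p)"
| "pset _ = {}"

fun pcl :: "complex list \<Rightarrow> complex set" where
  "pcl (x # y # p) = closed_segment x y \<union> pcl (y # p)"
| "pcl p = set p"

fun psimple :: "complex list \<Rightarrow> bool" where
  "psimple (x # y # p) \<longleftrightarrow> x \<noteq> y \<and> (closed_segment x y - {y}) \<inter> pset (y # p) = {} \<and> psimple (y # p)"
| "psimple _ \<longleftrightarrow> True"

lemma pang_append: "pang z (p @ x # q) = pang z (p @ [x]) + pang z (x # q)"
  by (induction p rule: pset.induct) auto

lemma pset_append: "pset (p @ x # q) = pset (p @ [x]) \<union> pset (x # q)"
  by (induction p rule: pset.induct) auto

lemma pcl_append: "pcl (p @ x # q) = pcl (p @ [x]) \<union> pcl (x # q)"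
proof (induction p rule: pcl.induct)
  case "2_1" then show ?case by (cases q) auto
next
  case "2_2" then show ?case by (cases q) auto
qed auto

lemma psimple_append:
  "psimple (p @ x # q) \<longleftrightarrow> psimple (p @ [x]) \<and> psimple (x # q) \<and> pset (p @ [x]) \<inter> pset (x # q) = {}"
proof (induction p rule: psimple.induct)
  case (1 a b p)
  have e: "pset (b # p @ x # q) = pset (b # p @ [x]) \<union> pset (x # q)"
    using pset_append[of "b # p" x q] by simp
  show ?case using 1 by (auto simp: e)
qed auto

lemma pcl_eq: "psimple p \<Longrightarrow> p \<noteq> [] \<Longrightarrow> pcl p = pset p \<union> {last p}"
proof (induction p rule: pset.induct)
  case (1 x y p)
  then have "y \<in> pset (y # p) \<union> {last (y # p)}" by (cases p) auto
  then show ?case using 1 by auto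
qed auto

lemma set_subset_pcl: "set p \<subseteq> pcl p"
  by (induction p rule: pcl.induct) auto

lemma butlast_subset_pset: "psimple p \<Longrightarrow> set (butlast p) \<subseteq> pset p"
  by (induction p rule: psimple.induct) auto

lemma compact_pcl: "compact (pcl p)"
  by (induction p rule: pcl.induct) (auto simp: finite_imp_compact)

lemma connected_pcl: "connected (pcl p)"
proof (induction p rule: pcl.induct)
  case (1 x y p)
  have "y \<in> pcl (y # p)" using set_subset_pcl[of "y # p"] by auto
  then show ?case using 1 by (auto intro!: connected_Un)
qed auto

lemma pcl_subset_convex: "set p \<subseteq> S \<Longrightarrow> convex S \<Longrightarrow> pcl p \<subseteq> S"
proof (induction p rule: pcl.induct)
  case (1 x y p)
  then show ?case using closed_segment_subset[of x S y] by auto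
qed auto

lemma Arg_scale: "0 < k \<Longrightarrow> Arg (of_real k * z) = Arg z"
  by (rule Arg_times_of_real)

text \<open>The branch cut of \<open>Arg\<close> is met only by viewpoints on the edge; this makes
  \<open>pang\<close> continuous off the path.\<close>

lemma nonpos_ratio_in_segment:
  fixes x y z :: complex
  assumes "(y - z) / (x - z) \<in> \<real>\<^sub>\<le>\<^sub>0" "z \<noteq> x"
  shows "z \<in> closed_segment x y"
proof -
  obtain k where k: "k \<le> 0" "(y - z) / (x - z) = of_real k"
    using assms(1) by (auto elim: nonpos_Reals_cases)
  have "x - z \<noteq> 0" using assms(2) by simp
  from k(2)[unfolded nonzero_divide_eq_eq[OF this]]
  have "y - z = of_real k * (x - z)" .
  then have e: "of_real (1 - k) * z = y - of_real k * x" by (simp add: algebra_simps)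
  define u where "u = 1 / (1 - k)"
  have u: "u * (1 - k) = 1" using k(1) by (simp add: u_def)
  then have uk: "u * k = u - 1" by (simp add: algebra_simps)
  have "z = of_real (u * (1 - k)) * z" unfolding u by simp
  also have "\<dots> = of_real u * (y - of_real k * x)" unfolding e[symmetric] by simp
  also have "\<dots> = of_real u * y - of_real (u * k) * x" by (simp add: algebra_simps)
  also have "\<dots> = (1 - u) *\<^sub>R x + u *\<^sub>R y"
    unfolding uk by (simp add: scaleR_conv_of_real algebra_simps)
  finally show ?thesis using k(1) unfolding in_segment
    by (intro exI[of _ u]) (auto simp: u_def)
qed

lemma continuous_on_pang:
  assumes "continuous_on S f" "\<And>s. s \<in> S \<Longrightarrow> f s \<notin> pcl p"
  shows "continuous_on S (\<lambda>s. pang (f s) p)"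
  using assms(2)
proof (induction p rule: pcl.induct)
  case (1 x y p)
  have "f s \<noteq> x" if "s \<in> S" for s using 1(2)[OF that] by auto
  moreover have "(y - f s) / (x - f s) \<notin> \<real>\<^sub>\<le>\<^sub>0" if "s \<in> S" for s
    using nonpos_ratio_in_segment[of y "f s" x] 1(2)[OF that] by auto
  ultimately have "continuous_on S (\<lambda>s. Arg ((y - f s) / (x - f s)))"
    by (intro continuous_intros assms(1)) auto
  moreover have "continuous_on S (\<lambda>s. pang (f s) (y # p))"
    using 1 by auto
  ultimately show ?case by (simp add: continuous_on_add)
qed auto

lemma cis_Arg_sgn: "z \<noteq> 0 \<Longrightarrow> cis (Arg z) = sgn z"
  using cis_Arg by blast

lemma cis_pang:
  assumes "p \<noteq> []" "z \<notin> set p"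
  shows "cis (pang z p) = sgn ((last p - z) / (hd p - z))"
  using assms
proof (induction z p rule: pang.induct)
  case (1 z x y p)
  have "cis (pang z (x # y # p)) = sgn ((y - z) / (x - z)) * sgn ((last (y # p) - z) / (y - z))"
  proof -
    have "y - z \<noteq> 0" "x - z \<noteq> 0" using 1 by auto
    then have "cis (Arg ((y - z) / (x - z))) = sgn ((y - z) / (x - z))" by (intro cis_Arg_sgn) auto
    moreover have "cis (pang z (y # p)) = sgn ((last (y # p) - z) / (y - z))" using 1 by simp
    moreover have "cis (pang z (x # y # p)) = cis (Arg ((y - z) / (x - z))) * cis (pang z (y # p))"
      by (simp add: cis_mult)
    ultimately show ?thesis by metis
  qed
  also have "\<dots> = sgn (((y - z) / (x - z)) * ((last (y # p) - z) / (y - z)))"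
    by (simp only: sgn_mult)
  also have "((y - z) / (x - z)) * ((last (y # p) - z) / (y - z)) = (last (y # p) - z) / (x - z)"
    using 1 by auto
  finally show ?case by simp
qed (auto simp: sgn_eq)

section \<open>Orientation of a simple closed polygon\<close>

lemma const_if_cis_const:
  fixes f :: "'a::metric_space \<Rightarrow> real"
  assumes "connected S" "continuous_on S f" "\<And>x. x \<in> S \<Longrightarrow> cis (f x) = c" "x \<in> S" "y \<in> S"
  shows "f x = f y"
proof -
  have "f constant_on S"
  proof (rule continuous_discrete_range_constant[OF assms(1,2)])
    fix x assume x: "x \<in> S"
    have "2 * pi \<le> norm (f y - f x)" if y: "y \<in> S" "f y \<noteq> f x" for y
    proof -
      have "cis (f y - f x) = 1"
        using assms(3)[OF x] assms(3)[OF y(1)] cis_divide[of "f y" "f x"] cis_neq_zero[of "f x"] by simp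
      then have "exp (\<i> * of_real (f y - f x)) = 1" by (simp add: cis_conv_exp)
      then obtain n :: int where n: "f y - f x = of_int (2 * n) * pi"
        unfolding exp_eq_1 by auto
      then have "n \<noteq> 0" using y by auto
      then have "\<bar>real_of_int n\<bar> \<ge> 1" by linarith
      then show ?thesis unfolding n by (simp add: abs_mult)
    qed
    then show "\<exists>e>0. \<forall>y. y \<in> S \<and> f y \<noteq> f x \<longrightarrow> e \<le> norm (f y - f x)"
      by (intro exI[of _ "2 * pi"]) auto
  qed
  then show ?thesis using assms(4,5) by (auto simp: constant_on_def)
qed

text \<open>Angle swept by the rest of the polygon as seen from its vertex \<open>v\<close>, plus
  the exterior angle at \<open>v\<close>. For a convex counterclockwise polygon this is interior
  plus exterior angle, hence pi. Unlike a winding number it is taken at a point of the polygon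
  itself.\<close>

definition ori :: "complex \<Rightarrow> complex list \<Rightarrow> real" where
  "ori v M = pang v M + Arg ((hd M - v) / (v - last M))"

lemma psimple_corner:
  assumes "psimple (p @ [x, v, y] @ q)" "q \<noteq> [] \<or> y \<notin> closed_segment x v"
  shows "closed_segment x v \<inter> closed_segment v y = {v}"
proof -
  have s: "psimple ([x, v, y] @ q)" using assms(1) psimple_append[of p x "[v,y] @ q"] by simp
  have "y \<notin> closed_segment x v"
  proof (cases q)
    case (Cons a r)
    then have "y \<in> pset (y # q)" using s by auto
    then show ?thesis using s by auto
  qed (use assms in auto)
  moreover have "(closed_segment x v - {v}) \<inter> (closed_segment v y - {y}) = {}" using s by auto
  ultimately show ?thesis by auto
qed

text \<open>If both edges left the corner in the same direction, the end of the shorter one would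
  lie on the other.\<close>

lemma corner_ray:
  assumes "closed_segment x v \<inter> closed_segment v y = {v}" "x \<noteq> v" "y \<noteq> v" "0 < s"
  shows "x \<noteq> v + of_real s * (y - v)"
proof
  assume x: "x = v + of_real s * (y - v)"
  show False
  proof (cases "s \<le> 1")
    case True
    then have "x \<in> closed_segment v y" unfolding x in_segment using assms
      by (intro exI[of _ s]) (auto simp: scaleR_conv_of_real algebra_simps)
    then show False using assms by auto
  next
    case False
    have "y = v + of_real (1 / s) * (x - v)" using assms(4) unfolding x by (simp add: mult.assoc[symmetric] of_real_mult[symmetric] del: of_real_mult)
    then have "y = (1 - (1 - 1/s)) *\<^sub>R x + (1 - 1/s) *\<^sub>R v"
      by (simp add: scaleR_conv_of_real algebra_simps)
    then have "y \<in> closed_segment x v" unfolding in_segment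
      using False by (intro exI[of _ "1 - 1/s"]) auto
    then show False using assms by auto
  qed
qed

lemma psimple_rotate: "psimple (v # y # M @ [v]) \<longleftrightarrow> psimple (y # M @ [v, y])"
  using psimple_append[of "[v]" y "M @ [v]"] psimple_append[of "y # M" v "[y]"] by auto

text \<open>The path \<open>v y v\<close> would run through the midpoint of its edge twice.\<close>

lemma closed_path_length:
  assumes "psimple (v # y # M @ [v])"
  shows "M \<noteq> []"
proof
  assume "M = []"
  then have "(closed_segment v y - {y}) \<inter> (closed_segment y v - {v}) = {}" "v \<noteq> y" using assms by auto
  moreover have "midpoint v y \<in> (closed_segment v y - {y}) \<inter> (closed_segment y v - {v})"
    using \<open>v \<noteq> y\<close> by (auto simp: midpoint_eq_endpoint closed_segment_commute[of y v])
  ultimately show False by blast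
qed

lemma closed_path_corner:
  assumes "psimple (v # y # M @ [v])"
  shows "closed_segment (last M) v \<inter> closed_segment v y = {v}" "last M \<noteq> v"
proof -
  note closed_path_length[OF assms]
  then obtain y' N where MN: "M = y' # N" by (cases M) auto
  obtain L x where Mx: "M = L @ [x]" using \<open>M \<noteq> []\<close> by (cases M rule: rev_cases) auto
  show "last M \<noteq> v" using assms Mx psimple_append[of "v # y # L" x "[v]"] by simp
  have vy: "v \<noteq> y" using assms by simp
  have "psimple ((y # L) @ [x, v, y] @ [])" using assms psimple_rotate[of v y M] Mx by simp
  moreover have "y \<notin> closed_segment x v"
  proof -
    have "(closed_segment y y' - {y'}) \<inter> pset (M @ [v]) = {}" "y \<noteq> y'" using assms MN by simp_all
    then have "y \<notin> pset (M @ [v])" by auto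
    then show ?thesis using pset_append[of L x "[v]"] Mx vy by auto
  qed
  ultimately have "closed_segment x v \<inter> closed_segment v y = {v}" using psimple_corner by blast
  then show "closed_segment (last M) v \<inter> closed_segment v y = {v}" by (simp add: Mx)
qed

text \<open>The viewpoint \<open>f t\<close> moves along the edge from \<open>v\<close> to
  \<open>y\<close>. In \<open>g\<close> the directions from \<open>f t\<close> to the ends of this
  edge, which degenerate when an end is reached, are replaced by the constant direction
  \<open>y - v\<close>. So \<open>g\<close> is continuous on the closed interval, and as its
  \<open>cis\<close> is constantly \<open>-1\<close>, it is constant; its values at
  \<open>0\<close>, at \<open>1\<close> and in between are the three quantities compared.\<close>

lemma ori_rotate:
  assumes "psimple (v # y # M @ [v])"
  shows "ori v (y # M) = ori y (M @ [v])"
    and "m \<in> open_segment v y \<Longrightarrow> pang m (y # M @ [v]) = ori v (y # M)"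
proof -
  note closed_path_length[OF assms]
  then obtain y' N where MN: "M = y' # N" by (cases M) auto
  obtain L x where Mx: "M = L @ [x]" using \<open>M \<noteq> []\<close> by (cases M rule: rev_cases) auto
  have "psimple (M @ [v])" using assms MN by simp
  then have sM: "psimple M" using psimple_append[of L x "[v]"] Mx by simp
  have vy: "v \<noteq> y" using assms by simp
  have c2: "closed_segment v y \<inter> closed_segment y y' = {y}"
    using psimple_corner[of "[]" v y y' "N @ [v]"] assms MN by simp
  have c1: "closed_segment x v \<inter> closed_segment v y = {v}"
    using closed_path_corner[OF assms] by (simp add: Mx)
  have ny: "y' \<noteq> y" using assms MN by auto
  have nx: "x \<noteq> v" using assms Mx psimple_append[of "v # y # L" x "[v]"] by simp
  define f where "f t = v + of_real t * (y - v)" for t :: real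
  have fseg: "f t \<in> closed_segment v y" if "t \<in> {0..1}" for t
    using that unfolding f_def in_segment by (intro exI[of _ t]) (auto simp: scaleR_conv_of_real algebra_simps)
  have fM: "f t \<notin> pcl M" if t: "t \<in> {0..1}" for t
  proof -
    have 1: "(closed_segment v y - {y}) \<inter> pset (y # M @ [v]) = {}" using assms by simp
    have p1: "pset (M @ [v]) = pset M \<union> (closed_segment x v - {v})"
      using pset_append[of L x "[v]"] unfolding Mx by simp
    have 2: "pset (y # M @ [v]) = (closed_segment y y' - {y'}) \<union> pset (M @ [v])"
      unfolding MN by simp
    have 3: "(closed_segment y y' - {y'}) \<inter> pset (M @ [v]) = {}" using assms unfolding MN by simp
    have "y \<in> closed_segment y y' - {y'}" using ny by simp
    with 3 have "y \<notin> pset (M @ [v])" by blast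
    with 1 2 p1 nx have "closed_segment v y \<inter> pset M = {}" "x \<notin> closed_segment v y"
      by auto
    then show ?thesis using fseg[OF t] pcl_eq[OF sM \<open>M \<noteq> []\<close>] unfolding Mx by auto
  qed
  define g where "g t = Arg ((y - v) / (f t - x)) + pang (f t) M + Arg ((y' - f t) / (y - v))" for t
  have "x \<in> set M" unfolding Mx by simp
  moreover have "y' \<in> set M" unfolding MN by simp
  ultimately have fx: "f t \<noteq> x" "f t \<noteq> y'" if "t \<in> {0..1}" for t
    using fM[OF that] set_subset_pcl[of M] by blast+
  \<comment> \<open>The branch cut would put \<open>x\<close> on the ray from \<open>v\<close>
    through \<open>y\<close>; for \<open>n2\<close> likewise \<open>y'\<close> on the ray from
    \<open>y\<close> through \<open>v\<close>.\<close>
  have n1: "(y - v) / (f t - x) \<notin> \<real>\<^sub>\<le>\<^sub>0" if t: "t \<in> {0..1}" for t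
  proof
    assume "(y - v) / (f t - x) \<in> \<real>\<^sub>\<le>\<^sub>0"
    then obtain k where k: "k \<le> 0" "(y - v) / (f t - x) = of_real k" by (auto elim: nonpos_Reals_cases)
    then have e: "y - v = of_real k * (f t - x)" using fx[OF t] by (simp add: field_simps)
    then have "k \<noteq> 0" using vy by auto
    then have "x = v + of_real (t - 1/k) * (y - v)" using e unfolding f_def by (simp add: field_simps)
    moreover have "t - 1/k > 0"
    proof -
      have "1/k < 0" using k \<open>k \<noteq> 0\<close> by simp
      moreover have "0 \<le> t" using t by simp
      ultimately show ?thesis by linarith
    qed
    ultimately show False using corner_ray[OF c1 nx vy[symmetric]] by blast
  qed
  have n2: "(y' - f t) / (y - v) \<notin> \<real>\<^sub>\<le>\<^sub>0" if t: "t \<in> {0..1}" for t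
  proof
    assume "(y' - f t) / (y - v) \<in> \<real>\<^sub>\<le>\<^sub>0"
    then obtain k where k: "k \<le> 0" "(y' - f t) / (y - v) = of_real k" by (auto elim: nonpos_Reals_cases)
    then have e: "y' = f t + of_real k * (y - v)" using vy by (simp add: field_simps)
    then have e2: "y' = y + of_real (1 - t - k) * (v - y)" unfolding f_def by (simp add: algebra_simps)
    then have "1 - t - k \<noteq> 0" using ny by auto
    then have "1 - t - k > 0" using k t by auto
    then show False using corner_ray[of y' y v "1 - t - k"] c2 ny vy e2 by (auto simp: closed_segment_commute)
  qed
  have cf: "continuous_on {0..1} f" unfolding f_def by (intro continuous_intros)
  have cg: "continuous_on {0..1} g" unfolding g_def
    by (intro continuous_intros continuous_on_pang cf) (use fx n1 n2 fM vy in auto)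
  have "cis (g t) = -1" if t: "t \<in> {0..1}" for t
  proof -
    have ft: "f t \<notin> set M" using fM[OF t] set_subset_pcl by blast
    have "cis (g t) = sgn ((y - v) / (f t - x)) * sgn ((x - f t) / (y' - f t)) * sgn ((y' - f t) / (y - v))"
    proof -
      have "last M = x" unfolding Mx by simp
      moreover have "hd M = y'" unfolding MN by simp
      ultimately have "cis (pang (f t) M) = sgn ((x - f t) / (y' - f t))" using cis_pang[OF \<open>M \<noteq> []\<close> ft] by simp
      moreover have "cis (Arg ((y - v) / (f t - x))) = sgn ((y - v) / (f t - x))"
        "cis (Arg ((y' - f t) / (y - v))) = sgn ((y' - f t) / (y - v))"
        using fx[OF t] vy by (auto intro!: cis_Arg_sgn simp del: sgn_divide)
      ultimately show ?thesis unfolding g_def by (simp only: cis_mult[symmetric])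
    qed
    also have "\<dots> = sgn ((y - v) / (f t - x) * ((x - f t) / (y' - f t)) * ((y' - f t) / (y - v)))"
      by (simp only: sgn_mult)
    also have "(y - v) / (f t - x) * ((x - f t) / (y' - f t)) * ((y' - f t) / (y - v)) = -1"
    proof -
      have cancel: "c / a * (- a / b) * (b / c) = -1" if "a \<noteq> 0" "b \<noteq> 0" "c \<noteq> 0" for a b c :: complex
        using that by simp
      show ?thesis using cancel[of "f t - x" "y' - f t" "y - v"] fx[OF t] vy
        unfolding minus_diff_eq by auto
    qed
    finally show ?thesis by (simp add: sgn_eq)
  qed
  note const = const_if_cis_const[of "{0..1::real}" g "-1", OF _ cg this]
  have g0: "g 0 = ori v (y # M)"
  proof -
    have "last (y # M) = x" unfolding Mx by simp
    moreover have "pang v (y # M) = Arg ((y' - v) / (y - v)) + pang v M" unfolding MN by simp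
    ultimately show ?thesis unfolding g_def ori_def f_def by simp
  qed
  have "g 1 = ori y (M @ [v])"
  proof -
    have "pang y (M @ [v]) = pang y M + Arg ((v - y) / (x - y))"
      using pang_append[of y L x "[v]"] unfolding Mx by simp
    moreover have "(v - y) / (x - y) = (y - v) / (y - x)"
      using minus_divide_divide[of "y - v" "y - x"] by simp
    ultimately show ?thesis unfolding g_def ori_def f_def using MN by simp
  qed
  then show "ori v (y # M) = ori y (M @ [v])" using const[of 0 1] g0 by auto
  assume "m \<in> open_segment v y"
  then obtain t where t: "0 < t" "t < 1" "m = f t"
    unfolding in_segment f_def by (auto simp: scaleR_conv_of_real algebra_simps)
  have "pang m (y # M @ [v]) = Arg ((y' - m) / (y - m)) + pang m M + Arg ((v - m) / (x - m))"
  proof -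
    have "pang m (y # M @ [v]) = Arg ((y' - m) / (y - m)) + pang m (M @ [v])" unfolding MN by simp
    moreover have "pang m (M @ [v]) = pang m M + Arg ((v - m) / (x - m))"
      using pang_append[of m L x "[v]"] unfolding Mx by simp
    ultimately show ?thesis by simp
  qed
  moreover have "Arg ((y' - m) / (y - m)) = Arg ((y' - m) / (y - v))"
  proof -
    have e: "y - m = of_real (1 - t) * (y - v)" unfolding t(3) f_def by (simp add: algebra_simps)
    have "(y' - m) / (y - v) = of_real (1 - t) * ((y' - m) / (y - m))"
      unfolding e using t vy by (simp del: of_real_diff)
    then show ?thesis using Arg_scale[of "1 - t" "(y' - m) / (y - m)"] t by (simp only: diff_gt_0_iff_gt)
  qed
  moreover have "Arg ((v - m) / (x - m)) = Arg ((y - v) / (m - x))"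
  proof -
    have e: "v - m = - (of_real t * (y - v))" unfolding t(3) f_def by (simp add: algebra_simps)
    have "(v - m) / (x - m) = of_real t * ((y - v) / (m - x))"
      unfolding e minus_diff_eq[of m x, symmetric] minus_divide_divide by simp
    then show ?thesis using Arg_scale[of t "(y - v) / (m - x)"] t by (simp only:)
  qed
  ultimately have "pang m (y # M @ [v]) = g t" unfolding g_def t(3) by simp
  then show "pang m (y # M @ [v]) = ori v (y # M)" using const[of t 0] g0 t by auto
qed

section \<open>Spherical length of polygonal chains\<close>

lemma vertex_notin_pcl:
  assumes "psimple (v # M @ [v])" "M \<noteq> []"
  shows "v \<notin> pcl M"
proof -
  obtain y N where MN: "M = y # N" using assms by (cases M) auto
  obtain L x where Mx: "M = L @ [x]" using assms by (cases M rule: rev_cases) auto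
  have "psimple (M @ [v])" "(closed_segment v y - {y}) \<inter> pset (M @ [v]) = {}" "v \<noteq> y"
    using assms MN by simp_all
  moreover have "psimple M" using \<open>psimple (M @ [v])\<close> psimple_append[of L x "[v]"] Mx by simp
  moreover have "pset (M @ [v]) = pset M \<union> (closed_segment x v - {v})"
    using pset_append[of L x "[v]"] unfolding Mx by simp
  moreover have "x \<noteq> v" using \<open>psimple (M @ [v])\<close> psimple_append[of L x "[v]"] Mx by simp
  ultimately show ?thesis using pcl_eq[of M] assms(2) Mx by auto
qed

section \<open>Orientation read off at an extreme vertex\<close>

lemma Im_ratio_turn: "Im ((y - v) / (v - x)) = turn x v y / (cmod (v - x))\<^sup>2"
  unfolding turn_def by (simp add: Im_divide cmod_power2 algebra_simps)

lemma Arg_divide_right_half: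
  assumes "Re a > 0" "Re b > 0"
  shows "Arg (b / a) = Arg b - Arg a"
proof (rule cis_Arg_unique)
  have "a \<noteq> 0" "b \<noteq> 0" using assms by auto
  then show "sgn (b / a) = cis (Arg b - Arg a)"
    by (simp add: cis_divide[symmetric] cis_Arg_sgn)
  show "-pi < Arg b - Arg a" "Arg b - Arg a \<le> pi"
    using assms Arg_Re_pos[of a] Arg_Re_pos[of b] by linarith+
qed

text \<open>In an open half-plane whose boundary passes through \<open>z\<close> one branch of the
  argument serves all vertices, so the sum telescopes.\<close>

lemma pang_half_plane:
  assumes "\<And>w. w \<in> set p \<Longrightarrow> 0 < Re (cnj d * (w - z))" "p \<noteq> []"
  shows "pang z p = Arg (cnj d * (last p - z)) - Arg (cnj d * (hd p - z))"
  using assms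
proof (induction z p rule: pang.induct)
  case (1 z x y p)
  have d: "d \<noteq> 0" using 1(2)[of x] by auto
  have "Arg ((y - z) / (x - z)) = Arg ((cnj d * (y - z)) / (cnj d * (x - z)))"
    using d by simp
  also have "\<dots> = Arg (cnj d * (y - z)) - Arg (cnj d * (x - z))"
    using 1(2)[of x] 1(2)[of y] by (intro Arg_divide_right_half) auto
  finally show ?case using 1 by simp
qed auto

text \<open>The swept angle is \<open>- Arg (?b / ?a)\<close> and the exterior angle is
  \<open>Arg (- (?b / ?a))\<close>; the sign of the imaginary part of the quotient decides whether
  they add up to pi or to -pi.\<close>

lemma ori_extreme:
  assumes "\<And>w. w \<in> set M \<Longrightarrow> 0 < Re (cnj d * (w - v))" "M \<noteq> []"
  shows "0 < turn (last M) v (hd M) \<Longrightarrow> ori v M = pi"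
    and "turn (last M) v (hd M) < 0 \<Longrightarrow> ori v M = - pi"
proof -
  let ?x = "last M" and ?y = "hd M"
  let ?a = "cnj d * (?x - v)" and ?b = "cnj d * (?y - v)"
  have ab: "Re ?a > 0" "Re ?b > 0" using assms by (metis last_in_set, metis hd_in_set)
  then have nz: "d \<noteq> 0" "?x \<noteq> v" "?y \<noteq> v" by auto
  have w: "(?y - v) / (v - ?x) = - (?b / ?a)"
    using nz by (simp add: divide_simps) (simp add: algebra_simps)
  have o: "ori v M = - Arg (?b / ?a) + Arg (- (?b / ?a))"
    unfolding ori_def w Arg_divide_right_half[OF ab]
    using pang_half_plane[of M d v, OF assms(1) assms(2)] by simp
  have im: "Im (?b / ?a) = - (turn ?x v ?y / (cmod (v - ?x))\<^sup>2)"
    using Im_ratio_turn[of ?y v ?x] unfolding w by simp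
  have ba: "?b / ?a \<noteq> 0" using nz by simp
  { assume "0 < turn ?x v ?y"
    then have "Im (?b / ?a) < 0" unfolding im using nz by simp
    then have "Arg (?b / ?a) < 0" using Arg_less_0[of "?b / ?a"] by linarith
    then show "ori v M = pi" unfolding o Arg_minus[OF ba] by simp }
  { assume "turn ?x v ?y < 0"
    then have "Im (?b / ?a) > 0" unfolding im using nz by (simp add: divide_neg_pos)
    then have "Arg (?b / ?a) > 0" using Arg_lt_pi[of "?b / ?a"] by linarith
    then show "ori v M = - pi" unfolding o Arg_minus[OF ba] by simp }
qed

lemma rotate_many:
  assumes "psimple (v # M @ [v])" "v # M = X @ e # Y"
  shows "psimple (e # (Y @ X) @ [e]) \<and> ori e (Y @ X) = ori v M"
  using assms
proof (induction X arbitrary: v M Y)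
  case (Cons x X)
  then have x: "x = v" "M = X @ e # Y" by auto
  have "M \<noteq> []" using x by simp
  then obtain y N where MN: "M = y # N" by (cases M) auto
  have "psimple (y # (N @ [v]) @ [y])" using Cons.prems psimple_rotate[of v y N] MN by simp
  moreover have "y # (N @ [v]) = X @ e # (Y @ [v])" using MN x by simp
  ultimately have "psimple (e # ((Y @ [v]) @ X) @ [e]) \<and> ori e ((Y @ [v]) @ X) = ori y (N @ [v])"
    by (rule Cons.IH)
  moreover have "ori y (N @ [v]) = ori v M" using ori_rotate(1)[of v y N] Cons.prems MN by simp
  ultimately show ?case using x by simp
qed auto

lemma closed_path_nonempty: "psimple (v # M @ [v]) \<Longrightarrow> 2 \<le> length M"
  using closed_path_length[of v "hd M" "tl M"] by (cases M; cases "tl M") auto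

lemma ori_at_extreme:
  assumes ps: "psimple (v # M @ [v])" and e: "v # M = X @ e # Y"
    and d: "\<And>w. w \<in> set (Y @ X) \<Longrightarrow> 0 < Re (cnj d * (w - e))"
  shows "0 < turn (last (Y @ X)) e (hd (Y @ X)) \<and> ori v M = pi \<or>
         turn (last (Y @ X)) e (hd (Y @ X)) < 0 \<and> ori v M = - pi"
proof -
  let ?N = "Y @ X"
  have N: "psimple (e # ?N @ [e])" "ori e ?N = ori v M" using rotate_many[OF ps e] by auto
  then have len: "2 \<le> length ?N" using closed_path_nonempty by blast
  then obtain y N' where N': "?N = y # N'" by (cases ?N) auto
  let ?x = "last ?N"
  have N'ne: "N' \<noteq> []" using len N' by auto
  have cor: "closed_segment ?x e \<inter> closed_segment e y = {e}" "?x \<noteq> e"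
    using closed_path_corner[of e y N'] N N' N'ne by auto
  have ye: "y \<noteq> e" using N N' by auto
  \<comment> \<open>At a straight corner both neighbours, being on the positive side of
    \<open>e\<close>, would lie in the same direction from it, against simplicity.\<close>
  have "turn ?x e y \<noteq> 0"
  proof
    assume "turn ?x e y = 0"
    then have "Im ((y - e) / (e - ?x)) = 0" by (simp add: Im_ratio_turn)
    then obtain s where "(y - e) / (e - ?x) = of_real s" by (metis complex_is_Real_iff Reals_cases)
    then have s: "y - e = of_real s * (e - ?x)" using cor(2) by (simp add: nonzero_divide_eq_eq)
    have "Re (cnj d * (y - e)) = - s * Re (cnj d * (?x - e))" unfolding s by (simp add: algebra_simps)
    moreover have "Re (cnj d * (y - e)) > 0" "Re (cnj d * (?x - e)) > 0"
      using d[of y] d[of ?x] N' last_in_set[of ?N] by auto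
    ultimately have "s < 0" by (metis mult_less_0_iff neg_less_0_iff_less not_less_iff_gr_or_eq zero_less_mult_pos2 minus_minus)
    then have "?x = e + of_real (- (1 / s)) * (y - e)" unfolding s by (simp add: field_simps)
    then show False using corner_ray[OF cor ye, of "- (1/s)"] \<open>s < 0\<close> by auto
  qed
  then consider "0 < turn ?x e y" | "turn ?x e y < 0" by linarith
  then show ?thesis using ori_extreme[of ?N d e, OF d] N N' by cases auto
qed

text \<open>If all extreme points of the hull of \<open>S\<close> were in \<open>T\<close>, then by
  Krein-Milman \<open>S\<close> would lie in the hull of \<open>T\<close>. The set \<open>T\<close>
  serves to avoid the two ends of a chord, where the bend of a closed-up path is not under
  control.\<close>

lemma exists_extreme:
  fixes S :: "complex set"
  assumes "finite S" "\<not> S \<subseteq> convex hull T"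
  obtains e d where "e \<in> S" "e \<notin> T" "\<And>w. w \<in> S - {e} \<Longrightarrow> 0 < Re (cnj d * (w - e))"
proof -
  have "\<exists>e. e extreme_point_of (convex hull S) \<and> e \<notin> T"
  proof (rule ccontr)
    assume "\<not> ?thesis"
    then have "{x. x extreme_point_of (convex hull S)} \<subseteq> T" by blast
    then have "convex hull S \<subseteq> convex hull T"
      using Krein_Milman_Minkowski[of "convex hull S"] assms(1)
      by (metis compact_convex_hull convex_convex_hull finite_imp_compact hull_mono)
    then show False using assms(2) hull_subset[of S convex] by blast
  qed
  then obtain e where e: "e extreme_point_of (convex hull S)" "e \<notin> T" by blast
  have eS: "e \<in> S" using e extreme_point_of_convex_hull by blast
  have "e \<notin> convex hull (S - {e})"
  proof
    assume "e \<in> convex hull (S - {e})"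
    moreover have "convex hull (S - {e}) \<subseteq> convex hull S - {e}"
      using e(1) hull_subset[of S convex] unfolding extreme_point_of_stillconvex[OF convex_convex_hull]
      by (intro hull_minimal) (auto simp: extreme_point_of_def)
    ultimately show False by blast
  qed
  moreover have "closed (convex hull (S - {e}))" "convex (convex hull (S - {e}))"
    using assms(1) by (intro compact_imp_closed compact_convex_hull finite_imp_compact convex_convex_hull; simp)+
  ultimately obtain d b where "d \<bullet> e < b" "\<forall>x\<in>convex hull (S - {e}). d \<bullet> x > b"
    using separating_hyperplane_closed_point by blast
  then have "0 < Re (cnj d * (w - e))" if "w \<in> S - {e}" for w
  proof -
    have "d \<bullet> w > d \<bullet> e" using that \<open>d \<bullet> e < b\<close> \<open>\<forall>x\<in>_. _\<close> hull_subset[of "S - {e}" convex] by force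
    then show ?thesis by (simp add: inner_complex_def algebra_simps)
  qed
  then show ?thesis using that eS e(2) by blast
qed

text \<open>The ray prolongs the edge from \<open>x\<close> beyond \<open>v\<close>. For
  \<open>ori v M = pi\<close> its points up to the first hit see a full turn of the polygon after a
  right bend at \<open>v\<close>, and none after a left bend: this tells inside from outside. In
  \<open>g\<close> the first angle is measured from the direction \<open>v - x\<close>, so that the
  start \<open>v\<close> of the ray is included.\<close>

lemma pang_ray:
  assumes ps: "psimple (v # M @ [v])" and x: "x = last M" and y: "y = hd M"
    and tn: "turn x v y \<noteq> 0"
    and miss: "\<And>s. 0 < s \<Longrightarrow> s < T \<Longrightarrow> v + of_real s * (v - x) \<notin> pcl M"
    and s0: "0 < s0" "s0 < T"
  shows "pang (v + of_real s0 * (v - x)) (v # M @ [v]) = ori v M + (if turn x v y < 0 then pi else - pi)"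
proof -
  have M2: "2 \<le> length M" by (rule closed_path_nonempty[OF ps])
  then obtain N where MN: "M = y # N" using y by (cases M) auto
  obtain L where Mx: "M = L @ [x]" using x M2 by (cases M rule: rev_cases) auto
  have vM: "v \<notin> pcl M" using vertex_notin_pcl[OF ps] M2 by fastforce
  moreover have "x \<in> set M" unfolding Mx by simp
  moreover have "y \<in> set M" unfolding MN by simp
  ultimately have xv: "x \<noteq> v" "y \<noteq> v" using set_subset_pcl[of M] by blast+
  define f where "f s = v + of_real s * (v - x)" for s :: real
  have f0: "f s \<notin> pcl M" if "s \<in> {0..s0}" for s
    using that vM miss[of s] s0 by (cases "s = 0") (auto simp: f_def)
  define g where "g s = Arg (- ((y - f s) / (v - x))) + pang (f s) M" for s
  have im: "Im ((y - f s) / (v - x)) \<noteq> 0" for s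
  proof -
    have "(y - f s) / (v - x) = (y - v) / (v - x) - of_real s"
      unfolding f_def using xv by (simp add: field_simps)
    then show ?thesis using tn xv by (simp add: Im_ratio_turn)
  qed
  have cf: "continuous_on A f" for A unfolding f_def by (intro continuous_intros)
  have cg: "continuous_on {0..s0} g" unfolding g_def
  proof (intro continuous_intros continuous_on_pang cf f0)
    fix s show "- ((y - f s) / (v - x)) \<notin> \<real>\<^sub>\<le>\<^sub>0"
      using im[of s] by (auto simp: complex_nonpos_Reals_iff simp del: minus_divide_left)
  qed (use xv in auto)
  have "cis (g s) = 1" if s: "s \<in> {0..s0}" for s
  proof -
    have n: "f s \<notin> set M" using f0[OF s] set_subset_pcl by blast
    moreover have "x \<in> set M" unfolding Mx by simp
    moreover have "y \<in> set M" unfolding MN by simp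
    ultimately have n': "f s \<noteq> y" "f s \<noteq> x" by blast+
    have "cis (g s) = sgn (- ((y - f s) / (v - x))) * sgn ((x - f s) / (y - f s))"
    proof -
      have "M \<noteq> []" using MN by simp
      then have "cis (pang (f s) M) = sgn ((x - f s) / (y - f s))" using cis_pang[OF _ n] x y by blast
      moreover have "- ((y - f s) / (v - x)) \<noteq> 0" using n' xv by auto
      then have "cis (Arg (- ((y - f s) / (v - x)))) = sgn (- ((y - f s) / (v - x)))" by (rule cis_Arg_sgn)
      ultimately show ?thesis unfolding g_def by (simp only: cis_mult[symmetric])
    qed
    also have "\<dots> = sgn (- ((y - f s) / (v - x)) * ((x - f s) / (y - f s)))" by (simp only: sgn_mult)
    also have "- ((y - f s) / (v - x)) * ((x - f s) / (y - f s)) = of_real (1 + s)"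
    proof -
      have "x - f s = - (of_real (1 + s) * (v - x))" unfolding f_def by (simp add: algebra_simps)
      then show ?thesis using n' xv by simp
    qed
    finally show ?thesis using s sgn_of_real[of "1 + s"] by (simp del: of_real_add)
  qed
  then have g: "g s0 = g 0" using s0 cg by (intro const_if_cis_const[of "{0..s0}" g 1]) auto
  have "pang (f s0) (v # M @ [v]) = Arg ((y - f s0) / (v - f s0)) + pang (f s0) M + Arg ((v - f s0) / (x - f s0))"
  proof -
    have "pang (f s0) (v # M @ [v]) = Arg ((y - f s0) / (v - f s0)) + pang (f s0) (M @ [v])"
      unfolding MN by simp
    moreover have "pang (f s0) (M @ [v]) = pang (f s0) M + Arg ((v - f s0) / (x - f s0))"
      using pang_append[of "f s0" L x "[v]"] unfolding Mx by simp
    ultimately show ?thesis by simp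
  qed
  also have "Arg ((v - f s0) / (x - f s0)) = 0"
  proof -
    have "(v - f s0) / (x - f s0) = of_real (s0 / (1 + s0))"
    proof -
      have "x - f s0 = - (of_real (1 + s0) * (v - x))" "v - f s0 = - (of_real s0 * (v - x))"
        unfolding f_def by (auto simp: algebra_simps)
      then show ?thesis using xv by simp
    qed
    moreover have "0 < s0 / (1 + s0)" using s0 by (intro divide_pos_pos) auto
    from less_not_sym[OF this] have "Arg (of_real (s0 / (1 + s0))) = 0"
      unfolding Arg_of_real by (rule if_not_P)
    ultimately show ?thesis by (simp only:)
  qed
  also have "Arg ((y - f s0) / (v - f s0)) = Arg (- ((y - f s0) / (v - x)))"
  proof -
    have "- ((y - f s0) / (v - x)) = of_real s0 * ((y - f s0) / (v - f s0))"
      using s0 xv unfolding f_def by (simp add: divide_simps)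
    then show ?thesis using Arg_scale[OF s0(1)] by metis
  qed
  finally have "pang (f s0) (v # M @ [v]) = g s0" unfolding g_def by simp
  also note g
  also have "g 0 = pang v M + Arg (- ((y - v) / (v - x)))" unfolding g_def f_def by simp
  also have "\<dots> = ori v M + (if turn x v y < 0 then pi else - pi)"
  proof -
    let ?w = "(y - v) / (v - x)"
    have w0: "?w \<noteq> 0" using xv by simp
    have "turn x v y < 0 \<longleftrightarrow> Im ?w < 0" using xv by (simp add: Im_ratio_turn divide_less_0_iff)
    also have "\<dots> \<longleftrightarrow> Arg ?w \<le> 0"
    proof -
      have "Im ?w \<noteq> 0" using tn xv by (simp add: Im_ratio_turn)
      then have "Arg ?w \<noteq> 0" by (auto simp: Arg_eq_0 complex_is_Real_iff)
      then show ?thesis using Arg_less_0[of ?w] by auto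
    qed
    finally show ?thesis unfolding ori_def x[symmetric] y[symmetric] Arg_minus[OF w0] by auto
  qed
  finally show ?thesis unfolding f_def .
qed

text \<open>A point of the chord lies on the closing edge of both pieces, and from there each piece
  sweeps its \<open>ori\<close> by \<open>ori_rotate\<close>.\<close>

lemma chord_split:
  assumes ps: "psimple (v # A @ q # B @ [v])"
    and chord: "open_segment v q \<inter> pcl (v # A @ q # B @ [v]) = {}"
  shows "psimple (v # (A @ [q]) @ [v])" "psimple (v # (q # B) @ [v])"
    and "m \<in> open_segment v q \<Longrightarrow> pang m (v # A @ q # B @ [v]) = ori v (A @ [q]) + ori v (q # B)"
proof -
  have s: "psimple (v # A @ [q])" "psimple (q # B @ [v])" "pset (v # A @ [q]) \<inter> pset (q # B @ [v]) = {}"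
    using ps psimple_append[of "v # A" q "B @ [v]"] by auto
  have vq: "v \<in> pset (v # A @ [q])" "q \<in> pset (q # B @ [v])"
    using butlast_subset_pset[OF s(1)] butlast_subset_pset[OF s(2)] by (auto simp: butlast_append)
  then have ne: "v \<noteq> q" using s(3) by blast
  have sub: "pset p \<subseteq> pcl p" for p by (induction p rule: pset.induct) auto
  have P: "pset (v # A @ [q]) \<union> pset (q # B @ [v]) \<subseteq> pcl (v # A @ q # B @ [v])"
    using pset_append[of "v # A" q "B @ [v]"] sub[of "v # A @ q # B @ [v]"] by simp
  have "pset (v # A @ [q]) \<inter> (closed_segment q v - {v}) = {}"
    using P chord vq s(3) by (auto simp: open_segment_def closed_segment_commute[of q v])
  then show 1: "psimple (v # (A @ [q]) @ [v])"
    using s(1) ne psimple_append[of "v # A" q "[v]"] by auto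
  have "(closed_segment v q - {q}) \<inter> pset (q # B @ [v]) = {}"
    using P chord vq s(3) by (auto simp: open_segment_def)
  then show 2: "psimple (v # (q # B) @ [v])"
    using s(2) ne by simp
  assume m: "m \<in> open_segment v q"
  have "psimple (q # v # A @ [q])" using 1 psimple_rotate[of q v A] by simp
  from ori_rotate[OF this] m have "pang m (v # A @ [q]) = ori v (A @ [q])"
    by (metis open_segment_commute)
  moreover have "pang m (q # B @ [v]) = ori v (q # B)" using ori_rotate(2)[of v q B m] 2 m by simp
  ultimately show "pang m (v # A @ q # B @ [v]) = ori v (A @ [q]) + ori v (q # B)"
    using pang_append[of m "v # A" q "B @ [v]"] by simp
qed

lemma vertex_notin: "psimple (v # M @ [v]) \<Longrightarrow> v \<notin> set M"
  using vertex_notin_pcl[of v M] set_subset_pcl[of M] by (cases "M = []") auto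

section \<open>Spherical length, bends and subdivision of planar paths\<close>

definition lift :: "complex \<Rightarrow> real^3" where "lift z = vector [Re z, Im z, 1]"

lemma lift_nonzero: "lift z \<noteq> 0"
proof -
  have "lift z $ 3 = 1" by (simp add: lift_def)
  then show ?thesis by (metis zero_index zero_neq_one)
qed

lemma det_lift: "lift a \<bullet> cross3 (lift b) (lift c) = turn a b c"
  by (simp add: lift_def turn_def cross3_def inner_vec_def sum_3 algebra_simps)

lemma turn_rotate: "turn a b c = turn b c a"
  by (simp add: turn_def algebra_simps)

fun plen :: "(real^3) list \<Rightarrow> real" where
  "plen (x # y # p) = sang x y + plen (y # p)"
| "plen _ = 0"

abbreviation slen :: "complex list \<Rightarrow> real" where "slen p \<equiv> plen (map lift p)"

lemma plen_append: "plen (p @ x # q) = plen (p @ [x]) + plen (x # q)"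
  by (induction p rule: plen.induct) auto

lemma sang_refl: "x \<noteq> 0 \<Longrightarrow> sang x x = 0"
  by (simp add: sang_def dot_square_norm power2_eq_square)

lemma plen_ge: "p \<noteq> [] \<Longrightarrow> 0 \<notin> set p \<Longrightarrow> sang (hd p) (last p) \<le> plen p"
proof (induction p rule: plen.induct)
  case (1 x y p)
  have "last (y # p) \<in> set (y # p)" by (rule last_in_set) simp
  then have "sang x (last (y # p)) \<le> sang x y + sang y (last (y # p))"
    using 1 by (intro sang_triangle) auto
  then show ?case using 1 by auto
qed (auto simp: sang_refl)

fun bends :: "real \<Rightarrow> complex list \<Rightarrow> bool" where
  "bends s (x # v # y # p) \<longleftrightarrow> 0 < s * turn x v y \<and> bends s (v # y # p)"
| "bends _ _ \<longleftrightarrow> True"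

lemma bends_Cons: "bends s (a # p) \<Longrightarrow> bends s p"
  by (cases "(s, a # p)" rule: bends.cases) auto

lemma bends_append: "bends s (p @ a # b # q) \<longleftrightarrow> bends s (p @ [a, b]) \<and> bends s (a # b # q)"
  by (induction s p rule: bends.induct) auto

lemma bends_suffix: "bends s (p @ q) \<Longrightarrow> bends s q"
  by (induction p) (auto dest: bends_Cons)

lemma bends_prefix: "bends s (p @ q) \<Longrightarrow> bends s p"
proof (induction s p rule: bends.induct)
  case (1 s x v y p) then show ?case by auto
qed auto

lemma bends_mid: "bends s (p @ a # b # c # q) \<Longrightarrow> 0 < s * turn a b c"
  using bends_suffix[of s p "a # b # c # q"] by simp

text \<open>The list \<open>A @ q # B\<close> traverses the same path as \<open>p\<close> and has the point \<open>q\<close> as a vertex.\<close>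

definition refines :: "complex list \<Rightarrow> complex list \<Rightarrow> complex \<Rightarrow> complex list \<Rightarrow> bool" where
  "refines p A q B \<longleftrightarrow> p = A @ q # B \<or>
     (\<exists>A' a b B'. p = A' @ a # b # B' \<and> q \<in> open_segment a b \<and> A = A' @ [a] \<and> B = b # B')"

lemma refines_exists: "q \<in> pcl p \<Longrightarrow> \<exists>A B. refines p A q B"
proof (induction p rule: pcl.induct)
  case (1 x y p)
  show ?case
  proof (cases "q \<in> pcl (y # p)")
    case True
    then obtain A B where "refines (y # p) A q B" using 1 by auto
    then have "refines (x # y # p) (x # A) q B" unfolding refines_def by (metis append_Cons)
    then show ?thesis by blast
  next
    case False
    then have "q \<in> closed_segment x y" "q \<noteq> y" using 1 set_subset_pcl[of "y # p"] by auto
    then have "q = x \<or> q \<in> open_segment x y" by (auto simp: open_segment_def)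
    then show ?thesis
    proof
      assume "q = x"
      then have "refines (x # y # p) [] q (y # p)" unfolding refines_def by simp
      then show ?thesis by blast
    next
      assume "q \<in> open_segment x y"
      then have "refines (x # y # p) [x] q (y # p)" unfolding refines_def by blast
      then show ?thesis by blast
    qed
  qed
next
  case "2_2" then show ?case unfolding refines_def by auto
qed auto

lemma refines_extend: "refines p A q B \<Longrightarrow> refines (X @ p @ Y) (X @ A) q (B @ Y)"
  unfolding refines_def by (elim disjE exE conjE) (simp, force)

lemma refines_hd: "refines p A q B \<Longrightarrow> hd (A @ [q]) = hd p"
  unfolding refines_def by (elim disjE exE conjE) (simp_all add: hd_append)

lemma refines_last: "refines p A q B \<Longrightarrow> last (q # B) = last p"
  unfolding refines_def by auto

lemma segment_insert:
  fixes a b q :: complex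
  assumes "q \<in> open_segment a b"
  shows "(closed_segment a q - {q}) \<union> (closed_segment q b - {b}) = closed_segment a b - {b}"
    "(closed_segment a q - {q}) \<inter> (closed_segment q b - {b}) = {}" "a \<noteq> q" "q \<noteq> b"
proof -
  have q: "q \<in> closed_segment a b" "q \<noteq> a" "q \<noteq> b" using assms by (auto simp: open_segment_def)
  have U: "closed_segment a q \<union> closed_segment q b = closed_segment a b"
    using Un_closed_segment[OF q(1)] .
  have I: "closed_segment a q \<inter> closed_segment q b = {q}"
    using Int_closed_segment[of q a b] q by auto
  show "(closed_segment a q - {q}) \<union> (closed_segment q b - {b}) = closed_segment a b - {b}"
    using U I q by auto
  show "(closed_segment a q - {q}) \<inter> (closed_segment q b - {b}) = {}" using I by auto
qed (use assms in \<open>auto simp: open_segment_def\<close>)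

lemma refines_psimple:
  assumes "refines p A q B" "psimple (X @ p @ Y)"
  shows "psimple (X @ A @ q # B @ Y)"
  using assms(1) unfolding refines_def
proof (elim disjE exE conjE)
  fix A' a b B' assume h: "p = A' @ a # b # B'" "q \<in> open_segment a b" "A = A' @ [a]" "B = b # B'"
  let ?V = "B' @ Y"
  have "psimple ((X @ A') @ a # b # ?V)" using assms(2) h by simp
  then have s: "psimple ((X @ A') @ [a])" "psimple (a # b # ?V)" "pset ((X @ A') @ [a]) \<inter> pset (a # b # ?V) = {}"
    using psimple_append[of "X @ A'" a "b # ?V"] by blast+
  have "pset (a # q # b # ?V) = pset (a # b # ?V)" using segment_insert(1)[OF h(2)] by auto
  moreover have "psimple (a # q # b # ?V)" using s(2) segment_insert[OF h(2)] by auto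
  ultimately have "psimple ((X @ A') @ a # q # b # ?V)" using s psimple_append[of "X @ A'" a] by simp
  then show ?thesis using h by simp
qed (use assms in simp)

lemma refines_pcl:
  assumes "refines p A q B"
  shows "pcl (X @ A @ q # B @ Y) = pcl (X @ p @ Y)"
  using assms unfolding refines_def
proof (elim disjE exE conjE)
  fix A' a b B' assume h: "p = A' @ a # b # B'" "q \<in> open_segment a b" "A = A' @ [a]" "B = b # B'"
  have "closed_segment a q \<union> closed_segment q b = closed_segment a b"
    using Un_closed_segment[of q a b] h(2) by (auto simp: open_segment_def)
  then have "pcl (a # q # b # B' @ Y) = pcl (a # b # B' @ Y)" by auto
  then show ?thesis using pcl_append[of "X @ A'" a "q # b # B' @ Y"] pcl_append[of "X @ A'" a "b # B' @ Y"] h by simp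
qed auto

lemma lift_segment:
  assumes "q \<in> closed_segment a b"
  shows "sang (lift a) (lift b) = sang (lift a) (lift q) + sang (lift q) (lift b)"
proof -
  obtain u where u: "0 \<le> u" "u \<le> 1" "q = (1 - u) *\<^sub>R a + u *\<^sub>R b" using assms by (auto simp: in_segment)
  have "lift q = (1 - u) *\<^sub>R lift a + u *\<^sub>R lift b"
    unfolding u(3) by (simp add: lift_def vec_eq_iff forall_3)
  then show ?thesis using u lift_nonzero by (intro sang_split[of "lift a" "lift b" "1 - u" u]) auto
qed

lemma refines_slen: 
  assumes "refines p A q B"
  shows "slen p = slen (A @ [q]) + slen (q # B)"
  using assms unfolding refines_def
proof (elim disjE exE conjE)
  fix A' a b B' assume h: "p = A' @ a # b # B'" "q \<in> open_segment a b" "A = A' @ [a]" "B = b # B'"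
  have "sang (lift a) (lift b) = sang (lift a) (lift q) + sang (lift q) (lift b)"
    using h(2) by (intro lift_segment) (auto simp: open_segment_def)
  then show ?thesis
    using plen_append[of "map lift A'" "lift a" "lift b # map lift B'"] plen_append[of "map lift A'" "lift a" "[lift q]"]
    by (simp add: h)
qed (simp add: plen_append[of _ _ "map lift B"])

lemma refines_bends:
  assumes "refines p A q B"
  shows "bends s (X @ p) \<Longrightarrow> bends s (X @ A @ [q])" "bends s (p @ Y) \<Longrightarrow> bends s (q # B @ Y)"
proof -
  have *: "(bends s (X @ p) \<longrightarrow> bends s (X @ A @ [q])) \<and> (bends s (p @ Y) \<longrightarrow> bends s (q # B @ Y))"
    using assms unfolding refines_def
  proof (elim disjE exE conjE)
    assume "p = A @ q # B"
    then show ?thesis using bends_prefix[of s "X @ A @ [q]" B] bends_suffix[of s A "q # B @ Y"] by simp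
  next
    fix A' a b B' assume h: "p = A' @ a # b # B'" "q \<in> open_segment a b" "A = A' @ [a]" "B = b # B'"
    obtain u where u: "0 < u" "u < 1" "q = (1 - u) *\<^sub>R a + u *\<^sub>R b" using h(2) by (auto simp: in_segment)
    have t1: "turn r a q = u * turn r a b" for r
      unfolding u(3) turn_def by (simp add: scaleR_conv_of_real algebra_simps)
    have t2: "turn q b c = (1 - u) * turn a b c" for c
      unfolding u(3) turn_def by (simp add: scaleR_conv_of_real algebra_simps)
    have 1: "bends s (Z @ [a, b]) \<Longrightarrow> bends s (Z @ [a, q])" for Z
    proof (cases Z rule: rev_cases)
      case (snoc Z' r)
      assume "bends s (Z @ [a, b])"
      then have "bends s (Z' @ [r, a])" "0 < s * turn r a b" using bends_append[of s Z' r a "[b]"] snoc by auto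
      then have "0 < s * turn r a q" unfolding t1 mult.left_commute[of s] using u by simp
      then show ?thesis using \<open>bends s (Z' @ [r, a])\<close> bends_append[of s Z' r a "[q]"] snoc by simp
    qed auto
    have 2: "bends s (a # b # Z) \<Longrightarrow> bends s (q # b # Z)" for Z
    proof (cases Z)
      case (Cons c Z')
      assume h: "bends s (a # b # Z)"
      have "s * turn q b c = (1 - u) * (s * turn a b c)" unfolding t2 by simp
      moreover have "0 < (1 - u) * (s * turn a b c)" using h u(1,2) Cons by simp
      ultimately have "0 < s * turn q b c" by (simp only:)
      then show ?thesis using h Cons by simp
    qed auto
    show ?thesis
      using 1[of "X @ A'"] bends_append[of s "X @ A'" a b B'] 2[of "B' @ Y"] bends_suffix[of s A' "a # b # B' @ Y"] h by auto
  qed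
  show "bends s (X @ p) \<Longrightarrow> bends s (X @ A @ [q])" "bends s (p @ Y) \<Longrightarrow> bends s (q # B @ Y)" using * by auto
qed

text \<open>A line separates \<open>z\<close> from the segment, and within a half-plane angles
  add.\<close>

lemma Arg_insert:
  assumes "z \<notin> closed_segment a b" "q \<in> open_segment a b"
  shows "Arg ((b - z) / (a - z)) = Arg ((q - z) / (a - z)) + Arg ((b - z) / (q - z))"
proof -
  obtain d c where "d \<bullet> z < c" "\<forall>x\<in>closed_segment a b. d \<bullet> x > c"
    using separating_hyperplane_closed_point[of "closed_segment a b" z] assms(1) by auto
  moreover have "{a, q, b} \<subseteq> closed_segment a b" using assms(2) by (auto simp: open_segment_def)
  ultimately have lt: "d \<bullet> w > d \<bullet> z" if "w \<in> {a, q, b}" for w using that by force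
  have *: "0 < Re (cnj d * (w - z))" if "w \<in> {a, q, b}" for w
    using lt[OF that] by (simp add: inner_complex_def algebra_simps)
  have "pang z [a, b] = Arg (cnj d * (last [a, b] - z)) - Arg (cnj d * (hd [a, b] - z))"
    by (intro pang_half_plane *) auto
  moreover have "pang z [a, q, b] = Arg (cnj d * (last [a, q, b] - z)) - Arg (cnj d * (hd [a, q, b] - z))"
    by (intro pang_half_plane *) auto
  ultimately show ?thesis by simp
qed

lemma refines_pang:
  assumes "refines p A q B" "z \<notin> pcl p"
  shows "pang z (X @ A @ q # B @ Y) = pang z (X @ p @ Y)"
  using assms(1) unfolding refines_def
proof (elim disjE exE conjE)
  fix A' a b B' assume h: "p = A' @ a # b # B'" "q \<in> open_segment a b" "A = A' @ [a]" "B = b # B'"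
  have "z \<notin> closed_segment a b" using assms(2) pcl_append[of A' a "b # B'"] h by auto
  then show ?thesis using Arg_insert[OF _ h(2)] h
     pang_append[of z "X @ A'" a "q # b # B' @ Y"] pang_append[of z "X @ A'" a "b # B' @ Y"] by simp
qed auto

text \<open>At a right turn of a counterclockwise polygon the ray starts inside, where the polygon
  sweeps 2 pi; far out the polygon is seen in a half-plane and sweeps nothing.\<close>

lemma ray_hits:
  assumes ps: "psimple (v # M @ [v])" and o: "ori v M = pi" and tn: "turn (last M) v (hd M) < 0"
  shows "\<exists>s>0. v + of_real s * (v - last M) \<in> pcl M"
proof (rule ccontr)
  assume no: "\<not> ?thesis"
  let ?x = "last M"
  have M0: "M \<noteq> []" using closed_path_nonempty[OF ps] by auto
  then have xv: "?x \<noteq> v" using vertex_notin_pcl[OF ps M0] set_subset_pcl[of M] last_in_set[OF M0] by blast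
  define K where "K = (\<Sum>w\<in>set (v # M). cmod (w - v))"
  have K: "cmod (w - v) \<le> K" if "w \<in> set (v # M)" for w
    unfolding K_def using that by (intro member_le_sum) auto
  have K0: "0 \<le> K" unfolding K_def by (intro sum_nonneg) auto
  let ?n = "cmod (v - ?x)"
  have n: "?n > 0" using xv by simp
  \<comment> \<open>\<open>K\<close> bounds the distances of the vertices from \<open>v\<close>, so
    at distance \<open>K + 1\<close> from \<open>v\<close> the whole polygon lies strictly behind
    the viewpoint.\<close>
  define s where "s = (K + 1) / ?n"
  have s: "s > 0" unfolding s_def using n K0 by simp
  let ?m = "v + of_real s * (v - ?x)"
  have "pang ?m (v # M @ [v]) = ori v M + pi"
    using pang_ray[OF ps refl refl, of "s + 1" s] tn no s by auto
  moreover have "pang ?m (v # M @ [v]) = 0"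
  proof -
    have "0 < Re (cnj (- (v - ?x)) * (w - ?m))" if w: "w \<in> set (v # M @ [v])" for w
    proof -
      have "Re (cnj (v - ?x) * (w - v)) \<le> cmod (cnj (v - ?x) * (w - v))" by (rule complex_Re_le_cmod)
      also have "\<dots> \<le> ?n * K" unfolding norm_mult complex_mod_cnj using K[of w] w by (intro mult_left_mono) auto
      finally have "Re (cnj (v - ?x) * (w - v)) \<le> ?n * K" .
      moreover have "Re (cnj (- (v - ?x)) * (w - ?m)) = - Re (cnj (v - ?x) * (w - v)) + s * ?n\<^sup>2"
      proof -
        have "?n\<^sup>2 = Re (cnj (v - ?x) * (v - ?x))"
          unfolding cmod_power2 by (simp add: power2_eq_square algebra_simps)
        then have "s * ?n\<^sup>2 = s * Re (cnj (v - ?x) * (v - ?x))" by simp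
        moreover have "Re (cnj (- (v - ?x)) * (w - ?m)) = - Re (cnj (v - ?x) * (w - v)) + s * Re (cnj (v - ?x) * (v - ?x))"
          by (simp add: algebra_simps)
        ultimately show ?thesis by (simp only:)
      qed
      moreover have "s * ?n = K + 1" unfolding s_def using n by simp
      then have "s * ?n * ?n = (K + 1) * ?n" by simp
      then have "s * ?n\<^sup>2 = ?n * K + ?n" by (simp add: power2_eq_square algebra_simps)
      ultimately show ?thesis using n by linarith
    qed
    from pang_half_plane[OF this, of "v # M @ [v]"] show ?thesis by simp
  qed
  ultimately show False using o by simp
qed

lemma ray_first_hit:
  assumes "compact K" "v \<notin> K" "\<exists>s>0. v + of_real s * (v - x) \<in> K"
  obtains T where "0 < T" "v + of_real T * (v - x) \<in> K"
    "\<And>s. 0 < s \<Longrightarrow> s < T \<Longrightarrow> v + of_real s * (v - x :: complex) \<notin> K"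
proof -
  let ?f = "\<lambda>s::real. v + of_real s * (v - x)"
  obtain s1 where s1: "s1 > 0" "?f s1 \<in> K" using assms(3) by blast
  let ?S = "{0..s1} \<inter> ?f -` K"
  have "closed ?S"
    by (intro continuous_closed_preimage continuous_intros compact_imp_closed assms(1)) auto
  then have "compact ?S" by (simp add: compact_eq_bounded_closed bounded_Int)
  moreover have "s1 \<in> ?S" using s1 by auto
  ultimately obtain T where T: "T \<in> ?S" "\<And>s. s \<in> ?S \<Longrightarrow> T \<le> s"
    using compact_attains_inf[of ?S] by blast
  have "T \<noteq> 0" using T(1) assms(2) by auto
  then have "0 < T" using T(1) by auto
  moreover have "?f s \<notin> K" if s: "0 < s" "s < T" for s
  proof
    assume "?f s \<in> K"
    then have "s \<in> ?S" using s T(1) by auto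
    from T(2)[OF this] show False using s by simp
  qed
  ultimately show ?thesis using that T(1) by auto
qed

lemma ray_not_on_corner:
  assumes tn: "turn x v y \<noteq> 0" and s: "0 < s"
  shows "v + of_real s * (v - x) \<notin> closed_segment v y" "v + of_real s * (v - x) \<notin> closed_segment x v"
proof -
  show "v + of_real s * (v - x) \<notin> closed_segment v y"
  proof
    assume "v + of_real s * (v - x) \<in> closed_segment v y"
    then obtain u where "v + of_real s * (v - x) = (1 - u) *\<^sub>R v + u *\<^sub>R y" by (auto simp: in_segment)
    then have "of_real s * (v - x) = of_real u * (y - v)" by (simp add: scaleR_conv_of_real algebra_simps)
    then have "Im (cnj (v - x) * (of_real s * (v - x))) = Im (cnj (v - x) * (of_real u * (y - v)))" by simp
    then have "u * turn x v y = 0" unfolding turn_def by (simp add: algebra_simps)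
    then have "u = 0" using tn by simp
    then have "of_real s * (v - x) = 0" using \<open>of_real s * (v - x) = of_real u * (y - v)\<close> by simp
    then have "v = x" using s by simp
    then show False using tn by (simp add: turn_def)
  qed
  show "v + of_real s * (v - x) \<notin> closed_segment x v"
  proof
    assume "v + of_real s * (v - x) \<in> closed_segment x v"
    then obtain u where u: "0 \<le> u" "u \<le> 1" "v + of_real s * (v - x) = (1 - u) *\<^sub>R x + u *\<^sub>R v" by (auto simp: in_segment)
    then have "of_real (1 + s - u) * (v - x) = 0" by (simp add: scaleR_conv_of_real algebra_simps)
    moreover have "1 + s - u \<noteq> 0" using u s by simp
    ultimately have "v = x" by (metis eq_iff_diff_eq_0 mult_eq_0_iff of_real_eq_0_iff)
    then show False using tn by (simp add: turn_def)
  qed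
qed

text \<open>The conclusion ranges over all ways to make the hit point a vertex, since each
  application picks the one that fits its own decomposition of \<open>M\<close>.\<close>

lemma ray_split:
  assumes ps: "psimple (v # M @ [v])" and tn: "turn (last M) v (hd M) \<noteq> 0"
    and hit: "\<exists>s>0. v + of_real s * (v - last M) \<in> pcl M"
  obtains q T where "0 < T" "q = v + of_real T * (v - last M)" "q \<in> pcl M"
    "\<forall>A B. refines M A q B \<longrightarrow> A \<noteq> [] \<and> B \<noteq> [] \<and> psimple (v # (A @ [q]) @ [v]) \<and> psimple (v # (q # B) @ [v]) \<and>
       ori v (A @ [q]) + ori v (q # B) = ori v M + (if turn (last M) v (hd M) < 0 then pi else - pi)"
proof -
  let ?x = "last M" and ?y = "hd M"
  have M0: "M \<noteq> []" using closed_path_nonempty[OF ps] by auto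
  have vM: "v \<notin> pcl M" by (rule vertex_notin_pcl[OF ps M0])
  obtain T where T: "0 < T" "v + of_real T * (v - ?x) \<in> pcl M"
    "\<And>s. 0 < s \<Longrightarrow> s < T \<Longrightarrow> v + of_real s * (v - ?x) \<notin> pcl M"
    using ray_first_hit[OF compact_pcl vM hit] by blast
  define q where "q = v + of_real T * (v - ?x)"
  have qx: "q \<noteq> ?x" "q \<noteq> ?y" using ray_not_on_corner[OF tn T(1)] unfolding q_def by auto
  have xv: "?x \<noteq> v" using tn by (auto simp: turn_def)
  have "A \<noteq> [] \<and> B \<noteq> [] \<and> psimple (v # (A @ [q]) @ [v]) \<and> psimple (v # (q # B) @ [v]) \<and>
       ori v (A @ [q]) + ori v (q # B) = ori v M + (if turn ?x v ?y < 0 then pi else - pi)"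
    if r: "refines M A q B" for A B
  proof -
    have "A \<noteq> []" using refines_hd[OF r] qx by auto
    have "B \<noteq> []" using refines_last[OF r] qx by auto
    have P: "psimple (v # A @ q # B @ [v])" using refines_psimple[OF r, of "[v]" "[v]"] ps by simp
    have pc: "pcl (v # A @ q # B @ [v]) = pcl (v # M @ [v])" using refines_pcl[OF r, of "[v]" "[v]"] by simp
    have pM: "pcl (v # M @ [v]) = closed_segment v ?y \<union> pcl M \<union> closed_segment ?x v"
    proof -
      obtain y N where MN: "M = y # N" using M0 by (cases M) auto
      obtain L x where Mx: "M = L @ [x]" using M0 by (cases M rule: rev_cases) auto
      have "pcl (v # M @ [v]) = closed_segment v ?y \<union> pcl (M @ [v])" unfolding MN by simp
      also have "pcl (M @ [v]) = pcl M \<union> closed_segment ?x v"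
        using pcl_append[of L x "[v]"] unfolding Mx by auto
      finally show ?thesis by blast
    qed
    have on_ray: "\<exists>s. 0 < s \<and> s < T \<and> m = v + of_real s * (v - ?x)" if m: "m \<in> open_segment v q" for m
    proof -
      obtain u where "0 < u" "u < 1" "m = (1 - u) *\<^sub>R v + u *\<^sub>R q" using m by (auto simp: in_segment)
      then show ?thesis using T(1) unfolding q_def
        by (intro exI[of _ "u * T"]) (auto simp: scaleR_conv_of_real algebra_simps)
    qed
    have "open_segment v q \<inter> pcl (v # A @ q # B @ [v]) = {}"
      unfolding pc pM using on_ray T(3) ray_not_on_corner[OF tn] by blast
    note ch = chord_split[OF P this]
    define m where "m = v + of_real (T/2) * (v - ?x)"
    have "q \<noteq> v" unfolding q_def using T(1) xv by simp
    have m: "m \<in> open_segment v q"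
      unfolding in_segment using \<open>q \<noteq> v\<close>
      by (intro conjI exI[of _ "1/2"]) (auto simp: m_def q_def scaleR_conv_of_real field_simps)
    have "0 < T / 2" "T / 2 < T" using T(1) by auto
    from T(3)[OF this] have "m \<notin> pcl M" unfolding m_def .
    then have "pang m (v # A @ q # B @ [v]) = pang m (v # M @ [v])"
      using refines_pang[OF r, of m "[v]" "[v]"] by simp
    also have "\<dots> = ori v M + (if turn ?x v ?y < 0 then pi else - pi)"
      unfolding m_def using T by (intro pang_ray[OF ps refl refl tn, of T "T/2"]) auto
    finally show ?thesis using ch m \<open>A \<noteq> []\<close> \<open>B \<noteq> []\<close> by simp
  qed
  then show ?thesis using that T q_def by blast
qed

lemma ori_values: "psimple (v # M @ [v]) \<Longrightarrow> ori v M = pi \<or> ori v M = - pi"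
proof -
  assume ps: "psimple (v # M @ [v])"
  obtain e d where e: "e \<in> set (v # M)" "\<And>w. w \<in> set (v # M) - {e} \<Longrightarrow> 0 < Re (cnj d * (w - e))"
    using exists_extreme[of "set (v # M)" "{}"] by auto
  obtain X Y where XY: "v # M = X @ e # Y" using e(1) by (meson split_list)
  have "psimple (e # (Y @ X) @ [e])" using rotate_many[OF ps XY] by simp
  then have "e \<notin> set (Y @ X)" by (rule vertex_notin)
  moreover have "set (Y @ X) \<subseteq> set (v # M)" unfolding XY by auto
  ultimately have "0 < Re (cnj d * (w - e))" if "w \<in> set (Y @ X)" for w using e(2) that by blast
  from ori_at_extreme[OF ps XY this] show ?thesis by blast
qed

lemma ori_bends_at_extreme:
  assumes ps: "psimple (v # M @ [v])" and XY: "v # M = X @ e # Y"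
    and ext: "\<And>w. w \<in> set (v # M) - {e} \<Longrightarrow> 0 < Re (cnj d * (w - e))"
    and b: "0 < s * turn (last (Y @ X)) e (hd (Y @ X))"
  shows "ori v M = sgn s * pi"
proof -
  have "psimple (e # (Y @ X) @ [e])" using rotate_many[OF ps XY] by simp
  then have "e \<notin> set (Y @ X)" by (rule vertex_notin)
  moreover have "set (Y @ X) \<subseteq> set (v # M)" unfolding XY by auto
  ultimately have "0 < Re (cnj d * (w - e))" if "w \<in> set (Y @ X)" for w using ext that by blast
  from ori_at_extreme[OF ps XY this] b show ?thesis
    by (auto simp: zero_less_mult_iff)
qed

lemma not_in_segment_if_turn:
  assumes "turn a b c \<noteq> 0" shows "c \<notin> closed_segment a b" "a \<notin> closed_segment b c"
proof -
  have *: "turn a b c = 0" if c: "c \<in> closed_segment a b" for a b c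
  proof -
    obtain u where u: "c = (1 - u) *\<^sub>R a + u *\<^sub>R b" using c by (auto simp: in_segment)
    show ?thesis unfolding u turn_def by (simp add: algebra_simps)
  qed
  show "c \<notin> closed_segment a b" using *[of c a b] assms by auto
  show "a \<notin> closed_segment b c" using *[of a b c] assms turn_rotate[of a b c] by auto
qed

text \<open>The bends at the ends \<open>v\<close> and \<open>q\<close> of the closing chord are not
  controlled. As \<open>hd A\<close> lies off the chord, some extreme vertex is neither of them, and
  its bend decides the orientation.\<close>

lemma ori_bends:
  assumes ps: "psimple (v # (A @ [q]) @ [v])" and b: "bends s (v # A @ [q])" and A: "A \<noteq> []"
    and off: "turn v q (hd A) \<noteq> 0"
  shows "ori v (A @ [q]) = sgn s * pi"
proof -
  have "\<not> set (v # A @ [q]) \<subseteq> convex hull {v, q}"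
  proof -
    have "turn v q (hd A) \<noteq> 0" "hd A \<in> set A" using off A by auto
    then show ?thesis using not_in_segment_if_turn(1)[of v q "hd A"] unfolding segment_convex_hull by auto
  qed
  then obtain e d where e: "e \<in> set (v # A @ [q])" "e \<notin> {v, q}"
    "\<And>w. w \<in> set (v # A @ [q]) - {e} \<Longrightarrow> 0 < Re (cnj d * (w - e))"
    using exists_extreme[of "set (v # A @ [q])" "{v, q}"] by auto
  then obtain X Y where XY: "A = X @ e # Y" by (auto dest: split_list)
  obtain X' p where Xp: "v # X = X' @ [p]" by (cases "v # X" rule: rev_cases) auto
  obtain n Y' where Yn: "Y @ [q] = n # Y'" by (cases "Y @ [q]") auto
  have "v # A @ [q] = X' @ p # e # n # Y'"
  proof -
    have "v # A @ [q] = (v # X) @ e # (Y @ [q])" using XY by simp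
    also have "\<dots> = X' @ p # e # n # Y'" unfolding Xp Yn by simp
    finally show ?thesis .
  qed
  then have "0 < s * turn p e n" using b bends_mid by simp
  moreover have "last ((Y @ [q]) @ (v # X)) = p" "hd ((Y @ [q]) @ (v # X)) = n"
    unfolding Xp Yn by auto
  ultimately show ?thesis
    using ori_bends_at_extreme[OF ps, of "v # X" e "Y @ [q]" d s] XY e(3) by auto
qed

section \<open>A chain that bends inwards is shorter than its complement\<close>

lemma psimple_closed_rotate: "psimple (v # (y # M) @ [v]) \<Longrightarrow> psimple (y # (M @ [v]) @ [y])"
  using psimple_rotate[of v y M] by simp

lemma slen_extend: "slen (p @ [q, w]) = slen (p @ [q]) + sang (lift q) (lift w)"
  using plen_append[of "map lift p" "lift q" "[lift w]"] by simp

lemma slen_ge: "p \<noteq> [] \<Longrightarrow> sang (lift (hd p)) (lift (last p)) \<le> slen p"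
proof -
  assume p: "p \<noteq> []"
  have "0 \<notin> set (map lift p)" using lift_nonzero by (metis ex_map_conv)
  then show ?thesis using plen_ge[of "map lift p"] p by (simp add: hd_map last_map)
qed

lemma turn_degenerate: "turn x v x = 0" "turn x v v = 0"
  by (simp_all add: turn_def algebra_simps)

lemma turn_on_ray: "turn v (v + of_real T * (v - x)) y = T * turn x v y"
  by (simp add: turn_def algebra_simps)

text \<open>Extending the first edge of the inner chain beyond its end cuts off a part of the outer chain,
  which does not make the outer chain longer.\<close>

lemma chain_shorter:
  assumes "psimple (b # (W @ [a] @ U) @ [b])" "ori b (W @ [a] @ U) = pi" "bends (-1) (b # W @ [a])" "W \<noteq> []"
  shows "slen (b # W @ [a]) < slen (a # U @ [b])"
  using assms
proof (induction W arbitrary: b U)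
  case (Cons w W)
  define M where "M = W @ [a] @ U @ [b]"
  have ps: "psimple (w # M @ [w])"
    using psimple_closed_rotate[of b w "W @ [a] @ U"] Cons.prems(1) by (simp add: M_def)
  have o: "ori w M = pi"
    using ori_rotate(1)[of b w "W @ [a] @ U"] Cons.prems(1,2) by (simp add: M_def)
  have lM: "last M = b" by (simp add: M_def)
  have hM: "hd M = hd (W @ [a])" by (simp add: M_def hd_append)
  have tn: "turn b w (hd (W @ [a])) < 0"
    using Cons.prems(3) by (cases W) auto
  have hit: "\<exists>s>0. w + of_real s * (w - last M) \<in> pcl M"
    using ray_hits[OF ps o] tn lM hM by simp
  have tn0: "turn (last M) w (hd M) \<noteq> 0" using tn lM hM by simp
  have e: "ori w M + (if turn b w (hd (W @ [a])) < 0 then pi else - pi) = 2 * pi" using o tn by simp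
  obtain q T where q: "0 < T" "q = w + of_real T * (w - b)" "q \<in> pcl M" and
    split': "\<forall>A B. refines M A q B \<longrightarrow> A \<noteq> [] \<and> B \<noteq> [] \<and> psimple (w # (A @ [q]) @ [w]) \<and>
       psimple (w # (q # B) @ [w]) \<and> ori w (A @ [q]) + ori w (q # B) = 2 * pi"
    by (rule ray_split[OF ps tn0 hit, unfolded lM hM e]) (rule that; assumption)
  note split = split'[rule_format]
  have off: "turn w q (hd (W @ [a])) \<noteq> 0" unfolding q(2) turn_on_ray using q(1) tn by simp
  have orip: "ori w (A @ [q]) = pi" if r: "refines M A q B" for A B
    using split[OF r] ori_values[of w "A @ [q]"] ori_values[of w "q # B"] by auto
  \<comment> \<open>A hit on the inner chain would cut off a piece bending only to the right, hence
    clockwise, whereas both pieces are counterclockwise.\<close>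
  have "q \<in> pcl (a # U @ [b])"
  proof (rule ccontr)
    assume "q \<notin> pcl (a # U @ [b])"
    then have "q \<in> pcl (W @ [a])" using q(3) pcl_append[of W a "U @ [b]"] by (simp add: M_def)
    then obtain A B where r: "refines (W @ [a]) A q B" using refines_exists by blast
    have rM: "refines M A q (B @ U @ [b])" using refines_extend[OF r, of "[]" "U @ [b]"] by (simp add: M_def)
    have A: "A \<noteq> []" using split[OF rM] by simp
    have "bends (-1) (w # A @ [q])" using refines_bends(1)[OF r, of "-1" "[w]"] bends_Cons Cons.prems(3) by force
    moreover have "hd A = hd (W @ [a])" using refines_hd[OF r] A by simp
    ultimately have "ori w (A @ [q]) = - pi"
      using ori_bends[of w A q "-1"] split[OF rM] A off by simp
    then show False using orip[OF rM] by simp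
  qed
  then obtain A B where r: "refines (a # U @ [b]) A q B" using refines_exists by blast
  have rM: "refines M (W @ A) q B" using refines_extend[OF r, of W "[]"] by (simp add: M_def)
  obtain U1 where U1: "A @ [q] = a # U1" using refines_hd[OF r] by (cases "A @ [q]") auto
  have ps1: "psimple (w # (W @ [a] @ U1) @ [w])" using split[OF rM] U1 by simp
  have o1: "ori w (W @ [a] @ U1) = pi" using orip[OF rM] U1 by simp
  \<comment> \<open>In the cut-off polygon the remaining inner chain competes with the outer chain
    up to \<open>q\<close> followed by the chord from \<open>q\<close> to \<open>w\<close>. For a
    single edge this is the strict triangle inequality.\<close>
  have len1: "slen (w # W @ [a]) < slen (A @ [q]) + sang (lift q) (lift w)"
  proof (cases "W = []")
    case True
    have "sang (lift w) (lift a) < sang (lift w) (lift q) + sang (lift q) (lift a)"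
      using off True by (intro sang_triangle_strict) (simp add: det_lift)
    moreover have "sang (lift a) (lift q) \<le> slen (A @ [q])"
    proof -
      have "hd (A @ [q]) = a" unfolding U1 by simp
      then show ?thesis using slen_ge[of "A @ [q]"] by (simp del: map_append)
    qed
    ultimately show ?thesis using True by (simp add: sang_commute del: map_append)
  next
    case False
    have "bends (-1) (w # W @ [a])" using Cons.prems(3) bends_Cons by force
    note Cons.IH[OF ps1 o1 this False]
    moreover have "(A @ [q]) @ [w] = (a # U1) @ [w]" by (simp only: U1)
    then have "a # U1 @ [w] = A @ [q, w]" by simp
    then have "slen (a # U1 @ [w]) = slen (A @ [q, w])" by (simp only:)
    ultimately show ?thesis using slen_extend[of A q w] by linarith
  qed
  \<comment> \<open>The first edge and the chord together form the arc from \<open>b\<close> to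
    \<open>q\<close>, which is no longer than the outer chain from \<open>q\<close> to
    \<open>b\<close>.\<close>
  have "w \<in> closed_segment b q"
  proof -
    have e: "(1 + T) *\<^sub>R w = T *\<^sub>R b + q" unfolding q(2) by (simp add: scaleR_conv_of_real algebra_simps)
    have "w = (1 / (1 + T)) *\<^sub>R ((1 + T) *\<^sub>R w)" using q(1) by simp
    also have "\<dots> = (T / (1 + T)) *\<^sub>R b + (1 / (1 + T)) *\<^sub>R q" unfolding e by (simp add: scaleR_add_right)
    also have "T / (1 + T) = 1 - 1 / (1 + T)" using q(1) by (simp add: field_simps)
    finally show ?thesis unfolding in_segment using q(1) by (intro exI[of _ "1 / (1 + T)"]) auto
  qed
  then have "sang (lift b) (lift q) = sang (lift b) (lift w) + sang (lift w) (lift q)" by (rule lift_segment)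
  moreover have "sang (lift q) (lift b) \<le> slen (q # B)"
    using slen_ge[of "q # B"] refines_last[OF r] by simp
  moreover have "slen (a # U @ [b]) = slen (A @ [q]) + slen (q # B)" by (rule refines_slen[OF r])
  ultimately show ?case using len1 by (simp add: sang_commute[of "lift q"] del: map_append)
qed simp

section \<open>Locally convex polygons are convex and have spherical length below 2 pi\<close>

definition cyc_left :: "complex \<Rightarrow> complex list \<Rightarrow> bool" where
  "cyc_left v M \<longleftrightarrow> bends 1 (last M # v # M @ [v])"

lemma cyc_left_rotate:
  assumes "cyc_left v (y # N)" "N \<noteq> []"
  shows "cyc_left y (N @ [v])"
proof -
  obtain L x where N: "N = L @ [x]" using assms(2) by (cases N rule: rev_cases) auto
  have b: "bends 1 (x # v # y # L @ [x, v])" using assms(1) by (simp add: cyc_left_def N)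
  then have "bends 1 ((v # y # L) @ [x, v])" "bends 1 [x, v, y]" by auto
  then have "bends 1 ((v # y # L) @ [x, v, y])" using bends_append[of 1 "v # y # L" x v "[y]"] by blast
  then show ?thesis by (simp add: cyc_left_def N)
qed

text \<open>The line of the edge from \<open>last M\<close> to \<open>v\<close> supports the
  polygon. The vertex \<open>last M\<close> lies on that line and is therefore left out.\<close>

definition support :: "complex \<Rightarrow> complex list \<Rightarrow> bool" where
  "support v M \<longleftrightarrow> (\<forall>w\<in>set (butlast M). 0 < turn (last M) v w)"

text \<open>A hit would cut the polygon into two pieces of opposite orientation. But each piece has
  an extreme vertex off the chord, where the original polygon bends left, so both would be
  counterclockwise.\<close>

lemma no_forward_hit:
  assumes ps: "psimple (v # M @ [v])" and o: "ori v M = pi" and L: "cyc_left v M" and s: "0 < s"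
  shows "v + of_real s * (v - last M) \<notin> pcl M"
proof
  assume hit: "v + of_real s * (v - last M) \<in> pcl M"
  have len: "2 \<le> length M" using closed_path_nonempty[OF ps] .
  then obtain y N where MN: "M = y # N" by (cases M) auto
  let ?x = "last M"
  have tn: "0 < turn ?x v y" using L unfolding cyc_left_def MN by simp
  have hit': "\<exists>s>0. v + of_real s * (v - last M) \<in> pcl M" using hit s by blast
  have tn0: "turn (last M) v (hd M) \<noteq> 0" using tn MN by simp
  have e: "ori v M + (if turn (last M) v (hd M) < 0 then pi else - pi) = 0" using o tn MN by simp
  obtain q T where q: "0 < T" "q = v + of_real T * (v - ?x)" "q \<in> pcl M" and
    split': "\<forall>A B. refines M A q B \<longrightarrow> A \<noteq> [] \<and> B \<noteq> [] \<and> psimple (v # (A @ [q]) @ [v]) \<and>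
       psimple (v # (q # B) @ [v]) \<and> ori v (A @ [q]) + ori v (q # B) = 0"
    by (rule ray_split[OF ps tn0 hit', unfolded e]) (rule that; assumption)
  note split = split'[rule_format]
  obtain A B where r: "refines M A q B" using refines_exists[OF q(3)] by blast
  note sp = split[OF r]
  have b: "bends 1 (v # M @ [v])" using L bends_Cons unfolding cyc_left_def by blast
  have "bends 1 (v # M)" using b bends_prefix[of 1 "v # M" "[v]"] by simp
  then have "bends 1 (v # A @ [q])" using refines_bends(1)[OF r, of 1 "[v]"] by simp
  moreover have "hd A = y" using refines_hd[OF r] sp MN by (cases A) auto
  moreover have "turn v q y \<noteq> 0" unfolding q(2) turn_on_ray using q(1) tn by simp
  ultimately have "ori v (A @ [q]) = pi" using ori_bends[of v A q 1] sp by auto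
  then have o2: "ori v (q # B) = - pi" using sp by simp
  have xv: "?x \<noteq> v" using tn by (auto simp: turn_def)
  have lB: "last B = ?x" using refines_last[OF r] sp by simp
  \<comment> \<open>\<open>?x\<close> is on the line of the chord but behind \<open>v\<close>, which
    shows that the second piece is not contained in the chord.\<close>
  have "?x \<notin> closed_segment v q"
  proof
    assume "?x \<in> closed_segment v q"
    then obtain u where u: "0 \<le> u" "?x = (1 - u) *\<^sub>R v + u *\<^sub>R q" by (auto simp: in_segment)
    then have "of_real (1 + u * T) * (v - ?x) = 0" unfolding q(2) by (simp add: scaleR_conv_of_real algebra_simps)
    moreover have "1 + u * T \<noteq> 0" using u(1) q(1) by (smt (verit) mult_nonneg_nonneg)
    ultimately show False using xv by (metis eq_iff_diff_eq_0 mult_eq_0_iff of_real_eq_0_iff)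
  qed
  moreover have "?x \<in> set B" using lB sp by (metis last_in_set)
  ultimately have "\<not> set (v # q # B) \<subseteq> convex hull {v, q}" unfolding segment_convex_hull[symmetric] by auto
  then obtain e d where e: "e \<in> set (v # q # B)" "e \<notin> {v, q}"
    "\<And>w. w \<in> set (v # q # B) - {e} \<Longrightarrow> 0 < Re (cnj d * (w - e))"
    using exists_extreme[of "set (v # q # B)" "{v, q}"] by auto
  then obtain X Y where XY: "B = X @ e # Y" by (auto dest: split_list)
  obtain X' p where Xp: "q # X = X' @ [p]" by (cases "q # X" rule: rev_cases) auto
  obtain n Y' where Yn: "Y @ [v] = n # Y'" by (cases "Y @ [v]") auto
  have "bends 1 (M @ [v])" using b bends_Cons by blast
  then have "bends 1 (q # B @ [v])" using refines_bends(2)[OF r, of 1 "[v]"] by simp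
  moreover have "q # B @ [v] = X' @ p # e # n # Y'"
  proof -
    have "q # B @ [v] = (q # X) @ e # (Y @ [v])" using XY by simp
    also have "\<dots> = X' @ p # e # n # Y'" unfolding Xp Yn by simp
    finally show ?thesis .
  qed
  ultimately have "0 < 1 * turn p e n" using bends_mid by metis
  moreover have "last (Y @ (v # q # X)) = p" unfolding Xp by simp
  moreover have "hd (Y @ (v # q # X)) = n" using Yn by (cases Y) auto
  ultimately have "ori v (q # B) = sgn 1 * pi"
    using sp XY by (intro ori_bends_at_extreme[of v "q # B" "v # q # X" e Y d 1] e(3)) auto
  then show False using o2 by simp
qed

text \<open>The remaining path is connected and misses the line of the edge from
  \<open>last M\<close> to \<open>v\<close>, so it stays on the side of its first vertex.\<close>

lemma support_if_miss:
  assumes ps: "psimple (v # M @ [v])" and tn: "0 < turn (last M) v (hd M)"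
    and fw: "\<And>s. 0 < s \<Longrightarrow> v + of_real s * (v - last M) \<notin> pcl M"
    and bw: "\<And>s. 0 < s \<Longrightarrow> last M - of_real s * (v - last M) \<notin> pcl M"
  shows "support v M"
proof -
  have len: "2 \<le> length M" using closed_path_nonempty[OF ps] .
  obtain N x where M1: "M = N @ [x]" using len by (cases M rule: rev_cases) auto
  then have "N \<noteq> []" using len by auto
  note M = M1 this
  obtain K l where N: "N = K @ [l]" using M(2) by (cases N rule: rev_cases) auto
  have xv: "x \<noteq> v" using tn M by (auto simp: turn_def)
  have NM: "pcl N \<subseteq> pcl M" using pcl_append[of K l "[x]"] N M by auto
  obtain h H where H: "N = h # H" using M(2) by (cases N) auto
  have ps2: "psimple (N @ [x, v])" using ps unfolding M(1) H by simp
  then have ps3: "psimple (N @ [x])" "pset (N @ [x]) \<inter> (closed_segment x v - {v}) = {}"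
    using psimple_append[of N x "[v]"] by auto
  have psN: "psimple N" "l \<noteq> x" using ps3(1) psimple_append[of K l "[x]"] N by auto
  have Np: "pcl N \<subseteq> pset (N @ [x])"
    using pcl_eq[OF psN(1) M(2)] pset_append[of K l "[x]"] psN(2) N by auto
  have vM: "v \<notin> pcl M" using vertex_notin_pcl[OF ps] M by simp
  have nz: "turn x v w \<noteq> 0" if w: "w \<in> pcl N" for w
  proof
    assume "turn x v w = 0"
    then have "Im ((w - v) / (v - x)) = 0" by (simp add: Im_ratio_turn)
    then obtain t where "(w - v) / (v - x) = of_real t" by (metis complex_is_Real_iff Reals_cases)
    then have t: "w = v + of_real t * (v - x)" using xv by (simp add: nonzero_divide_eq_eq algebra_simps)
    consider "0 < t" | "t < -1" | "-1 \<le> t" "t \<le> 0" by linarith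
    then show False
    proof cases
      case 1 then show False using fw[of t] t w NM M by auto
    next
      case 2
      have "w = x - of_real (-1 - t) * (v - x)" unfolding t by (simp add: algebra_simps)
      then show False using bw[of "-1 - t"] 2 w NM M by auto
    next
      case 3
      have "w \<in> closed_segment x v" unfolding in_segment t
        using 3 by (intro exI[of _ "1 + t"]) (auto simp: scaleR_conv_of_real algebra_simps)
      then show False using ps3(2) Np w vM NM by auto
    qed
  qed
  have "0 < turn x v w" if w: "w \<in> pcl N" for w
  proof (rule ccontr)
    assume "\<not> ?thesis"
    then have neg: "turn x v w < 0" using nz[OF w] by simp
    have h: "hd N \<in> pcl N" using M(2) set_subset_pcl[of N] by auto
    have pos: "0 < turn x v (hd N)" using tn M by simp
    have c: "continuous_on (pcl N) (turn x v)" unfolding turn_def by (intro continuous_intros)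
    have "connected (turn x v ` pcl N)" by (intro connected_continuous_image c connected_pcl)
    moreover have "turn x v w \<in> turn x v ` pcl N" "turn x v (hd N) \<in> turn x v ` pcl N" using h w by auto
    ultimately have "0 \<in> turn x v ` pcl N"
      using connectedD_interval[of "turn x v ` pcl N" "turn x v w" "turn x v (hd N)" 0] neg pos by simp
    then show False using nz by auto
  qed
  then show ?thesis unfolding support_def M using set_subset_pcl[of N] by auto
qed

text \<open>Forwards the edge \<open>v y\<close> can be prolonged by \<open>no_forward_hit\<close>.
  Backwards, beyond \<open>v\<close>, its prolongation leaves the supporting half-plane of the
  preceding edge; at the start of the induction the half-plane of an extreme vertex \<open>v\<close>
  takes that role.\<close>

lemma support_next:
  assumes ps: "psimple (v # (y # N) @ [v])" and o: "ori v (y # N) = pi" and L: "cyc_left v (y # N)"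
    and bw: "support v (y # N) \<or> (\<forall>w\<in>set (y # N). 0 < Re (cnj d * (w - v)))"
  shows "support y (N @ [v])"
proof -
  have N0: "N \<noteq> []" using closed_path_length[of v y N] ps by simp
  have ps': "psimple (y # (N @ [v]) @ [y])" by (rule psimple_closed_rotate[OF ps])
  have o': "ori y (N @ [v]) = pi" using ori_rotate(1)[of v y N] ps o by simp
  have L': "cyc_left y (N @ [v])" by (rule cyc_left_rotate[OF L N0])
  let ?x = "last N"
  have t0: "0 < turn ?x v y" using L N0 by (simp add: cyc_left_def)
  show ?thesis
  proof (rule support_if_miss[OF ps'])
    obtain y' N' where N: "N = y' # N'" using N0 by (cases N) auto
    show "0 < turn (last (N @ [v])) y (hd (N @ [v]))" using L by (simp add: cyc_left_def N)
    show "y + of_real s * (y - last (N @ [v])) \<notin> pcl (N @ [v])" if "0 < s" for s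
      by (rule no_forward_hit[OF ps' o' L' that])
    show "last (N @ [v]) - of_real s * (y - last (N @ [v])) \<notin> pcl (N @ [v])" if s: "0 < s" for s
      using bw
    proof
      assume sp: "support v (y # N)"
      let ?H = "{w. 0 \<le> turn ?x v w}"
      have lin: "turn ?x v w = Im (cnj (v - ?x) * w) - Im (cnj (v - ?x) * v)" for w
        by (simp add: turn_def algebra_simps)
      have "?H = {w. (\<i> * (v - ?x)) \<bullet> w \<ge> Im (cnj (v - ?x) * v)}"
        unfolding lin by (auto simp: inner_complex_def algebra_simps)
      then have "convex ?H" by (simp add: convex_halfspace_ge)
      moreover have "set (N @ [v]) \<subseteq> ?H"
      proof -
        have "0 \<le> turn ?x v w" if "w \<in> set N" for w
        proof (cases "w = ?x")
          case False
          then have "w \<in> set (butlast N)" using that N0 by (metis append_butlast_last_id in_set_conv_decomp rotate1.simps(2) set_ConsD set_rotate1)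
          then show ?thesis using sp N0 by (force simp: support_def)
        qed (simp add: turn_degenerate)
        then show ?thesis by (auto simp: turn_degenerate)
      qed
      ultimately have "pcl (N @ [v]) \<subseteq> ?H" by (intro pcl_subset_convex)
      moreover have "turn ?x v (v - of_real s * (y - v)) = - s * turn ?x v y" by (simp add: turn_def algebra_simps)
      ultimately show ?thesis using mult_pos_pos[OF s t0] by auto
    next
      assume ex: "\<forall>w\<in>set (y # N). 0 < Re (cnj d * (w - v))"
      let ?H = "{w. 0 \<le> Re (cnj d * (w - v))}"
      have "?H = {w. d \<bullet> w \<ge> d \<bullet> v}" by (auto simp: inner_complex_def algebra_simps)
      then have "convex ?H" by (simp add: convex_halfspace_ge)
      moreover have "set (N @ [v]) \<subseteq> ?H" using ex by (auto intro: less_imp_le)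
      ultimately have "pcl (N @ [v]) \<subseteq> ?H" by (intro pcl_subset_convex)
      moreover have "Re (cnj d * ((v - of_real s * (y - v)) - v)) = - s * Re (cnj d * (y - v))"
        by (simp add: algebra_simps)
      then have "Re (cnj d * ((v - of_real s * (y - v)) - v)) < 0"
        using ex s by (simp add: mult_neg_pos del: minus_mult_left)
      ultimately show ?thesis by auto
    qed
  qed
qed

lemma support_all:
  assumes "psimple (v # M @ [v])" "ori v M = pi" "cyc_left v M" "support v M" "v # M = X @ e # Y"
  shows "support e (Y @ X)"
  using assms
proof (induction X arbitrary: v M Y)
  case (Cons x X)
  then have x: "x = v" "M = X @ e # Y" by auto
  have "M \<noteq> []" using x by simp
  then obtain y N where MN: "M = y # N" by (cases M) auto
  have N0: "N \<noteq> []" using closed_path_length[of v y N] Cons.prems MN by simp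
  have "support e ((Y @ [v]) @ X)"
  proof (rule Cons.IH)
    show "psimple (y # (N @ [v]) @ [y])" using psimple_closed_rotate Cons.prems(1) MN by blast
    show "ori y (N @ [v]) = pi" using ori_rotate(1)[of v y N] Cons.prems MN by simp
    show "cyc_left y (N @ [v])" using cyc_left_rotate Cons.prems N0 MN by blast
    show "support y (N @ [v])" using support_next Cons.prems MN by blast
    show "y # (N @ [v]) = X @ e # (Y @ [v])" using MN x by simp
  qed
  then show ?case using x by simp
qed simp

lemma cyc_left_rotate_many:
  assumes "psimple (v # M @ [v])" "cyc_left v M" "v # M = X @ e # Y"
  shows "cyc_left e (Y @ X)"
  using assms
proof (induction X arbitrary: v M Y)
  case (Cons x X)
  then have x: "x = v" "M = X @ e # Y" by auto
  have "M \<noteq> []" using x by simp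
  then obtain y N where MN: "M = y # N" by (cases M) auto
  have N0: "N \<noteq> []" using closed_path_length[of v y N] Cons.prems MN by simp
  have "cyc_left e ((Y @ [v]) @ X)"
  proof (rule Cons.IH)
    show "psimple (y # (N @ [v]) @ [y])" using psimple_closed_rotate Cons.prems(1) MN by blast
    show "cyc_left y (N @ [v])" using cyc_left_rotate Cons.prems N0 MN by blast
    show "y # (N @ [v]) = X @ e # (Y @ [v])" using MN x by simp
  qed
  then show ?case using x by simp
qed simp

text \<open>The chain is cut off from the spherical triangle with apex \<open>z\<close> one edge at a time.\<close>

lemma fan_length:
  fixes ms :: "(real^3) list"
  assumes "2 \<le> length ms"
    and "\<And>X a b Y. ms = X @ a # b # Y \<Longrightarrow> Y \<noteq> [] \<Longrightarrow> 0 < a \<bullet> cross3 b (last ms)"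
    and "\<And>X a b c Y. ms = X @ a # b # c # Y \<Longrightarrow> 0 < a \<bullet> cross3 b c"
    and "\<And>a. a \<in> set (butlast ms) \<Longrightarrow> a \<bullet> cross3 (last ms) z < 0"
    and "hd ms \<bullet> cross3 (ms ! 1) z < 0"
  shows "plen ms < sang (hd ms) z + sang z (last ms)"
  using assms
proof (induction ms arbitrary: z rule: plen.induct)
  case (1 m1 m2 ms)
  show ?case
  proof (cases "ms = []")
    case True
    have "m1 \<bullet> cross3 z m2 \<noteq> 0" using 1(6) True by (simp add: cross3_simps)
    then show ?thesis using True sang_triangle_strict[of m1 z m2] by simp
  next
    case False
    then obtain m3 r where ms: "ms = m3 # r" by (cases ms) auto
    let ?l = "last ms"
    define la where "la = m1 \<bullet> cross3 m2 ?l"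
    define mu where "mu = - (m1 \<bullet> cross3 m2 z)"
    define al where "al = m2 \<bullet> cross3 ?l z"
    define be where "be = - (m1 \<bullet> cross3 ?l z)"
    \<comment> \<open>\<open>q\<close> is the point where the first edge, prolonged beyond
      \<open>m2\<close>, meets the arc from \<open>z\<close> to \<open>?l\<close>. The four
      coefficients are those of the linear relation between \<open>m1\<close>, \<open>m2\<close>,
      \<open>z\<close> and \<open>?l\<close>, and their signs place \<open>m2\<close> between
      \<open>m1\<close> and \<open>q\<close>.\<close>
    define q where "q = la *\<^sub>R z + mu *\<^sub>R ?l"
    have la: "0 < la" unfolding la_def using 1(3)[of "[]" m1 m2 ms] False by simp
    have mu: "0 < mu" unfolding mu_def using 1(6) by simp
    have be: "0 < be" unfolding be_def using 1(5)[of m1] False by simp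
    have al: "al < 0" unfolding al_def using 1(5)[of m2] False by simp
    have q2: "q = al *\<^sub>R m1 + be *\<^sub>R m2"
      unfolding q_def la_def mu_def al_def be_def
      by (simp add: vec_eq_iff forall_3 cross3_def inner_vec_def sum_3 algebra_simps)
    have d3: "0 < m1 \<bullet> cross3 m2 m3" using 1(4)[of "[]" m1 m2 m3 r] ms by simp
    have d23: "m2 \<bullet> cross3 m3 q < 0"
    proof -
      have "m2 \<bullet> cross3 m3 q = al * (m1 \<bullet> cross3 m2 m3)"
        unfolding q2 by (simp add: cross3_def inner_vec_def sum_3 algebra_simps)
      then show ?thesis using al d3 by (simp add: mult_neg_pos)
    qed
    have q0: "q \<noteq> 0" using d23 by auto
    have IH: "plen (m2 # ms) < sang (hd (m2 # ms)) q + sang q (last (m2 # ms))"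
    proof (rule 1(1))
      show "2 \<le> length (m2 # ms)" using ms by simp
      show "0 < a \<bullet> cross3 b (last (m2 # ms))" if "m2 # ms = X @ a # b # Y" "Y \<noteq> []" for X a b Y
        using 1(3)[of "m1 # X" a b Y] that False by simp
      show "0 < a \<bullet> cross3 b c" if "m2 # ms = X @ a # b # c # Y" for X a b c Y
        using 1(4)[of "m1 # X" a b c Y] that by simp
      show "a \<bullet> cross3 (last (m2 # ms)) q < 0" if "a \<in> set (butlast (m2 # ms))" for a
      proof -
        have "a \<bullet> cross3 ?l q = la * (a \<bullet> cross3 ?l z)"
          unfolding q_def by (simp add: cross3_def inner_vec_def sum_3 algebra_simps)
        moreover have "a \<bullet> cross3 ?l z < 0" using 1(5)[of a] that False by simp
        ultimately show ?thesis using la False by (simp add: mult_pos_neg)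
      qed
      show "hd (m2 # ms) \<bullet> cross3 ((m2 # ms) ! 1) q < 0" using d23 ms by simp
    qed
    have nz: "m1 \<noteq> 0" "m2 \<noteq> 0" "z \<noteq> 0" "?l \<noteq> 0" using d3 mu be unfolding mu_def be_def by auto
    have m2: "m2 = (- al / be) *\<^sub>R m1 + (1 / be) *\<^sub>R q"
      unfolding q2 using be by (simp add: scaleR_add_right)
    have "0 \<le> - al / be" "0 \<le> 1 / be" using divide_nonpos_pos[of al be] al be by simp_all
    from sang_split[OF nz(1) q0 this m2 nz(2)] have s1: "sang m1 q = sang m1 m2 + sang m2 q" .
    have s2: "sang z ?l = sang z q + sang q ?l"
      using la mu nz q0 by (intro sang_split[of z ?l la mu]) (auto simp: q_def)
    have "sang m1 q \<le> sang m1 z + sang z q" by (intro sang_triangle nz q0)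
    then show ?thesis using IH s1 s2 False by simp
  qed
qed auto

text \<open>A convex spherical polygon lies in the lune between its vertex \<open>v\<close> and the
  antipode, bounded by the two half great circles that prolong the edges at \<open>v\<close>. These
  have total length 2 pi, and \<open>fan_length\<close> with apex \<open>- lift v\<close> compares
  the rest of the polygon with the rest of the lune.\<close>

lemma convex_perimeter:
  assumes ps: "psimple (v0 # M0 @ [v0])" and o0: "ori v0 M0 = pi" and L0: "cyc_left v0 M0"
  shows "slen (v0 # M0 @ [v0]) < 2 * pi"
proof -
  have len0: "2 \<le> length M0" using closed_path_nonempty[OF ps] .
  obtain e d where e: "e \<in> set (v0 # M0)" "\<And>w. w \<in> set (v0 # M0) - {e} \<Longrightarrow> 0 < Re (cnj d * (w - e))"
    using exists_extreme[of "set (v0 # M0)" "{}"] by auto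
  obtain X0 Y0 where XY0: "v0 # M0 = X0 @ e # Y0" using e(1) by (meson split_list)
  have r0: "psimple (e # (Y0 @ X0) @ [e])" "ori e (Y0 @ X0) = pi" "cyc_left e (Y0 @ X0)"
    using rotate_many[OF ps XY0] cyc_left_rotate_many[OF ps L0 XY0] o0 by auto
  obtain y N where yN: "Y0 @ X0 = y # N" using closed_path_nonempty[OF r0(1)] by (cases "Y0 @ X0") auto
  have "set (Y0 @ X0) \<subseteq> set (v0 # M0) - {e}" using vertex_notin[OF r0(1)] unfolding XY0 by auto
  then have "\<forall>w\<in>set (y # N). 0 < Re (cnj d * (w - e))" using e(2) yN by auto
  \<comment> \<open>The edge that leaves the extreme vertex \<open>e\<close> is the first one known
    to be supporting.\<close>
  then have sy: "support y (N @ [e])" using support_next[of e y N d] r0 yN by simp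
  have N0: "N \<noteq> []" using closed_path_length[of e y N] r0(1) yN by simp
  have ry: "psimple (y # (N @ [e]) @ [y])" "ori y (N @ [e]) = pi" "cyc_left y (N @ [e])"
    using psimple_closed_rotate[of e y N] ori_rotate(1)[of e y N] cyc_left_rotate[of e y N] r0 yN N0 by auto
  have "v0 \<in> set (y # (N @ [e]))"
  proof -
    have "set (y # N @ [e]) = set (Y0 @ X0) \<union> {e}" unfolding yN by auto
    also have "\<dots> = set (v0 # M0)" unfolding XY0 by auto
    finally show ?thesis by simp
  qed
  have slen_rot: "slen (v # (y # N) @ [v]) = slen (y # (N @ [v]) @ [y])" for v y N
    using plen_append[of "map lift (y # N)" "lift v" "[lift y]"] by simp
  have slen_many: "slen (v # M @ [v]) = slen (e # (Y @ X) @ [e])" if "v # M = X @ e # Y" for v M X e Y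
    using that
  proof (induction X arbitrary: v M Y)
    case (Cons x X)
    then have x: "x = v" "M = X @ e # Y" by auto
    have "M \<noteq> []" using x by simp
    then obtain y N where MN: "M = y # N" by (cases M) auto
    have "slen (y # (N @ [v]) @ [y]) = slen (e # ((Y @ [v]) @ X) @ [e])"
      by (rule Cons.IH) (use MN x in simp)
    then show ?case using slen_rot[of v y N] MN x by simp
  qed simp
  define v where "v = y"
  define M where "M = N @ [e]"
  have S: "psimple (v # M @ [v])" "support v M"
    and SA: "\<And>X f Y. v # M = X @ f # Y \<Longrightarrow> support f (Y @ X)"
    using ry sy support_all[OF ry sy] by (auto simp: v_def M_def)
  have M0: "2 \<le> length M" using closed_path_nonempty[OF S(1)] .
  then have Mne: "M \<noteq> []" by auto
  have dist: "distinct (v # M)"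
  proof -
    have "f \<notin> set (Y @ X)" if "v # M = X @ f # Y" for X f Y
      using vertex_notin rotate_many[OF S(1) that] by blast
    then show ?thesis by (metis Un_iff in_set_conv_decomp not_distinct_decomp set_append append.assoc append_Cons)
  qed
  have edge: "0 < turn a b w" if h: "M = X @ a # b # Y" and w: "w \<in> set (Y @ v # X)" for X a b Y w
  proof -
    have "support b (Y @ (v # X @ [a]))" using SA[of "v # X @ [a]" b Y] h by simp
    then show ?thesis using w unfolding support_def by (auto simp: butlast_append)
  qed
  have edge0: "0 < turn (last M) v w" if "w \<in> set (butlast M)" for w
    using S(2) that unfolding support_def by blast
  let ?ms = "map lift M" and ?z = "- lift v"
  obtain m1 m2 r where Mm: "M = m1 # m2 # r" using M0 by (cases M; cases "tl M") auto
  have "plen ?ms < sang (hd ?ms) ?z + sang ?z (last ?ms)"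
  proof (rule fan_length)
    show "2 \<le> length ?ms" using M0 by simp
    show "0 < a \<bullet> cross3 b (last ?ms)" if h: "?ms = X @ a # b # Y" "Y \<noteq> []" for X a b Y
    proof -
      obtain X' a' b' Y' where M: "M = X' @ a' # b' # Y'" "a = lift a'" "b = lift b'" "Y = map lift Y'"
        using h(1) by (auto simp: map_eq_append_conv map_eq_Cons_conv)
      have Y': "Y' \<noteq> []" using M h(2) by auto
      then have "last M \<in> set Y'" unfolding M(1) by simp
      then have "0 < turn a' b' (last M)" using edge[OF M(1), of "last M"] by simp
      then show ?thesis using M(2,3) Mne by (simp add: last_map det_lift)
    qed
    show "0 < a \<bullet> cross3 b c" if h: "?ms = X @ a # b # c # Y" for X a b c Y
    proof -
      obtain X' a' b' c' Y' where M: "M = X' @ a' # b' # c' # Y'" "a = lift a'" "b = lift b'" "c = lift c'"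
        using h(1) by (auto simp: map_eq_append_conv map_eq_Cons_conv)
      then show ?thesis using edge[of X' a' b' "c' # Y'" c'] by (simp add: det_lift)
    qed
    show "a \<bullet> cross3 (last ?ms) ?z < 0" if am: "a \<in> set (butlast ?ms)" for a
    proof -
      obtain a' where a': "a = lift a'" "a' \<in> set (butlast M)" using am unfolding map_butlast[symmetric] by auto
      then show ?thesis using edge0[OF a'(2)] Mne turn_rotate[of a' "last M" v]
        by (simp add: last_map det_lift)
    qed
    show "hd ?ms \<bullet> cross3 (?ms ! 1) ?z < 0"
      using edge[of "[]" m1 m2 r v] Mm by (simp add: det_lift)
  qed
  also have "sang (hd ?ms) ?z = pi - sang (lift v) (hd ?ms)" by (simp add: sang_commute[of "hd ?ms"] sang_minus)
  also have "sang ?z (last ?ms) = pi - sang (last ?ms) (lift v)" by (simp add: sang_minus sang_commute)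
  finally have "plen ?ms + sang (lift v) (hd ?ms) + sang (last ?ms) (lift v) < 2 * pi" by simp
  moreover have "slen (v # M @ [v]) = sang (lift v) (hd ?ms) + plen ?ms + sang (last ?ms) (lift v)"
  proof -
    obtain L x where Mx: "M = L @ [x]" using Mne by (cases M rule: rev_cases) auto
    have "slen (v # M @ [v]) = sang (lift v) (lift m1) + slen (M @ [v])" unfolding Mm by simp
    moreover have "slen (M @ [v]) = slen M + sang (lift x) (lift v)" using slen_extend[of L x v] Mx by simp
    moreover have "last ?ms = lift x" using Mx by simp
    ultimately show ?thesis using Mm by simp
  qed
  ultimately have "slen (v # M @ [v]) < 2 * pi" by simp
  moreover have "slen (v0 # M0 @ [v0]) = slen (v # M @ [v])"
  proof -
    have "slen (v0 # M0 @ [v0]) = slen (e # (Y0 @ X0) @ [e])" by (rule slen_many[OF XY0])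
    also have "\<dots> = slen (v # M @ [v])" unfolding yN v_def M_def by (rule slen_rot)
    finally show ?thesis .
  qed
  ultimately show ?thesis by simp
qed

section \<open>Transfer to clockwise polygons by reflection\<close>

lemma closed_segment_cnj: "closed_segment (cnj x) (cnj y) = cnj ` closed_segment x y"
  by (rule closed_segment_linear_image[symmetric, OF bounded_linear.linear[OF bounded_linear_cnj], symmetric])

lemma pset_cnj: "pset (map cnj p) = cnj ` pset p"
proof (induction p rule: pset.induct)
  case (1 x y p)
  have "closed_segment (cnj x) (cnj y) - {cnj y} = cnj ` (closed_segment x y - {y})"
    unfolding closed_segment_cnj by auto
  then show ?case using 1 by (simp add: image_Un)
qed auto

lemma psimple_cnj: "psimple p \<Longrightarrow> psimple (map cnj p)"
proof (induction p rule: psimple.induct)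
  case (1 x y p)
  have e: "closed_segment (cnj x) (cnj y) - {cnj y} = cnj ` (closed_segment x y - {y})"
    unfolding closed_segment_cnj by auto
  have "(closed_segment (cnj x) (cnj y) - {cnj y}) \<inter> pset (map cnj (y # p)) =
      cnj ` ((closed_segment x y - {y}) \<inter> pset (y # p))"
    unfolding e pset_cnj by (auto simp: inj_on_def)
  also have "\<dots> = {}" using 1(2) by simp
  finally show ?case using 1 by simp
qed auto

lemma turn_cnj: "turn (cnj x) (cnj v) (cnj y) = - turn x v y"
  by (simp add: turn_def algebra_simps)

lemma bends_cnj: "bends s (map cnj p) = bends (- s) p"
  by (induction s p rule: bends.induct) (auto simp: turn_cnj)

lemma slen_cnj: "slen (map cnj p) = slen p"
proof -
  have n: "norm (lift (cnj x)) = norm (lift x)" for x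
    by (simp add: lift_def norm_eq_sqrt_inner inner_vec_def sum_3)
  have "sang (lift (cnj x)) (lift (cnj y)) = sang (lift x) (lift y)" for x y
    unfolding sang_def n by (simp add: lift_def inner_vec_def sum_3)
  then show ?thesis by (induction p rule: induct_list012) (auto simp: o_def)
qed

lemma sang_lift_less_pi: "sang (lift x) (lift y) < pi"
proof (rule ccontr)
  assume "\<not> ?thesis"
  then have "sang (lift x) (lift y) = pi" using sang_le_pi[of "lift x" "lift y"] by linarith
  then have "cos (sang (lift x) (lift y)) = -1" by simp
  then have "lift x \<bullet> lift y = - (norm (lift x) * norm (lift y))"
    unfolding cos_sang using lift_nonzero by (simp add: divide_eq_eq)
  from antiparallel[OF this lift_nonzero]
  have "lift y $ 3 = (- (norm (lift y) / norm (lift x)) *\<^sub>R lift x) $ 3" by (simp only:)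
  then have "1 = - (norm (lift y) / norm (lift x))" by (simp add: lift_def)
  moreover have "norm (lift y) / norm (lift x) \<ge> 0" by simp
  ultimately show False by linarith
qed

text \<open>The length 2 pi enters twice: a polygon with left bends only would be shorter, and a
  chain shorter than its complement has less than half of the length.\<close>

lemma planar_necessity_left:
  assumes ps: "psimple (v # M @ [v])" and len: "slen (v # M @ [v]) = 2 * pi" and o: "ori v M = pi"
  shows "\<not> bends 1 (last M # v # M @ [v])"
    and "M = W @ [a] @ U \<Longrightarrow> bends (-1) (v # W @ [a]) \<Longrightarrow> slen (v # W @ [a]) < pi"
proof -
  show "\<not> bends 1 (last M # v # M @ [v])"
    using convex_perimeter[OF ps o] len by (auto simp: cyc_left_def)
  assume M: "M = W @ [a] @ U" and b: "bends (-1) (v # W @ [a])"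
  show "slen (v # W @ [a]) < pi"
  proof (cases "W = []")
    case True then show ?thesis using sang_lift_less_pi by simp
  next
    case False
    have "slen (v # M @ [v]) = slen (v # W @ [a]) + slen (a # U @ [v])"
      using plen_append[of "map lift (v # W)" "lift a" "map lift (U @ [v])"] M by simp
    then show ?thesis using chain_shorter[of v W a U] ps o b False len M by simp
  qed
qed

lemma planar_necessity:
  assumes ps: "psimple (v # M @ [v])" and len: "slen (v # M @ [v]) = 2 * pi"
    and XY: "v # M = X @ e # Y" and ext: "\<And>w. w \<in> set (v # M) - {e} \<Longrightarrow> 0 < Re (cnj d * (w - e))"
    and s: "s = 1 \<or> s = -1" and t: "0 < s * turn (last (Y @ X)) e (hd (Y @ X))"
  shows "\<not> bends s (last M # v # M @ [v])"
    and "M = W @ [a] @ U \<Longrightarrow> bends (- s) (v # W @ [a]) \<Longrightarrow> slen (v # W @ [a]) < pi"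
proof -
  have M0: "M \<noteq> []" using closed_path_nonempty[OF ps] by auto
  have o: "ori v M = s * pi" using ori_bends_at_extreme[OF ps XY ext t] s by auto
  have cn: "psimple (cnj v # map cnj M @ [cnj v])" "slen (cnj v # map cnj M @ [cnj v]) = 2 * pi"
    using psimple_cnj[OF ps] slen_cnj[of "v # M @ [v]"] len by auto
  have on: "ori (cnj v) (map cnj M) = pi" if sn: "s = -1"
  proof -
    have YX: "Y @ X \<noteq> []"
    proof
      assume "Y @ X = []"
      then show False using XY M0 by auto
    qed
    have "0 < 1 * turn (last (map cnj Y @ map cnj X)) (cnj e) (hd (map cnj Y @ map cnj X))"
      using t sn YX by (simp add: last_map hd_map turn_cnj flip: map_append)
    moreover have "cnj v # map cnj M = map cnj X @ cnj e # map cnj Y"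
      using arg_cong[OF XY, of "map cnj"] by simp
    moreover have "0 < Re (cnj (cnj d) * (w - cnj e))" if w: "w \<in> set (cnj v # map cnj M) - {cnj e}" for w
    proof -
      obtain w' where w': "w = cnj w'" "w' \<in> set (v # M) - {e}" using w by auto
      have "Re (cnj (cnj d) * (cnj w' - cnj e)) = Re (cnj (cnj d * (w' - e)))" by simp
      then show ?thesis using ext[OF w'(2)] w'(1) by (simp add: algebra_simps)
    qed
    ultimately show ?thesis
      using ori_bends_at_extreme[OF cn(1), of "map cnj X" "cnj e" "map cnj Y" "cnj d" 1] by simp
  qed
  show "\<not> bends s (last M # v # M @ [v])"
  proof (cases "s = 1")
    case True then show ?thesis using planar_necessity_left(1)[OF ps len] o by simp
  next
    case False
    then have sn: "s = -1" using s by simp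
    have "\<not> bends 1 (map cnj (last M # v # M @ [v]))"
      using planar_necessity_left(1)[OF cn on[OF sn]] M0 by (simp add: last_map)
    then show ?thesis unfolding bends_cnj sn by simp
  qed
  assume M: "M = W @ [a] @ U" and b: "bends (- s) (v # W @ [a])"
  show "slen (v # W @ [a]) < pi"
  proof (cases "s = 1")
    case True then show ?thesis using planar_necessity_left(2)[OF ps len _ M] o b by simp
  next
    case False
    then have sn: "s = -1" using s by simp
    have "bends (-1) (map cnj (v # W @ [a]))" using b unfolding bends_cnj sn by simp
    moreover have "map cnj M = map cnj W @ [cnj a] @ map cnj U" using M by simp
    ultimately have "slen (map cnj (v # W @ [a])) < pi"
      using planar_necessity_left(2)[OF cn on[OF sn], of "map cnj W" "cnj a" "map cnj U"] by simp
    then show ?thesis unfolding slen_cnj .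
  qed
qed

section \<open>Sectors of a crease pattern\<close>

text \<open>The creases are numbered counterclockwise from a base crease of direction
  \<open>u\<close>. By \<open>th n = 2 * pi\<close> the base crease reappears as number
  \<open>n\<close>, so that sector \<open>k\<close> always lies between \<open>th k\<close> and
  \<open>th (Suc k)\<close>.\<close>

locale crease_frame =
  fixes p :: complex and r :: real and C :: "complex set" and u :: complex
    and n :: nat and th :: "nat \<Rightarrow> real"
  assumes r: "0 < r" and u: "cmod u = 1" and n: "3 \<le> n" and th0: "th 0 = 0" and thn: "th n = 2 * pi"
    and th_Suc: "\<And>k. k < n \<Longrightarrow> th k < th (Suc k)"
    and C: "C = (\<lambda>k. p + of_real r * u * cis (th k)) ` {..<n}"
begin

definition pt :: "real \<Rightarrow> real \<Rightarrow> complex" where "pt \<rho> \<phi> = p + of_real \<rho> * u * cis \<phi>"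
definition cr :: "nat \<Rightarrow> complex" where "cr k = pt r (th k)"
definition sec :: "nat \<Rightarrow> complex set" where "sec k = sector p r (cr k) (cr (Suc k))"

lemma u_nz: "u \<noteq> 0" using u by auto

lemma th_less: "i < j \<Longrightarrow> j \<le> n \<Longrightarrow> th i < th j"
proof (induction j)
  case (Suc j)
  then show ?case using th_Suc[of j] by (cases "i = j") (auto intro: less_trans)
qed simp

lemma th_le: "i \<le> j \<Longrightarrow> j \<le> n \<Longrightarrow> th i \<le> th j"
  using th_less[of i j] by (cases "i = j") (auto intro: less_imp_le)

lemma th_ge_0: "k \<le> n \<Longrightarrow> 0 \<le> th k" using th_le[of 0 k] th0 by simp

lemma th_le_2pi: "k \<le> n \<Longrightarrow> th k \<le> 2 * pi" using th_le[of k n] thn by simp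

lemma th_less_2pi: "k < n \<Longrightarrow> th k < 2 * pi" using th_less[of k n] thn by simp

lemma gap_less_2pi: "k < n \<Longrightarrow> th (Suc k) - th k < 2 * pi"
  using th_ge_0[of k] th_le_2pi[of "Suc k"] th_less[of 0 k] th_less[of "Suc k" n] th0 thn n
  by (cases "k = 0") auto

lemma C_eq: "C = cr ` {..<n}" unfolding C cr_def pt_def by simp

lemma cr_n: "cr n = cr 0" by (simp add: cr_def pt_def thn th0)

lemma dist_pt: "0 \<le> \<rho> \<Longrightarrow> dist p (pt \<rho> \<phi>) = \<rho>"
  by (simp add: pt_def dist_norm norm_mult u)

lemma pt_mem_cball: "0 \<le> \<rho> \<Longrightarrow> \<rho> \<le> r \<Longrightarrow> pt \<rho> \<phi> \<in> cball p r"
  by (simp add: dist_pt)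

lemma pt_2pi: "pt \<rho> (\<phi> + 2 * pi) = pt \<rho> \<phi>" "pt \<rho> (\<phi> - 2 * pi) = pt \<rho> \<phi>"
  by (simp_all add: pt_def complex_eq_iff cos_diff sin_diff cos_add sin_add)

lemma ccw_pt:
  assumes "0 < \<rho>" "0 < \<rho>'" "0 \<le> \<psi>" "\<psi> < 2 * pi"
  shows "ccw_angle p (pt \<rho>' \<phi>) (pt \<rho> (\<phi> + \<psi>)) = \<psi>"
proof -
  have "(pt \<rho> (\<phi> + \<psi>) - p) / (pt \<rho>' \<phi> - p) = of_real (\<rho> / \<rho>') * exp (\<i> * of_real \<psi>)"
    using assms u_nz unfolding pt_def cis_mult[symmetric] cis_conv_exp[symmetric] by simp
  then show ?thesis unfolding ccw_angle_def using assms by (intro Arg2pi_unique[of "\<rho> / \<rho>'"]) auto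
qed

lemma polar:
  obtains \<rho> \<psi> where "0 \<le> \<rho>" "0 \<le> \<psi>" "\<psi> < 2 * pi" "x = pt \<rho> (\<phi> + \<psi>)" "\<rho> = dist p x"
proof -
  let ?z = "(x - p) / (u * cis \<phi>)"
  have "?z = of_real (cmod ?z) * exp (\<i> * of_real (Arg2pi ?z))" by (rule Arg2pi_eq)
  then have "x - p = of_real (cmod ?z) * exp (\<i> * of_real (Arg2pi ?z)) * (u * cis \<phi>)"
    using u_nz by (simp add: nonzero_divide_eq_eq)
  moreover have "cmod ?z = dist p x" using u by (simp add: norm_divide norm_mult dist_norm norm_minus_commute)
  ultimately have "x = pt (dist p x) (\<phi> + Arg2pi ?z)"
    by (simp add: pt_def cis_conv_exp cis_mult[symmetric] algebra_simps exp_add)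
  then show ?thesis using that[of "dist p x" "Arg2pi ?z"] Arg2pi[of ?z] by auto
qed

lemma pt_inj:
  assumes "0 < \<rho>" "0 < \<rho>'" "pt \<rho> \<phi> = pt \<rho>' \<phi>'" "\<bar>\<phi> - \<phi>'\<bar> < 2 * pi"
  shows "\<rho> = \<rho>'" "\<phi> = \<phi>'"
proof -
  show e: "\<rho> = \<rho>'" using dist_pt[of \<rho> \<phi>] dist_pt[of \<rho>' \<phi>'] assms by simp
  have *: "a = b" if "pt \<rho> a = pt \<rho> b" "a \<le> b" "b - a < 2 * pi" for a b
    using ccw_pt[of \<rho> \<rho> "b - a" a] ccw_pt[of \<rho> \<rho> 0 a] that assms(1) by simp
  show "\<phi> = \<phi>'" using *[of \<phi> \<phi>'] *[of \<phi>' \<phi>] assms(3,4) unfolding e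
    by (cases "\<phi> \<le> \<phi>'") auto
qed

lemma cr_inj: "i < n \<Longrightarrow> j < n \<Longrightarrow> cr i = cr j \<Longrightarrow> i = j"
proof -
  assume ij: "i < n" "j < n" "cr i = cr j"
  have "\<bar>th i - th j\<bar> < 2 * pi"
    using ij th_ge_0[of i] th_ge_0[of j] th_less_2pi[of i] th_less_2pi[of j] by auto
  then have "th i = th j" using pt_inj[of r r "th i" "th j"] ij r unfolding cr_def by auto
  then show "i = j" using th_less[of i j] th_less[of j i] ij by (cases i j rule: linorder_cases) auto
qed

lemma cr_inj': "0 < i \<Longrightarrow> 0 < j \<Longrightarrow> i \<le> n \<Longrightarrow> j \<le> n \<Longrightarrow> cr i = cr j \<Longrightarrow> i = j"
proof -
  assume h: "0 < i" "0 < j" "i \<le> n" "j \<le> n" "cr i = cr j"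
  consider "i < n" "j < n" | "i = n" "j < n" | "i < n" "j = n" | "i = n" "j = n" using h by linarith
  then show "i = j" using cr_inj[of i j] cr_inj[of 0 j] cr_inj[of i 0] cr_n h by cases auto
qed

lemma ccw_cr: "i \<le> j \<Longrightarrow> j < n \<Longrightarrow> ccw_angle p (cr i) (cr j) = th j - th i"
  "j < i \<Longrightarrow> i < n \<Longrightarrow> ccw_angle p (cr i) (cr j) = th j - th i + 2 * pi"
proof -
  assume "i \<le> j" "j < n"
  then show "ccw_angle p (cr i) (cr j) = th j - th i"
    using ccw_pt[of r r "th j - th i" "th i"] r th_le[of i j] th_less_2pi[of j] th_ge_0[of i] by (simp add: cr_def)
next
  assume "j < i" "i < n"
  then show "ccw_angle p (cr i) (cr j) = th j - th i + 2 * pi"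
    using ccw_pt[of r r "th j - th i + 2 * pi" "th i"] r th_less[of j i] th_less_2pi[of i] th_ge_0[of j]
      pt_2pi(1)[of r "th j"] by (simp add: cr_def algebra_simps)
qed

lemma ccw_cr_Suc: "k < n \<Longrightarrow> ccw_angle p (cr k) (cr (Suc k)) = th (Suc k) - th k"
  using ccw_cr(1)[of k "Suc k"] ccw_cr(2)[of 0 k] cr_n thn th0 n
  by (cases "Suc k = n") auto

lemma consecutive_cr: "k < n \<Longrightarrow> consecutive p C (cr k) (cr (Suc k))"
proof -
  assume k: "k < n"
  have S: "cr (Suc k) \<in> C" unfolding C_eq using k cr_n n by (cases "Suc k = n") auto
  have ne: "cr k \<noteq> cr (Suc k)"
    using cr_inj[of k "Suc k"] cr_inj[of k 0] k cr_n n by (cases "Suc k = n") auto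
  have "ccw_angle p (cr k) (cr (Suc k)) \<le> ccw_angle p (cr k) e" if e: "e \<in> C - {cr k}" for e
  proof -
    obtain j where j: "e = cr j" "j < n" "j \<noteq> k" using e unfolding C_eq by auto
    show ?thesis
    proof (cases "k < j")
      case True
      then show ?thesis using ccw_cr(1)[of k j] ccw_cr_Suc[OF k] j th_le[of "Suc k" j] by simp
    next
      case False
      then show ?thesis using ccw_cr(2)[of j k] ccw_cr_Suc[OF k] j k th_ge_0[of j] th_le_2pi[of "Suc k"] by simp
    qed
  qed
  then show ?thesis unfolding consecutive_def using S ne k C_eq by auto
qed

lemma consecutive_cases:
  assumes "consecutive p C c d"
  obtains k where "k < n" "c = cr k" "d = cr (Suc k)"
proof -
  have cd: "c \<in> C" "d \<in> C" "c \<noteq> d" and m: "\<And>e. e \<in> C - {c} \<Longrightarrow> ccw_angle p c d \<le> ccw_angle p c e"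
    using assms by (auto simp: consecutive_def)
  obtain k where k: "c = cr k" "k < n" using cd C_eq by auto
  obtain j where j: "d = cr j" "j < n" using cd C_eq by auto
  have "cr (Suc k) \<in> C - {c}" using consecutive_cr[OF k(2)] k by (auto simp: consecutive_def)
  from m[OF this] have le: "ccw_angle p (cr k) (cr j) \<le> th (Suc k) - th k"
    using ccw_cr_Suc[OF k(2)] k j by simp
  have "j \<noteq> k" using cd k j by auto
  then consider "k < j" | "j < k" by linarith
  then have "d = cr (Suc k)"
  proof cases
    case 1
    then have "th j \<le> th (Suc k)" using le ccw_cr(1)[of k j] j by simp
    then have "j \<le> Suc k" using th_less[of "Suc k" j] j by (meson leD leI less_imp_le)
    then have "j = Suc k" using 1 by simp
    then show ?thesis using j by simp
  next
    case 2
    then have "th j + 2 * pi \<le> th (Suc k)" using le ccw_cr(2)[of j k] k by simp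
    then have t: "th j \<le> 0" "th (Suc k) = 2 * pi" using th_le_2pi[of "Suc k"] th_ge_0[of j] k j by auto
    then have "j = 0" using th_less[of 0 j] th0 j by (cases j) auto
    moreover have "Suc k = n" using t(2) th_less_2pi[of "Suc k"] k by (cases "Suc k = n") auto
    ultimately show ?thesis using j cr_n by simp
  qed
  then show ?thesis using that k by blast
qed

lemma next_cr: "k < n \<Longrightarrow> next_crease p C (cr k) = cr (Suc k)"
  unfolding next_crease_def
proof (rule the_equality)
  assume k: "k < n"
  then show "consecutive p C (cr k) (cr (Suc k))" by (rule consecutive_cr)
  fix d assume "consecutive p C (cr k) d"
  then obtain j where "j < n" "cr k = cr j" "d = cr (Suc j)" by (rule consecutive_cases)
  then show "d = cr (Suc k)" using cr_inj[of k j] k by simp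
qed

lemma prev_cr: "k < n \<Longrightarrow> prev_crease p C (cr (Suc k)) = cr k"
  unfolding prev_crease_def
proof (rule the_equality)
  assume k: "k < n"
  then show "consecutive p C (cr k) (cr (Suc k))" by (rule consecutive_cr)
  fix d assume "consecutive p C d (cr (Suc k))"
  then obtain j where "j < n" "d = cr j" "cr (Suc k) = cr (Suc j)" by (rule consecutive_cases)
  then show "d = cr k" using cr_inj'[of "Suc k" "Suc j"] k by simp
qed

lemma faces_eq: "faces p r C = sec ` {..<n}"
proof -
  have "S \<in> sec ` {..<n}" if "S \<in> faces p r C" for S
    using that unfolding faces_def sec_def by (auto elim!: consecutive_cases)
  moreover have "sec k \<in> faces p r C" if "k < n" for k
    using consecutive_cr[OF that] unfolding faces_def sec_def by blast
  ultimately show ?thesis by blast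
qed

lemma sec_mem:
  assumes "k < n" "0 \<le> \<rho>" "\<rho> \<le> r" "th k \<le> \<phi>" "\<phi> \<le> th (Suc k)"
  shows "pt \<rho> \<phi> \<in> sec k"
proof (cases "\<rho> = 0")
  case True
  then show ?thesis using r by (simp add: sec_def sector_def pt_def)
next
  case False
  have "ccw_angle p (cr k) (pt \<rho> (th k + (\<phi> - th k))) = \<phi> - th k"
    unfolding cr_def using assms False r gap_less_2pi[of k] by (intro ccw_pt) auto
  then show ?thesis
    unfolding sec_def sector_def using ccw_cr_Suc[OF assms(1)] assms pt_mem_cball[of \<rho> \<phi>] by simp
qed

lemma sec_cases:
  assumes "x \<in> sec k" "k < n"
  obtains \<rho> \<phi> where "0 \<le> \<rho>" "\<rho> \<le> r" "th k \<le> \<phi>" "\<phi> \<le> th (Suc k)" "x = pt \<rho> \<phi>"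
proof (cases "x = p")
  case True
  then show ?thesis using that[of 0 "th k"] r th_Suc[OF assms(2)] by (simp add: pt_def)
next
  case False
  obtain \<rho> \<psi> where x: "0 \<le> \<rho>" "0 \<le> \<psi>" "\<psi> < 2 * pi" "x = pt \<rho> (th k + \<psi>)" "\<rho> = dist p x"
    by (rule polar[where x = x and \<phi> = "th k"])
  have "x \<in> cball p r" using assms(1) by (auto simp: sec_def sector_def)
  then have \<rho>: "0 < \<rho>" "\<rho> \<le> r" unfolding x(5) using False by simp_all
  have "ccw_angle p (cr k) x = \<psi>" unfolding x(4) cr_def using x(2,3) \<rho> r by (intro ccw_pt) auto
  moreover have "ccw_angle p (cr k) x \<le> th (Suc k) - th k"
    using assms(1) False ccw_cr_Suc[OF assms(2)] by (auto simp: sec_def sector_def)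
  ultimately show ?thesis using that[of \<rho> "th k + \<psi>"] x(1,2,4) \<rho> by simp
qed

lemma find_sector:
  assumes "0 \<le> \<phi>" "\<phi> < 2 * pi"
  obtains k where "k < n" "th k \<le> \<phi>" "\<phi> < th (Suc k)"
proof -
  have ex: "\<exists>k. \<phi> < th k \<and> k \<le> n" using assms thn by (intro exI[of _ n]) simp
  define k where "k = (LEAST k. \<phi> < th k \<and> k \<le> n)"
  have k: "\<phi> < th k" "k \<le> n" using LeastI_ex[OF ex] unfolding k_def by auto
  have "k \<noteq> 0" using k assms th0 by (metis not_less)
  then obtain j where j: "k = Suc j" by (cases k) auto
  have "\<not> (\<phi> < th j \<and> j \<le> n)" unfolding k_def[symmetric] using not_less_Least[of j "\<lambda>k. \<phi> < th k \<and> k \<le> n"] j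
    unfolding k_def by simp
  then show ?thesis using that[of j] k j by auto
qed

lemma cball_cases:
  assumes "x \<in> cball p r"
  obtains k where "k < n" "x \<in> sec k"
proof -
  obtain \<rho> \<psi> where x: "0 \<le> \<rho>" "0 \<le> \<psi>" "\<psi> < 2 * pi" "x = pt \<rho> (0 + \<psi>)" "\<rho> = dist p x"
    by (rule polar[where x = x and \<phi> = 0])
  obtain k where "k < n" "th k \<le> \<psi>" "\<psi> < th (Suc k)" using find_sector x by blast
  moreover have "\<rho> \<le> r" unfolding x(5) using assms by simp
  ultimately have "pt \<rho> (0 + \<psi>) \<in> sec k" using sec_mem[of k \<rho> \<psi>] x(1) by simp
  then show ?thesis using that[of k] \<open>k < n\<close> unfolding x(4) by blast
qed

lemma sec_subset: "sec k \<subseteq> cball p r" by (auto simp: sec_def sector_def)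

end

text \<open>Sort the creases by their angle from \<open>b\<close>. Any crease can serve as base, so
  a claim about one crease may be proved for crease number 0.\<close>

lemma crease_frame_exists:
  assumes "crease_pattern p r C" "b \<in> C"
  obtains u n th where "crease_frame p r C u n th" "b = p + of_real r * u"
proof -
  have r: "0 < r" and fin: "finite C" and c2: "2 < card C" and sub: "C \<subseteq> sphere p r"
    using assms by (auto simp: crease_pattern_def)
  define u where "u = (b - p) / of_real r"
  have b: "b = p + of_real r * u" using r by (simp add: u_def)
  have u1: "cmod u = 1" using assms(2) sub r by (auto simp: u_def norm_divide dist_norm norm_minus_commute)
  then have u0: "u \<noteq> 0" by auto
  define a where "a c = ccw_angle p b c" for c
  have rep: "c = p + of_real r * u * cis (a c)" if c: "c \<in> C" for c
  proof -
    let ?z = "(c - p) / (b - p)"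
    have bp: "b - p = of_real r * u" using b by simp
    have "cmod (c - p) = r" using c sub by (auto simp: dist_norm norm_minus_commute)
    then have "cmod ?z = 1" unfolding bp using r u1 by (simp add: norm_divide norm_mult)
    then have "?z = cis (a c)" using Arg2pi_eq[of ?z] by (simp add: a_def ccw_angle_def cis_conv_exp)
    then have "c - p = cis (a c) * (of_real r * u)" unfolding bp using r u0 by (simp add: nonzero_divide_eq_eq)
    then show ?thesis by (simp add: algebra_simps)
  qed
  have inj: "inj_on a C" using rep by (metis inj_onI)
  have ab: "a b = 0"
  proof -
    have "(b - p) / (b - p) = 1" using r u0 b by simp
    then show ?thesis by (simp add: a_def ccw_angle_def Arg2pi_real)
  qed
  define A where "A = a ` C"
  have A: "finite A" "card A = card C" "0 \<in> A" "\<And>x. x \<in> A \<Longrightarrow> 0 \<le> x \<and> x < 2 * pi"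
  proof -
    show "finite A" using fin by (simp add: A_def)
    show "card A = card C" unfolding A_def by (rule card_image[OF inj])
    show "0 \<in> A" unfolding A_def using ab assms(2) by (metis imageI)
    show "0 \<le> x \<and> x < 2 * pi" if x: "x \<in> A" for x
      using x Arg2pi unfolding A_def a_def ccw_angle_def by blast
  qed
  define xs where "xs = sorted_list_of_set A"
  define n where "n = card C"
  have xs: "set xs = A" "length xs = n" "sorted_wrt (<) xs"
    using A by (auto simp: xs_def n_def strict_sorted_list_of_set)
  define th where "th k = (if k < n then xs ! k else 2 * pi)" for k
  have mono: "th k < th (Suc k)" if "k < n" for k
  proof (cases "Suc k < n")
    case True
    then show ?thesis using xs sorted_wrt_nth_less[of "(<)" xs k "Suc k"] by (simp add: th_def)
  next
    case False
    then show ?thesis using A(4)[of "xs ! k"] xs that nth_mem[of k xs] by (simp add: th_def)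
  qed
  have n3: "3 \<le> n" using c2 n_def by simp
  have th0: "th 0 = 0"
  proof -
    obtain i where i: "i < n" "xs ! i = 0" using A(3) xs by (metis in_set_conv_nth)
    have "xs ! 0 \<le> xs ! i"
      using sorted_wrt_nth_less[of "(<)" xs 0 i] xs i by (cases i) (auto intro: less_imp_le)
    moreover have "0 \<le> xs ! 0" using A(4)[of "xs ! 0"] xs nth_mem[of 0 xs] n3 by simp
    ultimately show ?thesis using i n3 by (simp add: th_def)
  qed
  have "C = (\<lambda>k. p + of_real r * u * cis (th k)) ` {..<n}"
  proof -
    have "A = th ` {..<n}" using xs by (auto simp: th_def in_set_conv_nth image_iff)
    then have "(\<lambda>k. p + of_real r * u * cis (th k)) ` {..<n} = (\<lambda>x. p + of_real r * u * cis x) ` A"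
      by (simp add: image_image)
    also have "\<dots> = (\<lambda>c. p + of_real r * u * cis (a c)) ` C" by (simp add: A_def image_image)
    also have "\<dots> = C" using rep by (auto simp: image_iff intro: rev_bexI)
    finally show ?thesis by simp
  qed
  then have "crease_frame p r C u n th"
    using r u1 n3 th0 mono by unfold_locales (auto simp: th_def)
  then show ?thesis using that b by blast
qed

section \<open>Folding angles as determinants\<close>

definition cross2 :: "complex \<Rightarrow> complex \<Rightarrow> real" where "cross2 a b = Im (cnj a * b)"

text \<open>Cramer's rule.\<close>

lemma cross2_expand:
  assumes "cross2 y1 y2 \<noteq> 0"
  shows "y = (cross2 y y2 / cross2 y1 y2) *\<^sub>R y1 + (cross2 y1 y / cross2 y1 y2) *\<^sub>R y2"
proof -
  have "cross2 y1 y2 *\<^sub>R y = cross2 y y2 *\<^sub>R y1 + cross2 y1 y *\<^sub>R y2"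
    by (simp add: cross2_def complex_eq_iff algebra_simps)
  then have "(1 / cross2 y1 y2) *\<^sub>R (cross2 y1 y2 *\<^sub>R y) =
      (1 / cross2 y1 y2) *\<^sub>R (cross2 y y2 *\<^sub>R y1 + cross2 y1 y *\<^sub>R y2)" by simp
  then show ?thesis using assms by (simp add: scaleR_add_right)
qed

lemma cross2_linear:
  "cross2 (a + b) c = cross2 a c + cross2 b c" "cross2 c (a + b) = cross2 c a + cross2 c b"
  "cross2 (k *\<^sub>R a) c = k * cross2 a c" "cross2 c (k *\<^sub>R a) = k * cross2 c a"
  by (simp_all add: cross2_def algebra_simps)

lemma linear_eq_if_eq_on_basis:
  fixes L L' :: "complex \<Rightarrow> 'a::real_vector"
  assumes "linear L" "linear L'" "cross2 y1 y2 \<noteq> 0" "L y1 = L' y1" "L y2 = L' y2"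
  shows "L = L'"
proof
  fix y
  let ?A = "cross2 y y2 / cross2 y1 y2" and ?B = "cross2 y1 y / cross2 y1 y2"
  have y: "y = ?A *\<^sub>R y1 + ?B *\<^sub>R y2" by (rule cross2_expand[OF assms(3)])
  have e: "F (?A *\<^sub>R y1 + ?B *\<^sub>R y2) = ?A *\<^sub>R F y1 + ?B *\<^sub>R F y2" if "linear F" for F :: "complex \<Rightarrow> 'a"
    using that by (simp only: linear_add linear_scale)
  show "L y = L' y" using e[OF assms(1)] e[OF assms(2)] assms(4,5) unfolding y[symmetric] by simp
qed

text \<open>By polarization the displacement \<open>h\<close> preserves inner products on the face.
  \<open>L\<close> extends it linearly from the basis \<open>y1\<close>, \<open>y2\<close>, and the
  inner square of \<open>h y - L y\<close> vanishes because it involves only inner products that are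
  already known.\<close>

lemma isometric_imp_linear:
  fixes f :: "complex \<Rightarrow> real^3"
  assumes S: "p \<in> S" "p + y1 \<in> S" "p + y2 \<in> S" and D: "cross2 y1 y2 \<noteq> 0"
    and iso: "\<And>x y. x \<in> S \<Longrightarrow> y \<in> S \<Longrightarrow> dist (f x) (f y) = dist x y"
  obtains L where "linear L" "\<And>x. x \<in> S \<Longrightarrow> f x = f p + L (x - p)" "\<And>a b. L a \<bullet> L b = a \<bullet> b"
proof -
  define h where "h y = f (p + y) - f p" for y
  have hh: "h a \<bullet> h b = a \<bullet> b" if "p + a \<in> S" "p + b \<in> S" for a b
  proof -
    have "norm (h a - h b) = norm (a - b)" "norm (h a) = norm a" "norm (h b) = norm b"
      using iso[OF that] iso[OF that(1) S(1)] iso[OF that(2) S(1)] by (simp_all add: h_def dist_norm)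
    then show ?thesis by (simp add: dot_norm_neg)
  qed
  let ?D = "cross2 y1 y2"
  define L where "L y = (cross2 y y2 / ?D) *\<^sub>R h y1 + (cross2 y1 y / ?D) *\<^sub>R h y2" for y
  have lin: "linear L"
    unfolding L_def
    by (intro linearI) (simp_all only: cross2_linear add_divide_distrib scaleR_add_left scaleR_add_right
        scaleR_scaleR times_divide_eq_right[symmetric] add_ac)
  have G: "h y1 \<bullet> h y1 = y1 \<bullet> y1" "h y1 \<bullet> h y2 = y1 \<bullet> y2" "h y2 \<bullet> h y1 = y2 \<bullet> y1" "h y2 \<bullet> h y2 = y2 \<bullet> y2"
    using hh S by auto
  have inner: "L a \<bullet> L b = a \<bullet> b" for a b
  proof -
    let ?A = "cross2 a y2 / ?D" and ?B = "cross2 y1 a / ?D" and ?A' = "cross2 b y2 / ?D" and ?B' = "cross2 y1 b / ?D"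
    have "L a \<bullet> L b = (?A *\<^sub>R y1 + ?B *\<^sub>R y2) \<bullet> (?A' *\<^sub>R y1 + ?B' *\<^sub>R y2)"
      unfolding L_def by (simp only: inner_add_left inner_add_right inner_scaleR_left inner_scaleR_right G)
    then show ?thesis using cross2_expand[OF D, of a] cross2_expand[OF D, of b] by metis
  qed
  have on: "f x = f p + L (x - p)" if x: "x \<in> S" for x
  proof -
    let ?y = "x - p"
    let ?A = "cross2 ?y y2 / ?D" and ?B = "cross2 y1 ?y / ?D"
    have xs: "p + ?y \<in> S" using x by simp
    have y: "?y = ?A *\<^sub>R y1 + ?B *\<^sub>R y2" by (rule cross2_expand[OF D])
    have h1: "h ?y \<bullet> h y1 = ?y \<bullet> y1" "h ?y \<bullet> h y2 = ?y \<bullet> y2" "h ?y \<bullet> h ?y = ?y \<bullet> ?y"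
      using hh xs S by auto
    have "h ?y \<bullet> L ?y = ?A * (?y \<bullet> y1) + ?B * (?y \<bullet> y2)"
      unfolding L_def by (simp only: inner_add_right inner_scaleR_right h1)
    also have "\<dots> = ?y \<bullet> (?A *\<^sub>R y1 + ?B *\<^sub>R y2)" by (simp only: inner_add_right inner_scaleR_right)
    finally have hL: "h ?y \<bullet> L ?y = ?y \<bullet> ?y" using y by simp
    have "(h ?y - L ?y) \<bullet> (h ?y - L ?y) = h ?y \<bullet> h ?y - 2 * (h ?y \<bullet> L ?y) + L ?y \<bullet> L ?y"
      by (simp add: inner_diff_left inner_diff_right inner_commute)
    also have "\<dots> = 0" unfolding hL h1(3) inner by simp
    finally have "h ?y = L ?y" by simp
    then show ?thesis by (simp add: h_def algebra_simps)
  qed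
  show ?thesis using that lin on inner by blast
qed

lemma cross3_linear:
  assumes "linear L" shows "cross3 (L a) (L b) = cross2 a b *\<^sub>R cross3 (L 1) (L \<i>)"
proof -
  have *: "L y = Re y *\<^sub>R L 1 + Im y *\<^sub>R L \<i>" for y
  proof -
    have "y = Re y *\<^sub>R 1 + Im y *\<^sub>R \<i>" by (simp add: complex_eq_iff)
    then have "L y = L (Re y *\<^sub>R 1 + Im y *\<^sub>R \<i>)" by simp
    then show ?thesis using assms by (simp add: linear_add linear_scale)
  qed
  show ?thesis unfolding *[of a] *[of b] cross2_def by (simp add: cross3_simps)
qed

lemma cross_cross_common: "cross3 (cross3 a b) (cross3 a c) = (a \<bullet> cross3 b c) *\<^sub>R a"
  by (simp add: vec_eq_iff forall_3 cross3_def inner_vec_def sum_3 algebra_simps)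

section \<open>Rigid foldings in polar coordinates\<close>

locale folded = crease_frame +
  fixes f :: "complex \<Rightarrow> real^3" and L :: "nat \<Rightarrow> complex \<Rightarrow> real^3"
  assumes lin: "\<And>k. k < n \<Longrightarrow> linear (L k)"
    and inner_L: "\<And>k a b. k < n \<Longrightarrow> L k a \<bullet> L k b = a \<bullet> b"
    and on_sec: "\<And>k x. k < n \<Longrightarrow> x \<in> sec k \<Longrightarrow> f x = f p + L k (x - p)"

context crease_frame
begin

text \<open>The sector after crease \<open>j\<close>. Wherever both neighbouring sectors matter,
  creases are numbered from \<open>1\<close> to \<open>n\<close>, the base crease being
  \<open>n\<close>: the sector before is then \<open>j - 1\<close>, and only the one after has to
  wrap around.\<close>

definition nx :: "nat \<Rightarrow> nat" where "nx j = (if j = n then 0 else j)"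
definition dir :: "real \<Rightarrow> complex" where "dir \<phi> = u * cis \<phi>"
lemma pt_dir: "pt \<rho> \<phi> - p = \<rho> *\<^sub>R dir \<phi>"
  by (simp add: pt_def dir_def scaleR_conv_of_real)

lemma dir_inner: "dir s \<bullet> dir t = cos (t - s)"
proof -
  have "cnj (dir s) * dir t = (cnj u * u) * (cnj (cis s) * cis t)" by (simp add: dir_def)
  also have "cnj u * u = 1" using u by (metis complex_norm_square mult.commute of_real_1 power_one)
  also have "cnj (cis s) * cis t = cis (t - s)" by (simp add: cis_cnj cis_mult)
  finally have "Re (cnj (dir s) * dir t) = cos (t - s)" by simp
  then show ?thesis by (simp add: inner_complex_def)
qed

lemma dir_th_nx: "dir (th (nx j)) = dir (th j)" by (simp add: nx_def th0 thn dir_def)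

lemma nx_less: "j \<le> n \<Longrightarrow> nx j < n" using n by (auto simp: nx_def)

lemma dir_add: "dir (s + d) = cos d *\<^sub>R dir s + sin d *\<^sub>R (\<i> * dir s)"
proof -
  have "dir (s + d) = dir s * cis d" by (simp add: dir_def cis_mult[symmetric])
  also have "\<dots> = cos d *\<^sub>R dir s + sin d *\<^sub>R (\<i> * dir s)"
    by (simp add: complex_eq_iff algebra_simps)
  finally show ?thesis .
qed

lemma cross2_dir: "cross2 (of_real a * u * cis s) (of_real b * u * cis t) = a * b * sin (t - s)"
proof -
  have "cnj (of_real a * u * cis s) * (of_real b * u * cis t) = of_real (a * b) * (cnj u * u) * (cnj (cis s) * cis t)"
    by simp
  also have "cnj u * u = 1" using u by (metis complex_norm_square mult.commute of_real_1 power_one)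
  also have "cnj (cis s) * cis t = cis (t - s)" by (simp add: cis_cnj cis_mult)
  finally have e: "cnj (of_real a * u * cis s) * (of_real b * u * cis t) = of_real (a * b) * 1 * cis (t - s)" .
  show ?thesis unfolding cross2_def e by simp
qed

lemma sec_basis:
  assumes "k < n"
  obtains y1 y2 where "p + y1 \<in> sec k" "p + y2 \<in> sec k" "cross2 y1 y2 \<noteq> 0"
proof -
  \<comment> \<open>Capped at a quarter turn, so that the two directions are independent even in a
    sector of angle pi or more.\<close>
  define d where "d = min (th (Suc k) - th k) (pi / 2)"
  have d: "0 < d" "d \<le> th (Suc k) - th k" using th_Suc[OF assms] by (auto simp: d_def)
  have d2: "d \<le> pi / 2" unfolding d_def by (rule min.cobounded2)
  have "pt r (th k) \<in> sec k" "pt r (th k + d) \<in> sec k" using d r assms by (auto intro!: sec_mem)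
  moreover have "cross2 (of_real r * u * cis (th k)) (of_real r * u * cis (th k + d)) \<noteq> 0"
    unfolding cross2_dir using r sin_gt_zero[of d] d d2 by simp
  ultimately show ?thesis using that unfolding pt_def by (metis add.assoc)
qed

lemma p_in_sec: "p \<in> sec k" using r by (simp add: sec_def sector_def)

lemma rigid_folded:
  assumes "rigid_folding p r C f"
  obtains L where "folded p r C u n th f L"
proof -
  have "\<exists>L. linear L \<and> (\<forall>x\<in>sec k. f x = f p + L (x - p)) \<and> (\<forall>a b. L a \<bullet> L b = a \<bullet> b)" if k: "k < n" for k
  proof -
    obtain y1 y2 where y: "p + y1 \<in> sec k" "p + y2 \<in> sec k" "cross2 y1 y2 \<noteq> 0" by (rule sec_basis[OF k])
    have "dist (f x) (f y) = dist x y" if "x \<in> sec k" "y \<in> sec k" for x y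
      using assms faces_eq k that unfolding rigid_folding_def by blast
    from isometric_imp_linear[OF p_in_sec y this] show ?thesis by metis
  qed
  then obtain L where L: "\<And>k. k < n \<Longrightarrow> linear (L k) \<and> (\<forall>x\<in>sec k. f x = f p + L k (x - p)) \<and> (\<forall>a b. L k a \<bullet> L k b = a \<bullet> b)"
    by metis
  have "folded p r C u n th f L" by (intro folded.intro folded_axioms.intro crease_frame_axioms) (use L in blast)+
  then show ?thesis by (rule that)
qed

end

context folded
begin

text \<open>The folded boundary circle as a unit-speed curve on the unit sphere.\<close>

definition g :: "real \<Rightarrow> real^3" where "g \<phi> = (1 / r) *\<^sub>R (f (pt r \<phi>) - f p)"
text \<open>\<open>tm j\<close> and \<open>tp j\<close> are the velocities with which
  \<open>g\<close> arrives at crease \<open>j\<close> and leaves it.\<close>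

definition tm :: "nat \<Rightarrow> real^3" where "tm j = L (j - 1) (\<i> * dir (th j))"
definition tp :: "nat \<Rightarrow> real^3" where "tp j = L (nx j) (\<i> * dir (th j))"

lemma f_pt: "k < n \<Longrightarrow> 0 \<le> \<rho> \<Longrightarrow> \<rho> \<le> r \<Longrightarrow> th k \<le> \<phi> \<Longrightarrow> \<phi> \<le> th (Suc k) \<Longrightarrow> f (pt \<rho> \<phi>) = f p + \<rho> *\<^sub>R L k (dir \<phi>)"
  using on_sec[of k "pt \<rho> \<phi>"] sec_mem[of k \<rho> \<phi>] lin[of k] by (simp add: pt_dir linear_scale)

lemma g_eq: "k < n \<Longrightarrow> th k \<le> \<phi> \<Longrightarrow> \<phi> \<le> th (Suc k) \<Longrightarrow> g \<phi> = L k (dir \<phi>)"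
  using f_pt[of k r \<phi>] r by (simp add: g_def)

lemma g_inner: "k < n \<Longrightarrow> th k \<le> s \<Longrightarrow> s \<le> th (Suc k) \<Longrightarrow> th k \<le> t \<Longrightarrow> t \<le> th (Suc k) \<Longrightarrow> g s \<bullet> g t = cos (t - s)"
  by (simp add: g_eq inner_L dir_inner)

lemma face_linear_sec: "k < n \<Longrightarrow> face_linear p f (sec k) = L k"
  unfolding face_linear_def
proof (rule the_equality)
  assume k: "k < n"
  show "linear (L k) \<and> (\<forall>x\<in>sec k. f x = f p + L k (x - p))" using lin on_sec k by blast
  fix L' assume L': "linear L' \<and> (\<forall>x\<in>sec k. f x = f p + L' (x - p))"
  obtain y1 y2 where y: "p + y1 \<in> sec k" "p + y2 \<in> sec k" "cross2 y1 y2 \<noteq> 0" by (rule sec_basis[OF k])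
  have "L' y = L k y" if "p + y \<in> sec k" for y using L' on_sec[OF k that] that by force
  then show "L' = L k" using linear_eq_if_eq_on_basis[OF _ lin[OF k] y(3)] L' y by blast
qed

lemma g_2pi: "g (\<phi> + 2 * pi) = g \<phi>" by (simp add: g_def pt_2pi)

lemma g_th_nx: "g (th (nx j)) = g (th j)" using g_2pi[of 0] by (simp add: nx_def th0 thn)

lemma crease_L: "0 < j \<Longrightarrow> j \<le> n \<Longrightarrow> L (j - 1) (dir (th j)) = g (th j) \<and> L (nx j) (dir (th j)) = g (th j)"
proof -
  assume j: "0 < j" "j \<le> n"
  have "g (th j) = L (j - 1) (dir (th j))"
    using j th_le[of "j - 1" j] by (intro g_eq) auto
  moreover have "g (th (nx j)) = L (nx j) (dir (th (nx j)))"
    using nx_less[OF j(2)] th_Suc[of "nx j"] by (intro g_eq) auto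
  ultimately show ?thesis by (simp add: g_th_nx dir_th_nx)
qed

lemma g_before: "0 < j \<Longrightarrow> j \<le> n \<Longrightarrow> 0 \<le> d \<Longrightarrow> d \<le> th j - th (j - 1) \<Longrightarrow> g (th j - d) = cos d *\<^sub>R g (th j) - sin d *\<^sub>R tm j"
proof -
  assume j: "0 < j" "j \<le> n" and d: "0 \<le> d" "d \<le> th j - th (j - 1)"
  have "g (th j - d) = L (j - 1) (dir (th j + - d))" using j d by (simp add: g_eq[of "j - 1"])
  also have "\<dots> = cos d *\<^sub>R g (th j) - sin d *\<^sub>R tm j"
    unfolding dir_add using lin[of "j - 1"] crease_L[OF j] j
    by (simp add: linear_diff linear_scale tm_def)
  finally show ?thesis .
qed

lemma g_after: "0 < j \<Longrightarrow> j \<le> n \<Longrightarrow> 0 \<le> d \<Longrightarrow> d \<le> th (Suc (nx j)) - th (nx j) \<Longrightarrow> g (th (nx j) + d) = cos d *\<^sub>R g (th j) + sin d *\<^sub>R tp j"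
proof -
  assume j: "0 < j" "j \<le> n" and d: "0 \<le> d" "d \<le> th (Suc (nx j)) - th (nx j)"
  have "g (th (nx j) + d) = L (nx j) (dir (th (nx j) + d))" using j d nx_less by (intro g_eq) auto
  also have "\<dots> = cos d *\<^sub>R g (th j) + sin d *\<^sub>R tp j"
    unfolding dir_add dir_th_nx using lin[of "nx j"] crease_L[OF j] nx_less[OF j(2)]
    by (simp add: linear_add linear_scale tp_def)
  finally show ?thesis .
qed

lemma frame_at_crease:
  assumes "0 < j" "j \<le> n"
  shows "g (th j) \<bullet> g (th j) = 1" "g (th j) \<bullet> tm j = 0" "g (th j) \<bullet> tp j = 0" "tm j \<bullet> tm j = 1" "tp j \<bullet> tp j = 1"
proof -
  have j: "j - 1 < n" "nx j < n" using assms nx_less by auto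
  have d: "dir (th j) \<bullet> (\<i> * dir (th j)) = 0" "(\<i> * dir (th j)) \<bullet> (\<i> * dir (th j)) = 1" "dir (th j) \<bullet> dir (th j) = 1"
    using dir_inner[of "th j" "th j"] by (auto simp: inner_complex_def)
  show "g (th j) \<bullet> g (th j) = 1" "g (th j) \<bullet> tm j = 0" "tm j \<bullet> tm j = 1"
    using inner_L[OF j(1), of "dir (th j)" "dir (th j)"] inner_L[OF j(1), of "dir (th j)" "\<i> * dir (th j)"]
      inner_L[OF j(1), of "\<i> * dir (th j)" "\<i> * dir (th j)"] d crease_L[OF assms] by (auto simp: tm_def)
  show "g (th j) \<bullet> tp j = 0" "tp j \<bullet> tp j = 1"
    using inner_L[OF j(2), of "dir (th j)" "\<i> * dir (th j)"]
      inner_L[OF j(2), of "\<i> * dir (th j)" "\<i> * dir (th j)"] d crease_L[OF assms] by (auto simp: tp_def)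
qed

text \<open>The sine of the angle from the arriving to the leaving tangent, which is the folding
  angle.\<close>

definition fold_sin :: "nat \<Rightarrow> real" where "fold_sin j = g (th j) \<bullet> cross3 (tm j) (tp j)"

text \<open>The face normals are \<open>tm j\<close> and \<open>tp j\<close> turned by a right angle
  about the folded crease, so both pairs enclose the same angle.\<close>

lemma folding_angle_cr:
  assumes j: "0 < j" "j \<le> n"
  shows "folding_angle p r C f (cr j) = Arg (Complex (tm j \<bullet> tp j) (fold_sin j))"
proof -
  let ?e = "g (th j)"
  have k: "j - 1 < n" "nx j < n" using j nx_less by auto
  have prev: "sector p r (prev_crease p C (cr j)) (cr j) = sec (j - 1)"
    using prev_cr[OF k(1)] j by (simp add: sec_def)
  have nxt: "sector p r (cr j) (next_crease p C (cr j)) = sec (nx j)"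
    using next_cr[OF k(2)] cr_n by (auto simp: sec_def nx_def split: if_splits)
  have c: "cross2 (dir (th j)) (\<i> * dir (th j)) = 1"
    using dir_inner[of "th j" "th j"] by (simp add: cross2_def inner_complex_def)
  have m: "face_normal p f (sec (j - 1)) = cross3 ?e (tm j)"
    unfolding face_normal_def face_linear_sec[OF k(1)]
    using cross3_linear[OF lin[OF k(1)], of "dir (th j)" "\<i> * dir (th j)"] c crease_L[OF j] by (simp add: tm_def)
  have nn: "face_normal p f (sec (nx j)) = cross3 ?e (tp j)"
    unfolding face_normal_def face_linear_sec[OF k(2)]
    using cross3_linear[OF lin[OF k(2)], of "dir (th j)" "\<i> * dir (th j)"] c crease_L[OF j] by (simp add: tp_def)
  note fr = frame_at_crease[OF j]
  have "f (cr j) - f p = r *\<^sub>R ?e" using r by (simp add: g_def cr_def)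
  then have e: "sgn (f (cr j) - f p) = ?e"
    using r fr(1) by (simp add: sgn_div_norm norm_eq_sqrt_inner)
  have d1: "cross3 ?e (tm j) \<bullet> cross3 ?e (tp j) = tm j \<bullet> tp j"
    unfolding dot_cross using fr by (simp add: inner_commute)
  have d2: "?e \<bullet> cross3 (cross3 ?e (tm j)) (cross3 ?e (tp j)) = fold_sin j"
    unfolding cross_cross_common fold_sin_def using fr(1) by simp
  show ?thesis
    unfolding folding_angle_def Let_def prev nxt m nn e d1 d2 ..
qed

lemma det_at_crease:
  assumes "0 < j" "j \<le> n" "0 \<le> d" "d \<le> th j - th (j - 1)" "0 \<le> d'" "d' \<le> th (Suc (nx j)) - th (nx j)"
  shows "g (th j - d) \<bullet> cross3 (g (th j)) (g (th (nx j) + d')) = sin d * sin d' * fold_sin j"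
  unfolding g_before[OF assms(1-4)] g_after[OF assms(1,2,5,6)] fold_sin_def
  by (simp add: cross3_def inner_vec_def sum_3 algebra_simps)

text \<open>The angle \<open>\<pi>\<close> would fold the two faces onto each other.\<close>

lemma folding_angle_sign:
  assumes j: "0 < j" "j \<le> n" and inj: "inj_on f (cball p r)"
  shows "0 < folding_angle p r C f (cr j) \<longleftrightarrow> 0 < fold_sin j"
    "folding_angle p r C f (cr j) < 0 \<longleftrightarrow> fold_sin j < 0"
proof -
  let ?z = "Complex (tm j \<bullet> tp j) (fold_sin j)"
  note fr = frame_at_crease[OF j]
  show neg: "folding_angle p r C f (cr j) < 0 \<longleftrightarrow> fold_sin j < 0"
    unfolding folding_angle_cr[OF j] Arg_neg_iff by simp
  have "Arg ?z \<noteq> pi"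
  proof
    assume "Arg ?z = pi"
    then have z: "fold_sin j = 0" "tm j \<bullet> tp j < 0" by (auto simp: Arg_eq_pi_iff complex_is_Real_iff)
    have "(tm j \<bullet> tp j)\<^sup>2 = 1"
    proof -
      have "(fold_sin j)\<^sup>2 + (tm j \<bullet> tp j)\<^sup>2 = 1"
      proof -
        have n1: "norm (tm j) = 1" "norm (tp j) = 1" "norm (g (th j)) = 1" unfolding norm_eq_1 by (fact fr)+
        have "(norm (cross3 (tm j) (tp j)))\<^sup>2 + (tm j \<bullet> tp j)\<^sup>2 = 1"
          using norm_cross_dot[of "tm j" "tp j"] n1 by simp
        moreover have "cross3 (tm j) (tp j) = fold_sin j *\<^sub>R g (th j)"
        proof -
          have "cross3 (g (th j)) (cross3 (tm j) (tp j)) = 0" unfolding Lagrange using fr by simp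
          moreover have "cross3 (g (th j)) (fold_sin j *\<^sub>R g (th j)) = 0" by (simp add: cross_mult_right)
          moreover have "g (th j) \<bullet> cross3 (tm j) (tp j) = g (th j) \<bullet> (fold_sin j *\<^sub>R g (th j))"
            unfolding inner_scaleR_right fr(1) by (simp add: fold_sin_def)
          moreover have "g (th j) \<noteq> 0" using n1 by auto
          ultimately show ?thesis using cross_dot_cancel by metis
        qed
        then have "(norm (cross3 (tm j) (tp j)))\<^sup>2 = (fold_sin j)\<^sup>2" using n1 by simp
        ultimately show ?thesis by simp
      qed
      then show ?thesis using z(1) by simp
    qed
    then have "tm j \<bullet> tp j = -1" using z(2) by (simp add: power2_eq_1_iff)
    then have "(tm j + tp j) \<bullet> (tm j + tp j) = 0"
      using fr by (simp add: inner_add_left inner_add_right inner_commute)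
    then have opp: "tp j = - tm j" by (simp add: eq_neg_iff_add_eq_0 add.commute)
    define d where "d = min (min (th j - th (j - 1)) (th (Suc (nx j)) - th (nx j))) (pi / 2)"
    have d2: "d \<le> pi / 2" unfolding d_def by (rule min.cobounded2)
    have d: "0 < d" "d \<le> th j - th (j - 1)" "d \<le> th (Suc (nx j)) - th (nx j)"
      using th_Suc[of "j - 1"] th_Suc[of "nx j"] nx_less j by (auto simp: d_def)
    have "g (th j - d) = g (th (nx j) + d)"
      using g_before[OF j, of d] g_after[OF j, of d] d opp by simp
    then have "f (pt r (th j - d)) = f (pt r (th (nx j) + d))" using r by (simp add: g_def)
    moreover have "pt r (th (nx j) + d) = pt r (th j + d)"
      using pt_2pi(1)[of r d] by (simp add: nx_def th0 thn add.commute)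
    ultimately have "pt r (th j - d) = pt r (th j + d)"
      using inj pt_mem_cball[of r] r by (metis inj_onD less_imp_le order_refl)
    then show False using pt_inj[of r r "th j - d" "th j + d"] r d(1) d2 by auto
  qed
  then show "0 < folding_angle p r C f (cr j) \<longleftrightarrow> 0 < fold_sin j"
    unfolding folding_angle_cr[OF j] using Arg_lt_pi[of ?z] Arg_le_pi[of ?z] by auto
qed

end

section \<open>The folded boundary circle lies in an open hemisphere\<close>

text \<open>On the compact set where \<open>G\<close> is nonpositive, \<open>F\<close> has a
  positive minimum, and \<open>e\<close> is so small that \<open>e * G\<close> cannot use it up.
  Where \<open>G\<close> is positive every positive \<open>e\<close> works.\<close>

lemma perturb_positive:
  fixes F G :: "'a::metric_space \<Rightarrow> real"
  assumes K: "compact K" and F: "continuous_on K F" and G: "continuous_on K G"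
    and nonneg: "\<And>x. x \<in> K \<Longrightarrow> 0 \<le> F x" and zero: "\<And>x. x \<in> K \<Longrightarrow> F x = 0 \<Longrightarrow> 0 < G x"
  obtains e where "0 < e" "\<And>x. x \<in> K \<Longrightarrow> 0 < F x + e * G x"
proof -
  let ?K = "K \<inter> G -` {..0}"
  have cK: "compact ?K"
  proof -
    have "closed ?K" using continuous_closed_preimage[OF G compact_imp_closed[OF K], of "{..0}"] by simp
    then show ?thesis using compact_Int_closed[OF K, of ?K] by (simp add: Int_absorb1)
  qed
  show ?thesis
  proof (cases "?K = {}")
    case True
    then have "0 < G x" if "x \<in> K" for x using that by force
    then show ?thesis using that[of 1] nonneg by (simp add: add_nonneg_pos)
  next
    case False
    obtain a where a: "a \<in> ?K" "\<And>x. x \<in> ?K \<Longrightarrow> F a \<le> F x"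
      using continuous_attains_inf[OF cK False] F continuous_on_subset by (metis Int_lower1)
    obtain b where b: "b \<in> ?K" "\<And>x. x \<in> ?K \<Longrightarrow> G b \<le> G x"
      using continuous_attains_inf[OF cK False] G continuous_on_subset by (metis Int_lower1)
    have "F a \<noteq> 0" using zero[of a] a(1) by auto
    then have Fa: "0 < F a" using nonneg[of a] a(1) by auto
    have Gb: "G b \<le> 0" using b(1) by auto
    define e where "e = F a / (1 - G b)"
    have e: "0 < e" using Fa Gb by (simp add: e_def)
    have "0 < F x + e * G x" if x: "x \<in> K" for x
    proof (cases "x \<in> ?K")
      case True
      have "e * (1 - G b) = F a" using Gb by (simp add: e_def)
      then have "F a + e * G b = e" by (simp add: algebra_simps)
      moreover have "e * G b \<le> e * G x" using b(2)[OF True] e by simp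
      ultimately show ?thesis using a(2)[OF True] e by linarith
    next
      case False
      then have "0 < G x" using x by auto
      then show ?thesis using nonneg[OF x] e by (simp add: add_nonneg_pos)
    qed
    then show ?thesis using that e by blast
  qed
qed

text \<open>Longitudes of points on an edge or in a sector. The range of \<phi> is half-open because
  \<open>c1\<close> is positive; this later keeps neighbouring edges and sectors apart.\<close>

lemma cone_direction:
  assumes "0 < c1" "0 \<le> c2" "0 < d" "d < pi"
  obtains \<rho> \<phi> where "0 < \<rho>" "0 \<le> \<phi>" "\<phi> < d" "of_real c1 + of_real c2 * cis d = of_real \<rho> * cis \<phi>"
    "c2 = 0 \<longleftrightarrow> \<phi> = 0"
proof -
  let ?w = "of_real c1 + of_real c2 * cis d"
  have sd: "0 < sin d" using assms by (simp add: sin_gt_zero)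
  have "Im (?w * cis (- d)) = - c1 * sin d"
    by (simp add: algebra_simps)
  then have im: "Im (?w * cis (- d)) < 0" using assms sd by simp
  have w0: "?w \<noteq> 0"
  proof
    assume "?w = 0"
    then have "Im (?w * cis (- d)) = 0" by (simp only: mult_zero_left) simp
    then show False using im by linarith
  qed
  have w: "?w = of_real (cmod ?w) * cis (Arg ?w)" using rcis_cmod_Arg[of ?w] by (simp add: rcis_def)
  have "0 \<le> Im ?w" using assms sd by simp
  then have A: "0 \<le> Arg ?w" using Arg_less_0 by blast
  have "?w * cis (- d) = of_real (cmod ?w) * cis (Arg ?w - d)"
    by (subst w) (simp add: cis_mult mult.assoc)
  then have "cmod ?w * sin (Arg ?w - d) < 0" using im by simp
  then have s: "sin (Arg ?w - d) < 0" by (simp add: mult_less_0_iff)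
  have "Arg ?w < d"
  proof (rule ccontr)
    assume "\<not> ?thesis"
    then have "0 \<le> sin (Arg ?w - d)" using Arg_le_pi[of ?w] assms by (intro sin_ge_zero) auto
    then show False using s by simp
  qed
  moreover have "c2 = 0 \<longleftrightarrow> Arg ?w = 0"
  proof
    assume "c2 = 0" then show "Arg ?w = 0" using assms by simp
  next
    assume "Arg ?w = 0"
    then have "Im ?w = 0" by (simp add: Arg_eq_0 complex_is_Real_iff)
    then show "c2 = 0" using sd by simp
  qed
  ultimately show ?thesis using that[of "cmod ?w" "Arg ?w"] w w0 A by simp
qed

context folded
begin

lemma norm_g: "0 \<le> s \<Longrightarrow> s \<le> 2 * pi \<Longrightarrow> norm (g s) = 1"
  and sector_of: "0 \<le> s \<Longrightarrow> s \<le> 2 * pi \<Longrightarrow> \<exists>k<n. th k \<le> s \<and> s \<le> th (Suc k)"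
proof -
  assume s: "0 \<le> s" "s \<le> 2 * pi"
  show k: "\<exists>k<n. th k \<le> s \<and> s \<le> th (Suc k)"
  proof (cases "s = 2 * pi")
    case True
    then show ?thesis using th_Suc[of "n - 1"] thn n by (intro exI[of _ "n - 1"]) simp
  next
    case False
    then show ?thesis using find_sector[of s] s by (metis less_imp_le order_le_less)
  qed
  then show "norm (g s) = 1" using g_inner[of _ s s] by (auto simp: norm_eq_1)
qed

lemma g_nonzero: "0 \<le> s \<Longrightarrow> s \<le> 2 * pi \<Longrightarrow> g s \<noteq> 0" using norm_g by fastforce

lemma sang_same_sector:
  assumes "k < n" "th k \<le> s" "s \<le> t" "t \<le> th (Suc k)"
  shows "sang (g s) (g t) \<le> t - s" "t - s \<le> pi \<Longrightarrow> sang (g s) (g t) = t - s"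
proof -
  have n1: "norm (g s) = 1" "norm (g t) = 1"
    using assms th_ge_0[of k] th_le_2pi[of "Suc k"] by (auto intro!: norm_g)
  have c: "sang (g s) (g t) = arccos (cos (t - s))"
    unfolding sang_def n1 using g_inner[of k s t] assms by simp
  show eq: "sang (g s) (g t) = t - s" if "t - s \<le> pi" using that assms c by (simp add: arccos_cos)
  show "sang (g s) (g t) \<le> t - s"
    using eq sang_le_pi[of "g s" "g t"] by (cases "t - s \<le> pi") auto
qed

text \<open>Inside one sector the curve is a unit-speed great circle; the triangle inequality adds
  up the sectors that are crossed.\<close>

lemma sang_g_le:
  assumes "0 \<le> s" "s \<le> t" "t \<le> 2 * pi"
  shows "sang (g s) (g t) \<le> t - s"
proof -
  have *: "sang (g s) (g t) \<le> t - s"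
    if "k + m < n" "th k \<le> s" "s \<le> th (Suc k)" "th (k + m) \<le> t" "t \<le> th (Suc (k + m))" "s \<le> t" for k m s t
    using that
  proof (induction m arbitrary: t)
    case 0 then show ?case using sang_same_sector(1)[of k s t] by simp
  next
    case (Suc m)
    let ?c = "th (Suc (k + m))"
    have sc: "s \<le> ?c" using Suc.prems th_le[of "Suc k" "Suc (k + m)"] by simp
    have b: "0 \<le> s" "t \<le> 2 * pi" "0 \<le> t" "0 \<le> ?c" "?c \<le> 2 * pi" "s \<le> 2 * pi"
      using Suc.prems th_ge_0[of k] th_le_2pi[of "Suc (k + Suc m)"] th_ge_0[of "Suc (k + m)"] th_le_2pi[of "Suc (k + m)"] sc by auto
    have "sang (g s) (g ?c) \<le> ?c - s"
      using Suc.IH[of ?c] Suc.prems th_le[of "k + m" "Suc (k + m)"] sc by simp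
    moreover have "sang (g ?c) (g t) \<le> t - ?c"
      using Suc.prems by (intro sang_same_sector(1)[of "k + Suc m"]) auto
    moreover have "sang (g s) (g t) \<le> sang (g s) (g ?c) + sang (g ?c) (g t)"
      using b by (intro sang_triangle g_nonzero)
    ultimately show ?case by linarith
  qed
  obtain k where k: "k < n" "th k \<le> s" "s \<le> th (Suc k)" using sector_of[of s] assms by auto
  obtain l where l: "l < n" "th l \<le> t" "t \<le> th (Suc l)" using sector_of[of t] assms by auto
  show ?thesis
  proof (cases "k \<le> l")
    case True
    then show ?thesis using *[of k "l - k" s t] k l assms by simp
  next
    case False
    then have "th (Suc l) \<le> th k" using k th_le[of "Suc l" k] by simp
    then have "s = t" using k l assms by simp
    then show ?thesis using sang_refl[OF g_nonzero[of s]] assms by simp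
  qed
qed

end

locale folded_all = folded +
  assumes inj: "inj_on f (cball p r)" and cont: "continuous_on (cball p r) f"
    and kinked: "\<And>j. 0 < j \<Longrightarrow> j \<le> n \<Longrightarrow> fold_sin j \<noteq> 0"
begin

text \<open>The arriving and leaving tangents at a crease differ, so cutting the corner saves
  length.\<close>

lemma kink:
  assumes "0 < j" "j \<le> n" "0 < d" "d \<le> th j - th (j - 1)" "d \<le> th (Suc (nx j)) - th (nx j)" "2 * d \<le> pi"
  shows "sang (g (th j - d)) (g (th (nx j) + d)) < 2 * d"
proof -
  note j = assms(1,2)
  note fr = frame_at_crease[OF j]
  have nj: "nx j < n" using nx_less[OF j(2)] .
  have d2: "0 \<le> d" using assms by simp
  have "tm j \<noteq> tp j" using kinked[OF j] by (auto simp: fold_sin_def)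
  then have "0 < (tm j - tp j) \<bullet> (tm j - tp j)" by simp
  then have lt: "tm j \<bullet> tp j < 1" using fr by (simp add: inner_diff_left inner_diff_right inner_commute)
  have "g (th j - d) \<bullet> g (th (nx j) + d) = (cos d)\<^sup>2 - (sin d)\<^sup>2 * (tm j \<bullet> tp j)"
    unfolding g_before[OF j d2 assms(4)] g_after[OF j d2 assms(5)]
    using fr by (simp add: inner_add_left inner_add_right inner_diff_left inner_diff_right inner_commute power2_eq_square)
  also have "\<dots> > cos (2 * d)"
  proof -
    have "0 < sin d" using assms pi_gt_zero by (intro sin_gt_zero) auto
    then have "0 < (sin d)\<^sup>2 * (1 - tm j \<bullet> tp j)" using lt by (intro mult_pos_pos) auto
    then have "(sin d)\<^sup>2 * (tm j \<bullet> tp j) < (sin d)\<^sup>2" by (simp add: algebra_simps)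
    then show ?thesis unfolding cos_double by linarith
  qed
  finally have gt: "cos (2 * d) < g (th j - d) \<bullet> g (th (nx j) + d)" .
  have h0: "0 \<le> th (j - 1)" using th_ge_0[of "j - 1"] j(2) by linarith
  have "norm (g (th j - d)) = 1" "norm (g (th (nx j) + d)) = 1"
    using assms th_le_2pi[OF j(2)] h0 th_ge_0[of "nx j"] th_le_2pi[of "Suc (nx j)"] nj by (auto intro!: norm_g)
  then have "cos (2 * d) < cos (sang (g (th j - d)) (g (th (nx j) + d)))" using gt by (simp add: cos_sang)
  then show ?thesis
    using cos_mono_less_eq[of "sang (g (th j - d)) (g (th (nx j) + d))" "2 * d"] sang_ge_0 sang_le_pi assms
    by (metis linorder_not_less mult_nonneg_nonneg less_eq_real_def zero_le_numeral)
qed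

text \<open>A piece of the curve that is as long as the distance of its ends cannot be shortened,
  but \<open>kink\<close> would shorten it at an interior crease.\<close>

lemma geodesic_no_crease:
  assumes st: "0 \<le> s" "s \<le> t" "t \<le> 2 * pi" and eq: "t - s \<le> sang (g s) (g t)"
    and j: "0 < j" "j < n" "s < th j" "th j < t"
  shows False
proof -
  have nj: "nx j = j" using j by (simp add: nx_def)
  define d where "d = Min {th j - th (j - 1), th (Suc j) - th j, pi / 2, th j - s, t - th j}"
  have d: "0 < d" using th_Suc[of "j - 1"] th_Suc[of j] j by (simp add: d_def)
  have d': "d \<le> th j - th (j - 1)" "d \<le> th (Suc j) - th j" "d \<le> pi / 2" "d \<le> th j - s" "d \<le> t - th j"
    unfolding d_def by (rule Min_le; simp)+
  have k: "sang (g (th j - d)) (g (th j + d)) < 2 * d"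
    using kink[of j d] j d d' nj by simp
  have b: "0 \<le> th j - d" "th j - d \<le> 2 * pi" "th j + d \<le> 2 * pi" "0 \<le> th j + d" using d d' st by auto
  have "sang (g s) (g t) \<le> sang (g s) (g (th j - d)) + sang (g (th j - d)) (g t)"
    using st b by (intro sang_triangle g_nonzero) auto
  also have "sang (g (th j - d)) (g t) \<le> sang (g (th j - d)) (g (th j + d)) + sang (g (th j + d)) (g t)"
    using st b by (intro sang_triangle g_nonzero) auto
  also have "sang (g s) (g (th j - d)) \<le> th j - d - s" using st b d' by (intro sang_g_le) auto
  also have "sang (g (th j + d)) (g t) \<le> t - (th j + d)" using st b d' by (intro sang_g_le) auto
  finally show False using k eq by linarith
qed

text \<open>The arc from \<open>z1\<close> to \<open>z2\<close> has length at least pi, so the arc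
  over the base crease has length at most pi. Antipodal ends would make that arc a geodesic,
  although it has the base crease inside. If \<open>z2 = 2 * pi\<close>, the base crease is an end
  of it instead; then all other creases would lie at angle pi, but there are at least two.\<close>

lemma not_antipodal_around_base:
  assumes z: "0 < z1" "z1 \<le> pi" "pi \<le> z2" "z2 \<le> 2 * pi" and a: "g z2 = - g z1"
  shows False
proof -
  have "sang (g z1) (g z2) = pi"
    unfolding a using sang_minus[of "g z1" "g z1"] sang_refl[OF g_nonzero[of z1]] z by (simp add: sang_commute)
  then have le: "pi \<le> z2 - z1" and s: "sang (g z2) (g z1) = pi"
    using sang_g_le[of z1 z2] z by (auto simp: sang_commute)
  have nj: "nx n = 0" by (simp add: nx_def)
  have z2: "z2 < 2 * pi \<or> z2 = 2 * pi" using z by auto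
  show False
  proof (cases "z2 = 2 * pi")
    case True
    have "g z2 = g 0" using g_2pi[of 0] True by simp
    then have "sang (g 0) (g z1) = pi" using s by simp
    then have "pi \<le> z1" using sang_g_le[of 0 z1] z by simp
    then have zz: "z1 = pi" "z2 = 2 * pi" using z True by auto
    text \<open>Both half turns are geodesics, so no crease lies strictly inside either of them.\<close>
    have "pi \<le> sang (g 0) (g pi)" "pi \<le> sang (g pi) (g (2 * pi))"
      using \<open>sang (g 0) (g z1) = pi\<close> s zz by (auto simp: sang_commute)
    note ends = this
    have no: "th j = pi" if j: "0 < j" "j < n" for j
    proof (rule ccontr)
      assume "th j \<noteq> pi"
      then consider "th j < pi" | "pi < th j" by linarith
      then show False
      proof cases
        case 1
        then show False using geodesic_no_crease[of 0 pi j] ends j th_less[of 0 j] th0 by simp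
      next
        case 2
        then show False using geodesic_no_crease[of pi "2 * pi" j] ends j th_less_2pi[of j] by simp
      qed
    qed
    have "th 1 = pi" "th 2 = pi" using no[of 1] no[of 2] n by auto
    then show False using th_less[of 1 2] n by simp
  next
    case False
    then have z2: "z2 < 2 * pi" using z by simp
    define d where "d = Min {th n - th (n - 1), th 1 - th 0, pi / 2, z1, 2 * pi - z2}"
    have d: "0 < d" using th_Suc[of "n - 1"] th_Suc[of 0] n z z2 by (simp add: d_def)
    have d': "d \<le> th n - th (n - 1)" "d \<le> th 1 - th 0" "d \<le> pi / 2" "d \<le> z1" "d \<le> 2 * pi - z2"
      unfolding d_def by (rule Min_le; simp)+
    have k: "sang (g (2 * pi - d)) (g d) < 2 * d"
      using kink[of n d] n d d' nj by (simp add: thn th0)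
    have b: "0 \<le> 2 * pi - d" "2 * pi - d \<le> 2 * pi" "d \<le> 2 * pi" "0 \<le> d" using d d' z by auto
    have "sang (g z2) (g z1) \<le> sang (g z2) (g (2 * pi - d)) + sang (g (2 * pi - d)) (g z1)"
      using z b by (intro sang_triangle g_nonzero) auto
    also have "sang (g (2 * pi - d)) (g z1) \<le> sang (g (2 * pi - d)) (g d) + sang (g d) (g z1)"
      using z b by (intro sang_triangle g_nonzero) auto
    also have "sang (g z2) (g (2 * pi - d)) \<le> 2 * pi - d - z2" using z b d' by (intro sang_g_le) auto
    also have "sang (g d) (g z1) \<le> z1 - d" using z b d' by (intro sang_g_le) auto
    finally show False using k s le by linarith
  qed
qed

lemma continuous_g: "continuous_on A g"
proof -
  have "continuous_on A (\<lambda>\<phi>. f (pt r \<phi>))"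
  proof (rule continuous_on_compose2[OF cont])
    show "continuous_on A (pt r)" unfolding pt_def cis_conv_exp by (intro continuous_intros)
    show "pt r ` A \<subseteq> cball p r" using pt_mem_cball r by (metis image_subsetI less_imp_le order_refl)
  qed
  then show ?thesis unfolding g_def by (intro continuous_intros)
qed

text \<open>If \<open>N = g 0 + g \<pi>\<close> is not positive on the curve at \<open>z\<close>, then the half of the curve through
  \<open>z\<close> consists of two geodesic arcs that meet at \<open>z\<close>, and \<open>N\<close> vanishes there.\<close>

lemma half_curve:
  assumes "0 \<le> a" "a + pi \<le> 2 * pi" "a \<le> z" "z \<le> a + pi" "(g a + g (a + pi)) \<bullet> g z \<le> 0"
  shows "(g a + g (a + pi)) \<bullet> g z = 0" "z - a \<le> sang (g a) (g z)" "a + pi - z \<le> sang (g z) (g (a + pi))"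
proof -
  let ?d1 = "sang (g a) (g z)" and ?d2 = "sang (g z) (g (a + pi))"
  have le: "?d1 \<le> z - a" "?d2 \<le> a + pi - z" using assms by (auto intro!: sang_g_le)
  have "cos ?d1 = g a \<bullet> g z" "cos ?d2 = g z \<bullet> g (a + pi)"
    using norm_g[of a] norm_g[of z] norm_g[of "a + pi"] assms by (auto simp: cos_sang)
  then have c: "cos ?d1 + cos ?d2 = (g a + g (a + pi)) \<bullet> g z" by (simp add: inner_add_left inner_commute[of "g z" "g (a + pi)"])
  have "cos ?d1 \<le> cos (pi - ?d2)" using c assms(5) by simp
  then have "pi - ?d2 \<le> ?d1"
    by (rule cos_ge_sum_if_le) (use sang_ge_0[of "g a" "g z"] sang_le_pi[of "g z" "g (a + pi)"] sang_ge_0[of "g z" "g (a + pi)"] in auto)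
  then show 1: "z - a \<le> ?d1" "a + pi - z \<le> ?d2" using le by linarith+
  have "?d2 = pi - ?d1" using 1 le by linarith
  then show "(g a + g (a + pi)) \<bullet> g z = 0" using c by simp
qed

lemma not_opposite: "g pi \<noteq> - g 0"
proof
  assume a: "g pi = - g 0"
  have "g (2 * pi) = - g pi" using g_2pi[of 0] a by simp
  then show False using not_antipodal_around_base[of pi "2 * pi"] by simp
qed

text \<open>With two contact points every crease inside the half would be inside one of the geodesic
  arcs. So the half lies in a single sector and is a half great circle, which makes
  \<open>g 0\<close> and \<open>g pi\<close> antipodal.\<close>

lemma half_curve_unique:
  assumes "a = 0 \<or> a = pi" "a \<le> z" "z < z'" "z' \<le> a + pi"
    "(g a + g (a + pi)) \<bullet> g z \<le> 0" "(g a + g (a + pi)) \<bullet> g z' \<le> 0"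
  shows False
proof -
  have a: "0 \<le> a" "a + pi \<le> 2 * pi" using assms by auto
  note h = half_curve(2,3)[OF a assms(2) _ assms(5)] half_curve(2,3)[OF a _ assms(4,6)]
  have b: "z \<le> a + pi" "a \<le> z'" using assms by auto
  have no: False if j: "0 < j" "j < n" "a < th j" "th j < a + pi" for j
  proof (cases "th j < z'")
    case True
    then show False using geodesic_no_crease[of a z' j] h b j a assms by auto
  next
    case False
    then show False using geodesic_no_crease[of z "a + pi" j] h b j a assms by auto
  qed
  obtain k where k: "k < n" "th k \<le> a" "a < th (Suc k)"
    using find_sector[of a] a pi_gt_zero by (metis add_le_same_cancel2 assms(1) field_sum_of_halves half_gt_zero_iff less_add_same_cancel1 mult_2 order_le_less order_less_le_trans)
  have "a + pi \<le> th (Suc k)"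
  proof (rule ccontr)
    assume "\<not> ?thesis"
    then have "th (Suc k) < a + pi" by simp
    moreover then have "Suc k \<noteq> n" using thn a by auto
    ultimately show False using no[of "Suc k"] k by auto
  qed
  moreover have "th k \<le> a + pi" using k pi_gt_zero by linarith
  ultimately have "g a \<bullet> g (a + pi) = cos pi" using g_inner[of k a "a + pi"] k by simp
  then have "(g a + g (a + pi)) \<bullet> (g a + g (a + pi)) = 0"
    using norm_g[of a] norm_g[of "a + pi"] a by (simp add: inner_add_left inner_add_right norm_eq_1 inner_commute)
  then have e: "g (a + pi) = - g a" by (simp add: eq_neg_iff_add_eq_0 add.commute)
  have "g (2 * pi) = g 0" using g_2pi[of 0] by simp
  then have "g pi = - g 0" using assms(1) e by auto
  then show False using not_opposite by simp
qed

text \<open>The vector \<open>?M\<close> is nonnegative on the curve and vanishes at most once in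
  each half. Tilting it slightly towards the sum \<open>H\<close> of the contact points makes it
  positive everywhere, because two contact points are not antipodal.\<close>

lemma hemisphere: obtains N where "\<And>\<phi>. 0 \<le> \<phi> \<Longrightarrow> \<phi> \<le> 2 * pi \<Longrightarrow> 0 < N \<bullet> g \<phi>"
proof -
  let ?M = "g 0 + g pi"
  have g2: "g (2 * pi) = g 0" using g_2pi[of 0] by simp
  have M2: "g pi + g (pi + pi) = ?M" using g2 by (simp add: add.commute)
  define Z1 where "Z1 = {z. 0 \<le> z \<and> z \<le> pi \<and> ?M \<bullet> g z \<le> 0}"
  define Z2 where "Z2 = {z. pi \<le> z \<and> z \<le> 2 * pi \<and> ?M \<bullet> g z \<le> 0}"
  have u1: "z = z'" if "z \<in> Z1" "z' \<in> Z1" for z z'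
    using half_curve_unique[of 0 z z'] half_curve_unique[of 0 z' z] that unfolding Z1_def
    by (cases z z' rule: linorder_cases) auto
  have u2: "z = z'" if "z \<in> Z2" "z' \<in> Z2" for z z'
    using half_curve_unique[of pi z z'] half_curve_unique[of pi z' z] that unfolding Z2_def M2
    by (cases z z' rule: linorder_cases) auto
  have nonneg: "0 \<le> ?M \<bullet> g z" if "z \<in> {0..2 * pi}" for z
    using half_curve(1)[of 0 z] half_curve(1)[of pi z] that unfolding M2
    by (cases "z \<le> pi"; cases "?M \<bullet> g z \<le> 0") auto
  define H where "H = (if Z1 = {} then 0 else g (SOME z. z \<in> Z1)) + (if Z2 = {} then 0 else g (SOME z. z \<in> Z2))"
  have s1: "(SOME z. z \<in> Z1) = z" if "z \<in> Z1" for z using u1 that by (metis someI_ex)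
  have s2: "(SOME z. z \<in> Z2) = z" if "z \<in> Z2" for z using u2 that by (metis someI_ex)
  have opp: "- 1 < g z1 \<bullet> g z2" if z: "z1 \<in> Z1" "z2 \<in> Z2" for z1 z2
  proof -
    have n1: "norm (g z1) = 1" "norm (g z2) = 1" using z by (auto simp: Z1_def Z2_def intro!: norm_g)
    have "\<bar>g z1 \<bullet> g z2\<bar> \<le> 1" using Cauchy_Schwarz_ineq2[of "g z1" "g z2"] n1 by simp
    moreover have "g z1 \<bullet> g z2 \<noteq> - 1"
    proof
      assume "g z1 \<bullet> g z2 = - 1"
      then have "(g z2 + g z1) \<bullet> (g z2 + g z1) = 0"
        using n1 by (simp add: inner_add_left inner_add_right norm_eq_1 inner_commute)
      then have a: "g z2 = - g z1" by (simp add: eq_neg_iff_add_eq_0)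
      have "z1 \<noteq> 0"
      proof
        assume "z1 = 0"
        then have "g 0 \<bullet> g 0 + g pi \<bullet> g 0 \<le> 0" using z by (simp add: Z1_def inner_add_left)
        moreover have n0: "g 0 \<bullet> g 0 = 1" "g pi \<bullet> g pi = 1" using norm_g[of 0] norm_g[of pi] by (auto simp: norm_eq_1)
        ultimately have "(g pi + g 0) \<bullet> (g pi + g 0) \<le> 0" by (simp add: inner_add_left inner_add_right inner_commute)
        then have "g pi + g 0 = 0" by (metis inner_ge_zero inner_eq_zero_iff order_antisym)
        then show False using not_opposite by (simp add: eq_neg_iff_add_eq_0)
      qed
      then show False using not_antipodal_around_base[of z1 z2] z a by (auto simp: Z1_def Z2_def)
    qed
    ultimately show ?thesis by linarith
  qed
  have HZ: "0 < H \<bullet> g z" if z: "z \<in> {0..2 * pi}" and "?M \<bullet> g z = 0" for z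
  proof -
    have n0: "g z \<bullet> g z = 1" using norm_g[of z] z by (simp add: norm_eq_1)
    have cases: "z \<in> Z1 \<or> z \<in> Z2" using that by (auto simp: Z1_def Z2_def)
    show ?thesis
    proof (cases "z \<in> Z1")
      case True
      show ?thesis
      proof (cases "Z2 = {}")
        case T: True
        have "H = g z" using True T s1[OF True] by (auto simp: H_def)
        then show ?thesis using n0 by simp
      next
        case False
        then obtain z2 where z2: "z2 \<in> Z2" by auto
        have "H = g z + g z2" using True z2 s1[OF True] s2[OF z2] by (auto simp: H_def)
        then show ?thesis using n0 opp[OF True z2] by (simp add: inner_add_left inner_commute[of "g z2" "g z"])
      qed
    next
      case False
      then have z2: "z \<in> Z2" using cases by simp
      show ?thesis
      proof (cases "Z1 = {}")
        case T: True
        have "H = g z" using z2 T s2[OF z2] by (auto simp: H_def)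
        then show ?thesis using n0 by simp
      next
        case F: False
        then obtain z1 where z1: "z1 \<in> Z1" by auto
        have "H = g z1 + g z" using z1 z2 s1[OF z1] s2[OF z2] by (auto simp: H_def)
        then show ?thesis using n0 opp[OF z1 z2] by (simp add: inner_add_left)
      qed
    qed
  qed
  obtain e where e: "0 < e" "\<And>x. x \<in> {0..2 * pi} \<Longrightarrow> 0 < ?M \<bullet> g x + e * (H \<bullet> g x)"
    by (rule perturb_positive[of "{0..2 * pi}" "\<lambda>x. ?M \<bullet> g x" "\<lambda>x. H \<bullet> g x"])
       (use nonneg HZ continuous_g in \<open>auto intro!: continuous_intros\<close>)
  show ?thesis
    by (rule that[of "?M + e *\<^sub>R H"]) (use e(2) in \<open>simp add: inner_add_left\<close>)
qed

end

section \<open>Central projection of the folded boundary circle\<close>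

definition gnom :: "real^3 \<Rightarrow> complex" where "gnom x = Complex (x $ 1 / x $ 3) (x $ 2 / x $ 3)"

lemma lift_gnom: "0 < x $ 3 \<Longrightarrow> lift (gnom x) = (1 / x $ 3) *\<^sub>R x"
  by (simp add: lift_def gnom_def vec_eq_iff forall_3)

lemma gnom_eq: "lift z = k *\<^sub>R x \<Longrightarrow> gnom x = z"
proof -
  assume h: "lift z = k *\<^sub>R x"
  have "1 = k * x $ 3" "Re z = k * x $ 1" "Im z = k * x $ 2"
    using arg_cong[OF h, of "\<lambda>v. v $ 3"] arg_cong[OF h, of "\<lambda>v. v $ 1"] arg_cong[OF h, of "\<lambda>v. v $ 2"]
    by (auto simp: lift_def)
  moreover then have "x $ 3 \<noteq> 0" by auto
  ultimately have "k = 1 / x $ 3" by (simp add: eq_divide_eq)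
  then show ?thesis using \<open>Re z = k * x $ 1\<close> \<open>Im z = k * x $ 2\<close> by (simp add: gnom_def complex_eq_iff)
qed

text \<open>\<open>R\<close> brings the pole of the hemisphere to the third axis. Determinant 1
  makes it preserve the signs of triple products, so the turns of the projected polygon keep the
  signs of the folding angles.\<close>

locale folded_gnom = folded_all +
  fixes R :: "real^3 \<Rightarrow> real^3"
  assumes R: "orthogonal_transformation R" and detR: "det (matrix R) = 1"
    and pos: "\<And>x. x \<in> sphere p r \<Longrightarrow> 0 < R (f x - f p) $ 3"
begin

definition P :: "real \<Rightarrow> complex" where "P \<phi> = gnom (R (f (pt r \<phi>) - f p))"

lemma linR: "linear R" using R by (simp add: orthogonal_transformation_def)

lemma pt_sphere: "pt r \<phi> \<in> sphere p r" using dist_pt[of r \<phi>] r by simp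

lemma Rg_pos: "0 < R (g \<phi>) $ 3"
  using pos[OF pt_sphere[of \<phi>]] linR r by (simp add: g_def linear_scale)

lemma lift_P: "\<exists>k>0. lift (P \<phi>) = k *\<^sub>R R (g \<phi>)"
proof -
  let ?x = "R (f (pt r \<phi>) - f p)"
  have "?x = r *\<^sub>R R (g \<phi>)" using linR r by (simp add: g_def linear_scale)
  moreover have "0 < ?x $ 3" using pos[OF pt_sphere] .
  ultimately have "lift (P \<phi>) = (1 / ?x $ 3 * r) *\<^sub>R R (g \<phi>)"
    unfolding P_def by (simp add: lift_gnom)
  then show ?thesis using \<open>0 < ?x $ 3\<close> r by (intro exI[of _ "1 / ?x $ 3 * r"]) simp
qed

lemma P_eqI: "lift z = k *\<^sub>R R (g \<phi>) \<Longrightarrow> P \<phi> = z"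
proof -
  assume h: "lift z = k *\<^sub>R R (g \<phi>)"
  have "R (g \<phi>) = (1 / r) *\<^sub>R R (f (pt r \<phi>) - f p)" using linR by (simp add: g_def linear_scale)
  then have "lift z = (k / r) *\<^sub>R R (f (pt r \<phi>) - f p)" using h by simp
  then show ?thesis unfolding P_def by (rule gnom_eq)
qed

lemma sang_P: "sang (lift (P s)) (lift (P t)) = sang (g s) (g t)"
proof -
  obtain k l where k: "0 < k" "lift (P s) = k *\<^sub>R R (g s)" and l: "0 < l" "lift (P t) = l *\<^sub>R R (g t)"
    using lift_P by metis
  have "sang (lift (P s)) (lift (P t)) = sang (R (g s)) (R (g t))"
    unfolding k l using k l by (simp add: sang_scale)
  also have "\<dots> = sang (g s) (g t)"
    using R by (simp add: sang_def orthogonal_transformation_norm orthogonal_transformation_def)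
  finally show ?thesis .
qed

lemma turn_P: "\<exists>k>0. turn (P a) (P b) (P c) = k * (g a \<bullet> cross3 (g b) (g c))"
proof -
  obtain i j k where i: "0 < i" "lift (P a) = i *\<^sub>R R (g a)" and j: "0 < j" "lift (P b) = j *\<^sub>R R (g b)"
    and k: "0 < k" "lift (P c) = k *\<^sub>R R (g c)"
    using lift_P by metis
  have "cross3 (R (g b)) (R (g c)) = R (cross3 (g b) (g c))"
    using cross_orthogonal_transformation[OF R, of "g b" "g c"] detR by simp
  then have "turn (P a) (P b) (P c) = (i * j * k) * (R (g a) \<bullet> R (cross3 (g b) (g c)))"
    unfolding det_lift[symmetric] i j k by (simp add: cross_mult_left cross_mult_right)
  also have "R (g a) \<bullet> R (cross3 (g b) (g c)) = g a \<bullet> cross3 (g b) (g c)"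
    using R by (simp add: orthogonal_transformation_def)
  finally show ?thesis using i j k by (intro exI[of _ "i * j * k"]) simp
qed

text \<open>A sector of angle pi or more contains opposite directions, whose images cannot both lie
  in an open hemisphere.\<close>

lemma gap_less_pi: "k < n \<Longrightarrow> th (Suc k) - th k < pi"
proof (rule ccontr)
  assume k: "k < n" and "\<not> th (Suc k) - th k < pi"
  then have "g (th k) = L k (dir (th k))" "g (th k + pi) = L k (dir (th k + pi))"
    using th_Suc[OF k] by (auto intro!: g_eq)
  moreover have "dir (th k + pi) = - dir (th k)" by (simp add: dir_def cis_mult[symmetric])
  ultimately have "g (th k + pi) = - g (th k)" using lin[OF k] by (simp add: linear_neg)
  then have "R (g (th k + pi)) = - R (g (th k))" using linR by (simp add: linear_neg)
  then show False using Rg_pos[of "th k"] Rg_pos[of "th k + pi"] by simp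
qed

lemma P_2pi: "P (2 * pi) = P 0" using pt_2pi(1)[of r 0] by (simp add: P_def)

lemma P_inj: "0 \<le> s \<Longrightarrow> s < 2 * pi \<Longrightarrow> 0 \<le> t \<Longrightarrow> t < 2 * pi \<Longrightarrow> P s = P t \<Longrightarrow> s = t"
proof -
  assume h: "0 \<le> s" "s < 2 * pi" "0 \<le> t" "t < 2 * pi" "P s = P t"
  obtain k l where k: "0 < k" "lift (P s) = k *\<^sub>R R (g s)" and l: "0 < l" "lift (P t) = l *\<^sub>R R (g t)"
    using lift_P by metis
  have nR: "norm (R x) = norm x" for x using R by (simp add: orthogonal_transformation_norm)
  have e: "k *\<^sub>R R (g s) = l *\<^sub>R R (g t)" using k l h by simp
  then have "norm (k *\<^sub>R R (g s)) = norm (l *\<^sub>R R (g t))" by simp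
  then have "k = l" using k l nR norm_g[of s] norm_g[of t] h by simp
  then have "R (g s) = R (g t)" using e k by simp
  then have "g s = g t" using R orthogonal_transformation_inj by (metis injD)
  then have "f (pt r s) = f (pt r t)" using r by (simp add: g_def)
  then have "pt r s = pt r t" using inj pt_mem_cball[of r] r by (metis inj_onD less_imp_le order_refl)
  then show "s = t" using pt_inj[of r r s t] r h by auto
qed

text \<open>Central projection turns arcs of great circles into segments. The edges are half-open to
  match \<open>pset\<close>, so that injectivity of \<open>P\<close> on one full turn gives a simple
  polygon.\<close>

lemma edge_P:
  assumes k: "k < n" and z: "z \<in> closed_segment (P (th k)) (P (th (Suc k))) - {P (th (Suc k))}"
  shows "z \<in> P ` {th k..<th (Suc k)}"
proof -
  let ?a = "th k" and ?b = "th (Suc k)"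
  obtain t where t: "0 \<le> t" "t \<le> 1" "z = (1 - t) *\<^sub>R P ?a + t *\<^sub>R P ?b" using z by (auto simp: in_segment)
  have "t \<noteq> 1" using z t by auto
  then have t1: "t < 1" using t by simp
  obtain i j where i: "0 < i" "lift (P ?a) = i *\<^sub>R R (g ?a)" and j: "0 < j" "lift (P ?b) = j *\<^sub>R R (g ?b)"
    using lift_P by metis
  have lz: "lift z = ((1 - t) * i) *\<^sub>R R (g ?a) + (t * j) *\<^sub>R R (g ?b)"
  proof -
    have "lift z = (1 - t) *\<^sub>R lift (P ?a) + t *\<^sub>R lift (P ?b)"
      unfolding t(3) by (simp add: lift_def vec_eq_iff forall_3)
    then show ?thesis unfolding i j by simp
  qed
  let ?c1 = "(1 - t) * i" and ?c2 = "t * j"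
  have "0 < ?c1" "0 \<le> ?c2" "0 < ?b - ?a" "?b - ?a < pi" using t t1 i j th_Suc[OF k] gap_less_pi[OF k] by auto
  then obtain \<rho> \<phi> where c: "0 < \<rho>" "0 \<le> \<phi>" "\<phi> < ?b - ?a" "of_real ?c1 + of_real ?c2 * cis (?b - ?a) = of_real \<rho> * cis \<phi>"
    by (rule cone_direction)
  have "?c1 *\<^sub>R dir ?a + ?c2 *\<^sub>R dir ?b = \<rho> *\<^sub>R dir (?a + \<phi>)"
  proof -
    have "dir ?b = dir ?a * cis (?b - ?a)" by (simp add: dir_def cis_mult mult.assoc)
    then have "?c1 *\<^sub>R dir ?a + ?c2 *\<^sub>R dir ?b = dir ?a * (of_real ?c1 + of_real ?c2 * cis (?b - ?a))"
      by (simp add: scaleR_conv_of_real algebra_simps)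
    also have "\<dots> = \<rho> *\<^sub>R dir (?a + \<phi>)"
      unfolding c(4) by (simp add: dir_def cis_mult[symmetric] scaleR_conv_of_real)
    finally show ?thesis .
  qed
  then have "L k (?c1 *\<^sub>R dir ?a + ?c2 *\<^sub>R dir ?b) = L k (\<rho> *\<^sub>R dir (?a + \<phi>))" by simp
  then have "?c1 *\<^sub>R L k (dir ?a) + ?c2 *\<^sub>R L k (dir ?b) = \<rho> *\<^sub>R L k (dir (?a + \<phi>))"
    using lin[OF k] by (simp only: linear_add linear_scale)
  moreover have "L k (dir ?a) = g ?a" "L k (dir ?b) = g ?b" "L k (dir (?a + \<phi>)) = g (?a + \<phi>)"
    using c th_Suc[OF k] k by (auto simp: g_eq)
  ultimately have "?c1 *\<^sub>R g ?a + ?c2 *\<^sub>R g ?b = \<rho> *\<^sub>R g (?a + \<phi>)" by simp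
  then have "R (?c1 *\<^sub>R g ?a + ?c2 *\<^sub>R g ?b) = R (\<rho> *\<^sub>R g (?a + \<phi>))" by simp
  then have "lift z = \<rho> *\<^sub>R R (g (?a + \<phi>))" unfolding lz using linR by (simp only: linear_add linear_scale)
  then have "P (?a + \<phi>) = z" by (rule P_eqI)
  then show ?thesis using c by (intro image_eqI[of _ _ "?a + \<phi>"]) auto
qed

abbreviation Q :: "nat \<Rightarrow> complex" where "Q k \<equiv> P (th k)"

lemma map_upt_split: "i < j \<Longrightarrow> map h [i..<j] = h i # map h [Suc i..<j]"
  by (simp add: upt_conv_Cons)

lemma polygon_simple: "k \<le> n \<Longrightarrow> psimple (map Q [k..<Suc n]) \<and> pset (map Q [k..<Suc n]) \<subseteq> P ` {th k..<2 * pi}"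
proof (induction "n - k" arbitrary: k)
  case 0
  then have "k = n" by simp
  then show ?case by (simp add: upt_rec)
next
  case (Suc m)
  then have k: "k < n" and m: "m = n - Suc k" by auto
  have IH: "psimple (map Q [Suc k..<Suc n])" "pset (map Q [Suc k..<Suc n]) \<subseteq> P ` {th (Suc k)..<2 * pi}"
    using Suc(1)[OF m] k by auto
  have l: "map Q [k..<Suc n] = Q k # Q (Suc k) # map Q [Suc (Suc k)..<Suc n]"
    "map Q [Suc k..<Suc n] = Q (Suc k) # map Q [Suc (Suc k)..<Suc n]"
    using k by (simp_all add: map_upt_split del: upt_Suc)
  have e: "closed_segment (Q k) (Q (Suc k)) - {Q (Suc k)} \<subseteq> P ` {th k..<th (Suc k)}" using edge_P[OF k] by blast
  have b: "0 \<le> th k" "th k < th (Suc k)" "th (Suc k) \<le> 2 * pi" "0 \<le> th (Suc k)"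
    using th_ge_0[of k] th_Suc[OF k] th_le_2pi[of "Suc k"] th_ge_0[of "Suc k"] k by auto
  have "P ` {th k..<th (Suc k)} \<inter> P ` {th (Suc k)..<2 * pi} = {}"
  proof -
    have False if "s \<in> {th k..<th (Suc k)}" "t \<in> {th (Suc k)..<2 * pi}" "P s = P t" for s t
      using P_inj[of s t] that b by auto
    then show ?thesis by blast
  qed
  then have d: "(closed_segment (Q k) (Q (Suc k)) - {Q (Suc k)}) \<inter> pset (map Q [Suc k..<Suc n]) = {}"
    using e IH(2) by blast
  have "Q k \<noteq> Q (Suc k)"
  proof
    assume q: "Q k = Q (Suc k)"
    show False
    proof (cases "Suc k = n")
      case True
      then have "P (th k) = P 0" using q thn P_2pi by simp
      then have "th k = 0" using P_inj[of "th k" 0] b by simp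
      then have "k = 0" using th_less[of 0 k] th0 k by (cases k) auto
      then show False using True n by simp
    next
      case False
      then have "th (Suc k) < 2 * pi" using k th_less_2pi[of "Suc k"] by simp
      then show False using P_inj[of "th k" "th (Suc k)"] b q by simp
    qed
  qed
  then have ps: "psimple (map Q [k..<Suc n])" using d IH(1) unfolding l by simp
  have sub: "P ` {th k..<th (Suc k)} \<subseteq> P ` {th k..<2 * pi}" "P ` {th (Suc k)..<2 * pi} \<subseteq> P ` {th k..<2 * pi}"
    using b by (intro image_mono; auto)+
  have un: "pset (map Q [k..<Suc n]) = (closed_segment (Q k) (Q (Suc k)) - {Q (Suc k)}) \<union> pset (map Q [Suc k..<Suc n])"
    unfolding l by (simp only: pset.simps)
  have "pset (map Q [k..<Suc n]) \<subseteq> P ` {th k..<2 * pi}"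
    unfolding un by (rule Un_least[OF order_trans[OF e sub(1)] order_trans[OF IH(2) sub(2)]])
  then show ?case using ps by blast
qed

lemma polygon_length: "i \<le> j \<Longrightarrow> j \<le> n \<Longrightarrow> slen (map Q [i..<Suc j]) = th j - th i"
proof (induction "j - i" arbitrary: i)
  case 0
  then show ?case by simp
next
  case (Suc m)
  then have k: "i < n" "i < j" and m: "m = j - Suc i" by auto
  have l: "map Q [i..<Suc j] = Q i # Q (Suc i) # map Q [Suc (Suc i)..<Suc j]"
    "map Q [Suc i..<Suc j] = Q (Suc i) # map Q [Suc (Suc i)..<Suc j]"
    using k by (simp_all add: map_upt_split del: upt_Suc)
  have "sang (lift (Q i)) (lift (Q (Suc i))) = th (Suc i) - th i"
    unfolding sang_P using sang_same_sector(2)[of i "th i" "th (Suc i)"] k th_Suc[of i] gap_less_pi[of i] by simp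
  moreover have "slen (map Q [Suc i..<Suc j]) = th j - th (Suc i)" using Suc(1)[OF m] Suc k by simp
  ultimately show ?case unfolding l by simp
qed

lemma turn_sign:
  assumes "0 < j" "j \<le> n"
  obtains k where "0 < k" "turn (Q (j - 1)) (Q j) (Q (Suc (nx j))) = k * fold_sin j"
proof -
  have j: "j - 1 < n" "nx j < n" "Suc (j - 1) = j" using assms nx_less by auto
  let ?d = "th j - th (j - 1)" and ?d' = "th (Suc (nx j)) - th (nx j)"
  have d: "0 < ?d" "?d < pi" "0 < ?d'" "?d' < pi"
    using th_Suc[OF j(1)] th_Suc[OF j(2)] gap_less_pi[OF j(1)] gap_less_pi[OF j(2)] j(3) by auto
  have "g (th (j - 1)) \<bullet> cross3 (g (th j)) (g (th (Suc (nx j)))) = sin ?d * sin ?d' * fold_sin j"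
    using det_at_crease[OF assms, of ?d ?d'] d by simp
  moreover obtain k where "0 < k" "turn (Q (j - 1)) (Q j) (Q (Suc (nx j))) = k * (g (th (j - 1)) \<bullet> cross3 (g (th j)) (g (th (Suc (nx j)))))"
    using turn_P by blast
  moreover have "0 < sin ?d * sin ?d'" using d by (simp add: sin_gt_zero)
  ultimately show ?thesis using that[of "k * (sin ?d * sin ?d')"] by simp
qed

lemma bends_polygon:
  assumes "0 < i" "i \<le> j" "j < n" "\<And>k. i \<le> k \<Longrightarrow> k < j \<Longrightarrow> 0 < s * fold_sin k"
  shows "bends s (map Q [i - 1..<Suc j])"
  using assms
proof (induction "j - i" arbitrary: i)
  case 0
  then have "i = j" by simp
  then show ?case using 0 by (simp add: map_upt_split del: upt_Suc)
next
  case (Suc m)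
  then have k: "i < j" "m = j - Suc i" by auto
  have l: "map Q [i - 1..<Suc j] = Q (i - 1) # Q i # Q (Suc i) # map Q [Suc (Suc i)..<Suc j]"
    "map Q [i..<Suc j] = Q i # Q (Suc i) # map Q [Suc (Suc i)..<Suc j]"
    using k Suc.prems by (simp_all add: map_upt_split del: upt_Suc)
  have "bends s (map Q [Suc i - 1..<Suc j])" using Suc(1)[of "Suc i"] k Suc.prems by simp
  then have "bends s (Q i # Q (Suc i) # map Q [Suc (Suc i)..<Suc j])" unfolding diff_Suc_1 l(2) .
  moreover obtain c where c: "0 < c" "turn (Q (i - 1)) (Q i) (Q (Suc (nx i))) = c * fold_sin i"
    using turn_sign[of i] Suc.prems k by auto
  moreover have "nx i = i" using Suc.prems k by (simp add: nx_def)
  moreover have "0 < c * (s * fold_sin i)" using c Suc.prems(4)[of i] k by simp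
  ultimately show ?case unfolding l(1) by (simp add: mult.left_commute del: upt_Suc)
qed

lemma P_le_2pi_cases: "Q n = Q 0" using P_2pi by (simp add: th0 thn)

definition M :: "complex list" where "M = map Q [1..<n]"

lemma polygon_eq: "Q 0 # M @ [Q 0] = map Q [0..<Suc n]"
proof -
  have "map Q [0..<Suc n] = map Q [0..<n] @ [Q n]" by simp
  also have "map Q [0..<n] = Q 0 # M" using n by (simp add: M_def map_upt_split)
  finally show ?thesis by (simp add: P_le_2pi_cases)
qed

lemma polygon_facts: "psimple (Q 0 # M @ [Q 0])" "slen (Q 0 # M @ [Q 0]) = 2 * pi" "set (Q 0 # M) = Q ` {..<n}"
proof -
  show "psimple (Q 0 # M @ [Q 0])" unfolding polygon_eq using polygon_simple[of 0] by simp
  show "slen (Q 0 # M @ [Q 0]) = 2 * pi" unfolding polygon_eq using polygon_length[of 0 n] by (simp add: th0 thn)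
  have "{0..<n} = insert 0 {1..<n}" using n by auto
  then show "set (Q 0 # M) = Q ` {..<n}" by (simp add: M_def atLeast0LessThan)
qed

text \<open>The number of crease \<open>i\<close> in the range from \<open>1\<close> to
  \<open>n\<close> that \<open>fold_sin\<close> expects.\<close>

definition ix :: "nat \<Rightarrow> nat" where "ix i = (if i = 0 then n else i)"

lemma neighbours:
  assumes "i < n"
  obtains X Y where "Q 0 # M = X @ Q i # Y" "last (Y @ X) = Q (ix i - 1)" "hd (Y @ X) = Q (Suc (nx (ix i)))"
proof -
  have "Q 0 # M = map Q [0..<n]" using n by (simp add: M_def map_upt_split)
  also have "[0..<n] = [0..<i] @ i # [Suc i..<n]" using assms
    by (metis append_Cons less_imp_le_nat upt_add_eq_append upt_conv_Cons le0 le_add_diff_inverse)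
  finally have e: "Q 0 # M = map Q [0..<i] @ Q i # map Q [Suc i..<n]" by simp
  have l: "last (map Q [Suc i..<n] @ map Q [0..<i]) = Q (ix i - 1)"
  proof (cases "i = 0")
    case True
    then show ?thesis using n by (simp add: ix_def last_map)
  next
    case False
    then show ?thesis by (simp add: ix_def last_map)
  qed
  have h: "hd (map Q [Suc i..<n] @ map Q [0..<i]) = Q (Suc (nx (ix i)))"
  proof (cases "Suc i < n")
    case True
    then show ?thesis by (simp add: ix_def nx_def hd_map hd_append)
  next
    case False
    then have "Suc i = n" using assms by simp
    then have i: "i = n - 1" "0 < i" "i < n" using n by auto
    then have "hd (map Q [Suc i..<n] @ map Q [0..<i]) = Q 0" by (simp add: hd_map)
    moreover have "Suc (nx (ix i)) = n" using i by (simp add: ix_def nx_def)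
    ultimately show ?thesis using P_le_2pi_cases by simp
  qed
  show ?thesis using that[OF e l h] .
qed

text \<open>Every extreme vertex has the sign of the orientation, hence that of \<open>e\<close>.
  For the second claim, an extreme vertex other than \<open>Q 0\<close> supplies a further crease of
  this sign; up to the first such crease the polygon bends the other way, and a chain of that kind
  is shorter than pi.\<close>

lemma necessity_frame:
  assumes sg: "\<And>j. 0 < j \<Longrightarrow> j \<le> n \<Longrightarrow> (sg (cr j) = 1 \<or> sg (cr j) = -1) \<and> 0 < sg (cr j) * fold_sin j"
    and e: "e < n" and ext: "\<And>k. k < n \<Longrightarrow> Q k \<noteq> Q e \<Longrightarrow> 0 < Re (cnj d * (Q k - Q e))"
  shows "\<exists>c\<in>C. sg c \<noteq> sg (cr e)"
    and "sg (cr 0) = sg (cr e) \<Longrightarrow> \<exists>j. 0 < j \<and> j < n \<and> sg (cr j) = sg (cr e) \<and> th j < pi"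
proof -
  let ?s = "sg (cr e)"
  have ix: "0 < ix i" "ix i \<le> n" "cr (ix i) = cr i" if "i < n" for i using that n cr_n by (auto simp: ix_def)
  note pf = polygon_facts
  have s: "?s = 1 \<or> ?s = -1" using sg[OF ix(1,2)[OF e]] ix(3)[OF e] by simp
  have ext_ori: "ori (Q 0) M = sg (cr i) * pi"
    if i: "i < n" and x: "\<And>k. k < n \<Longrightarrow> Q k \<noteq> Q i \<Longrightarrow> 0 < Re (cnj d' * (Q k - Q i))" for i d'
  proof -
    obtain X Y where XY: "Q 0 # M = X @ Q i # Y" "last (Y @ X) = Q (ix i - 1)" "hd (Y @ X) = Q (Suc (nx (ix i)))"
      by (rule neighbours[OF i])
    obtain k where k: "0 < k" "turn (Q (ix i - 1)) (Q (ix i)) (Q (Suc (nx (ix i)))) = k * fold_sin (ix i)"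
      using turn_sign[OF ix(1,2)[OF i]] by blast
    have "Q (ix i) = Q i" using P_le_2pi_cases by (simp add: ix_def)
    moreover have "0 < k * (sg (cr i) * fold_sin (ix i))"
      using sg[OF ix(1,2)[OF i]] k ix(3)[OF i] by simp
    ultimately have "0 < sg (cr i) * turn (last (Y @ X)) (Q i) (hd (Y @ X))"
      using k XY by (simp add: mult.left_commute)
    then have "ori (Q 0) M = sgn (sg (cr i)) * pi"
      using x pf(3) by (intro ori_bends_at_extreme[OF pf(1) XY(1)]) auto
    then show ?thesis using sg[OF ix(1,2)[OF i]] ix(3)[OF i] by auto
  qed
  obtain X Y where XY: "Q 0 # M = X @ Q e # Y" "last (Y @ X) = Q (ix e - 1)" "hd (Y @ X) = Q (Suc (nx (ix e)))"
    by (rule neighbours[OF e])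
  obtain k where k: "0 < k" "turn (Q (ix e - 1)) (Q (ix e)) (Q (Suc (nx (ix e)))) = k * fold_sin (ix e)"
    using turn_sign[OF ix(1,2)[OF e]] by blast
  have "Q (ix e) = Q e" using P_le_2pi_cases by (simp add: ix_def)
  moreover have "0 < k * (?s * fold_sin (ix e))" using sg[OF ix(1,2)[OF e]] k ix(3)[OF e] by simp
  ultimately have t: "0 < ?s * turn (last (Y @ X)) (Q e) (hd (Y @ X))" using k XY by (simp add: mult.left_commute)
  have extM: "0 < Re (cnj d * (w - Q e))" if w: "w \<in> set (Q 0 # M) - {Q e}" for w
  proof -
    obtain k where "k < n" "w = Q k" using w pf(3) by blast
    then show ?thesis using ext[of k] w by auto
  qed
  note nec = planar_necessity[OF pf(1,2) XY(1) extM s t]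
  show "\<exists>c\<in>C. sg c \<noteq> ?s"
  proof (rule ccontr)
    assume "\<not> ?thesis"
    then have all: "sg (cr j) = ?s" if "0 < j" "j \<le> n" for j
      using that C_eq cr_n n by (cases "j = n") auto
    then have pos: "0 < ?s * fold_sin j" if "0 < j" "j \<le> n" for j using sg[of j] that by simp
    have b: "bends ?s (Q 0 # M)"
    proof -
      have "bends ?s (map Q [1 - 1..<Suc (n - 1)])" using n by (intro bends_polygon pos) auto
      moreover have "Q 0 # M = map Q [0..<n]" using n by (simp add: M_def map_upt_split)
      ultimately show ?thesis using n by simp
    qed
    \<comment> \<open>The last two vertices are split off, because the bends at vertex
      \<open>n - 1\<close> and at the base vertex involve the closing edge and are not covered by
      \<open>bends_polygon\<close>.\<close>
    define K where "K = map Q [1..<n - 2]"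
    have MK: "M = K @ [Q (n - 2), Q (n - 1)]"
    proof -
      have "[1..<m + 3] = [1..<m + 3 - 2] @ [m + 3 - 2, m + 3 - 1]" for m
        by (simp add: numeral_3_eq_3)
      from this[of "n - 3"] have "[1..<n] = [1..<n - 2] @ [n - 2, n - 1]" using n by simp
      then show ?thesis unfolding M_def K_def by simp
    qed
    obtain N where MN: "M = Q 1 # N" using n by (simp add: M_def map_upt_split)
    have t1: "0 < ?s * turn (Q (n - 1)) (Q 0) (Q 1)"
    proof -
      obtain c where c: "0 < c" "turn (Q (n - 1)) (Q n) (Q (Suc (nx n))) = c * fold_sin n"
        using turn_sign[of n] n by auto
      have "0 < c * (?s * fold_sin n)" using c pos[of n] n by simp
      then show ?thesis using c P_le_2pi_cases by (simp add: nx_def mult.left_commute)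
    qed
    have t2: "0 < ?s * turn (Q (n - 2)) (Q (n - 1)) (Q 0)"
    proof -
      have e1: "n - 1 - 1 = n - 2" "Suc (nx (n - 1)) = n" using n by (auto simp: nx_def)
      obtain c where c: "0 < c" "turn (Q (n - 2)) (Q (n - 1)) (Q n) = c * fold_sin (n - 1)"
        using turn_sign[of "n - 1"] n unfolding e1 by auto
      have "0 < c * (?s * fold_sin (n - 1))" using c pos[of "n - 1"] n by simp
      then show ?thesis using c P_le_2pi_cases by (simp add: mult.left_commute)
    qed
    have "bends ?s ((Q 0 # K) @ [Q (n - 2), Q (n - 1)])" using b MK by simp
    moreover have "bends ?s [Q (n - 2), Q (n - 1), Q 0]" using t2 by simp
    ultimately have "bends ?s ((Q 0 # K) @ [Q (n - 2), Q (n - 1), Q 0])"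
      using bends_append[of ?s "Q 0 # K" "Q (n - 2)" "Q (n - 1)" "[Q 0]"] by blast
    then have b2: "bends ?s (Q 0 # M @ [Q 0])" using MK by simp
    moreover have "last M = Q (n - 1)" using MK by simp
    ultimately have "bends ?s (last M # Q 0 # M @ [Q 0])" using t1 MN by simp
    then show False using nec(1) by simp
  qed
  assume c0: "sg (cr 0) = ?s"
  show "\<exists>j. 0 < j \<and> j < n \<and> sg (cr j) = ?s \<and> th j < pi"
  proof (rule ccontr)
    assume no: "\<not> ?thesis"
    have "\<not> set (Q 0 # M) \<subseteq> convex hull {Q 0}"
    proof -
      have "Q 1 \<noteq> Q 0" using P_inj[of "th 1" "th 0"] th_less[of 0 1] th0 th_less_2pi[of 1] n by auto
      moreover have "Q 1 \<in> set (Q 0 # M)" unfolding pf(3) using n by auto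
      ultimately show ?thesis by auto
    qed
    then obtain e' d' where e': "e' \<in> set (Q 0 # M)" "e' \<notin> {Q 0}" "\<And>w. w \<in> set (Q 0 # M) - {e'} \<Longrightarrow> 0 < Re (cnj d' * (w - e'))"
      using exists_extreme[of "set (Q 0 # M)" "{Q 0}"] by auto
    then obtain i where i: "i < n" "e' = Q i" "i \<noteq> 0" unfolding pf(3) by auto
    have "ori (Q 0) M = sg (cr i) * pi" using ext_ori[OF i(1), of d'] e' i pf(3) by auto
    then have si: "sg (cr i) = ?s" using ext_ori[OF e ext] by simp
    define j where "j = (LEAST j. 0 < j \<and> j < n \<and> sg (cr j) = ?s)"
    have ex: "\<exists>j. 0 < j \<and> j < n \<and> sg (cr j) = ?s" using i si by blast
    have j: "0 < j" "j < n" "sg (cr j) = ?s" using LeastI_ex[OF ex] unfolding j_def by auto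
    have jmin: "sg (cr k) \<noteq> ?s" if "0 < k" "k < j" for k
      using not_less_Least[of k "\<lambda>j. 0 < j \<and> j < n \<and> sg (cr j) = ?s"] that j(2) unfolding j_def[symmetric] by auto
    have tj: "pi \<le> th j" using no j by auto
    let ?W = "map Q [1..<j]"
    have "M = ?W @ [Q j] @ map Q [Suc j..<n]"
    proof -
      have "[1..<n] = [1..<j] @ j # [Suc j..<n]"
        using j by (metis Suc_leI One_nat_def less_imp_le_nat upt_add_eq_append upt_conv_Cons le_add_diff_inverse)
      then show ?thesis by (simp add: M_def)
    qed
    moreover have W: "Q 0 # ?W @ [Q j] = map Q [0..<Suc j]"
    proof -
      have "map Q [0..<j] = Q 0 # ?W" using j by (simp add: map_upt_split)
      then show ?thesis by simp
    qed
    have "bends (- ?s) (Q 0 # ?W @ [Q j])"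
    proof -
      have "0 < - ?s * fold_sin k" if k: "1 \<le> k" "k < j" for k
      proof -
        have "sg (cr k) = - ?s" using sg[of k] jmin[of k] s k j by auto
        then show ?thesis using sg[of k] k j by simp
      qed
      then have "bends (- ?s) (map Q [1 - 1..<Suc j])" using j by (intro bends_polygon) auto
      then show ?thesis unfolding W by simp
    qed
    ultimately have "slen (Q 0 # ?W @ [Q j]) < pi" using nec(2) by blast
    then show False unfolding W using polygon_length[of 0 j] j tj th0 by simp
  qed
qed

end

section \<open>The bird's foot of a realized assignment\<close>

definition sg :: "(complex \<Rightarrow> mv) \<Rightarrow> complex \<Rightarrow> real" where
  "sg \<mu> c = (if \<mu> c = Valley then 1 else -1)"

lemma sg_eq: "sg \<mu> c = sg \<mu> d \<longleftrightarrow> \<mu> c = \<mu> d"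
  by (cases "\<mu> c"; cases "\<mu> d") (auto simp: sg_def)

context crease_frame
begin

lemma cr_in_C: "j \<le> n \<Longrightarrow> cr j \<in> C"
  using C_eq cr_n n by (cases "j = n") auto

lemma realizes_folded:
  assumes "rigid_folding p r C f" "realizes p r C \<mu> f"
  obtains L where "folded_all p r C u n th f L"
    "\<And>j. 0 < j \<Longrightarrow> j \<le> n \<Longrightarrow> 0 < sg \<mu> (cr j) * folded.fold_sin p r u n th f L j"
proof -
  obtain L where L: "folded p r C u n th f L" by (rule rigid_folded[OF assms(1)])
  have inj: "inj_on f (cball p r)" and cont: "continuous_on (cball p r) f"
    using assms(1) by (auto simp: rigid_folding_def)
  have *: "0 < sg \<mu> (cr j) * folded.fold_sin p r u n th f L j" if j: "0 < j" "j \<le> n" for j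
  proof -
    note fa = folded.folding_angle_sign[OF L j inj]
    have "cr j \<in> C" by (rule cr_in_C[OF j(2)])
    then show ?thesis using assms(2) fa unfolding realizes_def
      by (cases "\<mu> (cr j)") (auto simp: sg_def)
  qed
  have "folded_all p r C u n th f L"
  proof (intro folded_all.intro folded_all_axioms.intro L inj cont)
    fix j assume j: "0 < j" "j \<le> n"
    show "folded.fold_sin p r u n th f L j \<noteq> 0" using *[OF j] by (metis less_irrefl mult_zero_right)
  qed
  then show ?thesis using that * by blast
qed

lemma frame_result:
  assumes "rigid_folding p r C f" "realizes p r C \<mu> f"
    and R: "orthogonal_transformation R" "det (matrix R) = 1"
    and pos: "\<And>x. x \<in> sphere p r \<Longrightarrow> 0 < R (f x - f p) $ 3"
    and e: "e \<in> C"
    and ext: "\<And>c. c \<in> C \<Longrightarrow> gnom (R (f c - f p)) \<noteq> gnom (R (f e - f p)) \<Longrightarrow>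
      0 < Re (cnj d * (gnom (R (f c - f p)) - gnom (R (f e - f p))))"
  shows "\<exists>c\<in>C. \<mu> c \<noteq> \<mu> e"
    and "\<mu> (cr 0) = \<mu> e \<Longrightarrow> \<exists>c\<in>C. \<mu> c = \<mu> e \<and> 0 < ccw_angle p (cr 0) c \<and> ccw_angle p (cr 0) c < pi"
proof -
  obtain L where L: "folded_all p r C u n th f L"
    and s: "\<And>j. 0 < j \<Longrightarrow> j \<le> n \<Longrightarrow> 0 < sg \<mu> (cr j) * folded.fold_sin p r u n th f L j"
    using realizes_folded[OF assms(1,2)] by blast
  interpret folded_gnom p r C u n th f L R
    using L R pos by (intro folded_gnom.intro folded_gnom_axioms.intro) auto
  obtain i where i: "e = cr i" "i < n" using e C_eq by auto
  have Qc: "Q k = gnom (R (f (cr k) - f p))" for k by (simp add: P_def cr_def)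
  have x: "0 < Re (cnj d * (Q k - Q i))" if "k < n" "Q k \<noteq> Q i" for k
    using ext[of "cr k"] cr_in_C[of k] that unfolding Qc i(1) by simp
  have sgj: "(sg \<mu> (cr j) = 1 \<or> sg \<mu> (cr j) = -1) \<and> 0 < sg \<mu> (cr j) * fold_sin j" if "0 < j" "j \<le> n" for j
    using s[OF that] by (simp add: sg_def)
  note nf = necessity_frame[of "sg \<mu>" i d, OF sgj i(2) x]
  show "\<exists>c\<in>C. \<mu> c \<noteq> \<mu> e" using nf(1) unfolding sg_eq i(1) .
  assume "\<mu> (cr 0) = \<mu> e"
  then obtain j where j: "0 < j" "j < n" "\<mu> (cr j) = \<mu> e" "th j < pi" using nf(2) unfolding sg_eq i(1) by blast
  have "ccw_angle p (cr 0) (cr j) = th j" using ccw_cr(1)[of 0 j] j th0 by simp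
  then show "\<exists>c\<in>C. \<mu> c = \<mu> e \<and> 0 < ccw_angle p (cr 0) c \<and> ccw_angle p (cr 0) c < pi"
    using j cr_in_C[of j] th_less[of 0 j] th0 by (intro bexI[of _ "cr j"]) auto
qed

lemma orient_curve:
  assumes "rigid_folding p r C f" "realizes p r C \<mu> f"
  obtains R where "orthogonal_transformation R" "det (matrix R) = 1"
    "\<And>x. x \<in> sphere p r \<Longrightarrow> 0 < R (f x - f p) $ 3"
proof -
  obtain L where L: "folded_all p r C u n th f L" using realizes_folded[OF assms] by blast
  interpret folded_all p r C u n th f L by (rule L)
  obtain N where N: "\<And>\<phi>. 0 \<le> \<phi> \<Longrightarrow> \<phi> \<le> 2 * pi \<Longrightarrow> 0 < N \<bullet> g \<phi>" using hemisphere by metis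
  have N0: "N \<noteq> 0" using N[of 0] by auto
  have "norm N = norm (norm N *\<^sub>R axis 3 1 :: real^3)" by (simp add: norm_axis_1)
  then obtain R where R: "orthogonal_transformation R" "det (matrix R) = 1" "R N = norm N *\<^sub>R axis 3 1"
    using rotation_exists[of N "norm N *\<^sub>R axis 3 1"] by auto
  have "0 < R (f x - f p) $ 3" if x: "x \<in> sphere p r" for x
  proof -
    obtain \<rho> \<psi> where px: "0 \<le> \<psi>" "\<psi> < 2 * pi" "x = pt \<rho> (0 + \<psi>)" "\<rho> = dist p x"
      by (rule polar[where x = x and \<phi> = 0])
    have "\<rho> = r" unfolding px(4) using x by simp
    then have "f x - f p = r *\<^sub>R g \<psi>" using r unfolding px(3) by (simp add: g_def)
    then have "0 < N \<bullet> (f x - f p)" using N[of \<psi>] px(1,2) r by simp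
    then have "0 < R N \<bullet> R (f x - f p)" using R(1) by (simp add: orthogonal_transformation_def)
    then have "0 < norm N * (R (f x - f p) $ 3)" unfolding R(3) by (simp add: inner_axis' )
    then show ?thesis using N0 by (simp add: zero_less_mult_iff)
  qed
  then show ?thesis using that R by blast
qed

text \<open>Let \<open>a\<close> be the last crease of the kind less than pi after crease 0; its
  successor \<open>k\<close> lies at pi or beyond. Beyond pi, the creases 0, \<open>a\<close>,
  \<open>k\<close> form a tripod. At exactly pi the successor \<open>l\<close> of \<open>k\<close>
  decides: it completes a tripod unless it is opposite to \<open>a\<close>, and then there is a
  cross.\<close>

lemma tripod_or_cross:
  assumes m: "\<mu> (cr 0) = m"
    and next_m: "\<And>b. b \<in> C \<Longrightarrow> \<mu> b = m \<Longrightarrow> \<exists>c\<in>C. \<mu> c = m \<and> 0 < ccw_angle p b c \<and> ccw_angle p b c < pi"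
  shows "has_tripod p C \<mu> m \<or> has_cross p C \<mu> m"
proof -
  have succ: "\<exists>k<n. \<mu> (cr k) = m \<and> 0 < ccw_angle p (cr i) (cr k) \<and> ccw_angle p (cr i) (cr k) < pi"
    if "i < n" "\<mu> (cr i) = m" for i
    using next_m[of "cr i"] that C_eq by auto
  have tri: "has_tripod p C \<mu> m"
    if "i < j" "j < k" "k < n" "\<mu> (cr i) = m" "\<mu> (cr j) = m" "\<mu> (cr k) = m"
      "th j - th i < pi" "th k - th j < pi" "pi < th k - th i" for i j k
    unfolding has_tripod_def
    using that ccw_cr(1)[of i j] ccw_cr(1)[of j k] ccw_cr(1)[of i k] ccw_cr(2)[of i k] th_less[of i j] th_less[of j k] th_less_2pi[of k] th_ge_0[of i]
    by (intro bexI[of _ "cr i"] bexI[of _ "cr j"] bexI[of _ "cr k"] cr_in_C conjI) auto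
  define J where "J = {j. j < n \<and> \<mu> (cr j) = m \<and> 0 < th j \<and> th j < pi}"
  have J: "finite J" "J \<noteq> {}"
  proof -
    show "finite J" by (simp add: J_def)
    obtain k where k: "k < n" "\<mu> (cr k) = m" "0 < ccw_angle p (cr 0) (cr k)" "ccw_angle p (cr 0) (cr k) < pi"
      using succ[of 0] m n by auto
    then show "J \<noteq> {}" using ccw_cr(1)[of 0 k] th0 by (auto simp: J_def)
  qed
  define a where "a = Max J"
  have a: "a < n" "\<mu> (cr a) = m" "0 < th a" "th a < pi" using Max_in[OF J] by (auto simp: a_def J_def)
  have a0: "0 < a" using a(3) th0 by (cases a) auto
  obtain k where k: "k < n" "\<mu> (cr k) = m" "0 < ccw_angle p (cr a) (cr k)" "ccw_angle p (cr a) (cr k) < pi"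
    using succ[OF a(1,2)] by blast
  have ak: "a < k"
  proof (rule ccontr)
    assume "\<not> a < k"
    then consider "k < a" | "k = a" by linarith
    then show False
      using ccw_cr(2)[of k a] ccw_cr(1)[of a k] k a th_ge_0[of k] by cases auto
  qed
  then have b: "th k - th a < pi" using ccw_cr(1)[of a k] k by simp
  have "pi \<le> th k"
  proof (rule ccontr)
    assume "\<not> pi \<le> th k"
    then have "k \<in> J" using k th_less[of a k] a ak by (auto simp: J_def)
    then show False using Max_ge[OF J(1), of k] ak by (simp add: a_def)
  qed
  then consider "pi < th k" | "th k = pi" by linarith
  then show ?thesis
  proof cases
    case 1
    then have "has_tripod p C \<mu> m" using tri[of 0 a k] a0 ak k m a b th0 by simp
    then show ?thesis ..
  next
    case 2
    obtain l where l: "l < n" "\<mu> (cr l) = m" "0 < ccw_angle p (cr k) (cr l)" "ccw_angle p (cr k) (cr l) < pi"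
      using succ[OF k(1,2)] by blast
    have kl: "k < l"
    proof (rule ccontr)
      assume "\<not> k < l"
      then consider "l < k" | "l = k" by linarith
      then show False
        using ccw_cr(2)[of l k] ccw_cr(1)[of k l] k l th_ge_0[of l] 2 by cases auto
    qed
    have tl: "pi < th l" "th l < 2 * pi" using th_less[OF kl] l 2 th_less_2pi[of l] by auto
    consider "th l - th a < pi" | "pi < th l - th a" | "th l = th a + pi" by linarith
    then show ?thesis
    proof cases
      case 1
      then have "has_tripod p C \<mu> m" using tri[of 0 a l] a0 ak kl l m a tl th0 by simp
      then show ?thesis ..
    next
      case c2: 2
      then have "has_tripod p C \<mu> m" using tri[of a k l] ak kl l k a tl 2 th_less[OF ak] by simp
      then show ?thesis ..
    next
      case 3
      have opp: "p \<in> open_segment (pt r s) (pt r (s + pi))" for s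
      proof -
        have "pt r s \<noteq> pt r (s + pi)" using pt_inj[of r r s "s + pi"] r by auto
        moreover have "p = (1 - 1/2) *\<^sub>R pt r s + (1/2) *\<^sub>R pt r (s + pi)"
          by (simp add: pt_def complex_eq_iff algebra_simps)
        ultimately show ?thesis unfolding in_segment by (intro conjI exI[of _ "1/2"]) auto
      qed
      have "p \<in> open_segment (cr 0) (cr k)" "p \<in> open_segment (cr a) (cr l)"
        using opp[of 0] opp[of "th a"] 2 3 th0 by (auto simp: cr_def)
      moreover have "ccw_angle p (cr 0) (cr a) = th a" "ccw_angle p (cr 0) (cr k) = th k" "ccw_angle p (cr 0) (cr l) = th l"
        using ccw_cr(1)[of 0] a k l th0 by auto
      ultimately have "has_cross p C \<mu> m"
        unfolding has_cross_def using a k l m th_less[OF ak] th_less[OF kl] n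
        by (intro bexI[of _ "cr 0"] bexI[of _ "cr a"] bexI[of _ "cr k"] bexI[of _ "cr l"] cr_in_C) auto
      then show ?thesis ..
    qed
  qed
qed

end

text \<open>Each crease \<open>b\<close> in turn becomes the base crease, while the rotation
  \<open>R\<close> and the extreme vertex \<open>e\<close> stay fixed; hence the same assignment
  \<open>\<mu> e\<close> serves for all of them.\<close>

lemma realizable_imp_birds_foot:
  assumes cp: "crease_pattern p r C" and rf: "rigid_folding p r C f" and re: "realizes p r C \<mu> f"
  shows "contains_birds_foot p C \<mu>"
proof -
  have fin: "finite C" and ne: "C \<noteq> {}" using cp by (auto simp: crease_pattern_def)
  then obtain b0 where b0: "b0 \<in> C" by auto
  obtain u0 n0 th0 where F0: "crease_frame p r C u0 n0 th0" by (rule crease_frame_exists[OF cp b0])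
  obtain R where R: "orthogonal_transformation R" "det (matrix R) = 1"
    "\<And>x. x \<in> sphere p r \<Longrightarrow> 0 < R (f x - f p) $ 3"
    using crease_frame.orient_curve[OF F0 rf re] by metis
  let ?q = "\<lambda>c. gnom (R (f c - f p))"
  obtain e' d where e': "e' \<in> ?q ` C" "\<And>w. w \<in> ?q ` C - {e'} \<Longrightarrow> 0 < Re (cnj d * (w - e'))"
    using exists_extreme[of "?q ` C" "{}"] fin ne by auto
  then obtain e where e: "e \<in> C" "e' = ?q e" by auto
  have ext: "0 < Re (cnj d * (?q c - ?q e))" if "c \<in> C" "?q c \<noteq> ?q e" for c
    using e'(2)[of "?q c"] that e by auto
  let ?m = "\<mu> e"
  have succ: "\<exists>c\<in>C. \<mu> c = ?m \<and> 0 < ccw_angle p b c \<and> ccw_angle p b c < pi" if b: "b \<in> C" "\<mu> b = ?m" for b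
  proof -
    obtain u n th where F: "crease_frame p r C u n th" and bu: "b = p + of_real r * u"
      by (rule crease_frame_exists[OF cp b(1)])
    interpret crease_frame p r C u n th by (rule F)
    have "cr 0 = b" by (simp add: cr_def pt_def th0 bu)
    then show ?thesis using frame_result(2)[OF rf re R e(1) ext] b by simp
  qed
  obtain u n th where F: "crease_frame p r C u n th" and eu: "e = p + of_real r * u"
    by (rule crease_frame_exists[OF cp e(1)])
  interpret crease_frame p r C u n th by (rule F)
  have "cr 0 = e" by (simp add: cr_def pt_def th0 eu)
  then have "has_tripod p C \<mu> ?m \<or> has_cross p C \<mu> ?m" using tripod_or_cross[of \<mu> ?m] succ by simp
  moreover have "\<exists>c\<in>C. \<mu> c \<noteq> ?m" by (rule frame_result(1)[OF rf re R e(1) ext])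
  ultimately show ?thesis unfolding contains_birds_foot_def by blast
qed

section \<open>Balanced loads of zero energy\<close>

lemma quadratic_eventually_positive:
  fixes a b c :: real
  assumes "0 < c"
  obtains l0 where "0 \<le> l0" "\<And>l. l0 \<le> l \<Longrightarrow> 0 < a + b * l + c * l\<^sup>2"
proof -
  define l0 where "l0 = 1 + (\<bar>a\<bar> + \<bar>b\<bar>) / c"
  have l0: "1 \<le> l0" using assms by (simp add: l0_def)
  have "0 < a + b * l + c * l\<^sup>2" if l: "l0 \<le> l" for l
  proof -
    have l1: "1 \<le> l" using l l0 by simp
    have "c + (\<bar>a\<bar> + \<bar>b\<bar>) = c * l0" using assms by (simp add: l0_def field_simps)
    also have "\<dots> \<le> c * l" using l assms by simp
    finally have "(c + (\<bar>a\<bar> + \<bar>b\<bar>)) * l \<le> c * l * l" using l1 by (intro mult_right_mono) auto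
    moreover have "\<bar>a\<bar> * 1 \<le> \<bar>a\<bar> * l" using l1 by (intro mult_left_mono) auto
    moreover have "- (\<bar>b\<bar> * l) \<le> b * l" using l1 by (metis abs_ge_minus_self abs_mult abs_of_nonneg minus_le_iff order_trans zero_le_one)
    moreover have "0 < c * l" using assms l1 by simp
    ultimately show ?thesis by (simp add: power2_eq_square algebra_simps abs_le_iff)
  qed
  moreover have "0 \<le> l0" using l0 by simp
  ultimately show ?thesis using that by blast
qed

lemma cis_between:
  assumes "sin (t - s) \<noteq> 0"
  shows "cis w = of_real (sin (t - w) / sin (t - s)) * cis s + of_real (sin (w - s) / sin (t - s)) * cis t"
proof -
  have "of_real (sin (t - s)) * cis w = of_real (sin (t - w)) * cis s + of_real (sin (w - s)) * cis t"
  proof (rule complex_eqI)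
    show "Re (of_real (sin (t - s)) * cis w) = Re (of_real (sin (t - w)) * cis s + of_real (sin (w - s)) * cis t)"
      "Im (of_real (sin (t - s)) * cis w) = Im (of_real (sin (t - w)) * cis s + of_real (sin (w - s)) * cis t)"
      by (simp_all add: sin_diff algebra_simps)
  qed
  then have "cis w = (of_real (sin (t - w)) * cis s + of_real (sin (w - s)) * cis t) / of_real (sin (t - s))"
    using assms by (simp add: eq_divide_eq mult.commute)
  then show ?thesis by (simp add: add_divide_distrib)
qed

context crease_frame
begin

text \<open>The load \<open>\<rho> k\<close> is the infinitesimal folding angle of crease \<open>k\<close>, and \<open>load_height \<rho> k\<close> is the height to
  which it lifts the end of that crease. The cone closes up to first order if the resultant vanishes, and to
  second order if the energy vanishes as well.\<close>

definition load_height :: "(nat \<Rightarrow> real) \<Rightarrow> nat \<Rightarrow> real" where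
  "load_height \<rho> k = (\<Sum>j<k. \<rho> j * sin (th k - th j))"

definition load_energy :: "(nat \<Rightarrow> real) \<Rightarrow> real" where "load_energy \<rho> = (\<Sum>k<n. \<rho> k * load_height \<rho> k)"

definition resultant :: "(nat \<Rightarrow> real) \<Rightarrow> complex" where "resultant \<rho> = (\<Sum>k<n. of_real (\<rho> k) * cis (th k))"

lemma load_height_linear: "load_height (\<lambda>k. x * \<rho> k + y * \<sigma> k) k = x * load_height \<rho> k + y * load_height \<sigma> k"
  by (simp add: load_height_def sum_distrib_left sum.distrib algebra_simps)

lemma resultant_linear: "resultant (\<lambda>k. x * \<rho> k + y * \<sigma> k) = of_real x * resultant \<rho> + of_real y * resultant \<sigma>"
  by (simp add: resultant_def sum_distrib_left sum.distrib algebra_simps)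

lemma load_energy_expand: "load_energy (\<lambda>k. x * \<rho> k + y * \<sigma> k) =
    x\<^sup>2 * load_energy \<rho> + x * y * ((\<Sum>k<n. \<rho> k * load_height \<sigma> k) + (\<Sum>k<n. \<sigma> k * load_height \<rho> k)) + y\<^sup>2 * load_energy \<sigma>"
  unfolding load_energy_def load_height_linear
  by (simp add: sum_distrib_left sum.distrib algebra_simps power2_eq_square)

text \<open>The sum over all creases is a component of the resultant and vanishes, so the height can
  be computed from the creases on the other side as well. For a crease beyond pi this is the side
  with nonnegative sines.\<close>

lemma load_height_balanced: "resultant \<rho> = 0 \<Longrightarrow> k < n \<Longrightarrow> load_height \<rho> k = (\<Sum>j\<in>{k<..<n}. \<rho> j * sin (th j - th k))"
proof -
  assume b: "resultant \<rho> = 0" and k: "k < n"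
  have "Im (cnj (resultant \<rho>) * cis (th k)) = (\<Sum>j<n. \<rho> j * sin (th k - th j))"
    unfolding resultant_def cnj_sum sum_distrib_right Im_sum by (intro sum.cong refl) (simp add: sin_diff algebra_simps)
  then have s: "(\<Sum>j<n. \<rho> j * sin (th k - th j)) = 0" using b by simp
  have "{..<n} = {..<k} \<union> {k} \<union> {k<..<n}" using k by auto
  then have "(\<Sum>j<n. \<rho> j * sin (th k - th j)) =
      load_height \<rho> k + \<rho> k * sin (th k - th k) + (\<Sum>j\<in>{k<..<n}. \<rho> j * sin (th k - th j))"
    unfolding load_height_def using sum.union_disjoint[of "{..<k}" "{k<..<n}" "\<lambda>j. \<rho> j * sin (th k - th j)"] by fastforce
  moreover have "(\<Sum>j\<in>{k<..<n}. \<rho> j * sin (th k - th j)) = - (\<Sum>j\<in>{k<..<n}. \<rho> j * sin (th j - th k))"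
    unfolding sum_negf[symmetric] by (intro sum.cong refl) (simp add: sin_diff algebra_simps)
  ultimately show ?thesis using s by simp
qed

text \<open>A balanced nonnegative load is bent upwards at every crease, so it gives a convex cone.\<close>

lemma load_height_nonneg:
  assumes b: "resultant \<rho> = 0" and pos: "\<And>k. k < n \<Longrightarrow> 0 \<le> \<rho> k" and k: "k < n"
  shows "0 \<le> load_height \<rho> k"
proof (cases "th k \<le> pi")
  case True
  have "0 \<le> \<rho> j * sin (th k - th j)" if "j < k" for j
  proof (intro mult_nonneg_nonneg pos sin_ge_zero)
    show "0 \<le> th k - th j" using th_less[of j k] that k by simp
    show "th k - th j \<le> pi" using True th_ge_0[of j] that k by simp
  qed (use that k in simp)
  then show ?thesis unfolding load_height_def by (intro sum_nonneg) auto
next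
  case False
  have "0 \<le> \<rho> j * sin (th j - th k)" if "k < j" "j < n" for j
  proof (intro mult_nonneg_nonneg pos sin_ge_zero)
    show "0 \<le> th j - th k" using th_less[of k j] that by simp
    show "th j - th k \<le> pi" using False th_less_2pi[of j] that by simp
  qed (use that in simp)
  then show ?thesis unfolding load_height_balanced[OF b k] by (intro sum_nonneg) auto
qed

text \<open>Every term of the energy is nonnegative, and the load on crease 0 alone lifts crease
  \<open>a\<close>, which is less than pi away.\<close>

lemma load_energy_pos:
  assumes b: "resultant \<rho> = 0" and pos: "\<And>k. k < n \<Longrightarrow> 0 \<le> \<rho> k" and a: "0 < a" "a < n" "th a < pi"
    and s: "0 < \<rho> 0" "0 < \<rho> a"
  shows "0 < load_energy \<rho>"
proof -
  have ta: "0 < th a" using th_less[of 0 a] a th0 by simp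
  have "0 < load_height \<rho> a"
  proof -
    have "\<rho> 0 * sin (th a - th 0) \<le> load_height \<rho> a"
      unfolding load_height_def
    proof (rule member_le_sum)
      fix j assume j: "j \<in> {..<a} - {0}"
      show "0 \<le> \<rho> j * sin (th a - th j)"
      proof (intro mult_nonneg_nonneg pos sin_ge_zero)
        show "0 \<le> th a - th j" using th_less[of j a] j a by simp
        show "th a - th j \<le> pi" using a th_ge_0[of j] j by simp
      qed (use j a in simp)
    qed (use a in auto)
    moreover have "0 < \<rho> 0 * sin (th a - th 0)" using s ta a th0 by (simp add: sin_gt_zero)
    ultimately show ?thesis by simp
  qed
  then have "0 < \<rho> a * load_height \<rho> a" using s by simp
  also have "\<dots> \<le> load_energy \<rho>" unfolding load_energy_def
    using a pos load_height_nonneg[OF b pos] by (intro member_le_sum) auto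
  finally show ?thesis .
qed

section \<open>A load with prescribed signs and zero energy\<close>

definition unit_load :: "nat \<Rightarrow> nat \<Rightarrow> real" where "unit_load i k = (if k = i then 1 else 0)"

lemma resultant_unit_load: "i < n \<Longrightarrow> resultant (unit_load i) = cis (th i)"
proof -
  assume i: "i < n"
  have "resultant (unit_load i) = (\<Sum>k\<in>{i}. of_real (unit_load i k) * cis (th k))"
    unfolding resultant_def using i by (intro sum.mono_neutral_right) (auto simp: unit_load_def)
  then show ?thesis by (simp add: unit_load_def)
qed

lemma resultant_add: "resultant (\<lambda>k. \<rho> k + \<sigma> k) = resultant \<rho> + resultant \<sigma>" and resultant_scale: "resultant (\<lambda>k. x * \<rho> k) = of_real x * resultant \<rho>"
  using resultant_linear[of 1 \<rho> 1 \<sigma>] resultant_linear[of x \<rho> 0 \<rho>] by simp_all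

text \<open>Take the last marked crease \<open>i\<close> up to \<open>w\<close>. Its successor lies
  beyond \<open>w\<close>, possibly only after the full turn, and less than pi after
  \<open>i\<close>, so the direction \<open>w\<close> is in the cone of the two.\<close>

lemma spanning_cis:
  assumes m: "Q 0" and succ: "\<And>i. i < n \<Longrightarrow> Q i \<Longrightarrow> \<exists>k<n. Q k \<and> 0 < ccw_angle p (cr i) (cr k) \<and> ccw_angle p (cr i) (cr k) < pi"
    and w: "0 \<le> w" "w < 2 * pi"
  obtains i k x y where "i < n" "k < n" "Q i" "Q k" "0 \<le> x" "0 \<le> y" "cis w = of_real x * cis (th i) + of_real y * cis (th k)"
proof -
  define J where "J = {j. j < n \<and> Q j \<and> th j \<le> w}"
  have J: "finite J" "0 \<in> J" using m w n th0 by (auto simp: J_def)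
  define i where "i = Max J"
  have i: "i < n" "Q i" "th i \<le> w" using Max_in[OF J(1)] J(2) unfolding i_def[symmetric] by (auto simp: J_def)
  obtain k where k: "k < n" "Q k" "0 < ccw_angle p (cr i) (cr k)" "ccw_angle p (cr i) (cr k) < pi"
    using succ[OF i(1,2)] by blast
  obtain t where t: "w < t" "t - th i < pi" "cis t = cis (th k)"
  proof (cases "i < k")
    case True
    have "w < th k"
    proof (rule ccontr)
      assume "\<not> w < th k"
      then have "k \<in> J" using k by (simp add: J_def)
      then show False using Max_ge[OF J(1), of k] True unfolding i_def by linarith
    qed
    then show ?thesis using that[of "th k"] ccw_cr(1)[of i k] True k by simp
  next
    case False
    have "k \<noteq> i" using k ccw_cr(1)[of i i] i by auto
    then have "k < i" using False by simp
    then show ?thesis using that[of "th k + 2 * pi"] ccw_cr(2)[of k i] k i w th_ge_0[of k]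
      by (simp add: cis_mult[symmetric])
  qed
  have s: "0 < sin (t - th i)" using t i by (intro sin_gt_zero) auto
  have "0 \<le> sin (t - w) / sin (t - th i)" "0 \<le> sin (w - th i) / sin (t - th i)"
    using s t i by (auto intro!: divide_nonneg_pos sin_ge_zero)
  moreover have "cis w = of_real (sin (t - w) / sin (t - th i)) * cis (th i) + of_real (sin (w - th i) / sin (t - th i)) * cis (th k)"
    using cis_between[of t "th i" w] s t(3) by simp
  ultimately show ?thesis using that i k by blast
qed

text \<open>The loads \<open>\<rho>T\<close> and \<open>\<rho>D\<close> are balanced, have opposite
  energies and nowhere a wrong sign. A load with the right signs is modified by \<open>m\<close>
  times a convex combination of them, with \<open>m\<close> so large that the quadratic term fixes
  the sign of the energy at both ends; in between it vanishes somewhere.\<close>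

lemma balanced_null_load:
  assumes e: "\<And>k. k < n \<Longrightarrow> e k = 1 \<or> e k = (-1::real)"
    and i: "0 < i" "i < a" "a < n" "th a < pi" "e 0 = 1" "e i = -1" "e a = 1"
    and succ: "\<And>i. i < n \<Longrightarrow> e i = 1 \<Longrightarrow> \<exists>k<n. e k = 1 \<and> 0 < ccw_angle p (cr i) (cr k) \<and> ccw_angle p (cr i) (cr k) < pi"
  obtains \<rho> where "\<And>k. k < n \<Longrightarrow> 0 < e k * \<rho> k" "resultant \<rho> = 0" "load_energy \<rho> = 0"
proof -
  have t: "0 < th i" "th i < th a" "0 < th a" using th_less[of 0 i] th_less[of i a] i th0 by auto
  have sa: "0 < sin (th a)" "0 < sin (th i)" "0 < sin (th a - th i)" using t i by (auto intro!: sin_gt_zero)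
  text \<open>Adding a large multiple of \<open>\<rho>T\<close> or of \<open>\<rho>D\<close> to a load with the right signs makes the energy
    positive or negative.\<close>
  obtain k1 k2 x1 x2 where K: "k1 < n" "k2 < n" "e k1 = 1" "e k2 = 1" "0 \<le> x1" "0 \<le> x2"
    "cis (th a / 2 + pi) = of_real x1 * cis (th k1) + of_real x2 * cis (th k2)"
    by (rule spanning_cis[of "\<lambda>k. e k = 1" "th a / 2 + pi"]) (use i t succ in auto)
  \<comment> \<open>\<open>1 + cis (th a)\<close> has length \<open>c\<close> and direction
    \<open>th a / 2\<close>; the creases \<open>k1\<close> and \<open>k2\<close> supply the opposite
    direction.\<close>
  define c where "c = 2 * cos (th a / 2)"
  have c0: "0 < c" unfolding c_def using t i by (simp add: cos_gt_zero)
  define \<rho>T where "\<rho>T k = unit_load 0 k + unit_load a k + c * (x1 * unit_load k1 k + x2 * unit_load k2 k)" for k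
  have bT: "resultant \<rho>T = 0"
  proof -
    have "resultant \<rho>T = resultant (unit_load 0) + resultant (unit_load a) + of_real c * (of_real x1 * resultant (unit_load k1) + of_real x2 * resultant (unit_load k2))"
      unfolding \<rho>T_def by (simp add: resultant_add resultant_scale)
    also have "\<dots> = 1 + cis (th a) + of_real c * cis (th a / 2 + pi)"
      unfolding K(7) using resultant_unit_load i n K by (simp add: th0)
    also have "\<dots> = 0"
    proof -
      have "cis (th a) = cis (th a / 2) * cis (th a / 2)" by (simp add: cis_mult)
      moreover have "cis (th a / 2 + pi) = - cis (th a / 2)" by (simp add: cis_mult[symmetric])
      moreover have "of_real c = cis (th a / 2) + cis (- (th a / 2))"
        unfolding c_def by (simp add: complex_eq_iff)
      moreover have "cis (th a / 2) * cis (- (th a / 2)) = 1" by (simp add: cis_mult)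
      ultimately show ?thesis by (simp add: algebra_simps)
    qed
    finally show ?thesis .
  qed
  have T: "0 \<le> \<rho>T k" for k using K c0 by (auto simp: \<rho>T_def unit_load_def)
  have Te: "\<rho>T k = 0" if "e k \<noteq> 1" for k
  proof -
    have "k \<noteq> 0" "k \<noteq> a" "k \<noteq> k1" "k \<noteq> k2" using that K(3,4) i by metis+
    then show ?thesis by (simp add: \<rho>T_def unit_load_def)
  qed
  have T0: "0 < \<rho>T 0" "0 < \<rho>T a"
    using K c0 i by (auto simp: \<rho>T_def unit_load_def intro!: add_pos_nonneg mult_nonneg_nonneg)
  have AT: "0 < load_energy \<rho>T" by (rule load_energy_pos[OF bT T _ i(3,4) T0]) (use i in auto)
  \<comment> \<open>The coefficients are those of the linear relation between the directions
    \<open>0\<close>, \<open>th i\<close> and \<open>th a\<close>.\<close>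
  define \<rho>D where "\<rho>D k = sin (th a - th i) * unit_load 0 k + sin (th i) * unit_load a k - sin (th a) * unit_load i k" for k
  have bD: "resultant \<rho>D = 0"
  proof -
    have "resultant \<rho>D = resultant (\<lambda>k. (sin (th a - th i) * unit_load 0 k + sin (th i) * unit_load a k) + (- sin (th a)) * unit_load i k)"
      unfolding \<rho>D_def by (simp add: algebra_simps)
    also have "\<dots> = of_real (sin (th a - th i)) + of_real (sin (th i)) * cis (th a) - of_real (sin (th a)) * cis (th i)"
      unfolding resultant_add resultant_scale using resultant_unit_load i n by (simp add: th0)
    also have "\<dots> = 0" by (simp add: complex_eq_iff sin_diff algebra_simps)
    finally show ?thesis .
  qed
  have D: "0 \<le> e k * \<rho>D k" if "k < n" for k
    using sa i by (auto simp: \<rho>D_def unit_load_def)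
  have AD: "load_energy \<rho>D < 0"
  proof -
    have h: "load_height \<rho>D k = sin (th a - th i) * (if 0 < k then sin (th k) else 0) + sin (th i) * (if a < k then sin (th k - th a) else 0)
        - sin (th a) * (if i < k then sin (th k - th i) else 0)" for k
    proof -
      have dlh: "load_height (unit_load j) k = (if j < k then sin (th k - th j) else 0)" for j
      proof -
        have "load_height (unit_load j) k = (\<Sum>i\<in>{i. i < k \<and> i = j}. unit_load j i * sin (th k - th i))"
          unfolding load_height_def by (intro sum.mono_neutral_right) (auto simp: unit_load_def)
        also have "\<dots> = (if j < k then sin (th k - th j) else 0)"
        proof (cases "j < k")
          case True
          then have "{i. i < k \<and> i = j} = {j}" by auto
          then show ?thesis using True by (simp add: unit_load_def)
        next
          case False
          then have "{i. i < k \<and> i = j} = {}" by auto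
          then show ?thesis using False by (simp only: sum.empty if_False)
        qed
        finally show ?thesis .
      qed
      have "load_height \<rho>D k = load_height (\<lambda>k. 1 * (sin (th a - th i) * unit_load 0 k + sin (th i) * unit_load a k) + (- sin (th a)) * unit_load i k) k"
        unfolding \<rho>D_def by (simp add: algebra_simps)
      then show ?thesis unfolding load_height_linear dlh by (simp add: th0)
    qed
    have "load_energy \<rho>D = (\<Sum>k\<in>{0, i, a}. \<rho>D k * load_height \<rho>D k)"
      unfolding load_energy_def using i by (intro sum.mono_neutral_right) (auto simp: \<rho>D_def unit_load_def)
    also have "\<dots> = - sin (th a) * (sin (th a - th i) * sin (th i))"
      using i by (simp add: h \<rho>D_def unit_load_def)
    also have "\<dots> < 0" using sa by (simp add: mult_pos_pos)
    finally show ?thesis .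
  qed
  \<comment> \<open>\<open>x\<close> and \<open>y\<close> balance the unit loads on all other
    creases by loads on creases 0 and \<open>a\<close>, whose directions span the plane. Their signs
    may be wrong; adding \<open>l\<close> times \<open>\<rho>T\<close> repairs this.\<close>
  define S where "S = resultant (\<lambda>k. if k = 0 \<or> k = a then 0 else e k)"
  define y where "y = - Im S / sin (th a)"
  define x where "x = - Re S - y * cos (th a)"
  define \<rho>0 where "\<rho>0 k = (if k = 0 \<or> k = a then 0 else e k) + (x * unit_load 0 k + y * unit_load a k)" for k
  have b0: "resultant \<rho>0 = 0"
  proof -
    have "resultant \<rho>0 = S + (of_real x * resultant (unit_load 0) + of_real y * resultant (unit_load a))"
      unfolding \<rho>0_def S_def resultant_add resultant_scale ..
    also have "\<dots> = S + (of_real x + of_real y * cis (th a))" using resultant_unit_load i n by (simp add: th0)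
    also have "\<dots> = 0" using sa unfolding x_def y_def by (simp add: complex_eq_iff)
    finally show ?thesis .
  qed
  define l where "l = (\<bar>x\<bar> + 1) / \<rho>T 0 + (\<bar>y\<bar> + 1) / \<rho>T a"
  have l: "\<bar>x\<bar> + 1 \<le> l * \<rho>T 0" "\<bar>y\<bar> + 1 \<le> l * \<rho>T a" "0 \<le> l"
  proof -
    have q: "0 \<le> (\<bar>x\<bar> + 1) / \<rho>T 0" "0 \<le> (\<bar>y\<bar> + 1) / \<rho>T a" using T0 by simp_all
    show "0 \<le> l" using q by (simp add: l_def)
    have "(\<bar>x\<bar> + 1) / \<rho>T 0 \<le> l" "(\<bar>y\<bar> + 1) / \<rho>T a \<le> l" using q by (simp_all add: l_def)
    then have "(\<bar>x\<bar> + 1) / \<rho>T 0 * \<rho>T 0 \<le> l * \<rho>T 0" "(\<bar>y\<bar> + 1) / \<rho>T a * \<rho>T a \<le> l * \<rho>T a"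
      using T0 by (metis less_imp_le mult_right_mono)+
    then show "\<bar>x\<bar> + 1 \<le> l * \<rho>T 0" "\<bar>y\<bar> + 1 \<le> l * \<rho>T a" using T0 by simp_all
  qed
  define \<rho>1 where "\<rho>1 k = 1 * \<rho>0 k + l * \<rho>T k" for k
  have b1: "resultant \<rho>1 = 0" unfolding \<rho>1_def resultant_linear b0 bT by simp
  have p1: "0 < e k * \<rho>1 k" if k: "k < n" for k
  proof -
    consider "k = 0" | "k = a" | "k \<noteq> 0" "k \<noteq> a" "e k = 1" | "k \<noteq> 0" "k \<noteq> a" "e k = -1" using e[OF k] by auto
    then show ?thesis
    proof cases
      case 1
      then have "\<rho>1 k = x + l * \<rho>T 0" using i by (simp add: \<rho>1_def \<rho>0_def unit_load_def)
      then show ?thesis using l 1 i by simp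
    next
      case 2
      then have "\<rho>1 k = y + l * \<rho>T a" using i by (simp add: \<rho>1_def \<rho>0_def unit_load_def)
      then show ?thesis using l 2 i by simp
    next
      case 3
      then show ?thesis using T[of k] l by (simp add: \<rho>1_def \<rho>0_def unit_load_def add_pos_nonneg)
    next
      case 4
      then show ?thesis using Te[of k] by (simp add: \<rho>1_def \<rho>0_def unit_load_def)
    qed
  qed
  obtain l1 where l1: "0 \<le> l1" "\<And>l. l1 \<le> l \<Longrightarrow> 0 < load_energy \<rho>1 + ((\<Sum>k<n. \<rho>1 k * load_height \<rho>T k) + (\<Sum>k<n. \<rho>T k * load_height \<rho>1 k)) * l + load_energy \<rho>T * l\<^sup>2"
    using quadratic_eventually_positive[OF AT] by metis
  have nAD: "0 < - load_energy \<rho>D" using AD by simp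
  obtain l2 where l2: "0 \<le> l2" "\<And>l. l2 \<le> l \<Longrightarrow> 0 < - load_energy \<rho>1 + (- ((\<Sum>k<n. \<rho>1 k * load_height \<rho>D k) + (\<Sum>k<n. \<rho>D k * load_height \<rho>1 k))) * l + (- load_energy \<rho>D) * l\<^sup>2"
    using quadratic_eventually_positive[OF nAD] by metis
  define m where "m = max l1 l2"
  define \<rho> where "\<rho> s k = 1 * \<rho>1 k + m * ((1 - s) * \<rho>T k + s * \<rho>D k)" for s k
  have m0: "0 \<le> m" using l1 by (simp add: m_def)
  have cont: "continuous_on {0..1} (\<lambda>s. load_energy (\<rho> s))"
    unfolding load_energy_def load_height_def \<rho>_def by (intro continuous_intros)
  have r0: "\<rho> 0 = (\<lambda>k. 1 * \<rho>1 k + m * \<rho>T k)" "\<rho> 1 = (\<lambda>k. 1 * \<rho>1 k + m * \<rho>D k)" by (auto simp: \<rho>_def)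
  have "0 \<le> load_energy (\<rho> 0)" unfolding r0 load_energy_expand using l1(2)[of m] by (simp add: m_def algebra_simps)
  moreover have "load_energy (\<rho> 1) \<le> 0" unfolding r0 load_energy_expand using l2(2)[of m] by (simp add: m_def algebra_simps)
  ultimately obtain s where s: "0 \<le> s" "s \<le> 1" "load_energy (\<rho> s) = 0"
    using IVT2'[of "\<lambda>s. load_energy (\<rho> s)" 1 0 0] cont by auto
  have "0 < e k * \<rho> s k" if k: "k < n" for k
  proof -
    have "0 \<le> e k * \<rho>T k" using T[of k] Te[of k] e[OF k] by auto
    then have "0 \<le> m * ((1 - s) * (e k * \<rho>T k) + s * (e k * \<rho>D k))"
    proof -
      have "0 \<le> m * ((1 - s) * X + s * Y)" if "0 \<le> X" "0 \<le> Y" for X Y using m0 s that by simp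
      from this[OF \<open>0 \<le> e k * \<rho>T k\<close> D[OF k]] show ?thesis .
    qed
    moreover have "e k * \<rho> s k = e k * \<rho>1 k + m * ((1 - s) * (e k * \<rho>T k) + s * (e k * \<rho>D k))"
      by (simp add: \<rho>_def algebra_simps)
    ultimately show ?thesis using p1[OF k] by simp
  qed
  moreover have "resultant (\<rho> s) = 0" unfolding \<rho>_def resultant_linear b1 bT bD by simp
  ultimately show ?thesis using that[of "\<rho> s"] s(3) by blast
qed

end

section \<open>The load supplied by a bird's foot\<close>

lemma ccw_open_segment:
  assumes "p \<in> open_segment c d" shows "ccw_angle p c d = pi"
proof -
  obtain t where t: "0 < t" "t < 1" "p = (1 - t) *\<^sub>R c + t *\<^sub>R d" and cd: "c \<noteq> d"
    using assms by (auto simp: in_segment)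
  have cp: "c - p = of_real t * (c - d)" "d - p = - of_real (1 - t) * (c - d)"
    unfolding t(3) by (simp_all add: scaleR_conv_of_real algebra_simps)
  have "(d - p) / (c - p) = of_real ((1 - t) / t) * exp (\<i> * of_real pi)"
    unfolding cp using t cd by (simp add: field_simps)
  then show ?thesis unfolding ccw_angle_def using t by (intro Arg2pi_unique[of "(1 - t) / t"]) auto
qed

text \<open>Otherwise, with \<open>b\<close> as base crease, all creases of assignment
  \<open>m\<close> would lie at angle 0 or between pi and 2 pi. Such a half-plane with only one of
  its boundary rays at pi or 0 left uncovered beyond 2 pi contains neither a tripod nor a
  cross.\<close>

lemma tripod_or_cross_covers:
  assumes cp: "crease_pattern p r C" and tc: "has_tripod p C \<mu> m \<or> has_cross p C \<mu> m" and b: "b \<in> C"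
  shows "\<exists>c\<in>C. \<mu> c = m \<and> 0 < ccw_angle p b c \<and> ccw_angle p b c < pi"
proof (rule ccontr)
  assume neg: "\<not> ?thesis"
  obtain u n th where F: "crease_frame p r C u n th" and bu: "b = p + of_real r * u"
    using crease_frame_exists[OF cp b] by blast
  interpret crease_frame p r C u n th by (rule F)
  have n0: "0 < n" using n by simp
  have b0: "b = cr 0" by (simp add: bu cr_def pt_def th0)
  have far: "th k = 0 \<or> pi \<le> th k" if k: "k < n" "\<mu> (cr k) = m" for k
  proof (rule ccontr)
    assume "\<not> ?thesis"
    then have "0 < th k" "th k < pi" using th_ge_0[of k] k by auto
    then show False using neg k ccw_cr(1)[of 0 k] th0 cr_in_C[of k] unfolding b0 by auto
  qed
  have ccw: "ccw_angle p (cr i) (cr j) = (if i \<le> j then th j - th i else th j - th i + 2 * pi)" if "i < n" "j < n" for i j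
    using ccw_cr[of i j] ccw_cr(2)[of j i] that by auto
  have lt: "th i < 2 * pi" "0 \<le> th i" if "i < n" for i using th_less_2pi[of i] th_ge_0[of i] that by auto
  show False
    using tc
  proof
    assume "has_tripod p C \<mu> m"
    then obtain i j k where h: "i < n" "j < n" "k < n" "\<mu> (cr i) = m" "\<mu> (cr j) = m" "\<mu> (cr k) = m"
      "0 < ccw_angle p (cr i) (cr j)" "ccw_angle p (cr i) (cr j) < pi"
      "0 < ccw_angle p (cr j) (cr k)" "ccw_angle p (cr j) (cr k) < pi"
      "0 < ccw_angle p (cr k) (cr i)" "ccw_angle p (cr k) (cr i) < pi"
      unfolding has_tripod_def C_eq by auto
    note f = far[OF h(1,4)] far[OF h(2,5)] far[OF h(3,6)]
    note l = lt[OF h(1)] lt[OF h(2)] lt[OF h(3)]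
    show False
      using h(7-12) f l unfolding ccw[OF h(1,2)] ccw[OF h(2,3)] ccw[OF h(3,1)]
      by (cases "i \<le> j"; cases "j \<le> k"; cases "k \<le> i"; simp; linarith)
  next
    assume "has_cross p C \<mu> m"
    then obtain i j k l where h: "i < n" "j < n" "k < n" "l < n" "\<mu> (cr i) = m" "\<mu> (cr j) = m" "\<mu> (cr k) = m" "\<mu> (cr l) = m"
      "0 < ccw_angle p (cr i) (cr j)" "ccw_angle p (cr i) (cr j) < ccw_angle p (cr i) (cr k)"
      "p \<in> open_segment (cr i) (cr k)" "p \<in> open_segment (cr j) (cr l)"
      unfolding has_cross_def C_eq by auto
    note f = far[OF h(1,5)] far[OF h(2,6)] far[OF h(3,7)] far[OF h(4,8)]
    note lh = lt[OF h(1)] lt[OF h(2)] lt[OF h(3)] lt[OF h(4)]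
    show False
      using h(9,10) ccw_open_segment[OF h(11)] ccw_open_segment[OF h(12)] f lh
      unfolding ccw[OF h(1,2)] ccw[OF h(1,3)] ccw[OF h(2,4)]
      by (cases "i \<le> j"; cases "i \<le> k"; cases "j \<le> l"; simp; linarith)
  qed
qed

text \<open>Among the creases of assignment \<open>m\<close>, the base \<open>b\<close> is the last
  one before the opposite crease \<open>d\<close>. Any such crease \<open>a\<close> less than pi
  after \<open>b\<close> then comes after \<open>d\<close>, so \<open>d\<close> lies between two
  \<open>m\<close>-creases less than pi apart, as \<open>balanced_null_load\<close>
  requires.\<close>

lemma birds_foot_load:
  assumes cp: "crease_pattern p r C" and bf: "contains_birds_foot p C \<mu>"
  obtains u n th \<rho> where "crease_frame p r C u n th" "\<And>k. k < n \<Longrightarrow> th (Suc k) - th k < pi"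
    "\<And>k. k < n \<Longrightarrow> 0 < sg \<mu> (crease_frame.cr p r u th k) * \<rho> k"
    "crease_frame.resultant n th \<rho> = 0" "crease_frame.load_energy n th \<rho> = 0"
proof -
  obtain m d where tc: "has_tripod p C \<mu> m \<or> has_cross p C \<mu> m" and d: "d \<in> C" "\<mu> d \<noteq> m"
    using bf unfolding contains_birds_foot_def by blast
  note cover = tripod_or_cross_covers[OF cp tc]
  define T where "T = {c \<in> C. \<mu> c = m}"
  have T: "finite T" "T \<noteq> {}" using cover[OF d(1)] cp by (auto simp: T_def crease_pattern_def)
  obtain b where bT: "b \<in> T" and min: "\<And>c. c \<in> T \<Longrightarrow> ccw_angle p b d \<le> ccw_angle p c d"
    using ex_min_if_finite[of "(\<lambda>c. ccw_angle p c d) ` T"] T by (force simp: not_less)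
  have b: "b \<in> C" "\<mu> b = m" using bT by (auto simp: T_def)
  obtain u n th where F: "crease_frame p r C u n th" and bu: "b = p + of_real r * u"
    using crease_frame_exists[OF cp b(1)] by blast
  interpret crease_frame p r C u n th by (rule F)
  have n0: "0 < n" using n by simp
  have b0: "b = cr 0" by (simp add: bu cr_def pt_def th0)
  obtain i where i: "i < n" "d = cr i" using d(1) C_eq by auto
  have i0: "0 < i" using i d b b0 by (cases i) auto
  obtain a where a: "a < n" "\<mu> (cr a) = m" "0 < ccw_angle p b (cr a)" "ccw_angle p b (cr a) < pi"
    using cover[OF b(1)] C_eq by auto
  have ta: "0 < th a" "th a < pi" using a(3,4) ccw_cr(1)[of 0 a] a(1) th0 unfolding b0 by auto
  have ia: "i < a"
  proof (rule ccontr)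
    assume "\<not> i < a"
    then have ai: "a \<le> i" by simp
    have "cr a \<in> T" using a cr_in_C by (auto simp: T_def C_eq)
    from min[OF this] show False
      using ccw_cr(1)[OF ai i(1)] ccw_cr(1)[of 0 i] i ta th0 unfolding b0 i(2) by simp
  qed
  define e :: "nat \<Rightarrow> real" where "e k = (if \<mu> (cr k) = m then 1 else -1)" for k
  have succ: "\<exists>k<n. e k = 1 \<and> 0 < ccw_angle p (cr j) (cr k) \<and> ccw_angle p (cr j) (cr k) < pi" if j: "j < n" for j
    using cover[of "cr j"] j unfolding C_eq e_def by fastforce
  obtain \<rho> where \<rho>: "\<And>k. k < n \<Longrightarrow> 0 < e k * \<rho> k" "resultant \<rho> = 0" "load_energy \<rho> = 0"
  proof (rule balanced_null_load[of e i a])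
    show "e k = 1 \<or> e k = -1" for k by (simp add: e_def)
    show "e 0 = 1" "e i = -1" "e a = 1" using b b0 d i a by (auto simp: e_def)
  qed (use i0 ia a(1) ta succ in blast)+
  \<comment> \<open>Signs so far are relative to \<open>m\<close>. For \<open>m = Mountain\<close>
    the load is negated, which keeps the resultant and the energy zero.\<close>
  define \<sigma> :: real where "\<sigma> = (if m = Valley then 1 else -1)"
  have sg: "sg \<mu> (cr k) = \<sigma> * e k" for k
    by (cases "\<mu> (cr k)"; cases m) (auto simp: sg_def \<sigma>_def e_def)
  have ss: "\<sigma> * \<sigma> = 1" by (simp add: \<sigma>_def)
  have gap: "th (Suc k) - th k < pi" if k: "k < n" for k
  proof -
    obtain j where j: "j < n" "0 < ccw_angle p (cr k) (cr j)" "ccw_angle p (cr k) (cr j) < pi" using succ[OF k] by blast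
    have "j \<noteq> k" using j ccw_cr(1)[of k k] k by auto
    then have "cr j \<in> C - {cr k}" using j k cr_inj C_eq by auto
    then have "ccw_angle p (cr k) (cr (Suc k)) \<le> ccw_angle p (cr k) (cr j)"
      using consecutive_cr[OF k] unfolding consecutive_def by blast
    then show ?thesis using j ccw_cr_Suc[OF k] by simp
  qed
  show ?thesis
  proof (rule that[OF F gap])
    show "0 < sg \<mu> (cr k) * (\<sigma> * \<rho> k)" if k: "k < n" for k
    proof -
      have "sg \<mu> (cr k) * (\<sigma> * \<rho> k) = (\<sigma> * \<sigma>) * (e k * \<rho> k)" unfolding sg by (simp only: mult_ac)
      then show ?thesis using \<rho>(1)[OF k] unfolding ss by (simp only: mult_1)
    qed
    show "resultant (\<lambda>k. \<sigma> * \<rho> k) = 0" using \<rho>(2) by (simp add: resultant_scale)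
    show "load_energy (\<lambda>k. \<sigma> * \<rho> k) = 0" using load_energy_expand[of \<sigma> \<rho> 0 \<rho>] \<rho>(3) by simp
  qed
qed

section \<open>Heights of the folded crease ends\<close>

text \<open>The longitude difference of two points of the unit sphere at heights \<open>z\<close> and \<open>w\<close> and at
  spherical distance \<open>a\<close>.\<close>

definition lat :: "real \<Rightarrow> real" where "lat z = sqrt (1 - z\<^sup>2)"
definition coslon :: "real \<Rightarrow> real \<Rightarrow> real \<Rightarrow> real" where
  "coslon a z w = (cos a - z * w) / (lat z * lat w)"
definition lon :: "real \<Rightarrow> real \<Rightarrow> real \<Rightarrow> real" where "lon a z w = arccos (coslon a z w)"

lemma lat_pos: "\<bar>x\<bar> < 1 \<Longrightarrow> 0 < lat x"
  by (simp add: lat_def abs_square_less_1)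

lemma lat_sq: "\<bar>x\<bar> < 1 \<Longrightarrow> (lat x)\<^sup>2 = 1 - x\<^sup>2"
  by (simp add: lat_def abs_square_le_1)

lemma coslon_commute: "coslon a z w = coslon a w z"
  by (simp add: coslon_def mult.commute)

lemma cos_lon:
  assumes "\<bar>z\<bar> < 1" "\<bar>w\<bar> < 1" "\<bar>coslon a z w\<bar> < 1"
  shows "0 < lon a z w" "lon a z w < pi" "lat z * lat w * cos (lon a z w) + z * w = cos a" "0 < sin (lon a z w)"
proof -
  have c: "- 1 < coslon a z w" "coslon a z w < 1" using assms(3) by auto
  show b: "0 < lon a z w" "lon a z w < pi" using arccos_lt_bounded[OF c] by (auto simp: lon_def)
  then show "0 < sin (lon a z w)" by (simp add: sin_gt_zero)
  have "cos (lon a z w) = coslon a z w" unfolding lon_def using c by (intro cos_arccos) auto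
  then show "lat z * lat w * cos (lon a z w) + z * w = cos a"
    using lat_pos[OF assms(1)] lat_pos[OF assms(2)] by (simp add: coslon_def)
qed

lemma lon_0: "0 < a \<Longrightarrow> a < pi \<Longrightarrow> lon a 0 0 = a"
  by (simp add: lon_def coslon_def lat_def arccos_cos)

lemma has_derivative_lon:
  assumes z: "\<bar>z\<bar> < 1" "\<bar>w\<bar> < 1" "\<bar>coslon a z w\<bar> < 1"
  shows "((\<lambda>w. lon a z w) has_real_derivative
    (z * lat w / lat z - w * cos (lon a z w)) / ((lat w)\<^sup>2 * sin (lon a z w))) (at w)"
proof -
  note p = lat_pos[OF z(1)] lat_pos[OF z(2)]
  have c: "- 1 < coslon a z w" "coslon a z w < 1" using z by auto
  have w1: "0 < 1 - w\<^sup>2" using z by (simp add: abs_square_less_1)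
  have dl: "(lat has_real_derivative - w / lat w) (at w)"
    unfolding lat_def using w1 by (auto intro!: derivative_eq_intros simp: field_simps)
  have dc: "((\<lambda>w. coslon a z w) has_real_derivative
      ((- z) * (lat z * lat w) - (cos a - z * w) * (lat z * (- w / lat w))) / (lat z * lat w * (lat z * lat w))) (at w)"
    unfolding coslon_def by (rule derivative_eq_intros refl dl | use p in simp)+
  have "((\<lambda>w. lon a z w) has_real_derivative
    inverse (- sqrt (1 - (coslon a z w)\<^sup>2)) * (((- z) * (lat z * lat w) - (cos a - z * w) * (lat z * (- w / lat w))) / (lat z * lat w * (lat z * lat w)))) (at w)"
    unfolding lon_def by (rule DERIV_chain2[OF DERIV_arccos[OF c] dc])
  moreover have "sqrt (1 - (coslon a z w)\<^sup>2) = sin (lon a z w)"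
    unfolding lon_def using c by (simp add: sin_arccos)
  moreover have "cos a - z * w = lat z * lat w * cos (lon a z w)" using cos_lon(3)[OF z] by simp
  moreover have "inverse (- S) * (((- z) * (A * B) - (A * B * K) * (A * (- w / B))) / (A * B * (A * B))) =
      (z * B / A - w * K) / (B\<^sup>2 * S)" if "0 < A" "0 < B" "0 < S" for A B S K
    using that by (simp add: field_simps power2_eq_square)
  ultimately show ?thesis using p cos_lon(4)[OF z] by simp
qed

text \<open>The longitude of an edge with heights \<open>t * P\<close> and \<open>t * Q\<close> as a
  function of \<open>y = t^2\<close>. In this variable the second-order expansion at the flat state
  is a first derivative.\<close>

lemma has_derivative_lon_scaled:
  assumes a: "0 < a" "a < pi"
  shows "((\<lambda>y. arccos ((cos a - y * (P * Q)) / (sqrt (1 - y * P\<^sup>2) * sqrt (1 - y * Q\<^sup>2)))) has_real_derivative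
     - ((P\<^sup>2 + Q\<^sup>2) * cos a - 2 * P * Q) / (2 * sin a)) (at 0)"
proof -
  have s: "0 < sin a" using a by (simp add: sin_gt_zero)
  have c: "- 1 < cos a" "cos a < 1"
    using a cos_monotone_0_pi[of 0 a] cos_monotone_0_pi[of a pi] by auto
  let ?q = "\<lambda>y. (cos a - y * (P * Q)) / (sqrt (1 - y * P\<^sup>2) * sqrt (1 - y * Q\<^sup>2))"
  have d: "(?q has_real_derivative (cos a * (P\<^sup>2 + Q\<^sup>2) / 2 - P * Q)) (at 0)"
    by (rule derivative_eq_intros refl | simp)+ (simp add: field_simps)
  have "(arccos has_real_derivative inverse (- sqrt (1 - (?q 0)\<^sup>2))) (at (?q 0))"
    using c by (intro DERIV_arccos) auto
  from DERIV_chain2[OF this d]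
  have "((\<lambda>y. arccos (?q y)) has_real_derivative inverse (- sqrt (1 - (cos a)\<^sup>2)) * (cos a * (P\<^sup>2 + Q\<^sup>2) / 2 - P * Q)) (at 0)"
    by simp
  moreover have "sqrt (1 - (cos a)\<^sup>2) = sin a" using s by (simp add: sin_squared_eq[symmetric])
  moreover have "inverse (- sin a) * (cos a * (P\<^sup>2 + Q\<^sup>2) / 2 - P * Q) = - ((P\<^sup>2 + Q\<^sup>2) * cos a - 2 * P * Q) / (2 * sin a)"
    using s by (simp add: field_simps)
  ultimately show ?thesis by simp
qed

context crease_frame
begin

definition a :: "nat \<Rightarrow> real" where "a k = th (Suc k) - th k"

end

section \<open>Infinitesimal heights and their energy\<close>

locale null_load = crease_frame +
  fixes \<rho> :: "nat \<Rightarrow> real"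
  assumes gap: "\<And>k. k < n \<Longrightarrow> th (Suc k) - th k < pi"
    and nz: "\<And>k. k < n \<Longrightarrow> \<rho> k \<noteq> 0"
    and bal0: "resultant \<rho> = 0" and AA0: "load_energy \<rho> = 0"
begin

definition h :: "nat \<Rightarrow> real" where "h = load_height \<rho>"
text \<open>The slope with which the height arrives at crease \<open>k\<close>. To first order a
  great circle has a height with \<open>h'' = - h\<close>, and the load of a crease is the jump of
  the slope there.\<close>

definition h' :: "nat \<Rightarrow> real" where "h' k = (\<Sum>j<k. \<rho> j * cos (th k - th j))"

lemma a_bounds: "k < n \<Longrightarrow> 0 < a k \<and> a k < pi \<and> 0 < sin (a k)"
  using gap[of k] th_Suc[of k] by (auto simp: a_def intro!: sin_gt_zero)

lemma h_Suc: "h (Suc k) = cos (a k) * h k + sin (a k) * (h' k + \<rho> k)"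
proof -
  have "h (Suc k) = (\<Sum>j<k. \<rho> j * sin ((th k - th j) + a k)) + \<rho> k * sin (a k)"
    by (simp add: h_def load_height_def a_def)
  also have "(\<Sum>j<k. \<rho> j * sin ((th k - th j) + a k)) = cos (a k) * h k + sin (a k) * h' k"
    unfolding h_def load_height_def h'_def sum_distrib_left sum.distrib[symmetric]
    by (intro sum.cong refl) (simp only: sin_add, simp add: algebra_simps)
  finally show ?thesis by (simp add: algebra_simps)
qed

lemma h'_Suc: "h' (Suc k) = cos (a k) * (h' k + \<rho> k) - sin (a k) * h k"
proof -
  have "h' (Suc k) = (\<Sum>j<k. \<rho> j * cos ((th k - th j) + a k)) + \<rho> k * cos (a k)"
    by (simp add: h'_def a_def)
  also have "(\<Sum>j<k. \<rho> j * cos ((th k - th j) + a k)) = cos (a k) * h' k - sin (a k) * h k"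
    unfolding h_def load_height_def h'_def sum_distrib_left sum_subtractf[symmetric]
    by (intro sum.cong refl) (simp only: cos_add, simp add: algebra_simps)
  finally show ?thesis by (simp add: algebra_simps)
qed

lemma h_back: "h k = cos (a k) * h (Suc k) - sin (a k) * h' (Suc k)"
proof -
  have "(sin (a k))\<^sup>2 + (cos (a k))\<^sup>2 = 1" by simp
  then show ?thesis unfolding h_Suc h'_Suc by algebra
qed

lemma h_ends: "h 0 = 0" "h n = 0" "h' n = 0"
proof -
  show "h 0 = 0" by (simp add: h_def load_height_def)
  have "Im (resultant \<rho>) = 0" "Re (resultant \<rho>) = 0" using bal0 by simp_all
  then have b: "(\<Sum>j<n. \<rho> j * sin (th j)) = 0" "(\<Sum>j<n. \<rho> j * cos (th j)) = 0"
    by (simp_all add: resultant_def)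
  have "h n = - (\<Sum>j<n. \<rho> j * sin (th j))"
    unfolding h_def load_height_def thn sum_negf[symmetric] by (intro sum.cong refl) (simp add: sin_diff)
  then show "h n = 0" using b by simp
  have "h' n = (\<Sum>j<n. \<rho> j * cos (th j))"
    unfolding h'_def thn by (intro sum.cong refl) (simp add: cos_diff)
  then show "h' n = 0" using b by simp
qed

text \<open>The left-hand side is the determinant of three consecutive vertices to first order in the heights.\<close>

lemma h_kink:
  assumes "0 < j" "j \<le> n"
  shows "h (j - 1) * sin (a (nx j)) - h j * sin (a (j - 1) + a (nx j)) + h (Suc (nx j)) * sin (a (j - 1)) =
     \<rho> (nx j) * sin (a (j - 1)) * sin (a (nx j))"
proof -
  have e: "h j = h (nx j)" "h' j - h' (nx j) = 0" using h_ends by (auto simp: nx_def h'_def)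
  have b: "h (j - 1) = cos (a (j - 1)) * h j - sin (a (j - 1)) * h' j" using h_back[of "j - 1"] assms by simp
  have "h' j = h' (nx j)" using e by simp
  then show ?thesis unfolding b h_Suc[of "nx j"] sin_add e(1)
    by (simp add: algebra_simps)
qed

text \<open>Minus twice the \<open>t^2\<close> coefficient of the longitude of edge \<open>k\<close>
  at heights \<open>t * H\<close>.\<close>

definition edge_energy :: "(nat \<Rightarrow> real) \<Rightarrow> nat \<Rightarrow> real" where
  "edge_energy H k = (((H k)\<^sup>2 + (H (Suc k))\<^sup>2) * cos (a k) - 2 * H k * H (Suc k)) / sin (a k)"

text \<open>Summation by parts: each edge contributes a telescoping difference of
  \<open>h k * h' k\<close> minus the term \<open>h k * \<rho> k\<close> of the load energy.\<close>

lemma energy_h: "(\<Sum>k<n. edge_energy h k) = 0"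
proof -
  have "edge_energy h k = (h (Suc k) * h' (Suc k) - h k * h' k) - h k * \<rho> k" if "k < n" for k
  proof -
    let ?s = "sin (a k)" and ?c = "cos (a k)"
    have s: "?s \<noteq> 0" using a_bounds[OF that] by auto
    have "((h k)\<^sup>2 + (h (Suc k))\<^sup>2) * ?c - 2 * h k * h (Suc k) = ?s * (h (Suc k) * h' (Suc k) - h k * h' k - h k * \<rho> k)"
      using h_back[of k] h_Suc[of k] by algebra
    then show ?thesis using s by (simp add: edge_energy_def)
  qed
  then have "(\<Sum>k<n. edge_energy h k) = (\<Sum>k<n. (h (Suc k) * h' (Suc k) - h k * h' k)) - (\<Sum>k<n. h k * \<rho> k)"
    by (simp add: sum_subtractf)
  also have "\<dots> = 0"
    using AA0 h_ends sum_lessThan_telescope[of "\<lambda>k. h k * h' k" n] by (simp add: load_energy_def h_def mult.commute)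
  finally show ?thesis .
qed

text \<open>\<open>s\<close> is the adjustment of the one height that is left free, before scaling
  by \<open>t\<close>.\<close>

definition H :: "real \<Rightarrow> nat \<Rightarrow> real" where "H s k = h k + (if k = 1 then s else 0)"

text \<open>Only the two edges at vertex 1 change. The constant term is zero by
  \<open>energy_h\<close>, and the linear coefficient \<open>- 2 * \<rho> 1\<close> is not, so the
  energy changes sign at \<open>s = 0\<close>.\<close>

lemma energy_H:
  "(\<Sum>k<n. edge_energy (H s) k) = s * (s * (cos (a 0) / sin (a 0) + cos (a 1) / sin (a 1)) - 2 * \<rho> 1)"
proof -
  have s: "sin (a 0) \<noteq> 0" "sin (a 1) \<noteq> 0" using a_bounds[of 0] a_bounds[of 1] n by auto
  have "(\<Sum>k<n. edge_energy (H s) k) = (\<Sum>k<n. edge_energy (H s) k - edge_energy h k)" using energy_h by (simp add: sum_subtractf)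
  also have "\<dots> = (\<Sum>k\<in>{0, 1}. edge_energy (H s) k - edge_energy h k)"
    using n by (intro sum.mono_neutral_right) (auto simp: edge_energy_def H_def)
  also have "\<dots> = (s * (2 * h 1 + s) * cos (a 0) - 2 * h 0 * s) / sin (a 0) + (s * (2 * h 1 + s) * cos (a 1) - 2 * s * h 2) / sin (a 1)"
    using h_ends by (simp add: edge_energy_def H_def power2_eq_square diff_divide_distrib[symmetric] algebra_simps numeral_2_eq_2)
  also have "\<dots> = s * (s * (cos (a 0) / sin (a 0) + cos (a 1) / sin (a 1)) - 2 * \<rho> 1)"
  proof -
    have e: "h 0 = cos (a 0) * h 1 - sin (a 0) * h' 1" "h 2 = cos (a 1) * h 1 + sin (a 1) * (h' 1 + \<rho> 1)"
      using h_back[of 0] h_Suc[of 1] by (simp_all add: numeral_2_eq_2)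
    show ?thesis unfolding e using s by (simp add: field_simps)
  qed
  finally show ?thesis .
qed

section \<open>The exact closing condition near the flat state\<close>

definition Z :: "real \<times> real \<Rightarrow> nat \<Rightarrow> real" where "Z w k = fst w * H (snd w) k"
definition cc :: "real \<times> real \<Rightarrow> nat \<Rightarrow> real" where "cc w k = coslon (a k) (Z w k) (Z w (Suc k))"
definition dlon :: "real \<times> real \<Rightarrow> nat \<Rightarrow> real" where "dlon w k = lon (a k) (Z w k) (Z w (Suc k))"
text \<open>The determinant of three consecutive vertices at heights \<open>Z\<close>, divided by
  \<open>t\<close>. Unlike the determinant itself it has a nonzero limit at the flat state.\<close>

definition G :: "real \<times> real \<Rightarrow> nat \<Rightarrow> real" where
  "G w j = H (snd w) (j - 1) * (lat (Z w j) * lat (Z w (Suc (nx j)))) * sin (dlon w (nx j))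
     - H (snd w) j * (lat (Z w (j - 1)) * lat (Z w (Suc (nx j)))) * sin (dlon w (j - 1) + dlon w (nx j))
     + H (snd w) (Suc (nx j)) * (lat (Z w (j - 1)) * lat (Z w j)) * sin (dlon w (j - 1))"
definition Phi :: "real \<Rightarrow> real \<Rightarrow> real" where "Phi t s = (\<Sum>k<n. dlon (t, s) k) - 2 * pi"
definition good :: "real \<times> real \<Rightarrow> bool" where
  "good w \<longleftrightarrow> (\<forall>k\<le>n. \<bar>Z w k\<bar> < 1) \<and> (\<forall>k<n. \<bar>cc w k\<bar> < 1) \<and> (\<forall>j\<in>{1..n}. 0 < \<rho> (nx j) * G w j)"

lemma Z_ends: "Z w 0 = 0" "Z w n = 0" using h_ends n by (simp_all add: Z_def H_def)

lemma sum_gaps: "(\<Sum>k<n. a k) = 2 * pi"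
  using sum_lessThan_telescope[of th n] by (simp add: a_def th0 thn)

text \<open>Every condition is a strict inequality that holds in the limit at the flat state; for
  \<open>G\<close> the limit is given by \<open>h_kink\<close>.\<close>

lemma eventually_good: "eventually good (nhds (0, 0))"
proof -
  have tH: "((\<lambda>w. H (snd w) k) \<longlongrightarrow> h k) (nhds (0::real, 0::real))" for k
    using tendsto_add[OF tendsto_const tendsto_snd[OF filterlim_ident], of "h k" "(0, 0)"]
    by (cases "k = 1") (simp_all add: H_def)
  have tZ: "((\<lambda>w. Z w k) \<longlongrightarrow> 0) (nhds (0, 0))" for k
    using tendsto_mult[OF tendsto_fst[OF filterlim_ident] tH[of k]] by (simp add: Z_def)
  have tl: "((\<lambda>w. lat (Z w k)) \<longlongrightarrow> 1) (nhds (0, 0))" for k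
    unfolding lat_def by (rule tendsto_eq_intros refl tZ | simp)+
  have tc: "((\<lambda>w. cc w k) \<longlongrightarrow> cos (a k)) (nhds (0, 0))" for k
    unfolding cc_def coslon_def by (rule tendsto_eq_intros refl tZ tl | simp)+
  have c: "- 1 < cos (a k)" "cos (a k) < 1" if "k < n" for k
    using a_bounds[OF that] cos_monotone_0_pi[of 0 "a k"] cos_monotone_0_pi[of "a k" pi] by auto
  have td: "((\<lambda>w. dlon w k) \<longlongrightarrow> a k) (nhds (0, 0))" if k: "k < n" for k
  proof -
    have "isCont arccos (cos (a k))" using c[OF k] by (rule isCont_arccos)
    from isCont_tendsto_compose[OF this tc[of k]] show ?thesis
      using a_bounds[OF k] by (simp add: dlon_def lon_def cc_def arccos_cos)
  qed
  have tG: "((\<lambda>w. G w j) \<longlongrightarrow> \<rho> (nx j) * sin (a (j - 1)) * sin (a (nx j))) (nhds (0, 0))" if j: "0 < j" "j \<le> n" for j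
  proof -
    have k: "j - 1 < n" "nx j < n" using j nx_less by auto
    have "((\<lambda>w. G w j) \<longlongrightarrow> h (j - 1) * (1 * 1) * sin (a (nx j)) - h j * (1 * 1) * sin (a (j - 1) + a (nx j)) + h (Suc (nx j)) * (1 * 1) * sin (a (j - 1))) (nhds (0, 0))"
      unfolding G_def by (intro tendsto_intros tH tl td k)
    then show ?thesis using h_kink[OF j] by simp
  qed
  have "eventually (\<lambda>w. \<forall>k\<in>{..n}. \<bar>Z w k\<bar> < 1) (nhds (0, 0))"
    by (intro eventually_ball_finite ballI order_tendstoD(2)[OF tendsto_rabs[OF tZ]]) auto
  moreover have "eventually (\<lambda>w. \<forall>k\<in>{..<n}. \<bar>cc w k\<bar> < 1) (nhds (0, 0))"
    using c by (intro eventually_ball_finite ballI order_tendstoD(2)[OF tendsto_rabs[OF tc]]) (auto simp: abs_less_iff)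
  moreover have "eventually (\<lambda>w. \<forall>j\<in>{1..n}. 0 < \<rho> (nx j) * G w j) (nhds (0, 0))"
  proof (intro eventually_ball_finite ballI order_tendstoD(1)[OF tendsto_mult_left[OF tG]])
    fix j assume j: "j \<in> {1..n}"
    then have k: "j - 1 < n" "nx j < n" using nx_less by auto
    have "0 < (\<rho> (nx j))\<^sup>2 * (sin (a (j - 1)) * sin (a (nx j)))" using a_bounds[OF k(1)] a_bounds[OF k(2)] nz[OF k(2)] by simp
    then show "0 < \<rho> (nx j) * (\<rho> (nx j) * sin (a (j - 1)) * sin (a (nx j)))" by (simp add: power2_eq_square mult_ac)
  qed auto
  ultimately show ?thesis unfolding good_def by eventually_elim auto
qed

lemma good_box:
  obtains \<delta> where "0 < \<delta>" "\<And>t s. \<bar>t\<bar> \<le> \<delta> \<Longrightarrow> \<bar>s\<bar> \<le> \<delta> \<Longrightarrow> good (t, s)"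
proof -
  obtain d where d: "0 < d" "\<And>w. dist w (0, 0) < d \<Longrightarrow> good w"
    using eventually_good unfolding eventually_nhds_metric by blast
  have "good (t, s)" if ts: "\<bar>t\<bar> \<le> d / 3" "\<bar>s\<bar> \<le> d / 3" for t s
  proof (rule d(2))
    have "dist (t, s) (0, 0) \<le> \<bar>t\<bar> + \<bar>s\<bar>" by (simp add: dist_Pair_Pair sqrt_sum_squares_le_sum_abs)
    then show "dist (t, s) (0, 0) < d" using ts d(1) by linarith
  qed
  then show ?thesis using that[of "d / 3"] d(1) by simp
qed

text \<open>Moving the vertex \<open>v\<^sub>1\<close> up or down changes the total longitude monotonically, because the
  derivative is a positive multiple of the determinant at the crease \<open>1\<close>.\<close>

lemma Phi_deriv:
  assumes g: "good (t, s)"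
  obtains c where "0 < c" "((\<lambda>s. Phi t s) has_real_derivative t\<^sup>2 * c * G (t, s) 1) (at s)"
proof -
  let ?w = "(t, s)"
  let ?A = "dlon ?w 0" and ?B = "dlon ?w 1" and ?z = "Z ?w 1" and ?z2 = "Z ?w 2"
  have n2: "0 < n" "1 < n" "2 \<le> n" using n by auto
  have Zb: "\<bar>Z ?w k\<bar> < 1" if "k \<le> n" for k using g that by (auto simp: good_def)
  have z: "\<bar>?z\<bar> < 1" "\<bar>?z2\<bar> < 1" using Zb[of 1] Zb[of 2] n2 by auto
  have Ze: "Z (t, x) 0 = 0" "Z (t, x) 1 = t * (h 1 + x)" "k \<noteq> 1 \<Longrightarrow> Z (t, x) k = Z ?w k" for x k
    using h_ends by (simp_all add: Z_def H_def)
  have cA: "\<bar>coslon (a 0) 0 ?z\<bar> < 1" and cB: "\<bar>coslon (a 1) ?z2 ?z\<bar> < 1"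
    using g n2 Ze(1)[of s] coslon_commute[of "a 1" ?z2 ?z] by (auto simp: good_def cc_def numeral_2_eq_2)
  have A: "?A = lon (a 0) 0 ?z" and B: "?B = lon (a 1) ?z2 ?z"
    using Ze(1)[of s] coslon_commute[of "a 1" ?z2 ?z] by (simp_all add: dlon_def lon_def numeral_2_eq_2)
  have dz: "((\<lambda>x. Z (t, x) 1) has_real_derivative t) (at s)"
    unfolding Ze(2) by (auto intro!: derivative_eq_intros)
  note dA = DERIV_chain2[OF has_derivative_lon[OF _ z(1) cA] dz]
  note dB = DERIV_chain2[OF has_derivative_lon[OF z(2) z(1) cB] dz]
  have P: "Phi t x = lon (a 0) 0 (Z (t, x) 1) + (lon (a 1) ?z2 (Z (t, x) 1) + ((\<Sum>k\<in>{2..<n}. dlon ?w k) - 2 * pi))" for x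
  proof -
    have "{..<n} = insert 0 (insert 1 {2..<n})" using n by auto
    then have "Phi t x = dlon (t, x) 0 + (dlon (t, x) 1 + (\<Sum>k\<in>{2..<n}. dlon (t, x) k)) - 2 * pi" by (simp add: Phi_def)
    moreover have "dlon (t, x) 0 = lon (a 0) 0 (Z (t, x) 1)" using Ze(1)[of x] by (simp add: dlon_def)
    moreover have "dlon (t, x) 1 = lon (a 1) ?z2 (Z (t, x) 1)"
      using Ze(3)[of 2 x] coslon_commute[of "a 1" ?z2 "Z (t, x) 1"] by (simp add: dlon_def lon_def numeral_2_eq_2)
    moreover have "(\<Sum>k\<in>{2..<n}. dlon (t, x) k) = (\<Sum>k\<in>{2..<n}. dlon ?w k)"
    proof (intro sum.cong refl)
      fix k assume "k \<in> {2..<n}"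
      then show "dlon (t, x) k = dlon ?w k" using Ze(3)[of k x] Ze(3)[of "Suc k" x] unfolding dlon_def by simp
    qed
    ultimately show ?thesis by simp
  qed
  have sA: "0 < sin ?A" and sB: "0 < sin ?B"
    using cos_lon(4)[OF _ z(1) cA] cos_lon(4)[OF z(2) z(1) cB] unfolding A B by auto
  have l: "0 < lat ?z" "0 < lat ?z2" using z by (auto intro: lat_pos)
  have l0: "lat 0 = 1" by (simp add: lat_def)
  have d: "((\<lambda>s. Phi t s) has_real_derivative
      (0 * lat ?z / lat 0 - ?z * cos ?A) / ((lat ?z)\<^sup>2 * sin ?A) * t +
      ((?z2 * lat ?z / lat ?z2 - ?z * cos ?B) / ((lat ?z)\<^sup>2 * sin ?B) * t + 0)) (at s)"
    unfolding P A B by (intro DERIV_add dA dB DERIV_const) auto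
  define c where "c = 1 / ((lat ?z)\<^sup>2 * lat ?z2 * sin ?A * sin ?B)"
  have "nx 1 = 1" using n by (simp add: nx_def)
  then have tG: "t * G ?w 1 = ?z2 * lat ?z * sin ?A - ?z * lat ?z2 * sin (?A + ?B)"
    using h_ends Ze(1)[of s] l0 by (simp add: G_def Z_def H_def numeral_2_eq_2 algebra_simps)
  have "t\<^sup>2 * c * G ?w 1 = t * c * (t * G ?w 1)" by (simp add: power2_eq_square)
  also have "\<dots> = (0 * lat ?z / lat 0 - ?z * cos ?A) / ((lat ?z)\<^sup>2 * sin ?A) * t +
      ((?z2 * lat ?z / lat ?z2 - ?z * cos ?B) / ((lat ?z)\<^sup>2 * sin ?B) * t + 0)"
    unfolding tG c_def sin_add l0 using sA sB l by (simp add: field_simps power2_eq_square)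
  finally have e: "t\<^sup>2 * c * G ?w 1 = \<dots>" .
  show ?thesis
  proof (rule that)
    show "0 < c" unfolding c_def using sA sB l by simp
    show "((\<lambda>s. Phi t s) has_real_derivative t\<^sup>2 * c * G (t, s) 1) (at s)" unfolding e by (rule d)
  qed
qed

lemma Phi_strict_mono:
  assumes t: "t \<noteq> 0" and xy: "x < y" and g: "\<And>s. x \<le> s \<Longrightarrow> s \<le> y \<Longrightarrow> good (t, s)"
  shows "\<rho> 1 * Phi t x < \<rho> 1 * Phi t y"
proof (rule DERIV_pos_imp_increasing[OF xy])
  fix s assume s: "x \<le> s" "s \<le> y"
  obtain c where c: "0 < c" "((\<lambda>s. Phi t s) has_real_derivative t\<^sup>2 * c * G (t, s) 1) (at s)"
    using Phi_deriv[OF g[OF s]] by metis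
  have "0 < \<rho> (nx 1) * G (t, s) 1" using g[OF s] n by (simp add: good_def)
  moreover have "nx 1 = 1" using n by (simp add: nx_def)
  ultimately have "0 < (t\<^sup>2 * c) * (\<rho> 1 * G (t, s) 1)" using t c by simp
  moreover have "((\<lambda>s. \<rho> 1 * Phi t s) has_real_derivative \<rho> 1 * (t\<^sup>2 * c * G (t, s) 1)) (at s)"
    by (rule DERIV_cmult[OF c(2)])
  ultimately show "\<exists>D. ((\<lambda>s. \<rho> 1 * Phi t s) has_real_derivative D) (at s) \<and> 0 < D"
    by (intro exI[of _ "\<rho> 1 * (t\<^sup>2 * c * G (t, s) 1)"]) (simp add: mult_ac)
qed

text \<open>\<open>Phi\<close> is an even function of \<open>t\<close> that vanishes at \<open>0\<close>; its second-order coefficient is minus half the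
  energy.\<close>

lemma Phi_small:
  assumes "s * (s * (cos (a 0) / sin (a 0) + cos (a 1) / sin (a 1)) - 2 * \<rho> 1) * c < 0"
  obtains d where "0 < d" "\<And>t. 0 < t \<Longrightarrow> t < d \<Longrightarrow> 0 < c * Phi t s"
proof -
  let ?P = "\<lambda>y. c * ((\<Sum>k<n. arccos ((cos (a k) - y * (H s k * H s (Suc k))) / (sqrt (1 - y * (H s k)\<^sup>2) * sqrt (1 - y * (H s (Suc k))\<^sup>2)))) - 2 * pi)"
  have "(?P has_real_derivative c * ((\<Sum>k<n. - (((H s k)\<^sup>2 + (H s (Suc k))\<^sup>2) * cos (a k) - 2 * H s k * H s (Suc k)) / (2 * sin (a k))) - 0)) (at 0)"
    using a_bounds by (intro DERIV_cmult DERIV_diff DERIV_const DERIV_sum has_derivative_lon_scaled) auto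
  moreover have "(\<Sum>k<n. - (((H s k)\<^sup>2 + (H s (Suc k))\<^sup>2) * cos (a k) - 2 * H s k * H s (Suc k)) / (2 * sin (a k))) =
      - (\<Sum>k<n. edge_energy (H s) k) / 2"
  proof -
    have "- X / (2 * S) = - (X / S) / 2" for X S :: real by (simp add: field_simps)
    then show ?thesis
      unfolding sum_negf[symmetric] sum_divide_distrib by (intro sum.cong refl) (simp only: edge_energy_def)
  qed
  ultimately have D: "(?P has_real_derivative c * (- (\<Sum>k<n. edge_energy (H s) k) / 2)) (at 0)" by simp
  have pos: "0 < c * (- (\<Sum>k<n. edge_energy (H s) k) / 2)" unfolding energy_H using assms by (simp add: mult.commute)
  have P0: "?P 0 = 0"
  proof -
    have "(\<Sum>k<n. arccos (cos (a k))) = (\<Sum>k<n. a k)" using a_bounds by (intro sum.cong refl) (auto intro!: arccos_cos less_imp_le)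
    then show ?thesis by (simp add: sum_gaps)
  qed
  obtain d where d: "0 < d" "\<And>y. 0 < y \<Longrightarrow> y < d \<Longrightarrow> ?P 0 < ?P (0 + y)"
    using DERIV_pos_inc_right[OF D pos] by blast
  have "0 < c * Phi t s" if t: "0 < t" "t < sqrt d" for t
  proof -
    have "t\<^sup>2 < d" using t d(1) by (metis abs_of_pos real_sqrt_abs real_sqrt_less_iff)
    then have "?P 0 < ?P (0 + t\<^sup>2)" using t by (intro d(2)) auto
    then have "0 < ?P (0 + t\<^sup>2)" unfolding P0 .
    moreover have "Phi t s = (\<Sum>k<n. arccos ((cos (a k) - t\<^sup>2 * (H s k * H s (Suc k))) / (sqrt (1 - t\<^sup>2 * (H s k)\<^sup>2) * sqrt (1 - t\<^sup>2 * (H s (Suc k))\<^sup>2)))) - 2 * pi"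
      unfolding Phi_def dlon_def lon_def coslon_def lat_def Z_def
      by (simp add: power_mult_distrib) (simp add: power2_eq_square mult_ac)
    ultimately show ?thesis by simp
  qed
  then show ?thesis using that[of "sqrt d"] d(1) by simp
qed

lemma continuous_dlon:
  assumes "\<And>w. w \<in> S \<Longrightarrow> good w" "k < n"
  shows "continuous_on S (\<lambda>w. dlon w k)"
proof -
  have H: "continuous_on S (\<lambda>w. H (snd w) k)" for k
    unfolding H_def by (cases "k = 1") (auto intro!: continuous_intros)
  have Z: "continuous_on S (\<lambda>w. Z w k)" for k
    unfolding Z_def by (intro continuous_intros H)
  have l: "continuous_on S (\<lambda>w. lat (Z w k))" for k
    unfolding lat_def by (intro continuous_intros Z)
  have ln: "lat (Z w k) \<noteq> 0" if "w \<in> S" "k \<le> n" for w k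
    using lat_pos[of "Z w k"] assms(1)[OF that(1)] that(2) by (auto simp: good_def)
  have "continuous_on S (\<lambda>w. cc w k)"
    unfolding cc_def coslon_def using ln assms(2) by (intro continuous_intros Z l) auto
  moreover have "- 1 \<le> cc w k \<and> cc w k \<le> 1" if "w \<in> S" for w
    using assms(1)[OF that] assms(2) by (auto simp: good_def abs_less_iff less_imp_le)
  ultimately show ?thesis unfolding dlon_def lon_def cc_def by (intro continuous_on_arccos) auto
qed

text \<open>For each small \<open>t > 0\<close> the function \<open>Phi t\<close> has opposite signs
  at \<open>- \<epsilon>\<close> and \<open>\<epsilon>\<close> and is strictly monotone in between,
  so it has exactly one root \<open>\<sigma> t\<close>. The roots form a relatively closed graph
  with values in a compact interval, hence \<open>\<sigma>\<close> is continuous.\<close>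

theorem folding_heights:
  obtains z :: "real \<Rightarrow> nat \<Rightarrow> real" where
    "\<And>k. continuous_on {0..1} (\<lambda>t. z t k)" "\<And>k. z 0 k = 0" "\<And>t. z t 0 = 0" "\<And>t. z t n = 0"
    "\<And>t k. t \<in> {0..1} \<Longrightarrow> k \<le> n \<Longrightarrow> \<bar>z t k\<bar> < 1"
    "\<And>t k. t \<in> {0..1} \<Longrightarrow> k < n \<Longrightarrow> \<bar>coslon (a k) (z t k) (z t (Suc k))\<bar> < 1"
    "\<And>t. t \<in> {0..1} \<Longrightarrow> (\<Sum>k<n. lon (a k) (z t k) (z t (Suc k))) = 2 * pi"
    "\<And>j. 0 < j \<Longrightarrow> j \<le> n \<Longrightarrow> 0 < \<rho> (nx j) *
       (z 1 (j - 1) * (lat (z 1 j) * lat (z 1 (Suc (nx j)))) * sin (lon (a (nx j)) (z 1 (nx j)) (z 1 (Suc (nx j))))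
        - z 1 j * (lat (z 1 (j - 1)) * lat (z 1 (Suc (nx j)))) *
          sin (lon (a (j - 1)) (z 1 (j - 1)) (z 1 j) + lon (a (nx j)) (z 1 (nx j)) (z 1 (Suc (nx j))))
        + z 1 (Suc (nx j)) * (lat (z 1 (j - 1)) * lat (z 1 j)) * sin (lon (a (j - 1)) (z 1 (j - 1)) (z 1 j)))"
proof -
  obtain \<delta> where \<delta>: "0 < \<delta>" "\<And>t s. \<bar>t\<bar> \<le> \<delta> \<Longrightarrow> \<bar>s\<bar> \<le> \<delta> \<Longrightarrow> good (t, s)" using good_box by blast
  define K where "K = cos (a 0) / sin (a 0) + cos (a 1) / sin (a 1)"
  have r1: "\<rho> 1 \<noteq> 0" using nz n by simp
  \<comment> \<open>So small that in the energy at \<open>\<epsilon>\<close> and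
    \<open>- \<epsilon>\<close> the linear term outweighs the quadratic one, whose coefficient is
    \<open>K\<close>.\<close>
  define \<epsilon> where "\<epsilon> = min \<delta> (\<bar>\<rho> 1\<bar> / (\<bar>K\<bar> + 1))"
  have \<epsilon>: "0 < \<epsilon>" "\<epsilon> \<le> \<delta>" using \<delta>(1) r1 by (auto simp: \<epsilon>_def)
  have "\<epsilon> * (\<bar>K\<bar> + 1) \<le> \<bar>\<rho> 1\<bar> / (\<bar>K\<bar> + 1) * (\<bar>K\<bar> + 1)" unfolding \<epsilon>_def by (intro mult_right_mono) auto
  also have "\<dots> = \<bar>\<rho> 1\<bar>"
  proof -
    have "\<bar>K\<bar> + 1 \<noteq> 0" using abs_ge_zero[of K] by linarith
    then show ?thesis by (metis nonzero_eq_divide_eq)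
  qed
  finally have \<epsilon>K: "\<epsilon> * \<bar>K\<bar> + \<epsilon> \<le> \<bar>\<rho> 1\<bar>" by (simp add: algebra_simps)
  then have "\<bar>\<epsilon> * K\<bar> < \<bar>\<rho> 1\<bar>" using \<epsilon> by (simp add: abs_mult)
  then have "\<bar>\<epsilon> * K\<bar> * \<bar>\<rho> 1\<bar> < \<bar>\<rho> 1\<bar> * \<bar>\<rho> 1\<bar>" using r1 by (intro mult_strict_right_mono) auto
  then have s1: "\<bar>\<epsilon> * K * \<rho> 1\<bar> < (\<rho> 1)\<^sup>2" by (simp only: abs_mult abs_mult_self_eq power2_eq_square)
  have S1: "\<epsilon> * (\<epsilon> * K - 2 * \<rho> 1) * \<rho> 1 < 0" and S2: "(- \<epsilon>) * ((- \<epsilon>) * K - 2 * \<rho> 1) * (- \<rho> 1) < 0"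
  proof -
    have "\<epsilon> * K * \<rho> 1 - 2 * (\<rho> 1)\<^sup>2 < 0" "- (\<epsilon> * K * \<rho> 1) - 2 * (\<rho> 1)\<^sup>2 < 0" using s1 r1 by (auto simp: abs_less_iff)
    then have "\<epsilon> * (\<epsilon> * K * \<rho> 1 - 2 * (\<rho> 1)\<^sup>2) < 0" "\<epsilon> * (- (\<epsilon> * K * \<rho> 1) - 2 * (\<rho> 1)\<^sup>2) < 0"
      using \<epsilon> by (simp_all add: mult_pos_neg)
    then show "\<epsilon> * (\<epsilon> * K - 2 * \<rho> 1) * \<rho> 1 < 0" "(- \<epsilon>) * ((- \<epsilon>) * K - 2 * \<rho> 1) * (- \<rho> 1) < 0"
      by (simp_all add: algebra_simps power2_eq_square)
  qed
  obtain d1 where d1: "0 < d1" "\<And>t. 0 < t \<Longrightarrow> t < d1 \<Longrightarrow> 0 < \<rho> 1 * Phi t \<epsilon>"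
    using Phi_small[OF S1[unfolded K_def]] by metis
  obtain d2 where d2: "0 < d2" "\<And>t. 0 < t \<Longrightarrow> t < d2 \<Longrightarrow> 0 < (- \<rho> 1) * Phi t (- \<epsilon>)"
    using Phi_small[OF S2[unfolded K_def]] by metis
  define t0 where "t0 = min \<delta> (min d1 d2 / 2)"
  have t0: "0 < t0" "t0 \<le> \<delta>" "t0 < d1" "t0 < d2" using \<delta> d1 d2 by (auto simp: t0_def)
  let ?S = "{0<..t0}" and ?T = "{-\<epsilon>..\<epsilon>}"
  have good: "good (t, s)" if "t \<in> {0..t0}" "s \<in> ?T" for t s
    using that \<delta>(2)[of t s] t0 \<epsilon> by auto
  have cont: "continuous_on (?S \<times> ?T) (\<lambda>w. Phi (fst w) (snd w))"
    unfolding Phi_def prod.collapse using good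
    by (intro continuous_intros continuous_dlon) auto
  have root: "\<exists>s\<in>?T. Phi t s = 0" if t: "t \<in> ?S" for t
  proof -
    have "continuous_on ?T (\<lambda>s. \<rho> 1 * Phi t s)"
    proof -
      have "continuous_on ?T (\<lambda>s. (\<lambda>w. Phi (fst w) (snd w)) (t, s))"
        by (rule continuous_on_compose2[OF cont]) (use t in \<open>auto intro!: continuous_intros\<close>)
      then show ?thesis by (auto intro!: continuous_intros)
    qed
    moreover have "\<rho> 1 * Phi t (- \<epsilon>) \<le> 0" "0 \<le> \<rho> 1 * Phi t \<epsilon>" using d1(2)[of t] d2(2)[of t] t t0 by auto
    ultimately obtain s where "- \<epsilon> \<le> s" "s \<le> \<epsilon>" "\<rho> 1 * Phi t s = 0"
      using IVT'[of "\<lambda>s. \<rho> 1 * Phi t s" "- \<epsilon>" 0 \<epsilon>] \<epsilon> by auto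
    then show ?thesis using r1 by auto
  qed
  have uniq: "s = s'" if "t \<in> ?S" "s \<in> ?T" "s' \<in> ?T" "Phi t s = 0" "Phi t s' = 0" for t s s'
  proof (rule ccontr)
    assume "s \<noteq> s'"
    then consider "s < s'" | "s' < s" by linarith
    then show False
    proof cases
      case 1
      have "\<rho> 1 * Phi t s < \<rho> 1 * Phi t s'" by (rule Phi_strict_mono[OF _ 1]) (use that in \<open>auto intro!: good\<close>)
      then show False using that by simp
    next
      case 2
      have "\<rho> 1 * Phi t s' < \<rho> 1 * Phi t s" by (rule Phi_strict_mono[OF _ 2]) (use that in \<open>auto intro!: good\<close>)
      then show False using that by simp
    qed
  qed
  obtain \<sigma> where \<sigma>: "\<And>t. t \<in> ?S \<Longrightarrow> \<sigma> t \<in> ?T \<and> Phi t (\<sigma> t) = 0" using root by metis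
  have cs: "continuous_on ?S \<sigma>"
  proof (rule iffD2[OF continuous_closed_graph_eq[of ?T]])
    show "compact ?T" by simp
    show "\<sigma> \<in> ?S \<rightarrow> ?T" using \<sigma> by auto
    have "(\<lambda>t. (t, \<sigma> t)) ` ?S = (?S \<times> ?T) \<inter> (\<lambda>w. Phi (fst w) (snd w)) -` {0}"
    proof (intro equalityI subsetI)
      fix w assume "w \<in> (?S \<times> ?T) \<inter> (\<lambda>w. Phi (fst w) (snd w)) -` {0}"
      then obtain t s where w: "w = (t, s)" "t \<in> ?S" "s \<in> ?T" "Phi t s = 0" by (cases w) auto
      then have "s = \<sigma> t" using uniq[of t s "\<sigma> t"] \<sigma>[of t] by blast
      then show "w \<in> (\<lambda>t. (t, \<sigma> t)) ` ?S" using w by blast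
    qed (use \<sigma> in auto)
    moreover have "closedin (top_of_set (?S \<times> ?T)) ((?S \<times> ?T) \<inter> (\<lambda>w. Phi (fst w) (snd w)) -` {0})"
      by (rule continuous_closedin_preimage[OF cont]) simp
    ultimately show "closedin (top_of_set (?S \<times> ?T)) ((\<lambda>t. Pair t (\<sigma> t)) ` ?S)" by simp
  qed
  \<comment> \<open>At \<open>t = 0\<close> no root has been selected; the value 0 is harmless
    there, because it is multiplied by \<open>t0 * t\<close>, and for the same reason boundedness of
    \<open>\<sigma>\<close> gives continuity at 0.\<close>
  define z where "z t k = Z (t0 * t, if t \<le> 0 then 0 else \<sigma> (t0 * t)) k" for t k
  have tS: "t0 * t \<in> ?S" if "0 < t" "t \<le> 1" for t
    using that t0 mult_left_le[of t t0] by simp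
  have z0: "z 0 k = 0" for k by (simp add: z_def Z_def)
  have zt: "z t k = Z (t0 * t, \<sigma> (t0 * t)) k" if "0 < t" for t k using that by (simp add: z_def)
  have g: "good (t0 * t, \<sigma> (t0 * t))" if "0 < t" "t \<le> 1" for t
    using tS[OF that] \<sigma>[OF tS[OF that]] by (intro good) auto
  have zc: "continuous_on {0..1} (\<lambda>t. z t k)" for k
    unfolding continuous_on_eq_continuous_within
  proof
    fix t :: real assume t: "t \<in> {0..1}"
    have "continuous_on {0<..1} (\<lambda>t. \<sigma> (t0 * t))"
      by (rule continuous_on_compose2[OF cs]) (use tS in \<open>auto intro!: continuous_intros\<close>)
    then have c1: "continuous_on {0<..1} (\<lambda>t. z t k)"
      by (subst continuous_on_cong[OF refl, of _ _ "\<lambda>t. t0 * t * (h k + (if k = 1 then \<sigma> (t0 * t) else 0))"])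
        (cases "k = 1"; auto simp: zt Z_def H_def intro!: continuous_intros)+
    show "continuous (at t within {0..1}) (\<lambda>t. z t k)"
    proof (cases "t = 0")
      case False
      then have "continuous (at t within {0<..1}) (\<lambda>t. z t k)" using c1 t by (simp add: continuous_on_eq_continuous_within)
      moreover have "at t within {0<..1} = at t within {0..1}"
        using False t by (intro at_within_nhd[of t "{0<..}"]) auto
      ultimately show ?thesis by simp
    next
      case True
      have "((\<lambda>t. z t k) \<longlongrightarrow> 0) (at 0 within {0..1})"
      proof (rule Lim_null_comparison)
        have "norm (z t k) \<le> t0 * t * (\<bar>h k\<bar> + \<epsilon>)" if t: "0 \<le> t" "t \<le> 1" for t
        proof (cases "t = 0")
          case False
          then have tp: "0 < t" using t by simp
          have "\<bar>\<sigma> (t0 * t)\<bar> \<le> \<epsilon>" using \<sigma>[OF tS[OF tp t(2)]] by auto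
          then have "\<bar>H (\<sigma> (t0 * t)) k\<bar> \<le> \<bar>h k\<bar> + \<epsilon>" using \<epsilon> by (auto simp: H_def)
          then show ?thesis using tp t0 by (simp add: zt Z_def abs_mult)
        qed (simp add: z0)
        then show "eventually (\<lambda>t. norm (z t k) \<le> t0 * t * (\<bar>h k\<bar> + \<epsilon>)) (at 0 within {0..1})"
          by (auto simp: eventually_at_filter)
        show "((\<lambda>t. t0 * t * (\<bar>h k\<bar> + \<epsilon>)) \<longlongrightarrow> 0) (at 0 within {0..1})"
          by (rule tendsto_eq_intros refl | simp)+
      qed
      then show ?thesis using True z0 by (simp add: continuous_within)
    qed
  qed
  show ?thesis
  proof (rule that[of z])
    show "z t 0 = 0" "z t n = 0" for t using Z_ends by (simp_all add: z_def)
    fix t :: real assume t: "t \<in> {0..1}"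
    show "\<bar>z t k\<bar> < 1" if "k \<le> n" for k
      using g[of t] t that z0 by (cases "t = 0") (auto simp: good_def zt)
    show "\<bar>coslon (a k) (z t k) (z t (Suc k))\<bar> < 1" if k: "k < n" for k
    proof (cases "t = 0")
      case True
      have "- 1 < cos (a k)" "cos (a k) < 1"
        using a_bounds[OF k] cos_monotone_0_pi[of 0 "a k"] cos_monotone_0_pi[of "a k" pi] by auto
      then show ?thesis using True z0 by (simp add: coslon_def lat_def)
    next
      case False
      then show ?thesis using g[of t] t k by (auto simp: good_def zt cc_def)
    qed
    show "(\<Sum>k<n. lon (a k) (z t k) (z t (Suc k))) = 2 * pi"
    proof (cases "t = 0")
      case True
      have "(\<Sum>k<n. lon (a k) (z t k) (z t (Suc k))) = (\<Sum>k<n. a k)"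
        using a_bounds by (intro sum.cong refl) (auto simp: True z0 lon_0)
      then show ?thesis by (simp add: sum_gaps)
    next
      case False
      then have tp: "0 < t" "t \<le> 1" using t by auto
      have "Phi (t0 * t) (\<sigma> (t0 * t)) = 0" using \<sigma>[OF tS[OF tp]] by simp
      then show ?thesis using zt[OF tp(1)] by (simp add: Phi_def dlon_def)
    qed
  next
    fix j assume j: "0 < j" "j \<le> n"
    have "0 < \<rho> (nx j) * G (t0, \<sigma> t0) j" using g[of 1] j by (simp add: good_def)
    then have "0 < t0 * (\<rho> (nx j) * G (t0, \<sigma> t0) j)" using t0 by simp
    moreover have zz: "z 1 k = Z (t0, \<sigma> t0) k" for k using zt[of 1] by simp
    have "H (\<sigma> t0) j = H (\<sigma> t0) (nx j)" using h_ends n by (auto simp: nx_def H_def)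
    ultimately show "0 < \<rho> (nx j) *
       (z 1 (j - 1) * (lat (z 1 j) * lat (z 1 (Suc (nx j)))) * sin (lon (a (nx j)) (z 1 (nx j)) (z 1 (Suc (nx j))))
        - z 1 j * (lat (z 1 (j - 1)) * lat (z 1 (Suc (nx j)))) *
          sin (lon (a (j - 1)) (z 1 (j - 1)) (z 1 j) + lon (a (nx j)) (z 1 (nx j)) (z 1 (Suc (nx j))))
        + z 1 (Suc (nx j)) * (lat (z 1 (j - 1)) * lat (z 1 j)) * sin (lon (a (j - 1)) (z 1 (j - 1)) (z 1 j)))"
      using j unfolding zz G_def dlon_def Z_def by (simp add: algebra_simps)
  qed (use zc z0 in auto)
qed

end

section \<open>The folded cone\<close>

definition emb :: "complex \<Rightarrow> real \<Rightarrow> real^3" where "emb w h = vector [Re w, Im w, h]"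

lemma emb_inner: "emb w h \<bullet> emb w' h' = w \<bullet> w' + h * h'"
  by (simp add: emb_def inner_vec_def sum_3 vector_3 inner_complex_def)

lemma emb_det: "emb a x \<bullet> cross3 (emb b y) (emb c z) = x * cross2 b c - y * cross2 a c + z * cross2 a b"
  by (simp add: emb_def inner_vec_def sum_3 vector_3 cross3_def cross2_def algebra_simps)

lemma flat_state_emb: "flat_state x = emb x 0"
  by (simp add: flat_state_def emb_def)

lemma emb_add: "emb w h + emb w' h' = emb (w + w') (h + h')"
  and emb_scale: "c *\<^sub>R emb w h = emb (c *\<^sub>R w) (c * h)"
  by (simp_all add: emb_def vec_eq_iff forall_3 vector_3)

lemma emb_eq_iff: "emb w h = emb w' h' \<longleftrightarrow> w = w' \<and> h = h'"
  by (auto simp: emb_def vec_eq_iff forall_3 vector_3 complex_eq_iff)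

lemma continuous_on_emb:
  assumes "continuous_on S f" "continuous_on S g"
  shows "continuous_on S (\<lambda>x. emb (f x) (g x))"
proof -
  have "emb w h = Re w *\<^sub>R axis 1 1 + Im w *\<^sub>R axis 2 1 + h *\<^sub>R axis 3 1" for w h
    by (simp add: emb_def vec_eq_iff forall_3 axis_def)
  then show ?thesis using assms by (simp only:) (intro continuous_intros)
qed

context crease_frame
begin

text \<open>The folded boundary circle is the spherical polygon with vertices \<open>vtx z k\<close> at heights
  \<open>z k\<close> and longitudes \<open>ph z k\<close> (up to the direction \<open>u\<close> of the first crease).\<close>

definition ph :: "(nat \<Rightarrow> real) \<Rightarrow> nat \<Rightarrow> real" where
  "ph z k = (\<Sum>j<k. lon (a j) (z j) (z (Suc j)))"
definition vtx :: "(nat \<Rightarrow> real) \<Rightarrow> nat \<Rightarrow> real^3" where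
  "vtx z k = emb (of_real (lat (z k)) * u * cis (ph z k)) (z k)"
text \<open>Cramer's rule for the linear map that takes the directions of the two creases of sector
  \<open>k\<close> to their vertices.\<close>

definition Lz :: "(nat \<Rightarrow> real) \<Rightarrow> nat \<Rightarrow> complex \<Rightarrow> real^3" where
  "Lz z k y = (cross2 y (dir (th (Suc k))) / sin (a k)) *\<^sub>R vtx z k + (cross2 (dir (th k)) y / sin (a k)) *\<^sub>R vtx z (Suc k)"
text \<open>Half-open sectors make the index unique: a crease belongs to the sector after it. At
  \<open>p\<close> every index gives the same value of \<open>fold_map\<close>, because
  \<open>x - p\<close> is zero.\<close>

definition idx :: "complex \<Rightarrow> nat" where
  "idx x = (THE k. k < n \<and> th k \<le> ccw_angle p (cr 0) x \<and> ccw_angle p (cr 0) x < th (Suc k))"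
definition fold_map :: "(nat \<Rightarrow> real) \<Rightarrow> complex \<Rightarrow> real^3" where
  "fold_map z x = flat_state p + Lz z (idx x) (x - p)"

lemma idx_pt:
  assumes "0 < \<rho>" "k < n" "th k \<le> \<phi>" "\<phi> < th (Suc k)"
  shows "idx (pt \<rho> \<phi>) = k"
proof -
  have b: "0 \<le> \<phi>" "\<phi> < 2 * pi" using assms th_ge_0[of k] th_le_2pi[of "Suc k"] by auto
  have c: "ccw_angle p (cr 0) (pt \<rho> \<phi>) = \<phi>"
    using ccw_pt[of \<rho> r \<phi> 0] b assms(1) r by (simp add: cr_def th0)
  show ?thesis unfolding idx_def c
  proof (rule the_equality)
    fix j assume j: "j < n \<and> th j \<le> \<phi> \<and> \<phi> < th (Suc j)"
    have "\<not> j < k" using th_le[of "Suc j" k] assms j by auto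
    moreover have "\<not> k < j" using th_le[of "Suc k" j] assms j by auto
    ultimately show "j = k" by simp
  qed (use assms in auto)
qed

lemma polar_sector:
  assumes "x \<in> cball p r" "x \<noteq> p"
  obtains \<rho> k \<phi> where "0 < \<rho>" "\<rho> \<le> r" "k < n" "th k \<le> \<phi>" "\<phi> < th (Suc k)" "x = pt \<rho> \<phi>"
proof -
  obtain \<rho> \<psi> where x: "0 \<le> \<rho>" "0 \<le> \<psi>" "\<psi> < 2 * pi" "x = pt \<rho> (0 + \<psi>)" "\<rho> = dist p x"
    using polar[of x 0] by metis
  obtain k where "k < n" "th k \<le> \<psi>" "\<psi> < th (Suc k)" using find_sector x(2,3) by blast
  moreover have "0 < \<rho>" "\<rho> \<le> r" unfolding x(5) using assms by simp_all
  ultimately show ?thesis using that[of \<rho> k \<psi>] x(4) by simp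
qed

lemma compact_sec: "k < n \<Longrightarrow> compact (sec k)"
proof -
  assume k: "k < n"
  have "sec k = (\<lambda>w. pt (fst w) (snd w)) ` ({0..r} \<times> {th k..th (Suc k)})"
  proof (intro equalityI subsetI)
    fix x assume "x \<in> sec k"
    then obtain \<rho> \<phi> where "0 \<le> \<rho>" "\<rho> \<le> r" "th k \<le> \<phi>" "\<phi> \<le> th (Suc k)" "x = pt \<rho> \<phi>" using sec_cases k by blast
    then show "x \<in> (\<lambda>w. pt (fst w) (snd w)) ` ({0..r} \<times> {th k..th (Suc k)})" by force
  qed (use sec_mem[OF k] in auto)
  moreover have "continuous_on ({0..r} \<times> {th k..th (Suc k)}) (\<lambda>w. pt (fst w) (snd w))"
    unfolding pt_def by (intro continuous_intros)
  ultimately show ?thesis by (simp add: compact_continuous_image compact_Times)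
qed

lemma cball_eq_Union_sec: "cball p r = (\<Union>k<n. sec k)"
  using cball_cases sec_subset by blast

lemma not_in_other_sec:
  assumes "0 < \<rho>" "k < n" "th k < \<phi>" "\<phi> < th (Suc k)" "j < n" "pt \<rho> \<phi> \<in> sec j"
  shows "j = k"
proof -
  obtain \<rho>' \<phi>' where x: "0 \<le> \<rho>'" "\<rho>' \<le> r" "th j \<le> \<phi>'" "\<phi>' \<le> th (Suc j)" "pt \<rho> \<phi> = pt \<rho>' \<phi>'"
    using sec_cases[OF assms(6,5)] by blast
  have "\<rho>' = \<rho>" using dist_pt[of \<rho> \<phi>] dist_pt[of \<rho>' \<phi>'] x assms(1) by simp
  moreover have "\<bar>\<phi> - \<phi>'\<bar> < 2 * pi"
    using assms(2-5) x(3,4) th_ge_0[of k] th_le_2pi[of "Suc k"] th_ge_0[of j] th_le_2pi[of "Suc j"] by auto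
  ultimately have "\<phi> = \<phi>'" using pt_inj[of \<rho> \<rho>' \<phi> \<phi>'] x(5) assms(1) by simp
  moreover have "\<not> j < k" using th_le[of "Suc j" k] assms x(4) \<open>\<phi> = \<phi>'\<close> by auto
  moreover have "\<not> k < j" using th_le[of "Suc k" j] assms x(3) \<open>\<phi> = \<phi>'\<close> by auto
  ultimately show ?thesis by simp
qed

lemma cross2_dirs: "cross2 (dir s) (dir t) = sin (t - s)"
  using cross2_dir[of 1 s 1 t] by (simp add: dir_def)

end

section \<open>The cone over given heights is a rigid folding\<close>

locale heights = crease_frame +
  fixes z :: "nat \<Rightarrow> real"
  assumes gap: "\<And>k. k < n \<Longrightarrow> th (Suc k) - th k < pi"
    and z_ends: "z 0 = 0" "z n = 0"
    and z_bound: "\<And>k. k \<le> n \<Longrightarrow> \<bar>z k\<bar> < 1"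
    and c_bound: "\<And>k. k < n \<Longrightarrow> \<bar>coslon (a k) (z k) (z (Suc k))\<bar> < 1"
    and total: "(\<Sum>k<n. lon (a k) (z k) (z (Suc k))) = 2 * pi"
begin

abbreviation D :: "nat \<Rightarrow> real" where "D k \<equiv> lon (a k) (z k) (z (Suc k))"

lemma sin_a: "k < n \<Longrightarrow> 0 < sin (a k)"
  using gap[of k] th_Suc[of k] by (auto simp: a_def intro!: sin_gt_zero)

lemma D: "k < n \<Longrightarrow> 0 < D k \<and> D k < pi \<and> lat (z k) * lat (z (Suc k)) * cos (D k) + z k * z (Suc k) = cos (a k)"
  using cos_lon[OF z_bound z_bound c_bound] by simp

lemma ph_Suc: "ph z (Suc k) = ph z k + D k" and ph_0: "ph z 0 = 0" and ph_n: "ph z n = 2 * pi"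
  using total by (simp_all add: ph_def)

lemma ph_le: "i \<le> j \<Longrightarrow> j \<le> n \<Longrightarrow> ph z i \<le> ph z j"
proof (induction j)
  case (Suc j)
  then show ?case using D[of j] by (cases "i = Suc j") (auto simp: ph_Suc intro: order_trans less_imp_le)
qed simp

lemma vtx_n: "vtx z n = vtx z 0" by (simp add: vtx_def ph_n ph_0 z_ends)

lemma unit_inner: "(of_real x * u * cis s) \<bullet> (of_real y * u * cis t) = x * y * cos (t - s)"
proof -
  have "(of_real x * u * cis s) \<bullet> (of_real y * u * cis t) = (x *\<^sub>R dir s) \<bullet> (y *\<^sub>R dir t)"
    by (simp add: dir_def scaleR_conv_of_real mult.assoc)
  then show ?thesis by (simp add: dir_inner)
qed

lemma vtx_inner:
  shows "k \<le> n \<Longrightarrow> vtx z k \<bullet> vtx z k = 1" "k < n \<Longrightarrow> vtx z k \<bullet> vtx z (Suc k) = cos (a k)"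
  unfolding vtx_def emb_inner unit_inner using lat_sq[OF z_bound, of k] D[of k]
  by (simp_all add: power2_eq_square ph_Suc)

lemma Lz_linear: "linear (Lz z k)"
  by (rule linearI) (simp_all add: Lz_def cross2_linear add_divide_distrib scaleR_add_left scaleR_add_right)

lemma Lz_vtx: "k < n \<Longrightarrow> Lz z k (dir (th k)) = vtx z k" "k < n \<Longrightarrow> Lz z k (dir (th (Suc k))) = vtx z (Suc k)"
  using sin_a[of k] by (simp_all add: Lz_def cross2_dirs a_def)

text \<open>The two vertices have the same Gram matrix as the two crease directions; its
  off-diagonal entry is the spherical cosine rule built into \<open>lon\<close>.\<close>

lemma Lz_inner:
  assumes k: "k < n" shows "Lz z k x \<bullet> Lz z k y = x \<bullet> y"
proof -
  let ?p = "dir (th k)" and ?q = "dir (th (Suc k))"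
  have c: "cross2 ?p ?q = sin (a k)" by (simp add: cross2_dirs a_def)
  have e: "w = (cross2 w ?q / sin (a k)) *\<^sub>R ?p + (cross2 ?p w / sin (a k)) *\<^sub>R ?q" for w
    using cross2_expand[of ?p ?q w] c sin_a[OF k] by simp
  have G12: "vtx z k \<bullet> vtx z (Suc k) = ?p \<bullet> ?q" using vtx_inner(2)[OF k] by (simp add: dir_inner a_def)
  have G: "vtx z k \<bullet> vtx z k = ?p \<bullet> ?p" "vtx z (Suc k) \<bullet> vtx z (Suc k) = ?q \<bullet> ?q"
    using k vtx_inner(1)[of k] vtx_inner(1)[of "Suc k"] by (simp_all add: dir_inner)
  have G21: "vtx z (Suc k) \<bullet> vtx z k = ?q \<bullet> ?p" using G12 by (simp only: inner_commute)
  have "Lz z k x \<bullet> Lz z k y = ((cross2 x ?q / sin (a k)) *\<^sub>R ?p + (cross2 ?p x / sin (a k)) *\<^sub>R ?q) \<bullet>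
      ((cross2 y ?q / sin (a k)) *\<^sub>R ?p + (cross2 ?p y / sin (a k)) *\<^sub>R ?q)"
    unfolding Lz_def by (simp only: inner_add_left inner_add_right inner_scaleR_left inner_scaleR_right G G12 G21)
  then show ?thesis using e[of x] e[of y] by metis
qed

lemma fold_map_p: "fold_map z p = flat_state p"
  by (simp add: fold_map_def linear_0[OF Lz_linear])

text \<open>\<open>idx\<close> assigns the far crease of a sector to the next sector, whose linear
  map sends it to the same vertex. At the base crease this is the closing condition: the longitudes
  total 2 pi and both end heights are 0.\<close>

lemma fold_map_sec:
  assumes k: "k < n" and x: "x \<in> sec k"
  shows "fold_map z x = flat_state p + Lz z k (x - p)"
proof -
  obtain \<rho> \<phi> where x: "0 \<le> \<rho>" "\<rho> \<le> r" "th k \<le> \<phi>" "\<phi> \<le> th (Suc k)" "x = pt \<rho> \<phi>" using sec_cases[OF x k] by blast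
  show ?thesis
  proof (cases "\<rho> = 0")
    case True
    then have "x = p" using x by (simp add: pt_def)
    then show ?thesis using fold_map_p linear_0[OF Lz_linear] by simp
  next
    case False
    then have \<rho>: "0 < \<rho>" using x by simp
    show ?thesis
    proof (cases "\<phi> < th (Suc k)")
      case True
      then show ?thesis using idx_pt[OF \<rho> k] x by (simp add: fold_map_def)
    next
      case False
      then have \<phi>: "\<phi> = th (Suc k)" using x by simp
      let ?j = "nx (Suc k)"
      have j: "?j < n" using nx_less k by simp
      have "x = pt \<rho> (th ?j)" unfolding x(5) \<phi> using pt_2pi(1)[of \<rho> 0] by (simp add: nx_def thn th0)
      then have "idx x = ?j" using idx_pt[OF \<rho> j, of "th ?j"] th_Suc[OF j] by simp
      moreover have "x - p = \<rho> *\<^sub>R dir (th (Suc k))" unfolding x(5) \<phi> by (rule pt_dir)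
      moreover have "Lz z ?j (dir (th (Suc k))) = vtx z (Suc k)"
        using Lz_vtx(1)[OF j] vtx_n by (simp add: dir_th_nx) (simp add: nx_def)
      ultimately show ?thesis using Lz_vtx(2)[OF k] by (simp add: fold_map_def linear_scale[OF Lz_linear])
    qed
  qed
qed

lemma folded_fold_map: "folded p r C u n th (fold_map z) (Lz z)"
  by (intro folded.intro folded_axioms.intro crease_frame_axioms)
    (simp_all add: Lz_linear Lz_inner fold_map_sec fold_map_p)

lemma dist_fold_map:
  assumes "k < n" "x \<in> sec k" "y \<in> sec k"
  shows "dist (fold_map z x) (fold_map z y) = dist x y"
proof -
  have "fold_map z x - fold_map z y = Lz z k (x - y)"
    using fold_map_sec[OF assms(1,2)] fold_map_sec[OF assms(1,3)] linear_diff[OF Lz_linear, of k "x - p" "y - p"] by simp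
  then show ?thesis using Lz_inner[OF assms(1), of "x - y" "x - y"] by (simp add: dist_norm norm_eq_sqrt_inner)
qed

text \<open>The longitude increases along the folded boundary circle, so a total of \<open>2\<pi>\<close> makes the map injective.\<close>

lemma fold_map_longitude:
  assumes k: "k < n" "th k \<le> \<phi>" "\<phi> < th (Suc k)" and \<rho>: "0 < \<rho>" "\<rho> \<le> r"
  obtains R \<psi> h where "0 < R" "ph z k \<le> \<psi>" "\<psi> < ph z (Suc k)" "fold_map z (pt \<rho> \<phi>) = flat_state p + emb (pt R \<psi> - p) h"
proof -
  let ?s = "sin (a k)"
  define c1 where "c1 = \<rho> * sin (th (Suc k) - \<phi>) / ?s"
  define c2 where "c2 = \<rho> * sin (\<phi> - th k) / ?s"
  have s: "0 < ?s" by (rule sin_a[OF k(1)])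
  have "0 < sin (th (Suc k) - \<phi>)" "0 \<le> sin (\<phi> - th k)"
    using k gap[OF k(1)] by (auto intro!: sin_gt_zero sin_ge_zero)
  then have c: "0 < c1" "0 \<le> c2" using s \<rho> by (auto simp: c1_def c2_def)
  have l: "0 < lat (z k)" "0 < lat (z (Suc k))" using z_bound[of k] z_bound[of "Suc k"] k by (auto intro: lat_pos)
  have cc: "0 < c1 * lat (z k)" "0 \<le> c2 * lat (z (Suc k))" using c l by auto
  obtain R \<psi> where R: "0 < R" "0 \<le> \<psi>" "\<psi> < D k"
    "of_real (c1 * lat (z k)) + of_real (c2 * lat (z (Suc k))) * cis (D k) = of_real R * cis \<psi>"
    using cone_direction[OF cc] D[OF k(1)] by metis
  have L: "Lz z k (pt \<rho> \<phi> - p) = c1 *\<^sub>R vtx z k + c2 *\<^sub>R vtx z (Suc k)"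
    unfolding Lz_def pt_dir cross2_linear cross2_dirs c1_def c2_def ..
  have "c1 *\<^sub>R vtx z k + c2 *\<^sub>R vtx z (Suc k) =
      emb (u * cis (ph z k) * (of_real (c1 * lat (z k)) + of_real (c2 * lat (z (Suc k))) * cis (D k))) (c1 * z k + c2 * z (Suc k))"
    unfolding vtx_def emb_scale emb_add ph_Suc
    by (simp add: emb_eq_iff cis_mult[symmetric] scaleR_conv_of_real algebra_simps)
  also have "u * cis (ph z k) * (of_real (c1 * lat (z k)) + of_real (c2 * lat (z (Suc k))) * cis (D k)) = pt R (ph z k + \<psi>) - p"
    unfolding R(4) by (simp add: pt_def cis_mult[symmetric])
  finally have "fold_map z (pt \<rho> \<phi>) = flat_state p + emb (pt R (ph z k + \<psi>) - p) (c1 * z k + c2 * z (Suc k))"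
    using fold_map_sec[OF k(1) sec_mem[OF k(1)], of \<rho> \<phi>] k \<rho> L by simp
  then show ?thesis using that[of R "ph z k + \<psi>"] R(1-3) by (simp add: ph_Suc)
qed

lemma fold_map_norm: "x \<in> cball p r \<Longrightarrow> fold_map z x = flat_state p \<Longrightarrow> x = p"
proof -
  assume x: "x \<in> cball p r" "fold_map z x = flat_state p"
  obtain k where k: "k < n" "x \<in> sec k" using cball_cases[OF x(1)] by blast
  show "x = p" using dist_fold_map[OF k p_in_sec] x(2) fold_map_p by simp
qed

text \<open>The half-open longitude intervals of distinct sectors are disjoint, so equal images come
  from one sector, on which the map is an isometry.\<close>

lemma inj_fold_map: "inj_on (fold_map z) (cball p r)"
proof (rule inj_onI)
  fix x y assume xy: "x \<in> cball p r" "y \<in> cball p r" "fold_map z x = fold_map z y"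
  show "x = y"
  proof (cases "x = p \<or> y = p")
    case True
    then show ?thesis using fold_map_norm[OF xy(1)] fold_map_norm[OF xy(2)] xy(3) fold_map_p by metis
  next
    case False
    obtain \<rho> k \<phi> where x: "0 < \<rho>" "\<rho> \<le> r" "k < n" "th k \<le> \<phi>" "\<phi> < th (Suc k)" "x = pt \<rho> \<phi>"
      using polar_sector xy(1) False by blast
    obtain \<rho>' j \<phi>' where y: "0 < \<rho>'" "\<rho>' \<le> r" "j < n" "th j \<le> \<phi>'" "\<phi>' < th (Suc j)" "y = pt \<rho>' \<phi>'"
      using polar_sector xy(2) False by blast
    obtain R \<psi> h where X: "0 < R" "ph z k \<le> \<psi>" "\<psi> < ph z (Suc k)" "fold_map z x = flat_state p + emb (pt R \<psi> - p) h"
      using fold_map_longitude[OF x(3-5,1,2)] unfolding x(6) by metis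
    obtain R' \<psi>' h' where Y: "0 < R'" "ph z j \<le> \<psi>'" "\<psi>' < ph z (Suc j)" "fold_map z y = flat_state p + emb (pt R' \<psi>' - p) h'"
      using fold_map_longitude[OF y(3-5,1,2)] unfolding y(6) by metis
    have "pt R \<psi> = pt R' \<psi>'" using xy(3) unfolding X(4) Y(4) by (simp add: emb_eq_iff)
    moreover have "\<bar>\<psi> - \<psi>'\<bar> < 2 * pi"
      using X(2,3) Y(2,3) x(3) y(3) ph_le[of 0 k] ph_le[of 0 j] ph_le[of "Suc k" n] ph_le[of "Suc j" n] ph_n ph_0 by auto
    ultimately have e: "\<psi> = \<psi>'" using pt_inj(2)[OF X(1) Y(1)] by simp
    have "\<not> j < k" using ph_le[of "Suc j" k] X(2) Y(3) e x(3) by auto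
    moreover have "\<not> k < j" using ph_le[of "Suc k" j] X(3) Y(2) e y(3) by auto
    ultimately have "j = k" by simp
    then have "x \<in> sec k" "y \<in> sec k" using x y sec_mem by auto
    then show ?thesis using dist_fold_map[OF x(3)] xy(3) by (metis dist_eq_0_iff)
  qed
qed

text \<open>A point off the creases lies in one sector only. The other sectors are closed and
  finitely many, so near the point the map is affine.\<close>

lemma differentiable_fold_map:
  assumes x: "x \<in> cball p r - (\<Union>c\<in>C. closed_segment p c)"
  shows "fold_map z differentiable (at x within cball p r)"
proof -
  have "cr 0 \<in> C" using C_eq n by auto
  then have "x \<noteq> p" using x by auto
  then obtain \<rho> k \<phi> where x': "0 < \<rho>" "\<rho> \<le> r" "k < n" "th k \<le> \<phi>" "\<phi> < th (Suc k)" "x = pt \<rho> \<phi>"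
    using polar_sector x by blast
  have "\<phi> \<noteq> th k"
  proof
    assume "\<phi> = th k"
    then have "x = (1 - \<rho> / r) *\<^sub>R p + (\<rho> / r) *\<^sub>R cr k"
      using r unfolding x'(6) cr_def pt_def by (simp add: scaleR_conv_of_real field_simps)
    then have "x \<in> closed_segment p (cr k)" using x'(1,2) r by (auto simp: in_segment intro!: exI[of _ "\<rho> / r"])
    then show False using x x'(3) C_eq by auto
  qed
  then have \<phi>: "th k < \<phi>" using x' by simp
  define U where "U = - (\<Union>j\<in>{..<n} - {k}. sec j)"
  have "open U" unfolding U_def using compact_sec by (intro open_Compl closed_UN) (auto intro: compact_imp_closed)
  moreover have "x \<in> U" unfolding U_def x'(6) using not_in_other_sec[OF x'(1,3) \<phi> x'(5)] by auto
  ultimately obtain d where d: "0 < d" "ball x d \<subseteq> U" by (meson open_contains_ball)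
  have eq: "flat_state p + Lz z k (y - p) = fold_map z y" if y: "y \<in> cball p r" "dist y x < d" for y
  proof -
    obtain j where j: "j < n" "y \<in> sec j" using cball_cases[OF y(1)] by blast
    have "y \<in> U" using d y by (auto simp: dist_commute)
    then have "j = k" using j by (auto simp: U_def)
    then show ?thesis using fold_map_sec j by simp
  qed
  have bl: "bounded_linear (Lz z k)" using Lz_linear by (rule linear_conv_bounded_linear[THEN iffD1])
  have "((\<lambda>y. flat_state p + Lz z k (y - p)) has_derivative (\<lambda>h. 0 + Lz z k (h - 0))) (at x within cball p r)"
    by (intro has_derivative_add has_derivative_const bounded_linear.has_derivative[OF bl] has_derivative_diff has_derivative_ident)
  then have "(\<lambda>y. flat_state p + Lz z k (y - p)) differentiable (at x within cball p r)"
    unfolding differentiable_def by blast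
  then show ?thesis by (rule differentiable_transform_within[OF _ d(1)]) (use x eq in auto)
qed

lemma det_fold_map:
  assumes j: "0 < j" "j \<le> n"
  shows "vtx z (j - 1) \<bullet> cross3 (vtx z j) (vtx z (Suc (nx j))) =
    z (j - 1) * (lat (z j) * lat (z (Suc (nx j)))) * sin (D (nx j))
    - z j * (lat (z (j - 1)) * lat (z (Suc (nx j)))) * sin (D (j - 1) + D (nx j))
    + z (Suc (nx j)) * (lat (z (j - 1)) * lat (z j)) * sin (D (j - 1))"
proof -
  have "cis (ph z (nx j)) = cis (ph z j)" by (simp add: nx_def ph_0 ph_n)
  then have "cis (ph z (Suc (nx j))) = cis (ph z j + D (nx j))" unfolding ph_Suc by (simp add: cis_mult[symmetric])
  then have v: "vtx z (Suc (nx j)) = emb (of_real (lat (z (Suc (nx j)))) * u * cis (ph z j + D (nx j))) (z (Suc (nx j)))"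
    by (simp add: vtx_def)
  have pj: "ph z j = ph z (j - 1) + D (j - 1)" using ph_Suc[of "j - 1"] j by simp
  show ?thesis unfolding v vtx_def[of z "j - 1"] vtx_def[of z j] emb_det cross2_dir pj
    by (simp add: algebra_simps)
qed

lemma fold_sin_fold_map:
  assumes j: "0 < j" "j \<le> n"
  shows "sin (a (j - 1)) * sin (a (nx j)) * folded.fold_sin p r u n th (fold_map z) (Lz z) j =
    vtx z (j - 1) \<bullet> cross3 (vtx z j) (vtx z (Suc (nx j)))"
proof -
  interpret folded p r C u n th "fold_map z" "Lz z" by (rule folded_fold_map)
  have k: "j - 1 < n" "nx j < n" using j nx_less by auto
  have g: "g (th i) = vtx z i" if i: "0 < i" "i \<le> n" for i
    using crease_L[OF i] Lz_vtx(2)[of "i - 1"] i by simp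
  have g0: "g (th i) = vtx z i" if "i \<le> n" for i
  proof (cases "i = 0")
    case True
    then show ?thesis using g[of n] g_th_nx[of n] vtx_n n by (simp add: nx_def)
  qed (use g that in auto)
  have "g (th j - a (j - 1)) \<bullet> cross3 (g (th j)) (g (th (nx j) + a (nx j))) = sin (a (j - 1)) * sin (a (nx j)) * fold_sin j"
    using j th_Suc[OF k(1)] th_Suc[OF k(2)] by (intro det_at_crease) (auto simp: a_def)
  moreover have "th j - a (j - 1) = th (j - 1)" "th (nx j) + a (nx j) = th (Suc (nx j))" using j by (auto simp: a_def)
  ultimately show ?thesis using g0[of "j - 1"] g0[of j] g0[of "Suc (nx j)"] j k by simp
qed

end

section \<open>The continuous family from the flat state\<close>

lemma (in crease_frame) fold_map_flat:
  assumes gap: "\<And>k. k < n \<Longrightarrow> th (Suc k) - th k < pi" and x: "x \<in> cball p r"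
  shows "fold_map (\<lambda>k. 0) x = flat_state x"
proof -
  have ab: "0 < a k" "a k < pi" if "k < n" for k using gap[OF that] th_Suc[OF that] by (auto simp: a_def)
  have lon: "lon (a k) 0 0 = a k" if "k < n" for k using lon_0 ab[OF that] by simp
  have ph: "ph (\<lambda>k. 0) k = th k" if "k \<le> n" for k
  proof -
    have "ph (\<lambda>k. 0) k = (\<Sum>j<k. th (Suc j) - th j)" unfolding ph_def using lon that by (intro sum.cong) (auto simp: a_def)
    then show ?thesis using sum_lessThan_telescope[of th k] th0 by simp
  qed
  interpret heights p r C u n th "\<lambda>k. 0"
  proof (intro heights.intro heights_axioms.intro crease_frame_axioms gap)
    show "(\<Sum>k<n. lon (a k) 0 0) = 2 * pi" using ph[of n] thn by (simp add: ph_def)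
    fix k assume "k < n"
    then show "\<bar>coslon (a k) 0 0\<bar> < 1"
      using ab[of k] cos_monotone_0_pi[of 0 "a k"] cos_monotone_0_pi[of "a k" pi] by (auto simp: coslon_def lat_def abs_less_iff)
  qed auto
  have v: "vtx (\<lambda>k. 0) k = flat_state (dir (th k))" if "k \<le> n" for k
    using ph[OF that] by (simp add: vtx_def flat_state_emb dir_def lat_def)
  have lf: "linear flat_state"
    by (rule linearI) (simp_all add: flat_state_emb emb_add emb_scale emb_eq_iff)
  have L: "Lz (\<lambda>k. 0) k y = flat_state y" if k: "k < n" for k y
  proof -
    have "cross2 (dir (th k)) (dir (th (Suc k))) \<noteq> 0" using sin_a[OF k] by (simp add: cross2_dirs a_def)
    then have "Lz (\<lambda>k. 0) k = flat_state"
      using linear_eq_if_eq_on_basis[OF Lz_linear lf] Lz_vtx[OF k] v[of k] v[of "Suc k"] k by simp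
    then show ?thesis by simp
  qed
  obtain k where k: "k < n" "x \<in> sec k" using cball_cases[OF x] by blast
  show ?thesis using fold_map_sec[OF k] L[OF k(1)] linear_add[OF lf, of p "x - p"] by simp
qed

text \<open>Finitely many closed pieces are pasted together. On each of them the map is given by
  \<open>Lz\<close> with a fixed index, which bypasses the jumps of \<open>idx\<close>.\<close>

lemma (in crease_frame) continuous_fold_map:
  fixes z :: "real \<Rightarrow> nat \<Rightarrow> real"
  assumes H: "\<And>t. t \<in> {0..1} \<Longrightarrow> heights p r C u n th (z t)"
    and z: "\<And>k. continuous_on {0..1} (\<lambda>t. z t k)"
  shows "continuous_on ({0..1} \<times> cball p r) (\<lambda>(t, x). fold_map (z t) x)"
proof -
  have cl: "continuous_on {0..1} (\<lambda>t. lat (z t k))" for k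
    unfolding lat_def by (intro continuous_intros z)
  have clon: "continuous_on {0..1} (\<lambda>t. lon (a k) (z t k) (z t (Suc k)))" if k: "k < n" for k
  proof -
    have ln: "lat (z t i) \<noteq> 0" if "t \<in> {0..1}" "i \<le> n" for t i
      using lat_pos[OF heights.z_bound[OF H[OF that(1)] that(2)]] by simp
    have "continuous_on {0..1} (\<lambda>t. coslon (a k) (z t k) (z t (Suc k)))"
      unfolding coslon_def using k ln by (intro continuous_intros z cl) auto
    moreover have "- 1 \<le> coslon (a k) (z t k) (z t (Suc k)) \<and> coslon (a k) (z t k) (z t (Suc k)) \<le> 1" if "t \<in> {0..1}" for t
      using heights.c_bound[OF H[OF that] k] by (auto simp: abs_less_iff)
    ultimately show ?thesis unfolding lon_def by (intro continuous_on_arccos) auto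
  qed
  have cv: "continuous_on {0..1} (\<lambda>t. vtx (z t) k)" if k: "k \<le> n" for k
    unfolding vtx_def ph_def using k
    by (intro continuous_on_emb continuous_intros cl z clon continuous_on_cis) auto
  have S: "continuous_on ({0..1} \<times> sec k) (\<lambda>(t, x). fold_map (z t) x)" if k: "k < n" for k
  proof -
    have v: "continuous_on ({0..1} \<times> sec k) (\<lambda>w. vtx (z (fst w)) i)" if i: "i \<le> n" for i
      by (rule continuous_on_compose2[OF cv[OF i]]) (auto intro!: continuous_intros)
    have "continuous_on ({0..1} \<times> sec k) (\<lambda>w. flat_state p + Lz (z (fst w)) k (snd w - p))"
      unfolding Lz_def divide_inverse cross2_def using k by (intro continuous_intros v) auto
    then show ?thesis
      by (rule continuous_on_eq) (use heights.fold_map_sec[OF H k] in auto)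
  qed
  have "{0..1::real} \<times> cball p r = (\<Union>k\<in>{..<n}. {0..1} \<times> sec k)" unfolding cball_eq_Union_sec by auto
  moreover have "continuous_on (\<Union>k\<in>{..<n}. {0..1} \<times> sec k) (\<lambda>(t, x). fold_map (z t) x)"
    using S by (intro continuous_on_closed_Union closed_Times closed_atLeastAtMost compact_imp_closed[OF compact_sec]) auto
  ultimately show ?thesis by simp
qed

theorem birds_foot_imp_continuously_foldable:
  assumes cp: "crease_pattern p r C" and bf: "contains_birds_foot p C \<mu>"
  shows "continuously_foldable p r C \<mu>"
proof -
  obtain u n th \<rho> where F: "crease_frame p r C u n th" and gap: "\<And>k. k < n \<Longrightarrow> th (Suc k) - th k < pi"
    and sg: "\<And>k. k < n \<Longrightarrow> 0 < sg \<mu> (crease_frame.cr p r u th k) * \<rho> k"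
    and ba: "crease_frame.resultant n th \<rho> = 0" and load_energy: "crease_frame.load_energy n th \<rho> = 0"
    using birds_foot_load[OF cp bf] by metis
  interpret crease_frame p r C u n th by (rule F)
  have nz: "\<rho> k \<noteq> 0" if "k < n" for k using sg[OF that] by auto
  interpret N: null_load p r C u n th \<rho>
    by (intro null_load.intro null_load_axioms.intro F gap nz ba load_energy)
  show ?thesis
  proof (rule N.folding_heights)
    fix z :: "real \<Rightarrow> nat \<Rightarrow> real" assume z: "\<And>k. continuous_on {0..1} (\<lambda>t. z t k)" "\<And>k. z 0 k = 0" "\<And>t. z t 0 = 0" "\<And>t. z t n = 0"
      "\<And>t k. t \<in> {0..1} \<Longrightarrow> k \<le> n \<Longrightarrow> \<bar>z t k\<bar> < 1"
      "\<And>t k. t \<in> {0..1} \<Longrightarrow> k < n \<Longrightarrow> \<bar>coslon (a k) (z t k) (z t (Suc k))\<bar> < 1"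
      "\<And>t. t \<in> {0..1} \<Longrightarrow> (\<Sum>k<n. lon (a k) (z t k) (z t (Suc k))) = 2 * pi"
      and pos: "\<And>j. 0 < j \<Longrightarrow> j \<le> n \<Longrightarrow> 0 < \<rho> (nx j) *
         (z 1 (j - 1) * (lat (z 1 j) * lat (z 1 (Suc (nx j)))) * sin (lon (a (nx j)) (z 1 (nx j)) (z 1 (Suc (nx j))))
          - z 1 j * (lat (z 1 (j - 1)) * lat (z 1 (Suc (nx j)))) *
            sin (lon (a (j - 1)) (z 1 (j - 1)) (z 1 j) + lon (a (nx j)) (z 1 (nx j)) (z 1 (Suc (nx j))))
          + z 1 (Suc (nx j)) * (lat (z 1 (j - 1)) * lat (z 1 j)) * sin (lon (a (j - 1)) (z 1 (j - 1)) (z 1 j)))"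
    have H: "heights p r C u n th (z t)" if t: "t \<in> {0..1}" for t
      by (intro heights.intro heights_axioms.intro F gap z(3,4) z(5-7)[OF t])
    note cont = continuous_fold_map[OF H z(1)]
    have rigid: "rigid_folding p r C (fold_map (z t))" if t: "t \<in> {0..1}" for t
      unfolding rigid_folding_def
    proof (intro conjI ballI)
      show "inj_on (fold_map (z t)) (cball p r)" by (rule heights.inj_fold_map[OF H[OF t]])
      have "continuous_on (cball p r) (\<lambda>x. (\<lambda>(t, x). fold_map (z t) x) (t, x))"
        by (rule continuous_on_compose2[OF cont]) (use t in \<open>auto intro!: continuous_intros\<close>)
      then show "continuous_on (cball p r) (fold_map (z t))" by simp
      show "dist (fold_map (z t) x) (fold_map (z t) y) = dist x y" if "S \<in> faces p r C" "x \<in> S" "y \<in> S" for S x y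
        using heights.dist_fold_map[OF H[OF t]] that faces_eq by auto
      show "fold_map (z t) differentiable (at x within cball p r)" if "x \<in> cball p r - (\<Union>c\<in>C. closed_segment p c)" for x
        by (rule heights.differentiable_fold_map[OF H[OF t] that])
    qed
    have one: "(1::real) \<in> {0..1}" by simp
    interpret H1: heights p r C u n th "z 1" by (rule H[OF one])
    interpret f1: folded p r C u n th "fold_map (z 1)" "Lz (z 1)" by (rule H1.folded_fold_map)
    have fs: "0 < sg \<mu> (cr j) * f1.fold_sin j" if j: "0 < j" "j \<le> n" for j
    proof -
      have k: "j - 1 < n" "nx j < n" using j nx_less by auto
      have "cr (nx j) = cr j" using cr_n by (simp add: nx_def)
      then have s: "0 < sg \<mu> (cr j) * \<rho> (nx j)" using sg[OF k(2)] by simp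
      have "0 < \<rho> (nx j) * (vtx (z 1) (j - 1) \<bullet> cross3 (vtx (z 1) j) (vtx (z 1) (Suc (nx j))))"
        unfolding H1.det_fold_map[OF j] using pos[OF j] Suc_pred'[OF j(1)] by simp
      then have "0 < (sin (a (j - 1)) * sin (a (nx j))) * (\<rho> (nx j) * f1.fold_sin j)"
        unfolding H1.fold_sin_fold_map[OF j, symmetric] by (simp only: mult_ac)
      then have "0 < \<rho> (nx j) * f1.fold_sin j"
        by (rule zero_less_mult_pos) (intro mult_pos_pos H1.sin_a k)
      then show ?thesis using s by (auto simp: zero_less_mult_iff)
    qed
    have "realizes p r C \<mu> (fold_map (z 1))"
      unfolding realizes_def
    proof
      fix c assume "c \<in> C"
      then obtain k where "k < n" "c = cr k" using C_eq by auto
      then have "\<exists>j. 0 < j \<and> j \<le> n \<and> c = cr j"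
        using cr_n n by (cases "k = 0") (auto intro: exI[of _ n] exI[of _ k])
      then obtain j where j: "0 < j" "j \<le> n" "c = cr j" by blast
      note fa = f1.folding_angle_sign[OF j(1,2) H1.inj_fold_map]
      show "(\<mu> c = Valley \<longrightarrow> 0 < folding_angle p r C (fold_map (z 1)) c) \<and>
          (\<mu> c = Mountain \<longrightarrow> folding_angle p r C (fold_map (z 1)) c < 0)"
        using fs[OF j(1,2)] fa unfolding j(3) by (auto simp: sg_def)
    qed
    moreover have "fold_map (z 0) x = flat_state x" if "x \<in> cball p r" for x
    proof -
      have "z 0 = (\<lambda>k. 0)" using z(2) by auto
      then show ?thesis using fold_map_flat[OF gap that] by simp
    qed
    ultimately show ?thesis
      unfolding continuously_foldable_def using cont rigid by (intro exI[of _ "\<lambda>t. fold_map (z t)"]) auto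
  qed
qed

theorem theorem1:
  fixes p :: complex and r :: real and C :: "complex set" and \<mu> :: "complex \<Rightarrow> mv"
  assumes "crease_pattern p r C"
  shows "continuously_foldable p r C \<mu> \<longleftrightarrow> contains_birds_foot p C \<mu>"
proof
  assume "continuously_foldable p r C \<mu>"
  then obtain F :: "real \<Rightarrow> complex \<Rightarrow> real^3" where
    "\<forall>t\<in>{0..1}. rigid_folding p r C (F t)" "realizes p r C \<mu> (F 1)"
    unfolding continuously_foldable_def by blast
  then show "contains_birds_foot p C \<mu>"
    using realizable_imp_birds_foot[OF assms, of "F 1" \<mu>] by simp
next
  assume "contains_birds_foot p C \<mu>"
  then show "continuously_foldable p r C \<mu>"
    by (rule birds_foot_imp_continuously_foldable[OF assms])
qed

end
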